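(* Let $\lambda/\mu$ be a skew diagram satisfying the positivity condition $\lambda'_{i+1}-\mu'_i\le n$ ($i=1,\dots,l-1$, $l=\lambda_1$). There exists a weight-preserving bijection $\phi:P_2(\lambda/\mu)\to P(\lambda/\mu)$, i.e. a bijection with $z_a^{\phi(p)}=z_a^p$ for all $p\in P_2(\lambda/\mu)$ (for the fixed $a\in\mathbb C$).
   Context: Ring. Fix a positive integer $n$ (rank of type $D_n$) and $a\in\mathbb C$. $I=\{1,2,\dots,n,\overline n,\dots,\overline 2,\overline 1\}$. $\mathcal Z$ is the commutative ring over $\mathbb Z$ generated by $z_{i,b}$ ($i\in I$, $b\in\mathbb C$) with relations $z_{i,b}z_{\overline i,b-2n+2i}=z_{i-1,b}z_{\overline{i-1},b-2n+2i}$ ($i=1,\dots,n$), where $z_{0,b}=z_{\overline 0,b}=1$. A skew diagram $\lambda/\mu$ is a pair of partitions with $\lambda_i\ge\mu_i$ for all $i$; $\lambda',\mu'$ are the conjugates. Paths. For $w=(x,y)\in\mathbb R^2$ put $\mathrm{ht}(w)=x+y$ (height), $\mathrm{hp}(w)=\frac12(x-y)$ (horizontal position). Steps on $\mathbb Z^2$: NE-step $(x,y)\to(x+1,y)$, NW-step $(x,y)\to(x,y+1)$, E-step $(x,y)\to(x+1,y-1)$. A path is a sequence of consecutive NE-, NW-, E-steps from a lattice point of height $-n$ to one of height $n$, where E-steps occur only at height $0$ and their number is even. The weight $z_a^p\in\mathcal Z$ of a path $p$ is the product over its NE- and E-steps $s$ of $z_{L^1(s),a-2x}$, where $s$ starts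 at $(x,y)$, $m=x+y$, and $L^1(s)$ is: $n+1+m$ if $m<0$; $n$ if $m=0$ and $s$ is the 2nd, 4th, 6th, ... E-step of $p$; $\overline{n-m}$ otherwise. The weight of a tuple is $z_a^p=\prod_iz_a^{p_i}$. Put $u_i=(\mu'_i+1-i,-n-\mu'_i-1+i)$, $v_i=(\lambda'_i+1-i,n-\lambda'_i-1+i)$ for $1\le i\le l$. For $\sigma\in\mathfrak S_l$, $\mathfrak P(\sigma;u_\mu,v_\lambda)$ is the set of $l$-tuples $p=(p_1,\dots,p_l)$ of paths with $p_i$ from $u_i$ to $v_{\sigma(i)}$, and $\mathfrak P(u_\mu,v_\lambda)=\bigsqcup_\sigma\mathfrak P(\sigma;u_\mu,v_\lambda)$. Two paths intersect if they share a lattice point. An intersecting pair $(p_i,p_j)$ is specially intersecting if the intersection occurs only at height $0$ and $p_i(0)-p_j(0)$ is odd, where $p_i(0)$ is the horizontal position of the leftmost point of $p_i$ at height $0$; otherwise it is ordinarily intersecting. The two sets. $P_2(\lambda/\mu)$ is the set of all $p\in\mathfrak P(u_\mu,v_\lambda)$ having no ordinarily intersecting pair $(p_i,p_j)$ and no odd $\mathrm I$- or $\mathrm{II}$-region. $P(\lambda/\mu)$ is the set of all $p\in\mathfrak P(\mathrm{id};u_\mu,v_\lambda)$ having no ordinarily intersecting adjacent pair $(p_i,p_{i+1})$ and no odd $\mathrm{II}$-region. Regions. $S_+=\{0\le\mathrm{ht}\le n\}$, $S_-=\{-n\le\mathrm{ht}\le0\}$. A lower (resp. upper) path is a sequence of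 consecutive NE/NW-steps from height $-n$ to $0$ (resp. from $0$ to $n$); $\alpha(r)$ denotes the horizontal position at height $r$. Duals: $\alpha^*(r)=\alpha(-r)-1$, $\beta^*(-r)=\beta(r)+1$ ($0\le r\le n$) for a lower path $\alpha$ and an upper path $\beta$. Removing all E-steps from $p$ gives $\pi(p)=(\alpha;\beta)=(\alpha_1,\dots,\alpha_l;\beta_1,\dots,\beta_l)$, where $\alpha_i$ is the lower path starting at $u_i$ and $\beta_i$ the upper path ending at $v_i$. A unit $U\subset S_\pm$ is a unit square of the lattice inside $S_\pm$, or the half in $S_\pm$ of a unit square whose horizontal diagonal lies on the boundary of $S_\pm$; its height is the height of its left vertex; its left and right vertices have horizontal positions $c$ and $c'=c+1$. Let $\pm r=\mathrm{ht}(U)$, and set $\beta_{l+1}=\beta_{l+1}^*=-\infty$, $\alpha_0=\alpha_0^*=+\infty$. $U$ is a $\mathrm I$-unit if for some $0\le i\le l$: $\alpha^*_i(r)\le c<c'\le\beta_{i+1}(r)$ (if $U\subset S_+$), resp. $\alpha_i(-r)\le c<c'\le\beta^*_{i+1}(-r)$ (if $U\subset S_-$). $U$ is a $\mathrm{II}$-unit if for some $0\le i\le l$: $\beta_{i+1}(r)\le c<c'\le\alpha_i^*(r)$ (if $U\subset S_+$), resp. $\beta^*_{i+1}(-r)\le c<c'\le\alpha_i(-r)$ (if $U\subset S_-$); it is a boundary $\mathrm{II}$-unit if this holds with $i=0$, or $i=l$, or $r=n$. Two units are adjacent if the left or right vertex of one is also a vertex of the other. A connected component of the $\mathrm I$-units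 (resp. $\mathrm{II}$-units) is the union of an equivalence class for the equivalence relation on the set of $\mathrm I$-units (resp. $\mathrm{II}$-units) generated by adjacency. A $\mathrm I$-region is a connected component of the $\mathrm I$-units containing at least one $\mathrm I$-unit of height $0$; a $\mathrm{II}$-region is a connected component of the $\mathrm{II}$-units containing at least one $\mathrm{II}$-unit of height $0$ and no boundary $\mathrm{II}$-unit. For $1\le i\le l-1$ let $h=\alpha_i(0)-\beta_{i+1}(0)$; the pair $(\alpha_i,\beta_{i+1})$ is an overlap if $h\le0$, a hole if $h>0$, and is even/odd according to the parity of $h$. It intersects $V$ at height $0$ if the height-$0$ endpoint of $\alpha_i$ lies in a unit of $V$ in $S_-$ or that of $\beta_{i+1}$ lies in a unit of $V$ in $S_+$. For a $\mathrm I$-region (resp. $\mathrm{II}$-region) $V$, $n(V)$ is the number of $i$ such that $(\alpha_i,\beta_{i+1})$ is an even overlap (resp. an even hole) intersecting $V$ at height $0$; $V$ is odd if $n(V)$ is odd.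
   Formalization: Adjacency of units is taken only within the same strip S_+ or S_-; if units of S_+ and S_- sharing a vertex at height 0 also count as adjacent, the claim fails: n=1, λ=(3,2), μ=(1,0) gives |P_2|=6 but |P|=5. *)

theory Defs
  imports
    "HOL-Algebra.QuotRing"
    "HOL-Combinatorics.Permutations"
    "HOL-Library.Extended_Real"
    "HOL-Library.FuncSet"
    "HOL-Library.Poly_Mapping"
    Complex_Main
begin

section \<open>The ring generated by the $z_{i,b}$\<close>

datatype letter = Unbarred nat | Barred nat

definition letters :: "nat \<Rightarrow> letter set" where
  "letters n = Unbarred ` {1..n} \<union> Barred ` {1..n}"

type_synonym zpoly = "((letter \<times> complex) \<Rightarrow>\<^sub>0 nat) \<Rightarrow>\<^sub>0 int"

text \<open>Integral polynomials in the indeterminates indexed by \<open>letters n \<times> UNIV\<close>; the type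
  \<open>zpoly\<close> has indeterminates for all letters, hence the restriction of the carrier.\<close>

definition zpoly_ring :: "nat \<Rightarrow> zpoly ring" where
  "zpoly_ring n =
    \<lparr>carrier = {f. \<forall>m \<in> Poly_Mapping.keys f. Poly_Mapping.keys m \<subseteq> letters n \<times> UNIV},
     monoid.mult = (*), one = 1, zero = 0, add = (+)\<rparr>"

definition zvar :: "letter \<Rightarrow> complex \<Rightarrow> zpoly" where
  "zvar i b = (if i = Unbarred 0 \<or> i = Barred 0 then 1
     else Poly_Mapping.single (Poly_Mapping.single (i, b) 1) 1)"

definition zrelators :: "nat \<Rightarrow> zpoly set" where
  "zrelators n =
    {zvar (Unbarred i) b * zvar (Barred i) (b - 2 * of_nat n + 2 * of_nat i)
     - zvar (Unbarred (i - 1)) b * zvar (Barred (i - 1)) (b - 2 * of_nat n + 2 * of_nat i)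
     | i b. i \<in> {1..n}}"

definition zideal :: "nat \<Rightarrow> zpoly set" where
  "zideal n = genideal (zpoly_ring n) (zrelators n)"

definition Zring :: "nat \<Rightarrow> zpoly set ring" where
  "Zring n = zpoly_ring n Quot zideal n"

definition zgen :: "nat \<Rightarrow> letter \<Rightarrow> complex \<Rightarrow> zpoly set" where
  "zgen n i b = zideal n +>\<^bsub>zpoly_ring n\<^esub> zvar i b"

lemma zpoly_ring_cring: "cring (zpoly_ring n)"
proof -
  define C :: "zpoly set"
    where "C = {f. \<forall>m \<in> Poly_Mapping.keys f. Poly_Mapping.keys m \<subseteq> letters n \<times> UNIV}"
  have R: "zpoly_ring n = \<lparr>carrier = C, monoid.mult = (*), one = 1, zero = 0, add = (+)\<rparr>"
    by (simp add: zpoly_ring_def C_def)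
  have add: "f + g \<in> C" if "f \<in> C" "g \<in> C" for f g
    using that Poly_Mapping.keys_add[of f g] unfolding C_def by blast
  have mult: "f * g \<in> C" if fg: "f \<in> C" "g \<in> C" for f g
    unfolding C_def
  proof (rule CollectI, rule ballI)
    fix m assume "m \<in> Poly_Mapping.keys (f * g)"
    then obtain a b where "m = a + b" "a \<in> Poly_Mapping.keys f" "b \<in> Poly_Mapping.keys g"
      using Poly_Mapping.keys_mult[of f g] by blast
    then show "Poly_Mapping.keys m \<subseteq> letters n \<times> UNIV"
      using fg Poly_Mapping.keys_add[of a b] unfolding C_def by blast
  qed
  have uminus: "- f \<in> C" if "f \<in> C" for f
    using that unfolding C_def by simp
  have zero: "0 \<in> C" and one: "1 \<in> C"
    unfolding C_def by simp_all
  have inv: "\<exists>g\<in>C. f + g = 0" if "f \<in> C" for f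
    using uminus[OF that] by (intro bexI[of _ "- f"]) simp_all
  have "abelian_group (zpoly_ring n)"
    by (rule abelian_groupI) (simp_all add: R add zero inv add.assoc add.commute)
  moreover have "comm_monoid (zpoly_ring n)"
    by (rule comm_monoidI) (simp_all add: R mult one mult.assoc mult.commute)
  ultimately show ?thesis
    by (rule cringI) (simp add: R distrib_right)
qed

lemma zvar_closed:
  "i \<in> letters n \<union> {Unbarred 0, Barred 0} \<Longrightarrow> zvar i b \<in> carrier (zpoly_ring n)"
  by (auto simp: zvar_def zpoly_ring_def)

lemma zrelators_closed: "zrelators n \<subseteq> carrier (zpoly_ring n)"
proof
  interpret cring "zpoly_ring n" by (rule zpoly_ring_cring)
  fix f assume "f \<in> zrelators n"
  then obtain i b where i: "i \<in> {1..n}" and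
    f: "f = zvar (Unbarred i) b * zvar (Barred i) (b - 2 * of_nat n + 2 * of_nat i)
     + - (zvar (Unbarred (i - 1)) b * zvar (Barred (i - 1)) (b - 2 * of_nat n + 2 * of_nat i))"
    unfolding zrelators_def by auto
  have mem: "zvar (Unbarred j) c \<in> carrier (zpoly_ring n)" "zvar (Barred j) c \<in> carrier (zpoly_ring n)"
    if "j \<le> n" for j c
    using that by (cases "j = 0"; auto intro!: zvar_closed simp: letters_def)+
  have mult: "g * h \<in> carrier (zpoly_ring n)"
    if "g \<in> carrier (zpoly_ring n)" "h \<in> carrier (zpoly_ring n)" for g h
    using m_closed[OF that] by (simp add: zpoly_ring_def)
  have add: "g + h \<in> carrier (zpoly_ring n)"
    if "g \<in> carrier (zpoly_ring n)" "h \<in> carrier (zpoly_ring n)" for g h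
    using a_closed[OF that] by (simp add: zpoly_ring_def)
  have uminus: "- g \<in> carrier (zpoly_ring n)" if "g \<in> carrier (zpoly_ring n)" for g
    using that by (simp add: zpoly_ring_def)
  have "i \<le> n" "i - 1 \<le> n" using i by auto
  then show "f \<in> carrier (zpoly_ring n)"
    unfolding f by (intro add uminus mult mem)
qed

lemma Zring_cring: "cring (Zring n)"
proof -
  interpret cring "zpoly_ring n" by (rule zpoly_ring_cring)
  have "ideal (zideal n) (zpoly_ring n)"
    unfolding zideal_def by (rule genideal_ideal[OF zrelators_closed])
  then show ?thesis
    unfolding Zring_def by (rule ideal.quotient_is_cring) (rule zpoly_ring_cring)
qed


section \<open>Skew diagrams\<close>

text \<open>A partition is indexed from 1; the value at 0 is never used.\<close>

definition is_partition :: "(nat \<Rightarrow> nat) \<Rightarrow> bool" where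
  "is_partition lam \<longleftrightarrow> (\<forall>i\<ge>1. lam (i + 1) \<le> lam i) \<and> finite {i. 1 \<le> i \<and> lam i \<noteq> 0}"

definition conj_partition :: "(nat \<Rightarrow> nat) \<Rightarrow> nat \<Rightarrow> nat" where
  "conj_partition lam j = card {i. 1 \<le> i \<and> j \<le> lam i}"

definition skew_diagram :: "(nat \<Rightarrow> nat) \<Rightarrow> (nat \<Rightarrow> nat) \<Rightarrow> bool" where
  "skew_diagram lam mu \<longleftrightarrow> is_partition lam \<and> is_partition mu \<and> (\<forall>i\<ge>1. mu i \<le> lam i)"

definition positivity :: "nat \<Rightarrow> (nat \<Rightarrow> nat) \<Rightarrow> (nat \<Rightarrow> nat) \<Rightarrow> bool" where
  "positivity n lam mu \<longleftrightarrow>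
    (\<forall>i\<in>{1..<lam 1}. int (conj_partition lam (i + 1)) - int (conj_partition mu i) \<le> int n)"


section \<open>Paths\<close>

type_synonym point = "int \<times> int"

definition ht :: "('a::plus) \<times> 'a \<Rightarrow> 'a" where
  "ht w = fst w + snd w"

definition hp :: "point \<Rightarrow> real" where
  "hp w = (real_of_int (fst w) - real_of_int (snd w)) / 2"

datatype step = NE_step | NW_step | E_step

fun move :: "point \<Rightarrow> step \<Rightarrow> point" where
  "move (x, y) NE_step = (x + 1, y)"
| "move (x, y) NW_step = (x, y + 1)"
| "move (x, y) E_step = (x + 1, y - 1)"

text \<open>A sequence of consecutive steps, given by its initial point and its list of steps.
  Lower and upper paths are represented in the same way.\<close>

type_synonym path = "point \<times> step list"

definition vertex :: "path \<Rightarrow> nat \<Rightarrow> point" where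
  "vertex q k = foldl move (fst q) (take k (snd q))"

definition points :: "path \<Rightarrow> point set" where
  "points q = vertex q ` {..length (snd q)}"

definition endpoint :: "path \<Rightarrow> point" where
  "endpoint q = vertex q (length (snd q))"

definition num_E :: "path \<Rightarrow> nat" where
  "num_E q = card {k. k < length (snd q) \<and> snd q ! k = E_step}"

definition is_path :: "nat \<Rightarrow> path \<Rightarrow> bool" where
  "is_path n q \<longleftrightarrow> ht (fst q) = - int n \<and> ht (endpoint q) = int n \<and>
    (\<forall>k<length (snd q). snd q ! k = E_step \<longrightarrow> ht (vertex q k) = 0) \<and> even (num_E q)"

text \<open>$L^1(s)$ for the step \<open>s = snd q ! k\<close>, which starts at \<open>vertex q k\<close>.\<close>

definition L1 :: "nat \<Rightarrow> path \<Rightarrow> nat \<Rightarrow> letter" where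
  "L1 n q k = (let m = ht (vertex q k) in
     if m < 0 then Unbarred (nat (int n + 1 + m))
     else if m = 0 \<and> snd q ! k = E_step \<and> even (card {j. j \<le> k \<and> snd q ! j = E_step})
       then Unbarred n
     else Barred (nat (int n - m)))"

definition path_weight :: "nat \<Rightarrow> complex \<Rightarrow> path \<Rightarrow> zpoly set" where
  "path_weight n a q =
    (\<Otimes>\<^bsub>Zring n\<^esub>k\<in>{k. k < length (snd q) \<and> snd q ! k \<noteq> NW_step}.
       zgen n (L1 n q k) (a - 2 * of_int (fst (vertex q k))))"

definition weight :: "nat \<Rightarrow> complex \<Rightarrow> nat \<Rightarrow> (nat \<Rightarrow> path) \<Rightarrow> zpoly set" where
  "weight n a l p = (\<Otimes>\<^bsub>Zring n\<^esub>i\<in>{1..l}. path_weight n a (p i))"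

definition u_pt :: "nat \<Rightarrow> (nat \<Rightarrow> nat) \<Rightarrow> nat \<Rightarrow> point" where
  "u_pt n mu i = (int (conj_partition mu i) + 1 - int i,
                  - int n - int (conj_partition mu i) - 1 + int i)"

definition v_pt :: "nat \<Rightarrow> (nat \<Rightarrow> nat) \<Rightarrow> nat \<Rightarrow> point" where
  "v_pt n lam i = (int (conj_partition lam i) + 1 - int i,
                   int n - int (conj_partition lam i) - 1 + int i)"

definition tuples_perm ::
  "(nat \<Rightarrow> nat) \<Rightarrow> nat \<Rightarrow> (nat \<Rightarrow> nat) \<Rightarrow> (nat \<Rightarrow> nat) \<Rightarrow> (nat \<Rightarrow> path) set" where
  "tuples_perm \<sigma> n lam mu =
    (\<Pi>\<^sub>E i\<in>{1..lam 1}. {q. is_path n q \<and> fst q = u_pt n mu i \<and> endpoint q = v_pt n lam (\<sigma> i)})"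

text \<open>The union is disjoint, since the \<open>v_pt n lam i\<close> are distinct (lemma \<open>tuples_perm_disjoint\<close>).\<close>

definition tuples :: "nat \<Rightarrow> (nat \<Rightarrow> nat) \<Rightarrow> (nat \<Rightarrow> nat) \<Rightarrow> (nat \<Rightarrow> path) set" where
  "tuples n lam mu = (\<Union>\<sigma>\<in>{\<sigma>. \<sigma> permutes {1..lam 1}}. tuples_perm \<sigma> n lam mu)"

lemma v_pt_inj:
  assumes "is_partition lam"
  shows "inj_on (v_pt n lam) {1..l}"
proof -
  have antimono: "conj_partition lam j \<le> conj_partition lam i" if "1 \<le> i" "i \<le> j" for i j
    unfolding conj_partition_def
  proof (rule card_mono)
    have "{k. 1 \<le> k \<and> i \<le> lam k} \<subseteq> {k. 1 \<le> k \<and> lam k \<noteq> 0}"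
      using that(1) by auto
    then show "finite {k. 1 \<le> k \<and> i \<le> lam k}"
      using assms unfolding is_partition_def by (meson finite_subset)
  qed (use that in auto)
  have "i = j" if "1 \<le> i" "i \<le> j" "v_pt n lam i = v_pt n lam j" for i j
    using antimono[OF that(1,2)] that(2,3) by (simp add: v_pt_def)
  then show ?thesis
    by (intro inj_onI) (metis atLeastAtMost_iff nle_le)
qed

lemma tuples_perm_disjoint:
  assumes "is_partition lam" "\<sigma> permutes {1..lam 1}" "\<tau> permutes {1..lam 1}" "\<sigma> \<noteq> \<tau>"
  shows "tuples_perm \<sigma> n lam mu \<inter> tuples_perm \<tau> n lam mu = {}"
proof -
  obtain i where i: "\<sigma> i \<noteq> \<tau> i" using assms(4) by blast
  have mem: "i \<in> {1..lam 1}"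
    using i assms(2,3) by (metis permutes_not_in)
  then have "\<sigma> i \<in> {1..lam 1}" "\<tau> i \<in> {1..lam 1}"
    using assms(2,3) by (simp_all only: permutes_in_image)
  then have "v_pt n lam (\<sigma> i) \<noteq> v_pt n lam (\<tau> i)"
    using i v_pt_inj[OF assms(1), of n "lam 1"] by (meson inj_onD)
  moreover have "endpoint (p i) = v_pt n lam (\<sigma> i)" if "p \<in> tuples_perm \<sigma> n lam mu" for p \<sigma>
    using that mem unfolding tuples_perm_def PiE_def Pi_def by simp
  ultimately show ?thesis
    by (metis disjoint_iff)
qed


section \<open>Intersections\<close>

definition intersecting :: "path \<Rightarrow> path \<Rightarrow> bool" where
  "intersecting q q' \<longleftrightarrow> points q \<inter> points q' \<noteq> {}"

definition pos0 :: "path \<Rightarrow> real" where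
  "pos0 q = Min (hp ` {w \<in> points q. ht w = 0})"

definition specially_intersecting :: "path \<Rightarrow> path \<Rightarrow> bool" where
  "specially_intersecting q q' \<longleftrightarrow> intersecting q q' \<and>
    (\<forall>w \<in> points q \<inter> points q'. ht w = 0) \<and>
    (\<exists>k::int. odd k \<and> pos0 q - pos0 q' = of_int k)"

definition ordinarily_intersecting :: "path \<Rightarrow> path \<Rightarrow> bool" where
  "ordinarily_intersecting q q' \<longleftrightarrow> intersecting q q' \<and> \<not> specially_intersecting q q'"


section \<open>Lower and upper paths\<close>

text \<open>A path of height range $-n,\dots,n$ consists of $n$ NE/NW-steps, then its E-steps (all at
  height $0$), then $n$ NE/NW-steps.\<close>

definition lower_part :: "nat \<Rightarrow> path \<Rightarrow> path" where
  "lower_part n q = (fst q, take n (snd q))"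

definition upper_part :: "nat \<Rightarrow> path \<Rightarrow> path" where
  "upper_part n q = (vertex q (n + num_E q), drop (n + num_E q) (snd q))"

text \<open>$\alpha_i$ is the lower part of the path starting at $u_i$; $\beta_i$ is the upper part of
  the path ending at $v_i$, which is in general not \<open>p i\<close>.\<close>

definition alpha_path :: "nat \<Rightarrow> (nat \<Rightarrow> path) \<Rightarrow> nat \<Rightarrow> path" where
  "alpha_path n p i = lower_part n (p i)"

definition beta_path :: "nat \<Rightarrow> (nat \<Rightarrow> nat) \<Rightarrow> (nat \<Rightarrow> path) \<Rightarrow> nat \<Rightarrow> path" where
  "beta_path n lam p i =
    upper_part n (p (THE j. j \<in> {1..lam 1} \<and> endpoint (p j) = v_pt n lam i))"

text \<open>Horizontal position at height \<open>r\<close> of a lower or upper path, each step of which raises the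
  height by one.\<close>

definition pos_at :: "path \<Rightarrow> int \<Rightarrow> real" where
  "pos_at q r = hp (vertex q (nat (r - ht (fst q))))"

definition alpha :: "nat \<Rightarrow> (nat \<Rightarrow> path) \<Rightarrow> nat \<Rightarrow> int \<Rightarrow> ereal" where
  "alpha n p i r = (if i = 0 then \<infinity> else ereal (pos_at (alpha_path n p i) r))"

definition beta :: "nat \<Rightarrow> (nat \<Rightarrow> nat) \<Rightarrow> (nat \<Rightarrow> path) \<Rightarrow> nat \<Rightarrow> int \<Rightarrow> ereal" where
  "beta n lam p i r = (if i = lam 1 + 1 then -\<infinity> else ereal (pos_at (beta_path n lam p i) r))"

definition alpha_dual :: "nat \<Rightarrow> (nat \<Rightarrow> path) \<Rightarrow> nat \<Rightarrow> int \<Rightarrow> ereal" where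
  "alpha_dual n p i r = alpha n p i (- r) - 1"

definition beta_dual :: "nat \<Rightarrow> (nat \<Rightarrow> nat) \<Rightarrow> (nat \<Rightarrow> path) \<Rightarrow> nat \<Rightarrow> int \<Rightarrow> ereal" where
  "beta_dual n lam p i r = beta n lam p i (- r) + 1"


section \<open>Units\<close>

datatype strip = S_plus | S_minus

fun strip_set :: "nat \<Rightarrow> strip \<Rightarrow> (real \<times> real) set" where
  "strip_set n S_plus = {w. 0 \<le> ht w \<and> ht w \<le> real n}"
| "strip_set n S_minus = {w. - real n \<le> ht w \<and> ht w \<le> 0}"

fun strip_boundary :: "nat \<Rightarrow> strip \<Rightarrow> int set" where
  "strip_boundary n S_plus = {0, int n}"
| "strip_boundary n S_minus = {- int n, 0}"

definition rpt :: "point \<Rightarrow> real \<times> real" where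
  "rpt w = (of_int (fst w), of_int (snd w))"

text \<open>The unit square whose left vertex (the one of least horizontal position) is \<open>w = (x, y)\<close>.
  Its horizontal diagonal joins \<open>(x, y)\<close> and \<open>(x + 1, y - 1)\<close>.\<close>

definition square :: "point \<Rightarrow> (real \<times> real) set" where
  "square w = {of_int (fst w)..of_int (fst w) + 1} \<times> {of_int (snd w) - 1..of_int (snd w)}"

text \<open>A unit is given by the strip containing it and the left vertex of its square.\<close>

type_synonym strip_unit = "strip \<times> point"

definition unit_set :: "nat \<Rightarrow> strip_unit \<Rightarrow> (real \<times> real) set" where
  "unit_set n U = square (snd U) \<inter> strip_set n (fst U)"

definition is_unit :: "nat \<Rightarrow> strip_unit \<Rightarrow> bool" where
  "is_unit n U \<longleftrightarrow>
    square (snd U) \<subseteq> strip_set n (fst U) \<or> ht (snd U) \<in> strip_boundary n (fst U)"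

definition unit_ht :: "strip_unit \<Rightarrow> int" where
  "unit_ht U = ht (snd U)"

definition left_point :: "strip_unit \<Rightarrow> point" where
  "left_point U = snd U"

definition right_point :: "strip_unit \<Rightarrow> point" where
  "right_point U = (fst (snd U) + 1, snd (snd U) - 1)"

text \<open>Units are subsets of the disjoint union of the two strips: the common boundary line of
  height 0 counts twice, so a vertex of a unit is tagged with the strip of the unit, and a unit in
  one strip is never adjacent to a unit in the other one.\<close>

definition left_vertex :: "strip_unit \<Rightarrow> strip \<times> point" where
  "left_vertex U = (fst U, left_point U)"

definition right_vertex :: "strip_unit \<Rightarrow> strip \<times> point" where
  "right_vertex U = (fst U, right_point U)"

definition unit_vertices :: "nat \<Rightarrow> strip_unit \<Rightarrow> (strip \<times> point) set" where
  "unit_vertices n U = (let (x, y) = snd U in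
    {fst U} \<times> {w \<in> {(x, y), (x + 1, y - 1), (x + 1, y), (x, y - 1)}. rpt w \<in> unit_set n U})"

definition adjacent :: "nat \<Rightarrow> strip_unit \<Rightarrow> strip_unit \<Rightarrow> bool" where
  "adjacent n U U' \<longleftrightarrow>
    left_vertex U \<in> unit_vertices n U' \<or> right_vertex U \<in> unit_vertices n U' \<or>
    left_vertex U' \<in> unit_vertices n U \<or> right_vertex U' \<in> unit_vertices n U"

definition I_unit :: "nat \<Rightarrow> (nat \<Rightarrow> nat) \<Rightarrow> (nat \<Rightarrow> path) \<Rightarrow> strip_unit \<Rightarrow> bool" where
  "I_unit n lam p U \<longleftrightarrow> is_unit n U \<and>
    (\<exists>i\<le>lam 1. let c = ereal (hp (left_point U)); c' = ereal (hp (right_point U)); h = unit_ht U in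
      case fst U of
        S_plus \<Rightarrow> alpha_dual n p i h \<le> c \<and> c' \<le> beta n lam p (i + 1) h
      | S_minus \<Rightarrow> alpha n p i h \<le> c \<and> c' \<le> beta_dual n lam p (i + 1) h)"

definition II_unit_at :: "nat \<Rightarrow> (nat \<Rightarrow> nat) \<Rightarrow> (nat \<Rightarrow> path) \<Rightarrow> nat \<Rightarrow> strip_unit \<Rightarrow> bool" where
  "II_unit_at n lam p i U \<longleftrightarrow> is_unit n U \<and>
    (let c = ereal (hp (left_point U)); c' = ereal (hp (right_point U)); h = unit_ht U in
      case fst U of
        S_plus \<Rightarrow> beta n lam p (i + 1) h \<le> c \<and> c' \<le> alpha_dual n p i h
      | S_minus \<Rightarrow> beta_dual n lam p (i + 1) h \<le> c \<and> c' \<le> alpha n p i h)"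

definition II_unit :: "nat \<Rightarrow> (nat \<Rightarrow> nat) \<Rightarrow> (nat \<Rightarrow> path) \<Rightarrow> strip_unit \<Rightarrow> bool" where
  "II_unit n lam p U \<longleftrightarrow> (\<exists>i\<le>lam 1. II_unit_at n lam p i U)"

definition boundary_II_unit :: "nat \<Rightarrow> (nat \<Rightarrow> nat) \<Rightarrow> (nat \<Rightarrow> path) \<Rightarrow> strip_unit \<Rightarrow> bool" where
  "boundary_II_unit n lam p U \<longleftrightarrow>
    (\<exists>i\<le>lam 1. II_unit_at n lam p i U \<and> (i = 0 \<or> i = lam 1 \<or> \<bar>unit_ht U\<bar> = int n))"


section \<open>Regions\<close>

text \<open>A connected component is represented by the equivalence class of units of which it is the
  union.\<close>

definition components :: "nat \<Rightarrow> strip_unit set \<Rightarrow> strip_unit set set" where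
  "components n A =
    A // {(U, U'). equivclp (\<lambda>W W'. W \<in> A \<and> W' \<in> A \<and> adjacent n W W') U U'}"

definition I_region :: "nat \<Rightarrow> (nat \<Rightarrow> nat) \<Rightarrow> (nat \<Rightarrow> path) \<Rightarrow> strip_unit set \<Rightarrow> bool" where
  "I_region n lam p V \<longleftrightarrow> V \<in> components n {U. I_unit n lam p U} \<and> (\<exists>U\<in>V. unit_ht U = 0)"

definition II_region :: "nat \<Rightarrow> (nat \<Rightarrow> nat) \<Rightarrow> (nat \<Rightarrow> path) \<Rightarrow> strip_unit set \<Rightarrow> bool" where
  "II_region n lam p V \<longleftrightarrow> V \<in> components n {U. II_unit n lam p U} \<and> (\<exists>U\<in>V. unit_ht U = 0) \<and>
    \<not> (\<exists>U\<in>V. boundary_II_unit n lam p U)"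

definition gap :: "nat \<Rightarrow> (nat \<Rightarrow> nat) \<Rightarrow> (nat \<Rightarrow> path) \<Rightarrow> nat \<Rightarrow> real" where
  "gap n lam p i = pos_at (alpha_path n p i) 0 - pos_at (beta_path n lam p (i + 1)) 0"

definition even_overlap :: "nat \<Rightarrow> (nat \<Rightarrow> nat) \<Rightarrow> (nat \<Rightarrow> path) \<Rightarrow> nat \<Rightarrow> bool" where
  "even_overlap n lam p i \<longleftrightarrow>
    gap n lam p i \<le> 0 \<and> (\<exists>k::int. even k \<and> gap n lam p i = of_int k)"

definition even_hole :: "nat \<Rightarrow> (nat \<Rightarrow> nat) \<Rightarrow> (nat \<Rightarrow> path) \<Rightarrow> nat \<Rightarrow> bool" where
  "even_hole n lam p i \<longleftrightarrow>
    gap n lam p i > 0 \<and> (\<exists>k::int. even k \<and> gap n lam p i = of_int k)"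

definition intersects_at_0 ::
  "nat \<Rightarrow> (nat \<Rightarrow> nat) \<Rightarrow> (nat \<Rightarrow> path) \<Rightarrow> nat \<Rightarrow> strip_unit set \<Rightarrow> bool" where
  "intersects_at_0 n lam p i V \<longleftrightarrow>
    (\<exists>U\<in>V. fst U = S_minus \<and> rpt (endpoint (alpha_path n p i)) \<in> unit_set n U) \<or>
    (\<exists>U\<in>V. fst U = S_plus \<and> rpt (fst (beta_path n lam p (i + 1))) \<in> unit_set n U)"

definition odd_I_region ::
  "nat \<Rightarrow> (nat \<Rightarrow> nat) \<Rightarrow> (nat \<Rightarrow> path) \<Rightarrow> strip_unit set \<Rightarrow> bool" where
  "odd_I_region n lam p V \<longleftrightarrow> I_region n lam p V \<and>
    odd (card {i \<in> {1..<lam 1}. even_overlap n lam p i \<and> intersects_at_0 n lam p i V})"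

definition odd_II_region ::
  "nat \<Rightarrow> (nat \<Rightarrow> nat) \<Rightarrow> (nat \<Rightarrow> path) \<Rightarrow> strip_unit set \<Rightarrow> bool" where
  "odd_II_region n lam p V \<longleftrightarrow> II_region n lam p V \<and>
    odd (card {i \<in> {1..<lam 1}. even_hole n lam p i \<and> intersects_at_0 n lam p i V})"


section \<open>The two sets of tuples\<close>

definition P2_set :: "nat \<Rightarrow> (nat \<Rightarrow> nat) \<Rightarrow> (nat \<Rightarrow> nat) \<Rightarrow> (nat \<Rightarrow> path) set" where
  "P2_set n lam mu = {p \<in> tuples n lam mu.
    (\<forall>i\<in>{1..lam 1}. \<forall>j\<in>{1..lam 1}. i \<noteq> j \<longrightarrow> \<not> ordinarily_intersecting (p i) (p j)) \<and>
    \<not> (\<exists>V. odd_I_region n lam p V) \<and> \<not> (\<exists>V. odd_II_region n lam p V)}"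

definition P_set :: "nat \<Rightarrow> (nat \<Rightarrow> nat) \<Rightarrow> (nat \<Rightarrow> nat) \<Rightarrow> (nat \<Rightarrow> path) set" where
  "P_set n lam mu = {p \<in> tuples_perm id n lam mu.
    (\<forall>i\<in>{1..<lam 1}. \<not> ordinarily_intersecting (p i) (p (i + 1))) \<and>
    \<not> (\<exists>V. odd_II_region n lam p V)}"

end

theory Submission
  imports Defs
begin

text \<open>
  Reflecting the lower parts \<open>\<alpha>\<^sub>i\<close> into the upper strip, a tuple becomes two families of lattice paths on a
  triangulated strip. Count those lying weakly left of a node \<open>v\<close>: let \<open>S v\<close> be the sum and \<open>d v\<close> the
  difference of the numbers of \<open>\<alpha>\<close>'s and \<open>\<beta>\<close>'s. Units are nodes, I-units are the nodes with \<open>d \<ge> 2\<close>,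
  II-units those with \<open>d \<le> 0\<close>, and the relation of the ring, applied row by row, shows that the weight
  depends on \<open>S\<close> only. So it suffices to find, for each \<open>S\<close>, a bijection between the \<open>d\<close> belonging to
  \<open>P\<^sub>2\<close> and to \<open>P\<close>. Given \<open>S\<close>, the function \<open>d\<close> is constant on the faces, the connected components of
  nodes on which \<open>S\<close> has constant parity, and jumps by 1 between neighbouring faces. For \<open>P\<^sub>2\<close> the values
  of \<open>d\<close> at height 0 are 0, 1, 2, for \<open>P\<close> they are nonnegative; the absence of odd regions says in both cases
  that every face of even \<open>S\<close> cut off from the boundary has an even number of nodes at height 0, which is a
  condition on \<open>S\<close>. The bijection from \<open>P\<close> to \<open>P\<^sub>2\<close> folds the values of \<open>d\<close> at height 0 by 0, 1, 2, 3, 4, ... to 0, 1, 2, 1, 0, ... and keeps all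
  increments of \<open>d\<close> away from the faces that reach height 0.
\<close>

section \<open>Potentials on a triangulated strip\<close>

text \<open>Increments cannot be changed edge by edge, since around a triangle they have to cancel.
  They can be changed face by face: of the three nodes of a triangle two have equal parity, so
  increments that depend only on the two faces always fit together. Hence every construction
  prescribes jumps between faces and integrates them. Integration also gives a discrete Jordan curve
  theorem, which tells how faces are nested above row 0. The obstacle is to undo the fold. Heights 1
  and 3 have one image, so a sign must be chosen for each odd face that reaches row 0, the same
  wherever it does so. The sign is the parity of the number of closed even nodes weakly to the left
  on row 0; evenness of closed faces makes it well defined. Positivity enters as
  \<open>T x \<le> 1\<close> on the top row: it keeps the fold and its inverse from moving the fixed
  endpoints. At row 0 the link to intersections is \<open>del\<close>, which depends on
  \<open>S\<close> only: both sets are described by bounds on it and on the heights, plus, for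
  \<open>P\<close>, a rule on maximal runs of even nodes.\<close>

type_synonym node = "nat \<times> int"

text \<open>The node \<open>(r, x)\<close> is drawn at height \<open>r\<close> and horizontal
  position \<open>x - r/2\<close>. Each step then goes to the right, by 1 or by 1/2, along an edge
  of a triangular lattice; this orientation makes counting functions monotone.\<close>

definition step :: "nat \<Rightarrow> node \<Rightarrow> node \<Rightarrow> bool" where
  "step n p q \<longleftrightarrow> fst p \<le> n \<and> fst q \<le> n \<and>
    (fst q = fst p \<and> snd q = snd p + 1 \<or> fst q = Suc (fst p) \<and> snd q = snd p + 1 \<or>
     fst p = Suc (fst q) \<and> snd q = snd p)"

text \<open>The strip is simply connected, so cancellation on triangles suffices for integration.
  The potential is the row sum over horizontal edges; slanted edges follow by moving along the row
  across the two triangles between neighbouring columns.\<close>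

lemma potential:
  fixes g :: "node \<Rightarrow> node \<Rightarrow> int" and m :: int
  assumes tri: "\<And>p q s. step n p q \<Longrightarrow> step n q s \<Longrightarrow> step n p s \<Longrightarrow> g p s = g p q + g q s"
    and left: "\<And>p q. step n p q \<Longrightarrow> snd p < m \<Longrightarrow> g p q = 0"
  obtains c :: "node \<Rightarrow> int" where "\<And>p q. step n p q \<Longrightarrow> c q - c p = g p q"
    and "\<And>p. snd p \<le> m \<Longrightarrow> c p = 0"
proof -
  define c :: "node \<Rightarrow> int" where "c p = (\<Sum>y\<in>{m..<snd p}. g (fst p, y) (fst p, y + 1))" for p
  have c0: "c p = 0" if "snd p \<le> m" for p using that by (simp add: c_def)
  have ins: "{m..<x + 1} = insert x {m..<x}" if "m \<le> x" for x :: int using that by auto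
  have E: "c (r, x + 1) - c (r, x) = g (r, x) (r, x + 1)" if "r \<le> n" for r x
  proof (cases "m \<le> x")
    case True then show ?thesis by (simp add: c_def ins)
  next
    case False
    then have "g (r, x) (r, x + 1) = 0" using left that by (simp add: step_def)
    then show ?thesis using False c0 by simp
  qed
  have up: "g (r, x) (r, x + 1) = g (r, x) (Suc r, x + 1) + g (Suc r, x + 1) (r, x + 1)" if "r < n" for r x
    using that by (intro tri) (auto simp: step_def)
  have down: "g (Suc r, x) (Suc r, x + 1) = g (Suc r, x) (r, x) + g (r, x) (Suc r, x + 1)" if "r < n" for r x
    using that by (intro tri) (auto simp: step_def)
  have SE: "c (r, x) - c (Suc r, x) = g (Suc r, x) (r, x)" if r: "r < n" for r x
  proof (cases "m \<le> x")
    case True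
    then show ?thesis
    proof (induction x rule: int_ge_induct)
      case base
      have "g (Suc r, m - 1) (r, m - 1) = 0" "g (r, m - 1) (r, m) = 0"
        "g (r, m - 1) (Suc r, m) = 0"
        using left r by (auto simp: step_def)
      then have "g (Suc r, m) (r, m) = 0" using up[OF r, of "m - 1"] by simp
      then show ?case by (simp add: c0)
    next
      case (step x)
      then show ?case using E[of r x] E[of "Suc r" x] up[OF r, of x] down[OF r, of x] r by simp
    qed
  next
    case False
    then have "g (Suc r, x) (r, x) = 0" using left r by (simp add: step_def)
    then show ?thesis using False c0 by simp
  qed
  have NE: "c (Suc r, x + 1) - c (r, x) = g (r, x) (Suc r, x + 1)" if r: "r < n" for r x
    using SE[OF r, of x] E[of "Suc r" x] down[OF r, of x] r by simp
  have "c q - c p = g p q" if st: "step n p q" for p q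
  proof -
    obtain r x r' x' where pq: "p = (r, x)" "q = (r', x')" by (cases p, cases q)
    then show ?thesis using st E[of r x] NE[of r x] SE[of r' x'] unfolding step_def by auto
  qed
  then show ?thesis using that c0 by blast
qed

text \<open>The dihedral orbit of an endpoint is a path, so it has at most one other endpoint.\<close>

fun walk :: "('a \<Rightarrow> 'a) \<Rightarrow> ('a \<Rightarrow> 'a) \<Rightarrow> 'a \<Rightarrow> nat \<Rightarrow> 'a" where
  "walk u v e 0 = e"
| "walk u v e (Suc k) = (if even k then u (walk u v e k) else v (walk u v e k))"

lemma walk_closed:
  assumes u: "\<And>e. u (u e) = e" and v: "\<And>e. v (v e) = e" and e: "v e = e"
  shows "u (walk u v e k) \<in> range (walk u v e)" "v (walk u v e k) \<in> range (walk u v e)"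
proof -
  show "u (walk u v e k) \<in> range (walk u v e)"
  proof (cases "even k")
    case True then show ?thesis by (metis range_eqI walk.simps(2))
  next
    case False
    then obtain j where "k = Suc j" "even j" by (cases k) auto
    then show ?thesis using u by (metis range_eqI walk.simps(2))
  qed
  show "v (walk u v e k) \<in> range (walk u v e)"
  proof (cases "even k")
    case False then show ?thesis by (metis range_eqI walk.simps(2))
  next
    case True
    show ?thesis
    proof (cases k)
      case 0 then show ?thesis using e by (metis range_eqI walk.simps(1))
    next
      case (Suc j)
      then have "odd j" using True by simp
      then show ?thesis using Suc v by (metis range_eqI walk.simps(2))
    qed
  qed
qed

lemma walk_ends:
  assumes u: "\<And>e. u (u e) = e" and v: "\<And>e. v (v e) = e" and e: "v e = e"
    and a: "a \<in> range (walk u v e)" "a \<noteq> e" "u a = a \<or> v a = a"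
    and b: "b \<in> range (walk u v e)" "b \<noteq> e" "u b = b \<or> v b = b"
  shows "a = b"
proof -
  let ?w = "walk u v e"
  have nb: "u c = c \<or> v c = c \<Longrightarrow> c = ?w (Suc j) \<Longrightarrow> ?w (Suc j) = ?w j \<or> ?w (Suc (Suc j)) = ?w (Suc j)" for c j
    using u[of "?w j"] v[of "?w j"] by (cases "even j") auto
  have pos: "\<exists>i. c = ?w (Suc i)" if c: "c \<in> range ?w" "c \<noteq> e" for c
  proof -
    obtain j where "c = ?w j" using c by auto
    then show ?thesis using c(2) by (cases j) auto
  qed
  obtain i where i: "a = ?w (Suc i)" using pos[OF a(1,2)] by blast
  have ex: "\<exists>k. ?w (Suc k) = ?w k" using nb[OF a(3) i] by metis
  define K where "K = (LEAST k. ?w (Suc k) = ?w k)"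
  have K: "?w (Suc K) = ?w K" unfolding K_def using ex by (rule LeastI_ex)
  have min: "k < K \<Longrightarrow> ?w (Suc k) \<noteq> ?w k" for k unfolding K_def by (rule not_less_Least)
  \<comment> \<open>At its first repetition \<open>K\<close> the walk turns round and retraces
    itself, because the alternation of \<open>u\<close> and \<open>v\<close> is undone in reverse
    order. So the orbit is \<open>?w 0, ..., ?w K\<close>, and inside it no element is
    fixed.\<close>
  have refl: "j \<le> K \<Longrightarrow> ?w (Suc (K + j)) = ?w (K - j)" for j
  proof (induction j)
    case 0 then show ?case using K by simp
  next
    case (Suc j)
    then have IH: "?w (Suc (K + j)) = ?w (Suc (K - Suc j))" by (simp add: Suc_diff_Suc)
    have par: "even (Suc (K + j)) = even (K - Suc j)"
      using Suc.prems by auto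
    have "?w (Suc (K + Suc j)) = (if even (K - Suc j) then u (?w (Suc (K + j))) else v (?w (Suc (K + j))))"
      using par by simp
    also have "\<dots> = ?w (K - Suc j)" unfolding IH using u v by simp
    finally show ?case .
  qed
  have beyond: "\<exists>i\<le>K. ?w j = ?w i" for j
  proof (induction j)
    case (Suc j)
    then obtain i where i: "i \<le> K" "?w j = ?w i" by blast
    have "?w (Suc j) \<in> {u (?w i), v (?w i)}" using i by simp
    moreover have "u (?w i) \<in> ?w ` {..K} \<and> v (?w i) \<in> ?w ` {..K}"
    proof -
      have nxt: "?w (Suc i) \<in> ?w ` {..K}"
      proof (cases "i = K")
        case True then show ?thesis unfolding True K by auto
      next
        case False then have "Suc i \<in> {..K}" using i by simp
        then show ?thesis by (rule imageI)
      qed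
      show ?thesis
      proof (cases i)
        case 0
        then have "v (?w i) \<in> ?w ` {..K}" using e by (intro image_eqI[of _ _ 0]) auto
        moreover have "u (?w i) = ?w (Suc i)" using 0 by auto
        ultimately show ?thesis using nxt by presburger
      next
        case (Suc m)
        have m: "?w m \<in> ?w ` {..K}" using i Suc by auto
        show ?thesis
        proof (cases "even i")
          case True
          then have "?w (Suc i) = u (?w i)" "?w i = v (?w m)" using Suc by auto
          then show ?thesis using nxt m v by simp
        next
          case False
          then have "?w (Suc i) = v (?w i)" "?w i = u (?w m)" using Suc by auto
          then show ?thesis using nxt m u by simp
        qed
      qed
    qed
    ultimately show ?case by (auto simp: image_iff)
  qed auto
  have "c = ?w K" if c: "c \<in> range ?w" "c \<noteq> e" "u c = c \<or> v c = c" for c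
  proof -
    obtain j where j: "c = ?w j" using c by auto
    obtain i where i: "i \<le> K" "c = ?w i" using beyond[of j] j by auto
    obtain m where m: "i = Suc m" using c(2) i(2) by (cases i) auto
    have "?w (Suc m) = ?w m \<or> ?w (Suc (Suc m)) = ?w (Suc m)" using nb[OF c(3)] i m by simp
    then have "\<not> m < K \<or> \<not> i < K" using min[of m] min[of i] m by auto
    then have "i = K" using i m by auto
    then show ?thesis using i by simp
  qed
  then show ?thesis using a b by metis
qed

section \<open>Faces of a parity pattern and functions that are constant on them\<close>

locale strip =
  fixes n l :: nat and S :: "node \<Rightarrow> int"
  assumes n_pos: "0 < n"
    and S_step: "step n p q \<Longrightarrow> S q - S p \<in> {0, 1, 2}"
    and S_left: "\<exists>m. \<forall>p. fst p \<le> n \<and> snd p < m \<longrightarrow> S p = 0"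
    and S_right: "\<exists>m. \<forall>p. fst p \<le> n \<and> m \<le> snd p \<longrightarrow> S p = 2 * int l"
begin

definition eadj :: "node \<Rightarrow> node \<Rightarrow> bool" where
  "eadj p q \<longleftrightarrow> (step n p q \<or> step n q p) \<and> (even (S p) \<longleftrightarrow> even (S q))"

definition fc :: "node \<Rightarrow> node \<Rightarrow> bool" where "fc = eadj\<^sup>*\<^sup>*"

lemma fc_refl [simp]: "fc p p" by (simp add: fc_def)

lemma fc_sym: "fc p q \<Longrightarrow> fc q p"
  unfolding fc_def
  by (rule sympD[OF symp_rtranclp], rule sympI) (auto simp: eadj_def)

lemma fc_trans: "fc p q \<Longrightarrow> fc q s \<Longrightarrow> fc p s"
  by (simp add: fc_def)

lemma fc_cong: "fc p q \<Longrightarrow> fc p s \<longleftrightarrow> fc q s" "fc p q \<Longrightarrow> fc s p \<longleftrightarrow> fc s q"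
  using fc_sym fc_trans by blast+

lemma fc_step: "step n p q \<Longrightarrow> (even (S p) \<longleftrightarrow> even (S q)) \<Longrightarrow> fc p q"
  "step n p q \<Longrightarrow> (even (S p) \<longleftrightarrow> even (S q)) \<Longrightarrow> fc q p"
  by (auto simp: fc_def eadj_def intro!: r_into_rtranclp)

lemma fc_even: "fc p q \<Longrightarrow> even (S p) \<longleftrightarrow> even (S q)"
  unfolding fc_def by (induction rule: rtranclp_induct) (auto simp: eadj_def)

lemma fc_const:
  assumes "\<And>p q. step n p q \<Longrightarrow> (even (S p) \<longleftrightarrow> even (S q)) \<Longrightarrow> f p = f q" "fc p q"
  shows "f p = f q"
  using assms(2) unfolding fc_def
  by (induction rule: rtranclp_induct) (auto simp: eadj_def dest: assms(1))

text \<open>Two of the three nodes of a triangle share parity and hence the face, and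
  \<open>G\<close> vanishes inside a face, so cancellation on triangles comes for free. Every later
  construction of a function with prescribed jumps goes through this lemma.\<close>

lemma face_potential:
  fixes G :: "node \<Rightarrow> node \<Rightarrow> int"
  assumes anti: "\<And>p q. G q p = - G p q"
    and inv: "\<And>p p' q. fc p p' \<Longrightarrow> G p q = G p' q"
  obtains c :: "node \<Rightarrow> int" where "\<And>p q. step n p q \<Longrightarrow> c q - c p = G p q"
    and "\<exists>m. \<forall>p. snd p \<le> m \<longrightarrow> c p = 0" and "\<And>p q. fc p q \<Longrightarrow> c p = c q"
proof -
  have G0: "G p q = 0" if "fc p q" for p q
    using anti[of q q] inv[OF that, of q] by simp
  have inv2: "G q p = G q p'" if "fc p p'" for p p' q
    using anti[of q p] anti[of q p'] inv[OF that, of q] by simp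
  obtain m where m: "\<And>p. fst p \<le> n \<Longrightarrow> snd p < m \<Longrightarrow> S p = 0" using S_left by blast
  have tri: "G p s = G p q + G q s" if st: "step n p q" "step n q s" "step n p s" for p q s
  proof -
    consider "even (S p) = even (S q)" | "even (S q) = even (S s)" | "even (S p) = even (S s)" by blast
    then show ?thesis
    proof cases
      case 1
      then have "fc p q" using st fc_step by blast
      then show ?thesis using G0 inv by simp
    next
      case 2
      then have "fc q s" using st fc_step by blast
      then show ?thesis using G0 inv2 by simp
    next
      case 3
      then have "fc p s" using st fc_step by blast
      then show ?thesis using G0 inv2[of p s q] anti[of p q] by simp
    qed
  qed
  have left: "G p q = 0" if st: "step n p q" "snd p < m - 1" for p q
  proof -
    have "S p = 0" "S q = 0" using st by (auto simp: step_def intro!: m)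
    then show ?thesis using G0[OF fc_step(1)[OF st(1)]] by simp
  qed
  have "\<exists>c. (\<forall>p q. step n p q \<longrightarrow> c q - c p = G p q) \<and> (\<forall>p. snd p \<le> m - 1 \<longrightarrow> c p = 0)"
  proof (rule potential[of n G "m - 1"])
    fix p q s assume "step n p q" "step n q s" "step n p s"
    then show "G p s = G p q + G q s" by (rule tri)
  next
    fix p q assume "step n p q" "snd p < m - 1"
    then show "G p q = 0" by (rule left)
  qed blast
  then obtain c where c: "\<And>p q. step n p q \<Longrightarrow> c q - c p = G p q" "\<And>p. snd p \<le> m - 1 \<Longrightarrow> c p = 0"
    by blast
  have "c p = c q" if "fc p q" for p q
  proof (rule fc_const[OF _ that])
    fix p q assume "step n p q" "even (S p) \<longleftrightarrow> even (S q)"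
    then have "c q - c p = 0" using c(1)[of p q] G0[OF fc_step(1)[of p q]] by simp
    then show "c p = c q" by simp
  qed
  then show ?thesis using that c by blast
qed

text \<open>The differences that go with the sum \<open>S\<close>: the functions \<open>(S + d) / 2\<close> and \<open>(S - d) / 2\<close> count the paths
  of two families exactly if \<open>d\<close> is \<open>valid\<close>.\<close>

definition valid :: "(node \<Rightarrow> int) \<Rightarrow> bool" where
  "valid d \<longleftrightarrow>
    (\<forall>p q. step n p q \<longrightarrow> (if even (S p) = even (S q) then d q = d p else \<bar>d q - d p\<bar> = 1)) \<and>
    (\<exists>m. \<forall>p. fst p \<le> n \<and> snd p < m \<longrightarrow> d p = 0) \<and>
    (\<exists>m. \<forall>p. fst p \<le> n \<and> m \<le> snd p \<longrightarrow> d p = 0) \<and>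
    (\<forall>p. n < fst p \<longrightarrow> d p = 0)"

lemma
  assumes v: "valid d" and st: "step n p q"
  shows valid_even: "even (S p) = even (S q) \<Longrightarrow> d q = d p"
    and valid_odd: "even (S p) \<noteq> even (S q) \<Longrightarrow> \<bar>d q - d p\<bar> = 1"
proof -
  have *: "if even (S p) = even (S q) then d q = d p else \<bar>d q - d p\<bar> = 1"
    using v st unfolding valid_def by blast
  show "even (S p) = even (S q) \<Longrightarrow> d q = d p" "even (S p) \<noteq> even (S q) \<Longrightarrow> \<bar>d q - d p\<bar> = 1"
    using * by (simp_all only: if_True if_False)
qed

lemma valid_fc:
  assumes v: "valid d" and "fc p q" shows "d p = d q"
  by (rule fc_const[OF _ assms(2)]) (rule valid_even[OF v, symmetric])

lemma row_induct_const:
  fixes f :: "int \<Rightarrow> 'a"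
  assumes "\<And>x. a \<le> x \<Longrightarrow> x < b \<Longrightarrow> f (x + 1) = f x" "a \<le> b"
  shows "f b = f a"
proof -
  have *: "a \<le> x \<Longrightarrow> x \<le> b \<Longrightarrow> f x = f a" for x
  proof (induction x rule: int_ge_induct)
    case (step x) then show ?case using assms(1)[of x] by simp
  qed simp
  show ?thesis using *[of b] assms(2) by blast
qed

lemma step_E: "r \<le> n \<Longrightarrow> step n (r, x) (r, x + 1)" by (simp add: step_def)

lemma S_mono:
  assumes "r \<le> n" shows "x \<le> y \<Longrightarrow> S (r, x) \<le> S (r, y)"
proof (induction y rule: int_ge_induct)
  case (step y)
  then show ?case using S_step[OF step_E[OF assms, of y]] by auto
qed simp

lemma S_bounds: "fst p \<le> n \<Longrightarrow> 0 \<le> S p" "fst p \<le> n \<Longrightarrow> S p \<le> 2 * int l"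
proof -
  obtain r x where p: "p = (r, x)" by (cases p)
  assume r: "fst p \<le> n"
  obtain m where m: "\<And>p. fst p \<le> n \<Longrightarrow> snd p < m \<Longrightarrow> S p = 0" using S_left by blast
  have "S (r, min x (m - 1)) \<le> S (r, x)" by (rule S_mono) (use r p in auto)
  moreover have "S (r, min x (m - 1)) = 0" by (rule m) (use r p in auto)
  ultimately show "0 \<le> S p" using p by simp
  obtain m where m: "\<And>p. fst p \<le> n \<Longrightarrow> m \<le> snd p \<Longrightarrow> S p = 2 * int l" using S_right by blast
  have "S (r, x) \<le> S (r, max x m)" by (rule S_mono) (use r p in auto)
  moreover have "S (r, max x m) = 2 * int l" by (rule m) (use r p in auto)
  ultimately show "S p \<le> 2 * int l" using p by simp
qed

text \<open>Along a row both parities change on the same edges, and both functions vanish far to the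
  left.\<close>

lemma valid_parity: "valid d \<Longrightarrow> fst p \<le> n \<Longrightarrow> even (d p) = even (S p)"
proof -
  assume v: "valid d" and r: "fst p \<le> n"
  obtain r x where p: "p = (r, x)" by (cases p)
  obtain m where m: "\<And>p. fst p \<le> n \<Longrightarrow> snd p < m \<Longrightarrow> S p = 0" using S_left by blast
  obtain m' where m': "\<And>p. fst p \<le> n \<Longrightarrow> snd p < m' \<Longrightarrow> d p = 0" using v unfolding valid_def by blast
  have ab: "odd (k::int)" if "\<bar>k\<bar> = 1" for k using that by (cases "k < 0") auto
  define f where "f y = (even (d (r, y)) = even (S (r, y)))" for y
  have "f x = f (min x (min m m' - 1))"
  proof (rule row_induct_const)
    fix y
    have st: "step n (r, y) (r, y + 1)" using r p by (simp add: step_E)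
    show "f (y + 1) = f y"
    proof (cases "even (S (r, y)) = even (S (r, y + 1))")
      case True
      then show ?thesis unfolding f_def using valid_even[OF v st] by simp
    next
      case False
      then have "odd (d (r, y + 1) - d (r, y))" using ab valid_odd[OF v st] by blast
      then show ?thesis unfolding f_def using False by auto
    qed
  qed simp
  moreover have "f (min x (min m m' - 1))" unfolding f_def using r p m m' by simp
  ultimately show ?thesis unfolding f_def p by simp
qed

end

text \<open>The third vertex of the triangle on the given edge that points upwards;
  \<open>down\<close> does the same for the triangle pointing downwards. Each edge has one triangle
  of either kind, except that horizontal edges of row \<open>n\<close> lack the first and those of
  row 0 the second. This is why following a curve alternates between two involutions.\<close>

fun up :: "node \<Rightarrow> node \<Rightarrow> node" where
  "up (r, x) (r', x') = (if r = r' then (Suc r, max x x')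
     else if r < r' then (r, 2 * x' - 1 - x) else (r', 2 * x - 1 - x'))"

fun down :: "node \<Rightarrow> node \<Rightarrow> node" where
  "down (r, x) (r', x') = (if r = r' then (r - 1, min x x')
     else if r < r' then (r', 2 * x + 1 - x') else (r, 2 * x' + 1 - x))"

lemma step_cases:
  assumes "step n a b"
  obtains (E) r x where "r \<le> n" "a = (r, x)" "b = (r, x + 1)"
    | (NE) r x where "r < n" "a = (r, x)" "b = (Suc r, x + 1)"
    | (SE) r x where "r < n" "a = (Suc r, x)" "b = (r, x)"
proof -
  obtain r x r' x' where ab: "a = (r, x)" "b = (r', x')" by (cases a, cases b)
  have "r \<le> n" "r' \<le> n" "r' = r \<and> x' = x + 1 \<or> r' = Suc r \<and> x' = x + 1 \<or> r = Suc r' \<and> x' = x"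
    using assms ab by (auto simp: step_def)
  then show ?thesis
    using ab E[of r x] NE[of r x] SE[of r' x] by (elim disjE) auto
qed

lemma up_commute: "up a b = up b a" and down_commute: "down a b = down b a"
  by (cases a; cases b; auto)+

lemma up_triangle:
  assumes "step n a b \<or> step n b a" "\<not> (fst a = n \<and> fst b = n)"
  shows "step n a (up a b) \<or> step n (up a b) a" "step n b (up a b) \<or> step n (up a b) b"
    "up (up a b) b = a" "up a (up a b) = b"
    "\<not> (fst (up a b) = n \<and> fst b = n)" "\<not> (fst a = n \<and> fst (up a b) = n)"
proof -
  define P where "P a b \<longleftrightarrow> (step n a (up a b) \<or> step n (up a b) a) \<and> (step n b (up a b) \<or> step n (up a b) b) \<and>
    up (up a b) b = a \<and> up a (up a b) = b \<and> \<not> (fst (up a b) = n \<and> fst b = n) \<and>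
    \<not> (fst a = n \<and> fst (up a b) = n)" for a b
  have *: "P a b" if "step n a b" "\<not> (fst a = n \<and> fst b = n)" for a b
    using that(1)
  proof (cases rule: step_cases)
    case (E r x) then show ?thesis using that(2) by (cases r) (simp_all add: P_def step_def)
  next
    case (NE r x) then show ?thesis by (simp add: P_def step_def)
  next
    case (SE r x) then show ?thesis by (simp add: P_def step_def)
  qed
  have "P a b"
  proof (cases "step n a b")
    case False
    then have "P b a" using * assms by blast
    then show ?thesis unfolding P_def by (auto simp: up_commute)
  qed (use * assms in blast)
  then show "step n a (up a b) \<or> step n (up a b) a" "step n b (up a b) \<or> step n (up a b) b"
    "up (up a b) b = a" "up a (up a b) = b"
    "\<not> (fst (up a b) = n \<and> fst b = n)" "\<not> (fst a = n \<and> fst (up a b) = n)"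
    unfolding P_def by blast+
qed

lemma down_triangle:
  assumes "step n a b \<or> step n b a" "\<not> (fst a = 0 \<and> fst b = 0)"
  shows "step n a (down a b) \<or> step n (down a b) a" "step n b (down a b) \<or> step n (down a b) b"
    "down (down a b) b = a" "down a (down a b) = b"
    "\<not> (fst (down a b) = 0 \<and> fst b = 0)" "\<not> (fst a = 0 \<and> fst (down a b) = 0)"
proof -
  define P where "P a b \<longleftrightarrow> (step n a (down a b) \<or> step n (down a b) a) \<and> (step n b (down a b) \<or> step n (down a b) b) \<and>
    down (down a b) b = a \<and> down a (down a b) = b \<and> \<not> (fst (down a b) = 0 \<and> fst b = 0) \<and>
    \<not> (fst a = 0 \<and> fst (down a b) = 0)" for a b
  have *: "P a b" if "step n a b" "\<not> (fst a = 0 \<and> fst b = 0)" for a b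
    using that(1)
  proof (cases rule: step_cases)
    case (E r x) then show ?thesis using that(2) by (cases r) (simp_all add: P_def step_def)
  next
    case (NE r x) then show ?thesis by (simp add: P_def step_def)
  next
    case (SE r x) then show ?thesis by (simp add: P_def step_def)
  qed
  have "P a b"
  proof (cases "step n a b")
    case False
    then have "P b a" using * assms by blast
    then show ?thesis unfolding P_def by (auto simp: down_commute)
  qed (use * assms in blast)
  then show "step n a (down a b) \<or> step n (down a b) a" "step n b (down a b) \<or> step n (down a b) b"
    "down (down a b) b = a" "down a (down a b) = b"
    "\<not> (fst (down a b) = 0 \<and> fst b = 0)" "\<not> (fst a = 0 \<and> fst (down a b) = 0)"
    unfolding P_def by blast+
qed

text \<open>The guards exclude the edges on the border of the strip, where \<open>up\<close> or
  \<open>down\<close> does not give a vertex of a triangle of the strip.\<close>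

definition tri :: "nat \<Rightarrow> node \<Rightarrow> node \<Rightarrow> node \<Rightarrow> bool" where
  "tri n a b c \<longleftrightarrow> \<not> (fst a = n \<and> fst b = n) \<and> c = up a b \<or> \<not> (fst a = 0 \<and> fst b = 0) \<and> c = down a b"

lemma tri_steps:
  assumes "step n p q" "step n q s" "step n p s"
  shows "tri n p q s" "tri n q p s" "tri n p s q" "tri n s p q" "tri n q s p" "tri n s q p"
proof -
  have "\<exists>r x. r < n \<and> (p = (r, x) \<and> q = (Suc r, x + 1) \<and> s = (r, x + 1) \<or>
    p = (Suc r, x) \<and> q = (r, x) \<and> s = (Suc r, x + 1))"
    using assms(1)
  proof (cases rule: step_cases)
    case (E r x) then show ?thesis using assms(2,3) by (cases s) (auto simp: step_def)
  next
    case (NE r x)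
    then have "s = (r, x + 1)" using assms(2,3) by (cases s) (auto simp: step_def)
    then show ?thesis using NE by blast
  next
    case (SE r x)
    then have "s = (Suc r, x + 1)" using assms(2,3) by (cases s) (auto simp: step_def)
    then show ?thesis using SE by blast
  qed
  then obtain r x where "r < n" and "p = (r, x) \<and> q = (Suc r, x + 1) \<and> s = (r, x + 1) \<or>
    p = (Suc r, x) \<and> q = (r, x) \<and> s = (Suc r, x + 1)" by blast
  then show "tri n p q s" "tri n q p s" "tri n p s q" "tri n s p q" "tri n q s p" "tri n s q p"
    by (auto simp: tri_def)
qed

section \<open>Curves between two faces\<close>

context strip
begin

definition odd_edge :: "node \<times> node \<Rightarrow> bool" where
  "odd_edge e \<longleftrightarrow> even (S (fst e)) \<and> odd (S (snd e)) \<and> (step n (fst e) (snd e) \<or> step n (snd e) (fst e))"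

text \<open>An edge separating an even from an odd node lies in at most two triangles, each of which has exactly
  one other such edge. Following the edges through the triangles gives the curve that separates two faces.\<close>

definition inv_up :: "node \<times> node \<Rightarrow> node \<times> node" where
  "inv_up e = (case e of (a, b) \<Rightarrow> if odd_edge e \<and> \<not> (fst a = n \<and> fst b = n)
     then (if even (S (up a b)) then (up a b, b) else (a, up a b)) else e)"

definition inv_down :: "node \<times> node \<Rightarrow> node \<times> node" where
  "inv_down e = (case e of (a, b) \<Rightarrow> if odd_edge e \<and> \<not> (fst a = 0 \<and> fst b = 0)
     then (if even (S (down a b)) then (down a b, b) else (a, down a b)) else e)"

lemma inv_up_up: "inv_up (inv_up e) = e"
proof -
  obtain a b where Pair: "e = (a, b)" by (cases e)
  show ?thesis
  proof (cases "odd_edge e \<and> \<not> (fst a = n \<and> fst b = n)")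
    case True
    then have st: "step n a b \<or> step n b a" and top: "\<not> (fst a = n \<and> fst b = n)"
      and par: "even (S a)" "odd (S b)"
      using Pair by (auto simp: odd_edge_def)
    note t = up_triangle[OF st top]
    show ?thesis
    proof (cases "even (S (up a b))")
      case even: True
      then have e: "inv_up e = (up a b, b)" using True by (simp add: inv_up_def Pair)
      have "odd_edge (up a b, b)" using even par t(2) by (auto simp: odd_edge_def)
      then show ?thesis unfolding e using t(3,5) par Pair by (simp add: inv_up_def)
    next
      case odd: False
      then have e: "inv_up e = (a, up a b)" using True by (simp add: inv_up_def Pair)
      have "odd_edge (a, up a b)" using odd par t(1) by (auto simp: odd_edge_def)
      then show ?thesis unfolding e using t(4,6) par Pair by (simp add: inv_up_def)
    qed
  next
    case False
    then have "inv_up e = e" unfolding inv_up_def Pair prod.case by (rule if_not_P)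
    then show ?thesis by simp
  qed
qed

lemma inv_down_down: "inv_down (inv_down e) = e"
proof -
  obtain a b where Pair: "e = (a, b)" by (cases e)
  show ?thesis
  proof (cases "odd_edge e \<and> \<not> (fst a = 0 \<and> fst b = 0)")
    case True
    then have st: "step n a b \<or> step n b a" and top: "\<not> (fst a = 0 \<and> fst b = 0)"
      and par: "even (S a)" "odd (S b)"
      using Pair by (auto simp: odd_edge_def)
    note t = down_triangle[OF st top]
    show ?thesis
    proof (cases "even (S (down a b))")
      case even: True
      then have e: "inv_down e = (down a b, b)" using True by (simp add: inv_down_def Pair)
      have "odd_edge (down a b, b)" using even par t(2) by (auto simp: odd_edge_def)
      then show ?thesis unfolding e using t(3,5) par Pair by (simp add: inv_down_def)
    next
      case odd: False
      then have e: "inv_down e = (a, down a b)" using True by (simp add: inv_down_def Pair)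
      have "odd_edge (a, down a b)" using odd par t(1) by (auto simp: odd_edge_def)
      then show ?thesis unfolding e using t(4,6) par Pair by (simp add: inv_down_def)
    qed
  next
    case False
    then have "inv_down e = e" unfolding inv_down_def Pair prod.case by (rule if_not_P)
    then show ?thesis by simp
  qed
qed

text \<open>The third vertex of a triangle replaces the end of its own parity, to which it is
  adjacent. So the even end stays in one face and the odd end in another: a curve runs between two
  fixed faces.\<close>

lemma inv_edge:
  assumes "odd_edge e"
  shows "odd_edge (inv_up e)" "fc (fst e) (fst (inv_up e))" "fc (snd e) (snd (inv_up e))"
    "odd_edge (inv_down e)" "fc (fst e) (fst (inv_down e))" "fc (snd e) (snd (inv_down e))"
proof -
  obtain a b where e: "e = (a, b)" by (cases e)
  have st: "step n a b \<or> step n b a" and par: "even (S a)" "odd (S b)"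
    using assms e by (auto simp: odd_edge_def)
  have "odd_edge (inv_up e) \<and> fc (fst e) (fst (inv_up e)) \<and> fc (snd e) (snd (inv_up e))"
  proof (cases "fst a = n \<and> fst b = n")
    case True then show ?thesis using assms e by (simp add: inv_up_def)
  next
    case False
    note t = up_triangle[OF st False]
    have "even (S (up a b)) \<Longrightarrow> fc a (up a b)" "odd (S (up a b)) \<Longrightarrow> fc b (up a b)"
      using fc_step t(1,2) par by blast+
    then show ?thesis using False assms e t(1,2) by (auto simp: inv_up_def odd_edge_def)
  qed
  then show "odd_edge (inv_up e)" "fc (fst e) (fst (inv_up e))" "fc (snd e) (snd (inv_up e))" by auto
  have "odd_edge (inv_down e) \<and> fc (fst e) (fst (inv_down e)) \<and> fc (snd e) (snd (inv_down e))"
  proof (cases "fst a = 0 \<and> fst b = 0")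
    case True then show ?thesis using assms e by (simp add: inv_down_def)
  next
    case False
    note t = down_triangle[OF st False]
    have "even (S (down a b)) \<Longrightarrow> fc a (down a b)" "odd (S (down a b)) \<Longrightarrow> fc b (down a b)"
      using fc_step t(1,2) par by blast+
    then show ?thesis using False assms e t(1,2) by (auto simp: inv_down_def odd_edge_def)
  qed
  then show "odd_edge (inv_down e)" "fc (fst e) (fst (inv_down e))" "fc (snd e) (snd (inv_down e))" by auto
qed

lemma walk_edge:
  assumes "odd_edge e"
  shows "odd_edge (walk inv_up inv_down e k) \<and> fc (fst e) (fst (walk inv_up inv_down e k)) \<and>
    fc (snd e) (snd (walk inv_up inv_down e k))"
proof (induction k)
  case (Suc k)
  let ?e = "walk inv_up inv_down e k"
  have "odd_edge ?e" "fc (fst e) (fst ?e)" "fc (snd e) (snd ?e)" using Suc by auto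
  then show ?case
    using inv_edge[of ?e] fc_trans[of "fst e" "fst ?e"] fc_trans[of "snd e" "snd ?e"] by simp
qed (use assms in simp)

lemma S0_fc: "fst p \<le> n \<Longrightarrow> S p = 0 \<Longrightarrow> z \<le> snd p \<Longrightarrow> fc (fst p, z) p"
proof -
  assume p: "fst p \<le> n" "S p = 0" "z \<le> snd p"
  obtain r x where rx: "p = (r, x)" by (cases p)
  have S0: "S (r, y) = 0" if "y \<le> x" for y
    using S_mono[of r y x] S_bounds(1)[of "(r, y)"] that p rx by simp
  have "fc (r, z) (r, x) = fc (r, z) (r, z)"
  proof (rule row_induct_const)
    fix y assume "z \<le> y" "y < x"
    then have "fc (r, y) (r, y + 1)" using S0[of y] S0[of "y + 1"] step_E p rx by (intro fc_step) auto
    then show "fc (r, z) (r, y + 1) = fc (r, z) (r, y)" using fc_cong by blast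
  qed (use p rx in simp)
  then show ?thesis using rx by simp
qed

lemma S2l_fc: "fst p \<le> n \<Longrightarrow> S p = 2 * int l \<Longrightarrow> snd p \<le> z \<Longrightarrow> fc p (fst p, z)"
proof -
  assume p: "fst p \<le> n" "S p = 2 * int l" "snd p \<le> z"
  obtain r x where rx: "p = (r, x)" by (cases p)
  have S0: "S (r, y) = 2 * int l" if "x \<le> y" for y
    using S_mono[of r x y] S_bounds(2)[of "(r, y)"] that p rx by simp
  have "fc (r, x) (r, z) = fc (r, x) (r, x)"
  proof (rule row_induct_const)
    fix y assume "x \<le> y" "y < z"
    then have "fc (r, y) (r, y + 1)" using S0[of y] S0[of "y + 1"] step_E p rx by (intro fc_step) auto
    then show "fc (r, x) (r, y + 1) = fc (r, x) (r, y)" using fc_cong by blast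
  qed (use p rx in simp)
  then show ?thesis using rx by simp
qed

text \<open>Far to the right all nodes have \<open>S = 2 * int l\<close> and are joined vertically.
  Such nodes thus belong to a face that meets the top row, which transports boundary values from the
  top to the right side.\<close>

lemma right_fc_top:
  assumes "fst p \<le> n" "S p = 2 * int l" obtains z where "fc p (n, z)" "fc p (0, z)" "S (0, z) = 2 * int l" "snd p \<le> z"
    "S (n, z) = 2 * int l"
proof -
  obtain m where m: "\<And>p. fst p \<le> n \<Longrightarrow> m \<le> snd p \<Longrightarrow> S p = 2 * int l" using S_right by blast
  define z where "z = max m (snd p)"
  have *: "fc (0, z) (r, z)" if "r \<le> n" for r
    using that
  proof (induction r)
    case (Suc r)
    have "fc (r, z) (Suc r, z)"
      using Suc.prems m[of "(r, z)"] m[of "(Suc r, z)"] by (intro fc_step(2)) (auto simp: step_def z_def)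
    then show ?case using Suc fc_trans by simp
  qed simp
  have "fc p (fst p, z)" using assms by (intro S2l_fc) (auto simp: z_def)
  then have "fc p (0, z)" using *[OF assms(1)] fc_sym fc_trans by blast
  then show ?thesis using that[of z] *[of n] fc_trans m[of "(0, z)"] m[of "(n, z)"] by (auto simp: z_def)
qed

end

context strip
begin

text \<open>A discrete Jordan curve: the boundary curve that leaves row 0 between \<open>x\<close>
  and \<open>a\<close> has to come back to row 0 between \<open>a\<close> and \<open>y\<close>, and
  \<open>c\<close> distinguishes its inside from its outside. Consequently a face with a node at
  \<open>a\<close> can reach neither the top, nor the sides, nor row 0 outside the gap between
  \<open>x\<close> and \<open>y\<close>.\<close>

lemma separator:
  assumes d: "valid d" and xay: "x < a" "a < y" and xy: "fc (0, x) (0, y)" and xa: "\<not> fc (0, x) (0, a)"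
  obtains c :: "node \<Rightarrow> int" where "\<And>p q. fc p q \<Longrightarrow> c p = c q" "c (0, a) \<noteq> 0"
    "\<And>z. z \<le> x \<or> y \<le> z \<Longrightarrow> c (0, z) = 0" "\<And>z. c (n, z) = 0"
    "\<And>p. fst p \<le> n \<Longrightarrow> S p = 0 \<or> S p = 2 * int l \<Longrightarrow> c p = 0"
proof -
  define X where "X = {z \<in> {x..<a}. fc (0, x) (0, z)}"
  have fin: "finite X" by (rule finite_subset[of _ "{x..<a}"]) (auto simp: X_def)
  have xX: "x \<in> X" using xay by (auto simp: X_def)
  \<comment> \<open>The last node of the face of \<open>x\<close> before \<open>a\<close>; the curve
    starts at the edge to its right.\<close>
  define x1 where "x1 = Max X"
  have x1X: "x1 \<in> X" unfolding x1_def using fin xX by (intro Max_in) auto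
  then have x1: "x \<le> x1" "x1 < a" "fc (0, x) (0, x1)" by (auto simp: X_def)
  have after: "\<not> fc (0, x) (0, z)" if "x1 < z" "z \<le> a" for z
  proof (cases "z = a")
    case False
    then have "z \<notin> X" using that Max_ge[OF fin, of z] unfolding x1_def[symmetric] by auto
    then show ?thesis using that x1 False by (auto simp: X_def)
  qed (use xa in simp)
  have st0: "step n (0, x1) (0, x1 + 1)" by (simp add: step_E)
  have par: "even (S (0, x1)) \<noteq> even (S (0, x1 + 1))"
    using after[of "x1 + 1"] x1 fc_trans[OF x1(3) fc_step(1)[OF st0]] by auto
  define e0 where "e0 = (if even (S (0, x1)) then ((0, x1), (0, x1 + 1)) else ((0::nat, x1 + 1), (0::nat, x1)))"
  have oe: "odd_edge e0" using par st0 by (auto simp: e0_def odd_edge_def)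
  define K where "K = range (walk inv_up inv_down e0)"
  have vfix: "inv_down e = e" if "fst (fst e) = 0" "fst (snd e) = 0" for e
    using that by (auto simp: inv_down_def split: prod.splits)
  have ufix: "inv_up e = e" if "fst (fst e) = n" "fst (snd e) = n" for e
    using that by (auto simp: inv_up_def split: prod.splits)
  have e0fix: "inv_down e0 = e0" by (rule vfix) (auto simp: e0_def)
  have Kedge: "odd_edge e" "fc (fst e0) (fst e)" "fc (snd e0) (snd e)" if "e \<in> K" for e
    using that walk_edge[OF oe] unfolding K_def by auto
  have Kup: "inv_up e \<in> K" and Kdown: "inv_down e \<in> K" if "e \<in> K" for e
    using that walk_closed[OF inv_up_up inv_down_down e0fix] unfolding K_def by auto
  have ends: "e = f" if "e \<in> K" "e \<noteq> e0" "inv_up e = e \<or> inv_down e = e" "f \<in> K" "f \<noteq> e0" "inv_up f = f \<or> inv_down f = f" for e f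
    using walk_ends[OF inv_up_up inv_down_down e0fix, of e f] that unfolding K_def by blast
  define inK where "inK p q \<longleftrightarrow> (p, q) \<in> K \<or> (q, p) \<in> K" for p q
  have inK_sym: "inK p q = inK q p" for p q unfolding inK_def by blast
  have Kodd: "even (S p)" "odd (S q)" if "(p, q) \<in> K" for p q
    using Kedge(1)[OF that] by (simp_all add: odd_edge_def)
  have inK_odd: "even (S p) \<noteq> even (S q)" if "inK p q" for p q
    using that Kodd unfolding inK_def by blast
  have inK_imp: "inK w z'" if t: "tri n w z z'" "tri n z w z'" and p: "even (S z) = even (S z')" and w: "inK w z" for w z z'
  proof (cases "even (S w)")
    case True
    then have K: "(w, z) \<in> K" using w Kodd unfolding inK_def by blast
    then have "odd_edge (w, z)" "odd (S z')" using Kedge(1) Kodd(2) p by auto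
    then have "(w, z') \<in> {inv_up (w, z), inv_down (w, z)}"
      using t(1) unfolding tri_def inv_up_def inv_down_def by auto
    then show ?thesis using Kup[OF K] Kdown[OF K] unfolding inK_def by auto
  next
    case False
    then have K: "(z, w) \<in> K" using w Kodd unfolding inK_def by blast
    then have "odd_edge (z, w)" "even (S z')" using Kedge(1) Kodd(1) p by auto
    then have "(z', w) \<in> {inv_up (z, w), inv_down (z, w)}"
      using t(2) unfolding tri_def inv_up_def inv_down_def by auto
    then show ?thesis using Kup[OF K] Kdown[OF K] unfolding inK_def by auto
  qed
  \<comment> \<open>The increments of \<open>d\<close>, kept only across the curve. In a triangle
    the curve uses both of its odd edges or neither, and \<open>d\<close> does not change along the
    third edge, so cancellation survives; \<open>d\<close> supplies consistent signs of
    crossing.\<close>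
  define g where "g p q = (if inK p q then d q - d p else 0)" for p q
  obtain m where m: "\<And>p. fst p \<le> n \<Longrightarrow> snd p < m \<Longrightarrow> S p = 0" using S_left by blast
  have triid: "g p s = g p q + g q s" if st: "step n p q" "step n q s" "step n p s" for p q s
  proof -
    note t = tri_steps[OF st]
    note o = inK_odd[of p q] inK_odd[of q s] inK_odd[of p s]
    consider "even (S p) = even (S q)" "even (S q) = even (S s)"
      | "even (S p) = even (S q)" "even (S q) \<noteq> even (S s)"
      | "even (S p) \<noteq> even (S q)" "even (S q) = even (S s)"
      | "even (S p) = even (S s)" "even (S q) \<noteq> even (S s)" by blast
    then show ?thesis
    proof cases
      case 1
      then show ?thesis unfolding g_def using o by auto
    next
      case 2
      have "inK p s = inK q s" using inK_imp[of s p q] inK_imp[of s q p] t 2 inK_sym by blast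
      moreover have "d q = d p" using valid_even[OF d st(1)] 2 by simp
      ultimately show ?thesis using 2 o unfolding g_def by auto
    next
      case 3
      have "inK p s = inK p q" using inK_imp[of p q s] inK_imp[of p s q] t 3 inK_sym by blast
      moreover have "d q = d s" using valid_even[OF d st(2)] 3 by simp
      ultimately show ?thesis using 3 o unfolding g_def by auto
    next
      case 4
      have "inK p q = inK q s" using inK_imp[of q p s] inK_imp[of q s p] t 4 inK_sym by blast
      moreover have "d s = d p" using valid_even[OF d st(3)] 4 by simp
      ultimately show ?thesis using 4 o unfolding g_def by auto
    qed
  qed
  have "\<exists>c. (\<forall>p q. step n p q \<longrightarrow> c q - c p = g p q) \<and> (\<forall>p. snd p \<le> m - 1 \<longrightarrow> c p = 0)"
  proof (rule potential[of n g "m - 1"])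
    fix p q s assume "step n p q" "step n q s" "step n p s"
    then show "g p s = g p q + g q s" by (rule triid)
  next
    fix p q assume st: "step n p q" "snd p < m - 1"
    then have "S p = 0" "S q = 0" by (auto simp: step_def intro!: m)
    then show "g p q = 0" using inK_odd[of p q] by (auto simp: g_def)
  qed blast
  then obtain c where c: "\<And>p q. step n p q \<Longrightarrow> c q - c p = g p q" "\<And>p. snd p \<le> m - 1 \<Longrightarrow> c p = 0"
    by blast
  have c_fc: "c p = c q" if "fc p q" for p q
  proof (rule fc_const[OF _ that])
    fix p q assume st: "step n p q" "even (S p) \<longleftrightarrow> even (S q)"
    then have "\<not> inK p q" using inK_odd by blast
    then show "c p = c q" using c(1)[OF st(1)] by (simp add: g_def)
  qed
  have cE: "c (r, z + 1) = c (r, z)" if "r \<le> n" "\<not> inK (r, z) (r, z + 1)" for r z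
    using c(1)[OF step_E[of r z]] that by (auto simp: g_def)
  have e0K: "e0 \<in> K" unfolding K_def by (metis rangeI walk.simps(1))
  have inK0: "inK (0, x1) (0, x1 + 1)" using e0K by (auto simp: inK_def e0_def split: if_splits)
  have jump: "c (0, x1 + 1) \<noteq> c (0, x1)"
    using c(1)[OF st0] inK0 valid_odd[OF d st0 par] by (auto simp: g_def)
  have cx1: "c (0, y) = c (0, x1)" using c_fc xy x1(3) by metis
  \<comment> \<open>With a single crossing \<open>c\<close> would differ at \<open>x1\<close> and
    \<open>y\<close>, which lie in one face. The second crossing uses up the other end of the curve,
    so no edge of the top row remains.\<close>
  have "\<exists>x2. x1 < x2 \<and> x2 < y \<and> inK (0, x2) (0, x2 + 1)"
  proof (rule ccontr)
    assume no: "\<not> ?thesis"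
    have "c (0, y) = c (0, x1 + 1)"
    proof (rule row_induct_const[where f = "\<lambda>z. c (0, z)"])
      fix z assume "x1 + 1 \<le> z" "z < y"
      then have "\<not> inK (0, z) (0, z + 1)" using no by auto
      then show "c (0, z + 1) = c (0, z)" using cE[of 0] by simp
    qed (use x1 xay in simp)
    then show False using jump cx1 by simp
  qed
  then obtain x2 where x2: "x1 < x2" "x2 < y" "inK (0, x2) (0, x2 + 1)" by blast
  have "\<exists>e2 \<in> K. e2 = ((0, x2), (0, x2 + 1)) \<or> e2 = ((0, x2 + 1), (0, x2))"
    using x2(3) unfolding inK_def by blast
  then obtain e2 where e2: "e2 \<in> K" "e2 = ((0, x2), (0, x2 + 1)) \<or> e2 = ((0, x2 + 1), (0, x2))" by blast
  have e20: "e2 \<noteq> e0" using e2(2) x2(1) by (auto simp: e0_def)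
  have e2fix: "inv_down e2 = e2" by (rule vfix) (use e2(2) in auto)
  have only: "z = x1 \<or> z = x2" if "inK (0, z) (0, z + 1)" for z
  proof -
    obtain e where e: "e \<in> K" "e = ((0, z), (0, z + 1)) \<or> e = ((0, z + 1), (0, z))"
      using \<open>inK (0, z) (0, z + 1)\<close> unfolding inK_def by blast
    have "inv_down e = e" by (rule vfix) (use e(2) in auto)
    then have "e = e0 \<or> e = e2" using ends[of e e2] e(1) e2(1) e20 e2fix by blast
    then show ?thesis using e(2) e2(2) by (auto simp: e0_def split: if_splits)
  qed
  have topK: "\<not> inK (n, z) (n, z + 1)" for z
  proof
    assume "inK (n, z) (n, z + 1)"
    then obtain e where e: "e \<in> K" "e = ((n, z), (n, z + 1)) \<or> e = ((n, z + 1), (n, z))"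
      unfolding inK_def by blast
    have "inv_up e = e" by (rule ufix) (use e(2) in auto)
    moreover have "e \<noteq> e0" using e(2) n_pos by (auto simp: e0_def)
    ultimately have "e = e2" using ends[of e e2] e(1) e2(1) e20 e2fix by blast
    then show False using e(2) e2(2) n_pos by auto
  qed
  have ctop: "c (n, z) = 0" for z
  proof -
    have "c (n, z) = c (n, min z (m - 1))"
      by (rule row_induct_const[where f = "\<lambda>z. c (n, z)"]) (use cE topK in auto)
    then show ?thesis using c(2) by simp
  qed
  have crow: "c (0, w) = c (0, z)" if "z \<le> w" "\<And>x. z \<le> x \<Longrightarrow> x < w \<Longrightarrow> x \<noteq> x1 \<and> x \<noteq> x2" for z w
  proof (rule row_induct_const[where f = "\<lambda>z. c (0, z)"])
    fix x assume "z \<le> x" "x < w"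
    then have "\<not> inK (0, x) (0, x + 1)" using that(2) only by blast
    then show "c (0, x + 1) = c (0, x)" using cE by simp
  qed (rule that(1))
  have cleft: "c (0, z) = 0" if "z \<le> x1" for z
  proof -
    have "c (0, z) = c (0, min z (m - 1))"
      by (rule crow) (use that x2 in auto)
    then show ?thesis using c(2) by simp
  qed
  have cright: "c (0, z) = 0" if "x2 < z" for z
  proof -
    have "c (0, w) = c (0, x2 + 1)" if "x2 < w" for w
      by (rule crow) (use that x2 in auto)
    from this[of z] this[of y] show ?thesis using that x2 cx1 cleft by simp
  qed
  \<comment> \<open>The edge at \<open>x2\<close> has an end in the face of \<open>x1\<close>, and
    between \<open>x1\<close> and \<open>a\<close> there is no such node.\<close>
  have x2a: "a \<le> x2"
  proof (rule ccontr)
    assume "\<not> a \<le> x2"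
    then have bad: "\<not> fc (0, x1) (0, x2)" "\<not> fc (0, x1) (0, x2 + 1)"
      using after[of x2] after[of "x2 + 1"] x2 x1 fc_trans by auto
    show False
      using Kedge(2,3)[OF e2(1)] e2(2) bad unfolding e0_def by (auto split: if_splits)
  qed
  have ca: "c (0, a) = c (0, x1 + 1)"
    by (rule crow) (use x2a x1 in auto)
  have cS: "c p = 0" if p: "fst p \<le> n" "S p = 0 \<or> S p = 2 * int l" for p
  proof (cases "S p = 0")
    case True
    have "fc (fst p, min (snd p) (m - 1)) p" by (rule S0_fc[OF p(1) True]) simp
    from c_fc[OF this] show ?thesis using c(2)[of "(fst p, min (snd p) (m - 1))"] by simp
  next
    case False
    then obtain z where "fc p (n, z)" using right_fc_top[OF p(1)] p(2) by blast
    from c_fc[OF this] show ?thesis using ctop by simp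
  qed
  show ?thesis
  proof (rule that[of c])
    show "c p = c q" if "fc p q" for p q using c_fc that .
    show "c (0, a) \<noteq> 0" using ca jump cleft by simp
    show "c (0, z) = 0" if "z \<le> x \<or> y \<le> z" for z using that cleft cright x1 x2 by auto
    show "c (n, z) = 0" for z by (rule ctop)
    show "c p = 0" if "fst p \<le> n" "S p = 0 \<or> S p = 2 * int l" for p using cS that .
  qed
qed

end

section \<open>Folding the heights\<close>

definition zig :: "int \<Rightarrow> int" where
  "zig z = (if z mod 4 = 3 then 1 else z mod 4)"

lemma mod4_cases: "(z::int) mod 4 = 0 \<or> z mod 4 = 1 \<or> z mod 4 = 2 \<or> z mod 4 = 3"
  by presburger

lemma zig_step: "\<bar>a - b\<bar> = 1 \<Longrightarrow> \<bar>zig a - zig b\<bar> = 1"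
proof -
  have *: "\<bar>zig (b + 1) - zig b\<bar> = 1" for b
  proof -
    have "b mod 4 = 0 \<Longrightarrow> (b + 1) mod 4 = 1" "b mod 4 = 1 \<Longrightarrow> (b + 1) mod 4 = 2"
      "b mod 4 = 2 \<Longrightarrow> (b + 1) mod 4 = 3" "b mod 4 = 3 \<Longrightarrow> (b + 1) mod 4 = 0" by presburger+
    then show ?thesis using mod4_cases[of b] by (auto simp: zig_def)
  qed
  assume "\<bar>a - b\<bar> = 1"
  then have "a = b + 1 \<or> b = a + 1" by linarith
  then show ?thesis using *[of a] *[of b] by (auto simp: abs_minus_commute)
qed

lemma zig_abs: "zig \<bar>a\<bar> = zig a"
proof -
  have "a mod 4 = 0 \<Longrightarrow> (- a) mod 4 = 0" "a mod 4 = 1 \<Longrightarrow> (- a) mod 4 = 3"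
    "a mod 4 = 2 \<Longrightarrow> (- a) mod 4 = 2" "a mod 4 = 3 \<Longrightarrow> (- a) mod 4 = 1" by presburger+
  then have "zig (- a) = zig a" using mod4_cases[of a] by (auto simp: zig_def)
  then show ?thesis by (simp add: abs_if)
qed

lemma zig_range: "zig a \<in> {0, 1, 2}"
  using mod4_cases[of a] by (auto simp: zig_def)

text \<open>The fold turns only at even values. A step away from an odd value can therefore be read
  off its image; the ambiguity of an unfolding is confined to steps away from even values.\<close>

lemma zig_inj_odd: "odd D \<Longrightarrow> \<bar>a - D\<bar> = 1 \<Longrightarrow> \<bar>b - D\<bar> = 1 \<Longrightarrow> zig a = zig b \<Longrightarrow> a = b"
proof -
  assume *: "odd D" "\<bar>a - D\<bar> = 1" "\<bar>b - D\<bar> = 1" "zig a = zig b"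
  have "D mod 4 = 1 \<or> D mod 4 = 3" using *(1) by presburger
  moreover have "D mod 4 = 1 \<Longrightarrow> (D + 1) mod 4 = 2 \<and> (D - 1) mod 4 = 0"
    "D mod 4 = 3 \<Longrightarrow> (D + 1) mod 4 = 0 \<and> (D - 1) mod 4 = 2" by presburger+
  moreover have "a = D + 1 \<or> a = D - 1" "b = D + 1 \<or> b = D - 1" using *(2,3) by linarith+
  ultimately show ?thesis using *(4) by (auto simp: zig_def)
qed

section \<open>Admissible differences for a given sum, and the fold\<close>

context strip
begin

definition touch :: "node \<Rightarrow> bool" where "touch p \<longleftrightarrow> (\<exists>x. fc p (0, x))"

definition opn :: "node \<Rightarrow> bool" where
  "opn p \<longleftrightarrow> (\<exists>q. fc p q \<and> fst q \<le> n \<and> (fst q = n \<or> S q = 0 \<or> S q = 2 * int l))"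

definition even_faces :: bool where
  "even_faces \<longleftrightarrow> (\<forall>x. even (S (0, x)) \<and> \<not> opn (0, x) \<longrightarrow> even (card {y. fc (0, x) (0, y)}))"

text \<open>A tie, a jump of \<open>S\<close> by 2, is a point of row 0 where members of both
  families coincide. Without ties after even nodes, \<open>S\<close> is constant on each run of
  consecutive even nodes.\<close>

definition no_even_tie :: bool where
  "no_even_tie \<longleftrightarrow> (\<forall>x. even (S (0, x)) \<longrightarrow> S (0, x + 1) - S (0, x) \<le> 1)"

text \<open>What the ban on ordinary intersections of adjacent paths imposes on \<open>d\<close> at
  row 0 besides nonnegativity, once \<open>S\<close> is known: on a maximal run
  \<open>x1, ..., x2 - 1\<close> of even nodes with nonzero value, the length decides whether the
  values on its two sides agree.\<close>

definition runrule :: "(node \<Rightarrow> int) \<Rightarrow> bool" where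
  "runrule d \<longleftrightarrow> (\<forall>x1 x2. x1 < x2 \<and> odd (S (0, x1 - 1)) \<and> (\<forall>y. x1 \<le> y \<and> y < x2 \<longrightarrow> even (S (0, y))) \<and>
     odd (S (0, x2)) \<and> d (0, x1) \<noteq> 0 \<longrightarrow> (d (0, x1 - 1) = d (0, x2) \<longleftrightarrow> even (x2 - x1)))"

definition conf2 :: "(int \<Rightarrow> int) \<Rightarrow> (node \<Rightarrow> int) set" where
  "conf2 T = {d. valid d \<and> (\<forall>x. d (n, x) = T x) \<and> (\<forall>x. d (0, x) \<in> {0, 1, 2})}"

definition confP :: "(int \<Rightarrow> int) \<Rightarrow> (node \<Rightarrow> int) set" where
  "confP T = {d. valid d \<and> (\<forall>x. d (n, x) = T x) \<and> (\<forall>x. 0 \<le> d (0, x)) \<and> runrule d}"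

text \<open>A relation instead of a map: existence and uniqueness are proved in both directions, so
  the unfolding needs no closed formula.\<close>

definition rel :: "(node \<Rightarrow> int) \<Rightarrow> (node \<Rightarrow> int) \<Rightarrow> bool" where
  "rel d' d \<longleftrightarrow> (\<forall>x. zig (d (0, x)) = d' (0, x)) \<and>
    (\<forall>p q. step n p q \<longrightarrow> \<not> (touch p \<and> touch q) \<longrightarrow> d q - d p = d' q - d' p)"

lemma touch_fc: "fc p q \<Longrightarrow> touch p = touch q"
  unfolding touch_def by (simp add: fc_cong(1)[of p q])

lemma touch_bottom [simp]: "touch (0, x)"
  unfolding touch_def using fc_refl by blast

lemma opn_fc: "fc p q \<Longrightarrow> opn p = opn q"
  unfolding opn_def by (simp add: fc_cong(1)[of p q])

lemma step_even_bottom: "no_even_tie \<Longrightarrow> even (S (0, x)) \<Longrightarrow> even (S (0, x + 1)) \<Longrightarrow> S (0, x + 1) = S (0, x)"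
proof -
  assume *: "no_even_tie" "even (S (0, x))" "even (S (0, x + 1))"
  have "S (0, x + 1) - S (0, x) \<in> {0, 1, 2}" by (rule S_step) (simp add: step_E)
  moreover have "S (0, x + 1) - S (0, x) \<le> 1" using * unfolding no_even_tie_def by blast
  moreover have "S (0, x + 1) - S (0, x) \<noteq> 1" using *(2,3) by presburger
  ultimately show "S (0, x + 1) = S (0, x)" by auto
qed

lemma bottom_fc: "(even (S (0, x)) \<longleftrightarrow> even (S (0, x + 1))) \<Longrightarrow> fc (0, x) (0, x + 1)"
  using step_E[of 0] by (intro fc_step) auto

lemma run_fc:
  assumes "\<And>y. a \<le> y \<Longrightarrow> y \<le> b \<Longrightarrow> even (S (0, y))" "a \<le> b"
  shows "fc (0, a) (0, b)"
proof -
  have "fc (0, a) (0, b) = fc (0, a) (0, a)"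
  proof (rule row_induct_const)
    fix x assume "a \<le> x" "x < b"
    then have "fc (0, x) (0, x + 1)" using assms by (intro bottom_fc) auto
    then show "fc (0, a) (0, x + 1) = fc (0, a) (0, x)" using fc_cong by blast
  qed (rule assms)
  then show ?thesis by simp
qed

text \<open>Without ties an even run cannot change the value of \<open>S\<close>. A run going back
  to the far left would have \<open>S = 0\<close>, so any other run starts right after an odd
  node.\<close>

lemma prev_gap:
  assumes nt: "no_even_tie" and x: "even (S (0, x))" "S (0, x) \<noteq> 0"
  obtains x1 where "x1 \<le> x" "odd (S (0, x1 - 1))" "\<And>y. x1 \<le> y \<Longrightarrow> y \<le> x \<Longrightarrow> even (S (0, y))"
proof -
  obtain m where m: "\<And>p. fst p \<le> n \<Longrightarrow> snd p < m \<Longrightarrow> S p = 0" using S_left by blast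
  define Y where "Y = {y \<in> {m..x}. odd (S (0, y))}"
  have fin: "finite Y" by (rule finite_subset[of _ "{m..x}"]) (auto simp: Y_def)
  have ne: "Y \<noteq> {}"
  proof
    assume e: "Y = {}"
    have ev: "even (S (0, y))" if "y \<le> x" for y
      using e that m[of "(0, y)"] by (cases "m \<le> y") (auto simp: Y_def)
    have "S (0, x) = S (0, min x (m - 1))"
      by (rule row_induct_const[where f = "\<lambda>z. S (0, z)"]) (use step_even_bottom[OF nt] ev in auto)
    then show False using m[of "(0, min x (m - 1))"] x by auto
  qed
  define g where "g = Max Y"
  have gY: "g \<in> Y" unfolding g_def by (rule Max_in[OF fin ne])
  have "even (S (0, y))" if "g + 1 \<le> y" "y \<le> x" for y
  proof (rule ccontr)
    assume "odd (S (0, y))"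
    then have "y \<in> Y" using that gY by (auto simp: Y_def)
    then show False using Max_ge[OF fin, of y] that unfolding g_def[symmetric] by simp
  qed
  moreover have "g + 1 \<le> x" using gY x by (cases "g = x") (auto simp: Y_def)
  ultimately show ?thesis using that[of "g + 1"] gY by (auto simp: Y_def)
qed

lemma valid_sides: "valid d \<Longrightarrow> fst p \<le> n \<Longrightarrow> S p = 0 \<or> S p = 2 * int l \<Longrightarrow> d p = 0"
proof -
  assume d: "valid d" and p: "fst p \<le> n" "S p = 0 \<or> S p = 2 * int l"
  obtain a where a: "\<And>p. fst p \<le> n \<Longrightarrow> snd p < a \<Longrightarrow> d p = 0" using d unfolding valid_def by blast
  obtain b where b: "\<And>p. fst p \<le> n \<Longrightarrow> b \<le> snd p \<Longrightarrow> d p = 0" using d unfolding valid_def by blast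
  show "d p = 0"
  proof (cases "S p = 0")
    case True
    have "fc (fst p, min (snd p) (a - 1)) p" by (rule S0_fc[OF p(1) True]) simp
    then show ?thesis using valid_fc[OF d] a[of "(fst p, min (snd p) (a - 1))"] p by fastforce
  next
    case False
    then have "fc p (fst p, max (snd p) b)" using p by (intro S2l_fc) auto
    then show ?thesis using valid_fc[OF d] b[of "(fst p, max (snd p) b)"] p by fastforce
  qed
qed

lemma row_eqI:
  fixes f g :: "int \<Rightarrow> int"
  assumes "\<And>x. f (x + 1) - f x = g (x + 1) - g x" "\<And>x. x < m \<Longrightarrow> f x = g x"
  shows "f x = g x"
proof -
  have "f x - g x = f (min x (m - 1)) - g (min x (m - 1))"
  proof (rule row_induct_const[where f = "\<lambda>z. f z - g z"])
    fix z show "f (z + 1) - g (z + 1) = f z - g z" using assms(1)[of z] by linarith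
  qed simp
  then show ?thesis using assms(2)[of "min x (m - 1)"] by simp
qed

lemma valid_eqI:
  assumes a: "valid a" and b: "valid b" and eq: "\<And>p q. step n p q \<Longrightarrow> a q - a p = b q - b p"
  shows "a = b"
proof
  fix p :: node
  obtain r x where p: "p = (r, x)" by (cases p)
  show "a p = b p"
  proof (cases "r \<le> n")
    case True
    obtain m where m: "\<And>p. fst p \<le> n \<Longrightarrow> snd p < m \<Longrightarrow> S p = 0" using S_left by blast
    have "a (r, x) = b (r, x)"
    proof (rule row_eqI[where m = m and f = "\<lambda>z. a (r, z)" and g = "\<lambda>z. b (r, z)"])
      show "a (r, z + 1) - a (r, z) = b (r, z + 1) - b (r, z)" for z by (rule eq) (simp add: step_E True)
      show "a (r, z) = b (r, z)" if "z < m" for z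
        using valid_sides[OF a] valid_sides[OF b] m[of "(r, z)"] True that by simp
    qed
    then show ?thesis using p by simp
  qed (use a b p in \<open>auto simp: valid_def\<close>)
qed

text \<open>Integration guarantees zero only on the left. That the new function also vanishes on the
  right comes from the top row, where it agrees with \<open>d0\<close>: the far right belongs to a
  face meeting that row.\<close>

lemma new_conf:
  assumes d0: "valid d0" and anti: "\<And>p q. G q p = - G p q" and inv: "\<And>p p' q. fc p p' \<Longrightarrow> G p q = G p' q"
    and one: "\<And>p q. step n p q \<Longrightarrow> even (S p) \<noteq> even (S q) \<Longrightarrow> \<bar>G p q\<bar> = 1"
    and top: "\<And>x. G (n, x) (n, x + 1) = d0 (n, x + 1) - d0 (n, x)"
  obtains d where "valid d" "\<And>x. d (n, x) = d0 (n, x)" "\<And>p q. step n p q \<Longrightarrow> d q - d p = G p q"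
proof -
  obtain c where c: "\<And>p q. step n p q \<Longrightarrow> c q - c p = G p q" "\<exists>m. \<forall>p. snd p \<le> m \<longrightarrow> c p = 0"
    "\<And>p q. fc p q \<Longrightarrow> c p = c q"
    by (rule face_potential[of G]) (use anti inv in blast)+
  obtain m where m: "\<And>p. snd p \<le> m \<Longrightarrow> c p = 0" using c(2) by blast
  obtain m' where m': "\<And>p. fst p \<le> n \<Longrightarrow> snd p < m' \<Longrightarrow> d0 p = 0" using d0 unfolding valid_def by blast
  have ctop: "c (n, x) = d0 (n, x)" for x
  proof (rule row_eqI[where m = "min m m'" and f = "\<lambda>z. c (n, z)" and g = "\<lambda>z. d0 (n, z)"])
    show "c (n, z + 1) - c (n, z) = d0 (n, z + 1) - d0 (n, z)" for z using c(1)[OF step_E[of n z]] top by simp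
    show "c (n, z) = d0 (n, z)" if "z < min m m'" for z using m[of "(n, z)"] m'[of "(n, z)"] that by simp
  qed
  define d where "d p = (if fst p \<le> n then c p else 0)" for p
  obtain M where M: "\<And>p. fst p \<le> n \<Longrightarrow> M \<le> snd p \<Longrightarrow> S p = 2 * int l" using S_right by blast
  have right: "c p = 0" if p: "fst p \<le> n" "M \<le> snd p" for p
  proof -
    obtain z where z: "fc p (n, z)" "S (n, z) = 2 * int l" using right_fc_top[OF p(1) M[OF p]] by blast
    then show ?thesis using c(3)[OF z(1)] ctop valid_sides[OF d0, of "(n, z)"] by simp
  qed
  have stepd: "d q - d p = G p q" if "step n p q" for p q
    using c(1)[OF that] that by (simp add: d_def step_def)
  have "valid d"
    unfolding valid_def
  proof (intro conjI allI impI)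
    fix p q assume st: "step n p q"
    show "if even (S p) = even (S q) then d q = d p else \<bar>d q - d p\<bar> = 1"
    proof (cases "even (S p) = even (S q)")
      case True
      then have "c p = c q" using c(3) fc_step st by blast
      then show ?thesis using True st by (simp add: d_def step_def)
    next
      case False
      then show ?thesis using one[OF st] stepd[OF st] by simp
    qed
  next
    show "\<exists>m. \<forall>p. fst p \<le> n \<and> snd p < m \<longrightarrow> d p = 0" using m by (auto simp: d_def intro!: exI[of _ m])
    show "\<exists>m. \<forall>p. fst p \<le> n \<and> m \<le> snd p \<longrightarrow> d p = 0" using right by (auto simp: d_def intro!: exI[of _ M])
  qed (simp add: d_def)
  then show ?thesis using that[of d] ctop stepd by (simp add: d_def)
qed

lemma bottom_left: "\<exists>m. \<forall>x<m. S (0, x) = 0"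
  using S_left by force

text \<open>A sweep from the left along row 0. After an odd value the next one is determined by its
  fold; after 0 it is 1 by nonnegativity; after any other even value the run rule determines it from
  the value before the run.\<close>

lemma bottom_gap_eq:
  assumes nt: "no_even_tie" and a: "a \<in> confP T" and b: "b \<in> confP T"
    and eq: "\<And>x. zig (a (0, x)) = zig (b (0, x))"
  shows "a (0, x) = b (0, x)"
proof -
  have va: "valid a" "runrule a" "\<And>x. 0 \<le> a (0, x)" and vb: "valid b" "runrule b" "\<And>x. 0 \<le> b (0, x)"
    using a b by (auto simp: confP_def)
  obtain m where m: "\<And>x. x < m \<Longrightarrow> S (0, x) = 0" using bottom_left by blast
  have left: "a (0, z) = b (0, z)" if "z < m" for z
    using valid_sides[OF va(1)] valid_sides[OF vb(1)] m[OF that] by simp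
  have "\<forall>z. z < m + int k \<longrightarrow> a (0, z) = b (0, z)" for k
  proof (induction k)
    case 0 then show ?case using left by simp
  next
    case (Suc k)
    have IH: "a (0, z) = b (0, z)" if "z < m + int k" for z using Suc that by blast
    define x where "x = m + int k - 1"
    have st: "step n (0, x) (0, x + 1)" by (simp add: step_E)
    have eqx: "a (0, x) = b (0, x)" using IH by (simp add: x_def)
    have "a (0, x + 1) = b (0, x + 1)"
    proof (cases "even (S (0, x)) = even (S (0, x + 1))")
      case True
      then show ?thesis using valid_even[OF va(1) st] valid_even[OF vb(1) st] eqx by simp
    next
      case False
      have ab: "\<bar>a (0, x + 1) - a (0, x)\<bar> = 1" "\<bar>b (0, x + 1) - a (0, x)\<bar> = 1"
        using valid_odd[OF va(1) st False] valid_odd[OF vb(1) st False] eqx by simp_all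
      show ?thesis
      proof (cases "odd (S (0, x))")
        case True
        then have "odd (a (0, x))" using valid_parity[OF va(1), of "(0, x)"] by simp
        then show ?thesis using zig_inj_odd ab eq by blast
      next
        case ev: False
        show ?thesis
        proof (cases "a (0, x) = 0")
          case True
          then show ?thesis using ab va(3)[of "x + 1"] vb(3)[of "x + 1"] by linarith
        next
          case nz: False
          then have "S (0, x) \<noteq> 0" using valid_sides[OF va(1), of "(0, x)"] by auto
          moreover have "even (S (0, x))" using ev by simp
          ultimately obtain x1 where x1: "x1 \<le> x" "odd (S (0, x1 - 1))" "\<And>y. x1 \<le> y \<Longrightarrow> y \<le> x \<Longrightarrow> even (S (0, y))"
            using prev_gap[OF nt, of x] by blast
          have f: "fc (0, x1) (0, x)" by (rule run_fc) (use x1 in auto)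
          have mid: "a (0, x1) = a (0, x)" "b (0, x1) = b (0, x)" using valid_fc[OF va(1) f] valid_fc[OF vb(1) f] by auto
          have hyp: "x1 < x + 1 \<and> odd (S (0, x1 - 1)) \<and> (\<forall>y. x1 \<le> y \<and> y < x + 1 \<longrightarrow> even (S (0, y))) \<and> odd (S (0, x + 1))"
            using x1 ev False by auto
          have ra: "a (0, x1 - 1) = a (0, x + 1) \<longleftrightarrow> even (x + 1 - x1)"
            using va(2)[unfolded runrule_def, rule_format, of x1 "x + 1"] hyp mid nz by simp
          have rb: "b (0, x1 - 1) = b (0, x + 1) \<longleftrightarrow> even (x + 1 - x1)"
            using vb(2)[unfolded runrule_def, rule_format, of x1 "x + 1"] hyp mid nz eqx by simp
          have st1: "step n (0, x1 - 1) (0, x1)" using step_E[of 0 "x1 - 1"] by simp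
          have par1: "even (S (0, x1 - 1)) \<noteq> even (S (0, x1))" using x1 by auto
          have "a (0, x1 - 1) = b (0, x1 - 1)" using IH x1 by (simp add: x_def)
          moreover have "\<bar>a (0, x) - a (0, x1 - 1)\<bar> = 1" using valid_odd[OF va(1) st1 par1] mid by simp
          ultimately show ?thesis using ra rb ab by linarith
        qed
      qed
    qed
    then show ?case
    proof (intro allI impI)
      fix z assume "a (0, x + 1) = b (0, x + 1)" "z < m + int (Suc k)"
      then show "a (0, z) = b (0, z)" using IH[of z] by (cases "z = x + 1") (auto simp: x_def)
    qed
  qed
  from spec[OF this[of "nat (x - m + 1)"], of x] show ?thesis using left[of x] by (cases "x < m") auto
qed

lemma rel_unique1:
  assumes a: "a \<in> conf2 T" and b: "b \<in> conf2 T" and ra: "rel a d" and rb: "rel b d"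
  shows "a = b"
proof (rule valid_eqI)
  show va: "valid a" and vb: "valid b" using a b by (auto simp: conf2_def)
  have bot: "a (0, x) = b (0, x)" for x using ra rb by (simp add: rel_def)
  have t: "a p = b p" if "touch p" for p
    using that valid_fc[OF va] valid_fc[OF vb] bot unfolding touch_def by fastforce
  show "a q - a p = b q - b p" if st: "step n p q" for p q
  proof (cases "touch p \<and> touch q")
    case False then show ?thesis using ra rb st unfolding rel_def by metis
  qed (use t in simp)
qed

lemma rel_unique2:
  assumes nt: "no_even_tie" and a: "a \<in> confP T" and b: "b \<in> confP T" and ra: "rel d' a" and rb: "rel d' b"
  shows "a = b"
proof (rule valid_eqI)
  show va: "valid a" and vb: "valid b" using a b by (auto simp: confP_def)
  have bot: "a (0, x) = b (0, x)" for x
    by (rule bottom_gap_eq[OF nt a b]) (use ra rb in \<open>simp add: rel_def\<close>)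
  have t: "a p = b p" if "touch p" for p
    using that valid_fc[OF va] valid_fc[OF vb] bot unfolding touch_def by fastforce
  show "a q - a p = b q - b p" if st: "step n p q" for p q
  proof (cases "touch p \<and> touch q")
    case False then show ?thesis using ra rb st unfolding rel_def by metis
  qed (use t in simp)
qed

text \<open>The fold is applied to the increments between faces that both reach row 0. The top row
  is left alone: a top node whose face reaches row 0 has height at least 0, and at most 1 by the
  bound on \<open>T\<close>, and \<open>zig\<close> fixes 0 and 1.\<close>

lemma rel_exists1:
  assumes T: "\<And>x. T x \<le> 1" and d: "d \<in> confP T"
  shows "\<exists>d'\<in>conf2 T. rel d' d"
proof -
  have v: "valid d" "\<And>x. d (n, x) = T x" "\<And>x. 0 \<le> d (0, x)" using d by (auto simp: confP_def)
  define G where "G p q = (if touch p \<and> touch q then zig (d q) - zig (d p) else d q - d p)" for p q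
  have top: "G (n, x) (n, x + 1) = d (n, x + 1) - d (n, x)" for x
  proof (cases "touch (n, x) \<and> touch (n, x + 1)")
    case True
    have "zig (d (n, z)) = d (n, z)" if "touch (n, z)" for z
    proof -
      have "0 \<le> d (n, z)" using that valid_fc[OF v(1)] v(3) unfolding touch_def by metis
      then have "d (n, z) \<in> {0, 1}" using T[of z] v(2)[of z] by auto
      then show ?thesis by (auto simp: zig_def)
    qed
    then show ?thesis using True by (simp add: G_def)
  qed (auto simp: G_def)
  obtain d' where d': "valid d'" "\<And>x. d' (n, x) = d (n, x)" "\<And>p q. step n p q \<Longrightarrow> d' q - d' p = G p q"
  proof (rule new_conf[OF v(1), of G])
    show "G q p = - G p q" for p q by (simp add: G_def)
    show "G p q = G p' q" if "fc p p'" for p p' q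
      using touch_fc[OF that] valid_fc[OF v(1) that] by (simp add: G_def)
    show "\<bar>G p q\<bar> = 1" if "step n p q" "even (S p) \<noteq> even (S q)" for p q
      using valid_odd[OF v(1) that] zig_step by (simp add: G_def)
  qed (use top in blast)+
  obtain m where m: "\<And>x. x < m \<Longrightarrow> S (0, x) = 0" using bottom_left by blast
  have bot: "d' (0, x) = zig (d (0, x))" for x
  proof (rule row_eqI[where m = m and f = "\<lambda>z. d' (0, z)" and g = "\<lambda>z. zig (d (0, z))"])
    show "d' (0, z + 1) - d' (0, z) = zig (d (0, z + 1)) - zig (d (0, z))" for z
      using d'(3)[OF step_E[of 0 z]] by (simp add: G_def)
    show "d' (0, z) = zig (d (0, z))" if "z < m" for z
      using valid_sides[OF d'(1), of "(0, z)"] valid_sides[OF v(1), of "(0, z)"] m[OF that] by (simp add: zig_def)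
  qed
  have "d' \<in> conf2 T" using d'(1,2) v(2) bot zig_range by (simp add: conf2_def)
  moreover have "rel d' d" unfolding rel_def using bot d'(3) by (simp add: G_def)
  ultimately show ?thesis by blast
qed

end

section \<open>Signs of the slopes, and the unfolding\<close>

context strip
begin

lemma separator':
  assumes "valid d" "x < a" "a < y" "fc (0, x) (0, y)" "\<not> fc (0, x) (0, a)"
  shows "\<exists>c :: node \<Rightarrow> int. (\<forall>p q. fc p q \<longrightarrow> c p = c q) \<and> c (0, a) \<noteq> 0 \<and>
    (\<forall>z. z \<le> x \<or> y \<le> z \<longrightarrow> c (0, z) = 0) \<and> (\<forall>z. c (n, z) = 0) \<and>
    (\<forall>p. fst p \<le> n \<longrightarrow> S p = 0 \<or> S p = 2 * int l \<longrightarrow> c p = 0)"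
  by (rule separator[OF assms]) blast

definition clE :: "int \<Rightarrow> bool" where "clE y \<longleftrightarrow> even (S (0, y)) \<and> \<not> opn (0, y)"

text \<open>The sign of the slope of the fold at \<open>x\<close>.\<close>

definition sgnJ :: "int \<Rightarrow> int" where "sgnJ x = (if even (card {y. y \<le> x \<and> clE y}) then 1 else - 1)"

lemma opnI: "fst p \<le> n \<Longrightarrow> fst p = n \<or> S p = 0 \<or> S p = 2 * int l \<Longrightarrow> opn p"
  unfolding opn_def using fc_refl by blast

lemma clE_fc: "fc (0, x) (0, y) \<Longrightarrow> clE x = clE y"
  unfolding clE_def using fc_even opn_fc by blast

lemma finite_clE: "finite {y. clE y}"
proof -
  obtain a where a: "\<And>p. fst p \<le> n \<Longrightarrow> snd p < a \<Longrightarrow> S p = 0" using S_left by blast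
  obtain b where b: "\<And>p. fst p \<le> n \<Longrightarrow> b \<le> snd p \<Longrightarrow> S p = 2 * int l" using S_right by blast
  have "{y. clE y} \<subseteq> {a..b}"
  proof
    fix y assume "y \<in> {y. clE y}"
    then have "\<not> opn (0, y)" by (simp add: clE_def)
    then have "S (0, y) \<noteq> 0" "S (0, y) \<noteq> 2 * int l" using opnI[of "(0, y)"] by auto
    then show "y \<in> {a..b}" using a[of "(0, y)"] b[of "(0, y)"] by force
  qed
  then show ?thesis using finite_subset by blast
qed

lemma finite_clE_le: "finite {z. z \<le> x \<and> clE z}"
  by (rule finite_subset[OF _ finite_clE]) auto

text \<open>Split off one face at a time; each is closed and even and contributes an even number of
  nodes of row 0.\<close>

lemma even_union:
  assumes ev: "even_faces"
  shows "finite Z \<Longrightarrow> (\<And>z. z \<in> Z \<Longrightarrow> clE z) \<Longrightarrow> (\<And>z w. z \<in> Z \<Longrightarrow> fc (0, z) (0, w) \<Longrightarrow> w \<in> Z) \<Longrightarrow> even (card Z)"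
proof (induction Z rule: finite_psubset_induct)
  case (psubset Z)
  show ?case
  proof (cases "Z = {}")
    case False
    then obtain z where z: "z \<in> Z" by blast
    define C where "C = {w. fc (0, z) (0, w)}"
    have CZ: "C \<subseteq> Z" using psubset.prems(2)[OF z] by (auto simp: C_def)
    have zC: "z \<in> C" by (simp add: C_def)
    have "even (card C)" using ev psubset.prems(1)[OF z] unfolding even_faces_def clE_def C_def by blast
    moreover have "even (card (Z - C))"
    proof (rule psubset.IH)
      show "Z - C \<subset> Z" using z zC by blast
      show "clE w" if "w \<in> Z - C" for w using that psubset.prems(1) by blast
      show "w' \<in> Z - C" if "w \<in> Z - C" "fc (0, w) (0, w')" for w w'
      proof -
        have "w' \<in> Z" using psubset.prems(2) that by blast
        moreover have "w' \<notin> C" using that fc_trans[of "(0, z)" "(0, w')" "(0, w)"] fc_sym[OF that(2)] by (auto simp: C_def)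
        ultimately show ?thesis by blast
      qed
    qed
    moreover have "card Z = card C + card (Z - C)"
    proof -
      have "finite C" using CZ psubset.hyps finite_subset by blast
      then show ?thesis using card_Diff_subset[of C Z] CZ card_mono[OF psubset.hyps(1) CZ] by simp
    qed
    ultimately show ?thesis by simp
  qed simp
qed

text \<open>A closed even face with a node of row 0 strictly between two nodes of an odd face has
  all its nodes of row 0 there, by the separating curve. The closed even nodes passed between
  \<open>x\<close> and \<open>y\<close> thus form whole faces, and their number is even.\<close>

lemma sgnJ_face_less:
  assumes d: "valid d" and ev: "even_faces" and x: "odd (S (0, x))" and xy: "fc (0, x) (0, y)" "x < y"
  shows "sgnJ x = sgnJ y"
proof -
  define Z where "Z = {z. x < z \<and> z \<le> y \<and> clE z}"
  have "odd (S (0, y))" using fc_even[OF xy(1)] x by simp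
  then have ny: "\<not> clE y" by (simp add: clE_def)
  have fin: "finite Z" by (rule finite_subset[OF _ finite_clE]) (auto simp: Z_def)
  have "even (card Z)"
  proof (rule even_union[OF ev fin])
    show "clE z" if "z \<in> Z" for z using that by (simp add: Z_def)
    show "w \<in> Z" if z: "z \<in> Z" and zw: "fc (0, z) (0, w)" for z w
    proof -
      have "z \<noteq> y" using z ny by (auto simp: Z_def)
      then have zy: "x < z" "z < y" "clE z" using z by (auto simp: Z_def)
      have nf: "\<not> fc (0, x) (0, z)" using fc_even[of "(0, x)" "(0, z)"] x zy by (auto simp: clE_def)
      obtain c :: "node \<Rightarrow> int" where c: "\<And>p q. fc p q \<Longrightarrow> c p = c q" "c (0, z) \<noteq> 0"
        "\<And>z. z \<le> x \<or> y \<le> z \<Longrightarrow> c (0, z) = 0" "\<And>z. c (n, z) = 0"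
        "\<And>p. fst p \<le> n \<Longrightarrow> S p = 0 \<or> S p = 2 * int l \<Longrightarrow> c p = 0"
        using separator'[OF d zy(1,2) xy(1) nf] by blast
      have "\<not> (w \<le> x \<or> y \<le> w)" using c(1)[OF zw] c(2) c(3)[of w] by auto
      then show ?thesis using clE_fc[OF zw] zy by (auto simp: Z_def)
    qed
  qed
  moreover have "{z. z \<le> y \<and> clE z} = {z. z \<le> x \<and> clE z} \<union> Z" using xy by (auto simp: Z_def)
  moreover have "card ({z. z \<le> x \<and> clE z} \<union> Z) = card {z. z \<le> x \<and> clE z} + card Z"
    by (rule card_Un_disjoint[OF finite_clE_le fin]) (auto simp: Z_def)
  ultimately show ?thesis by (simp add: sgnJ_def)
qed

lemma sgnJ_face:
  assumes "valid d" "even_faces" "odd (S (0, x))" "fc (0, x) (0, y)"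
  shows "sgnJ x = sgnJ y"
proof -
  have "odd (S (0, y))" using fc_even[OF assms(4)] assms(3) by simp
  then show ?thesis
    using sgnJ_face_less[OF assms(1-4)] sgnJ_face_less[OF assms(1,2) _ fc_sym[OF assms(4)], symmetric]
    by (metis linorder_less_linear)
qed

text \<open>A closed face cannot pass over an open one: having nodes on both sides of
  \<open>x\<close>, it would enclose the face of \<open>x\<close> and cut it off from the top and
  the sides. So the closed even nodes left of \<open>x\<close> form whole faces.\<close>

lemma even_left_of_open:
  assumes d: "valid d" and ev: "even_faces" and x: "even (S (0, x))" "opn (0, x)"
  shows "even (card {z. z < x \<and> clE z})"
proof (rule even_union[OF ev])
  show "finite {z. z < x \<and> clE z}" by (rule finite_subset[OF _ finite_clE]) auto
  show "clE z" if "z \<in> {z. z < x \<and> clE z}" for z using that by simp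
  show "w \<in> {z. z < x \<and> clE z}" if z: "z \<in> {z. z < x \<and> clE z}" and zw: "fc (0, z) (0, w)" for z w
  proof -
    have cw: "clE w" using clE_fc[OF zw] z by simp
    have "w < x"
    proof (rule ccontr)
      assume "\<not> w < x"
      moreover have "w \<noteq> x" using cw x by (auto simp: clE_def)
      ultimately have xw: "x < w" by simp
      have zx: "z < x" using z by simp
      have nf: "\<not> fc (0, z) (0, x)" using z x opn_fc by (auto simp: clE_def)
      obtain c :: "node \<Rightarrow> int" where c: "\<And>p q. fc p q \<Longrightarrow> c p = c q" "c (0, x) \<noteq> 0"
        "\<And>y. y \<le> z \<or> w \<le> y \<Longrightarrow> c (0, y) = 0" "\<And>z. c (n, z) = 0"
        "\<And>p. fst p \<le> n \<Longrightarrow> S p = 0 \<or> S p = 2 * int l \<Longrightarrow> c p = 0"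
        using separator'[OF d zx xw zw nf] by blast
      obtain q where q: "fc (0, x) q" "fst q \<le> n" "fst q = n \<or> S q = 0 \<or> S q = 2 * int l"
        using x(2) unfolding opn_def by blast
      have "c q = 0" using q(3)
      proof
        assume "fst q = n" then show ?thesis using c(4)[of "snd q"] by (cases q) simp
      qed (use c(5) q(2) in blast)
      then show False using c(1)[OF q(1)] c(2) by simp
    qed
    then show ?thesis using cw by simp
  qed
qed

text \<open>Integrate the jump that occurs exactly between the faces of \<open>p\<close> and
  \<open>q\<close>. If these faces had no neighbouring nodes on row 0, the potential would be
  constant there; both faces reach row 0, so it could not jump between \<open>p\<close> and
  \<open>q\<close>. Signs, known on row 0, thereby govern adjacent nodes high up in the
  strip.\<close>

lemma adjacent_at_bottom:
  assumes d: "valid d" and st: "step n p q \<or> step n q p" and par: "even (S p)" "odd (S q)" and t: "touch p" "touch q"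
  obtains x y where "\<bar>x - y\<bar> = 1" "fc p (0, x)" "fc q (0, y)"
proof (rule ccontr)
  assume no: "\<not> thesis"
  define G where "G a b = (if fc p a \<and> fc q b then 1 else if fc p b \<and> fc q a then - 1 else (0::int))" for a b
  have npq: "\<not> (fc p a \<and> fc q a)" for a using fc_even[of p a] fc_even[of q a] par by blast
  obtain c where c: "\<And>a b. step n a b \<Longrightarrow> c b - c a = G a b" "\<And>a b. fc a b \<Longrightarrow> c a = c b"
  proof (rule face_potential[of G])
    show "G b a = - G a b" for a b unfolding G_def using npq by auto
    show "G a b = G a' b" if "fc a a'" for a a' b unfolding G_def using fc_cong(2)[OF that] by simp
  qed blast
  obtain x y where xy: "fc p (0, x)" "fc q (0, y)" using t unfolding touch_def by blast
  have G0: "G (0, z) (0, z + 1) = 0" for z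
  proof -
    have "\<not> (fc p (0, z) \<and> fc q (0, z + 1))" "\<not> (fc p (0, z + 1) \<and> fc q (0, z))"
      using no that[of z "z + 1"] that[of "z + 1" z] by auto
    then show ?thesis unfolding G_def by auto
  qed
  have "c (0, z + 1) = c (0, z)" for z using c(1)[OF step_E[of 0 z]] G0[of z] by simp
  then have "c (0, b) = c (0, a)" if "a \<le> b" for a b
    using row_induct_const[where f = "\<lambda>z. c (0, z)", OF _ that] by simp
  from this[of x y] this[of y x] have "c (0, x) = c (0, y)" by (cases "x \<le> y") auto
  then have "c p = c q" using c(2)[OF xy(1)] c(2)[OF xy(2)] by simp
  moreover have "\<not> fc p q" using fc_even[of p q] par by auto
  moreover have "\<not> fc q p" using fc_even[of q p] par by auto
  ultimately show False using st c(1)[of p q] c(1)[of q p] by (auto simp: G_def)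
qed

text \<open>On row 0 the value is 0 or 2, but the face also contains a node of the top row or of a
  side, where it is at most 1.\<close>

lemma even_open_bottom_zero:
  assumes d: "valid d" and T: "\<And>x. d (n, x) \<le> 1" and b: "\<And>x. d (0, x) \<in> {0, 1, 2}"
    and p: "touch p" "even (S p)" "opn p"
  shows "d p = 0"
proof -
  obtain q where q: "fc p q" "fst q \<le> n" "fst q = n \<or> S q = 0 \<or> S q = 2 * int l"
    using p unfolding opn_def by blast
  obtain x where x: "fc p (0, x)" using p unfolding touch_def by blast
  have "even (d (0, x))" using valid_parity[OF d, of "(0, x)"] fc_even[OF x] p by simp
  then have dx: "d (0, x) \<in> {0, 2}" using b[of x] by auto
  have "d (0, x) = d q" using valid_fc[OF d x] valid_fc[OF d q(1)] by simp
  moreover have "d q \<le> 1"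
  proof (cases "fst q = n")
    case True then show ?thesis using T[of "snd q"] by (cases q) simp
  next
    case False then show ?thesis using valid_sides[OF d q(2)] q(3) by simp
  qed
  ultimately have "d (0, x) = 0" using dx by auto
  then show ?thesis using valid_fc[OF d x] by simp
qed

text \<open>The unfolding has two stages. First each increment between faces that reach row 0 is
  multiplied by the sign of the odd face involved; the result \<open>d1\<close> folds back to
  \<open>d\<close> but may be negative. Then absolute values are taken, which is harmless because
  \<open>zig\<close> is an even function.\<close>

lemma rel_exists2:
  assumes T: "\<And>x. T x \<le> 1" and d: "d \<in> conf2 T" and nt: "no_even_tie" and ev: "even_faces"
  shows "\<exists>d2\<in>confP T. rel d d2"
proof -
  have v: "valid d" "\<And>x. d (n, x) = T x" "\<And>x. d (0, x) \<in> {0, 1, 2}" using d by (auto simp: conf2_def)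
  have dodd: "d (0, x) = 1" if "odd (S (0, x))" for x
  proof -
    have "odd (d (0, x))" using valid_parity[OF v(1), of "(0, x)"] that by simp
    then show ?thesis using v(3)[of x] by auto
  qed
  have deven: "d (0, x) = 0 \<or> d (0, x) = 2" if "even (S (0, x))" for x
  proof -
    have "even (d (0, x))" using valid_parity[OF v(1), of "(0, x)"] that by simp
    then show ?thesis using v(3)[of x] by auto
  qed
  have Tv: "d (n, x) \<le> 1" for x using v(2) T by simp
  \<comment> \<open>For an odd face the choice of the node of row 0 is immaterial by
    \<open>sgnJ_face\<close>. For every other \<open>p\<close> the value is arbitrary, yet still the
    same throughout a face.\<close>
  define JF where "JF p = sgnJ (SOME x. fc p (0, x))" for p
  have JF_fc: "JF p = JF q" if "fc p q" for p q unfolding JF_def by (simp add: fc_cong(1)[OF that])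
  have JF_bot: "JF p = sgnJ x" if "fc p (0, x)" "odd (S p)" for p x
  proof -
    have "fc p (0, SOME x. fc p (0, x))" using that(1) by (rule someI)
    then have "fc (0, x) (0, SOME x. fc p (0, x))" using that(1) fc_sym fc_trans by blast
    moreover have "odd (S (0, x))" using fc_even[OF that(1)] that(2) by simp
    ultimately show ?thesis unfolding JF_def using sgnJ_face[OF v(1) ev] by metis
  qed
  have J1: "\<bar>sgnJ x\<bar> = 1" for x by (simp add: sgnJ_def)
  define w where "w p q = (if touch p \<and> touch q \<and> even (S p) \<noteq> even (S q) then (if odd (S p) then JF p else JF q) else 1)" for p q
  have w1: "\<bar>w p q\<bar> = 1" for p q unfolding w_def using J1 by (simp add: JF_def)
  have w_sym: "w p q = w q p" for p q
    unfolding w_def by (cases "even (S p)"; cases "even (S q)"; simp add: conj_commute)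
  have w_fc: "w p q = w p' q" if "fc p p'" for p p' q
    unfolding w_def using touch_fc[OF that] fc_even[OF that] JF_fc[OF that] by simp
  \<comment> \<open>Next to an open even face the sign is positive. All top nodes are open, so the
    signs do not alter the top row.\<close>
  have J_open: "JF q = 1" if st: "step n p q \<or> step n q p" and par: "even (S p)" "odd (S q)"
    and t: "touch p" "touch q" and o: "opn p" for p q
  proof -
    obtain x y where xy: "\<bar>x - y\<bar> = 1" "fc p (0, x)" "fc q (0, y)" by (rule adjacent_at_bottom[OF v(1) st par t])
    have x: "even (S (0, x))" "opn (0, x)" using fc_even[OF xy(2)] opn_fc[OF xy(2)] par o by auto
    have y: "odd (S (0, y))" using fc_even[OF xy(3)] par by simp
    have "\<not> clE x" "\<not> clE y" using x y by (auto simp: clE_def)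
    moreover have "y = x + 1 \<or> y = x - 1" using xy(1) by linarith
    ultimately have "z \<le> y \<and> clE z \<longleftrightarrow> z < x \<and> clE z" for z
      by (cases "z = x"; cases "z = y") auto
    then have "{z. z \<le> y \<and> clE z} = {z. z < x \<and> clE z}" by blast
    then have "sgnJ y = 1" using even_left_of_open[OF v(1) ev x] by (simp add: sgnJ_def)
    then show ?thesis using JF_bot[OF xy(3)] par by simp
  qed
  define G where "G p q = w p q * (d q - d p)" for p q
  have opn_top: "opn (n, x)" for x by (rule opnI) auto
  have wtop: "w (n, x) (n, x + 1) = 1" for x
  proof (cases "touch (n, x) \<and> touch (n, x + 1) \<and> even (S (n, x)) \<noteq> even (S (n, x + 1))")
    case True
    then show ?thesis
      using J_open[of "(n, x)" "(n, x + 1)"] J_open[of "(n, x + 1)" "(n, x)"] opn_top step_E[of n x]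
      unfolding w_def by auto
  qed (auto simp: w_def)
  obtain d1 where d1: "valid d1" "\<And>x. d1 (n, x) = d (n, x)" "\<And>p q. step n p q \<Longrightarrow> d1 q - d1 p = G p q"
  proof (rule new_conf[OF v(1), of G])
    show "G q p = - G p q" for p q using w_sym[of p q] by (simp add: G_def algebra_simps)
    show "G p q = G p' q" if "fc p p'" for p p' q
      using w_fc[OF that] valid_fc[OF v(1) that] by (simp add: G_def)
    show "\<bar>G p q\<bar> = 1" if "step n p q" "even (S p) \<noteq> even (S q)" for p q
      using valid_odd[OF v(1) that] w1 by (simp add: G_def abs_mult)
    show "G (n, x) (n, x + 1) = d (n, x + 1) - d (n, x)" for x using wtop by (simp add: G_def)
  qed blast
  have zero: "d1 p = 0" if p: "touch p" "even (S p)" "opn p" for p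
  proof -
    obtain q where q: "fc p q" "fst q \<le> n" "fst q = n \<or> S q = 0 \<or> S q = 2 * int l"
      using p unfolding opn_def by blast
    have "d1 q = d q"
    proof (cases "fst q = n")
      case True then show ?thesis using d1(2)[of "snd q"] by (cases q) simp
    next
      case False then show ?thesis using valid_sides[OF v(1) q(2)] valid_sides[OF d1(1) q(2)] q(3) by simp
    qed
    moreover have "d q = 0" using even_open_bottom_zero[OF v(1) Tv v(3) p] valid_fc[OF v(1) q(1)] by simp
    ultimately show ?thesis using valid_fc[OF d1(1) q(1)] by simp
  qed
  obtain m where m: "\<And>x. x < m \<Longrightarrow> S (0, x) = 0" using bottom_left by blast
  \<comment> \<open>The fold rises at values congruent to 1 and falls at values congruent to 3
    modulo 4. So at an odd node the sign must be the residue of the unfolded value, and this is the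
    invariant of the sweep.\<close>
  define good where "good x \<longleftrightarrow> (if even (S (0, x)) then d1 (0, x) mod 4 = d (0, x) mod 4 else d1 (0, x) mod 4 = sgnJ x mod 4)" for x
  have sJ: "sgnJ x = 1 \<or> sgnJ x = - 1" for x by (simp add: sgnJ_def)
  have good_step: "good (x + 1)" if i: "good x" for x
  proof (cases "even (S (0, x)) = even (S (0, x + 1))")
    case True
    then have "fc (0, x) (0, x + 1)" by (rule bottom_fc)
    then have "d1 (0, x) = d1 (0, x + 1)" "d (0, x) = d (0, x + 1)"
      "odd (S (0, x)) \<Longrightarrow> sgnJ x = sgnJ (x + 1)"
      using valid_fc[OF d1(1)] valid_fc[OF v(1)] sgnJ_face[OF v(1) ev] by blast+
    then show ?thesis using i True unfolding good_def by auto
  next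
    case False
    have D: "d1 (0, x + 1) = d1 (0, x) + w (0, x) (0, x + 1) * (d (0, x + 1) - d (0, x))"
      using d1(3)[OF step_E[of 0 x]] by (simp add: G_def)
    show ?thesis
    proof (cases "even (S (0, x))")
      case True
      then have o: "odd (S (0, x + 1))" using False by simp
      have "w (0, x) (0, x + 1) = sgnJ (x + 1)" using True o JF_bot[of "(0, x + 1)" "x + 1"] by (simp add: w_def)
      then have "d1 (0, x + 1) = d1 (0, x) + sgnJ (x + 1) * (1 - d (0, x))" using D dodd[OF o] by simp
      moreover have "d1 (0, x) mod 4 = d (0, x) mod 4" using i True by (simp add: good_def)
      ultimately have "d1 (0, x + 1) mod 4 = sgnJ (x + 1) mod 4"
        using deven[OF True] sJ[of "x + 1"] by (elim disjE) (simp_all, presburger+)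
      then show ?thesis using o by (simp add: good_def)
    next
      case o: False
      then have e: "even (S (0, x + 1))" using False by simp
      have "w (0, x) (0, x + 1) = sgnJ x" using e o JF_bot[of "(0, x)" x] by (simp add: w_def)
      then have "d1 (0, x + 1) = d1 (0, x) + sgnJ x * (d (0, x + 1) - 1)" using D dodd[OF o] by simp
      moreover have "d1 (0, x) mod 4 = sgnJ x mod 4" using i o by (simp add: good_def)
      ultimately have "d1 (0, x + 1) mod 4 = d (0, x + 1) mod 4"
        using deven[OF e] sJ[of x] by (elim disjE) (simp_all, presburger+)
      then show ?thesis using e by (simp add: good_def)
    qed
  qed
  have good: "good x" for x
  proof (cases "x < m")
    case True
    then show ?thesis using m valid_sides[OF v(1), of "(0, x)"] valid_sides[OF d1(1), of "(0, x)"] by (simp add: good_def)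
  next
    case False
    have "m - 1 \<le> x \<Longrightarrow> good x"
    proof (induction x rule: int_ge_induct)
      case base
      show ?case using m[of "m - 1"] valid_sides[OF v(1), of "(0, m - 1)"] valid_sides[OF d1(1), of "(0, m - 1)"]
        by (simp add: good_def)
    qed (rule good_step)
    then show ?thesis using False by simp
  qed
  have zig1: "zig (d1 (0, x)) = d (0, x)" for x
  proof (cases "even (S (0, x))")
    case True
    then show ?thesis using good[of x] deven[OF True] by (auto simp: good_def zig_def)
  next
    case False
    then show ?thesis using good[of x] dodd[OF False] sJ[of x] by (auto simp: good_def zig_def)
  qed
  \<comment> \<open>Absolute values of integers that differ by 1 again differ by 1, so jumps between
    faces remain admissible. Top nodes whose faces reach row 0 are already nonnegative.\<close>
  define H where "H p q = (if touch p \<and> touch q then \<bar>d1 q\<bar> - \<bar>d1 p\<bar> else d1 q - d1 p)" for p q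
  have Htop: "H (n, x) (n, x + 1) = d (n, x + 1) - d (n, x)" for x
  proof -
    have "0 \<le> d1 (n, z)" if t: "touch (n, z)" for z
    proof -
      obtain x where "fc (n, z) (0, x)" using t unfolding touch_def by blast
      then have "0 \<le> d (n, z)" using valid_fc[OF v(1), of "(n, z)" "(0, x)"] v(3)[of x] by auto
      then show ?thesis using d1(2) by simp
    qed
    then show ?thesis using d1(2) by (simp add: H_def)
  qed
  obtain d2 where d2: "valid d2" "\<And>x. d2 (n, x) = d (n, x)" "\<And>p q. step n p q \<Longrightarrow> d2 q - d2 p = H p q"
  proof (rule new_conf[OF v(1), of H])
    show "H q p = - H p q" for p q by (simp add: H_def)
    show "H p q = H p' q" if "fc p p'" for p p' q
      using touch_fc[OF that] valid_fc[OF d1(1) that] by (simp add: H_def)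
    show "\<bar>H p q\<bar> = 1" if "step n p q" "even (S p) \<noteq> even (S q)" for p q
      using valid_odd[OF d1(1) that] unfolding H_def by (auto simp: abs_if split: if_splits)
    show "H (n, x) (n, x + 1) = d (n, x + 1) - d (n, x)" for x by (rule Htop)
  qed blast
  have bot: "d2 (0, x) = \<bar>d1 (0, x)\<bar>" for x
  proof (rule row_eqI[where m = m and f = "\<lambda>z. d2 (0, z)" and g = "\<lambda>z. \<bar>d1 (0, z)\<bar>"])
    show "d2 (0, z + 1) - d2 (0, z) = \<bar>d1 (0, z + 1)\<bar> - \<bar>d1 (0, z)\<bar>" for z
      using d2(3)[OF step_E[of 0 z]] by (simp add: H_def)
    show "d2 (0, z) = \<bar>d1 (0, z)\<bar>" if "z < m" for z
      using valid_sides[OF d2(1), of "(0, z)"] valid_sides[OF d1(1), of "(0, z)"] m[OF that] by simp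
  qed
  have "runrule d2"
    unfolding runrule_def
  proof (intro allI impI)
    fix x1 x2 assume "x1 < x2 \<and> odd (S (0, x1 - 1)) \<and> (\<forall>y. x1 \<le> y \<and> y < x2 \<longrightarrow> even (S (0, y))) \<and>
       odd (S (0, x2)) \<and> d2 (0, x1) \<noteq> 0"
    then have r: "x1 < x2" "odd (S (0, x1 - 1))" "\<And>y. x1 \<le> y \<Longrightarrow> y < x2 \<Longrightarrow> even (S (0, y))"
      "odd (S (0, x2))" "d1 (0, x1) \<noteq> 0" using bot by auto
    have f: "fc (0, x1) (0, y)" if "x1 \<le> y" "y < x2" for y by (rule run_fc) (use r that in auto)
    have nz: "d1 (0, y) = d1 (0, x1)" if "x1 \<le> y" "y < x2" for y using valid_fc[OF d1(1) f[OF that]] by simp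
    have ev1: "even (S (0, x1))" using r by simp
    have cl: "clE y" if "x1 \<le> y" "y < x2" for y
    proof -
      have "\<not> opn (0, x1)" using zero[of "(0, x1)"] r(5) ev1 by auto
      then have "clE x1" using ev1 by (simp add: clE_def)
      then show ?thesis using clE_fc[OF f[OF that]] by simp
    qed
    \<comment> \<open>A run with nonzero value lies in a closed face, since \<open>d1\<close>
      vanishes on open even faces reaching row 0. All of its nodes count for the sign, which
      therefore changes across the run exactly if the length is odd.\<close>
    have "{z. z \<le> x2 \<and> clE z} = {z. z \<le> x1 - 1 \<and> clE z} \<union> {x1..<x2}"
    proof -
      have "\<not> clE x2" using r by (simp add: clE_def)
      then have "z \<le> x2 \<and> clE z \<longleftrightarrow> z \<le> x1 - 1 \<and> clE z \<or> x1 \<le> z \<and> z < x2" for z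
        using cl[of z] r(1) by (cases "z = x2") auto
      then show ?thesis unfolding set_eq_iff Un_iff mem_Collect_eq atLeastLessThan_iff by blast
    qed
    moreover have "card ({z. z \<le> x1 - 1 \<and> clE z} \<union> {x1..<x2}) = card {z. z \<le> x1 - 1 \<and> clE z} + card {x1..<x2}"
      by (rule card_Un_disjoint[OF finite_clE_le]) auto
    ultimately have J: "sgnJ (x1 - 1) = sgnJ x2 \<longleftrightarrow> even (x2 - x1)"
      using r(1) by (auto simp: sgnJ_def even_nat_iff)
    have st1: "step n (0, x1 - 1) (0, x1)" and st2: "step n (0, x2 - 1) (0, x2)"
      using step_E[of 0 "x1 - 1"] step_E[of 0 "x2 - 1"] by simp_all
    have a: "\<bar>d1 (0, x1) - d1 (0, x1 - 1)\<bar> = 1" by (rule valid_odd[OF d1(1) st1]) (use r ev1 in auto)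
    have "\<bar>d1 (0, x2) - d1 (0, x2 - 1)\<bar> = 1" by (rule valid_odd[OF d1(1) st2]) (use r in auto)
    then have b: "\<bar>d1 (0, x2) - d1 (0, x1)\<bar> = 1" using nz[of "x2 - 1"] r(1) by simp
    have "even (d1 (0, x1))" using valid_parity[OF d1(1), of "(0, x1)"] ev1 by simp
    \<comment> \<open>Both neighbours of the run then have the sign of its value, so equality of
      their absolute values is equality. They differ by 0 or 2, hence residues modulo 4
      decide.\<close>
    then have "d1 (0, x1) \<ge> 2 \<or> d1 (0, x1) \<le> - 2" using r(5) by presburger
    then have A: "\<bar>d1 (0, x1 - 1)\<bar> = \<bar>d1 (0, x2)\<bar> \<longleftrightarrow> d1 (0, x1 - 1) = d1 (0, x2)" using a b by linarith
    have m1: "d1 (0, x1 - 1) mod 4 = sgnJ (x1 - 1) mod 4" "d1 (0, x2) mod 4 = sgnJ x2 mod 4"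
      using good[of "x1 - 1"] good[of x2] r by (auto simp: good_def)
    have dd: "d1 (0, x1 - 1) = d1 (0, x2) \<or> d1 (0, x1 - 1) = d1 (0, x2) + 2 \<or> d1 (0, x1 - 1) = d1 (0, x2) - 2"
      using a b by linarith
    have "d1 (0, x1 - 1) = d1 (0, x2) \<longleftrightarrow> sgnJ (x1 - 1) = sgnJ x2"
    proof
      assume "d1 (0, x1 - 1) = d1 (0, x2)"
      then show "sgnJ (x1 - 1) = sgnJ x2" using m1 sJ[of x2] sJ[of "x1 - 1"] by auto
    next
      assume "sgnJ (x1 - 1) = sgnJ x2"
      then have "d1 (0, x1 - 1) mod 4 = d1 (0, x2) mod 4" using m1 by simp
      then show "d1 (0, x1 - 1) = d1 (0, x2)" using dd by presburger
    qed
    then show "d2 (0, x1 - 1) = d2 (0, x2) \<longleftrightarrow> even (x2 - x1)" using bot A J by simp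
  qed
  then have "d2 \<in> confP T" using d2(1,2) v(2) bot by (simp add: confP_def)
  moreover have "rel d d2"
    unfolding rel_def using bot zig1 zig_abs d2(3) d1(3) by (auto simp: H_def G_def w_def)
  ultimately show ?thesis by blast
qed

theorem conf_bij:
  assumes T: "\<And>x. T x \<le> 1" and nt: "no_even_tie" and ev: "even_faces"
  shows "\<exists>f. bij_betw f (conf2 T) (confP T)"
proof -
  define f where "f a = (SOME b. b \<in> confP T \<and> rel a b)" for a
  have f: "f a \<in> confP T \<and> rel a (f a)" if "a \<in> conf2 T" for a
    unfolding f_def using rel_exists2[of T, OF T that nt ev] by (intro someI_ex[of "\<lambda>b. b \<in> confP T \<and> rel a b"]) blast
  have "bij_betw f (conf2 T) (confP T)"
  proof (rule bij_betwI')
    fix a b assume ab: "a \<in> conf2 T" "b \<in> conf2 T"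
    show "f a = f b \<longleftrightarrow> a = b"
      using rel_unique1[OF ab] f[OF ab(1)] f[OF ab(2)] by metis
  next
    fix a assume "a \<in> conf2 T" then show "f a \<in> confP T" using f by blast
  next
    fix b assume b: "b \<in> confP T"
    then obtain a where a: "a \<in> conf2 T" "rel a b" using rel_exists1[of T, OF T] by blast
    then have "f a = b" using rel_unique2[OF nt _ b _ a(2)] f by blast
    then show "\<exists>a\<in>conf2 T. b = f a" using a by blast
  qed
  then show ?thesis by blast
qed

end

section \<open>Odd regions and even faces\<close>

context strip
begin

text \<open>For \<open>P\<close> the regions say nothing about faces with nonzero height at row 0;
  there the run rule itself forces evenness. A potential that jumps only between the face and its
  neighbours of height \<open>m + 1\<close> changes parity over a run exactly if the two sides
  differ, that is, if the run has odd length. As the face is closed, the potential returns to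
  0.\<close>

lemma face_even_nonzero:
  assumes d: "valid d" and rr: "runrule d" and nt: "no_even_tie"
    and x0: "even (S (0, x0))" "\<not> opn (0, x0)" "d (0, x0) \<noteq> 0"
  shows "even (card {y. fc (0, x0) (0, y)})"
proof -
  define m where "m = d (0, x0)"
  define G where "G p q = (if fc (0, x0) p \<and> d q = m + 1 \<or> fc (0, x0) q \<and> d p = m + 1 then d q - d p else 0)" for p q
  have "\<exists>c. (\<forall>p q. step n p q \<longrightarrow> c q - c p = G p q) \<and> (\<exists>m. \<forall>p. snd p \<le> m \<longrightarrow> c p = 0) \<and> (\<forall>p q. fc p q \<longrightarrow> c p = c q)"
  proof (rule face_potential[of G])
    show "G q p = - G p q" for p q by (auto simp: G_def)
    show "G p q = G p' q" if "fc p p'" for p p' q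
      unfolding G_def using fc_cong(2)[OF that] valid_fc[OF d that] by simp
  qed blast
  then obtain c a where c: "\<And>p q. step n p q \<Longrightarrow> c q - c p = G p q" "\<And>p q. fc p q \<Longrightarrow> c p = c q"
    and a: "\<And>p. snd p \<le> a \<Longrightarrow> c p = 0" by blast
  have notPhi: "\<not> fc (0, x0) p" if "opn p" for p using opn_fc[of "(0, x0)" p] that x0 by blast
  have oddPhi: "\<not> fc (0, x0) p" if "odd (S p)" for p using fc_even[of "(0, x0)" p] that x0 by blast
  have c0: "c p = 0" if p: "fst p \<le> n" "S p = 0" for p
  proof -
    have "fc (fst p, min (snd p) a) p" by (rule S0_fc[OF p]) simp
    then show ?thesis using c(2) a[of "(fst p, min (snd p) a)"] by fastforce
  qed
  define k where "k x = card {y. y \<le> x \<and> fc (0, x0) (0, y)}" for x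
  have fin: "finite {y. y \<le> x \<and> fc (0, x0) (0, y)}" for x
    by (rule finite_subset[OF _ finite_clE]) (use clE_fc x0 in \<open>auto simp: clE_def\<close>)
  obtain lo where lo: "\<And>x. x < lo \<Longrightarrow> S (0, x) = 0" using bottom_left by blast
  \<comment> \<open>Sweep from the left over odd nodes only: each even run is crossed in one move,
    from the odd node before it to the odd node after it.\<close>
  have main0: "\<forall>x. x < lo + int j \<longrightarrow> odd (S (0, x)) \<longrightarrow> even (int (k x) + c (0, x))" for j
  proof (induction j)
    case 0 then show ?case using lo by auto
  next
    case (Suc j)
    show ?case
    proof (intro allI impI)
      fix x assume x: "x < lo + int (Suc j)" "odd (S (0, x))"
      have IH: "even (int (k y) + c (0, y))" if "y < x" "odd (S (0, y))" for y
        using Suc.IH that x by auto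
      have st: "step n (0, x - 1) (0, x)" using step_E[of 0 "x - 1"] by simp
      show "even (int (k x) + c (0, x))"
      proof (cases "odd (S (0, x - 1))")
        case True
        have "c (0, x - 1) = c (0, x)" using c(2) fc_step(1)[OF st] True x by blast
        moreover have "k x = k (x - 1)"
        proof -
          have "y \<le> x \<and> fc (0, x0) (0, y) \<longleftrightarrow> y \<le> x - 1 \<and> fc (0, x0) (0, y)" for y
            using oddPhi[OF x(2)] by (cases "y = x") auto
          then show ?thesis unfolding k_def by simp
        qed
        ultimately show ?thesis using IH[of "x - 1"] True by simp
      next
        case False
        then have ev: "even (S (0, x - 1))" by simp
        show ?thesis
        proof (cases "S (0, x - 1) = 0")
          case True
          have o: "opn (0, y)" if "y \<le> x - 1" for y
          proof -
            have "S (0, y) = 0" using S_mono[of 0 y "x - 1"] S_bounds(1)[of "(0, y)"] True that by simp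
            then show ?thesis by (intro opnI) auto
          qed
          have "\<not> (y \<le> x \<and> fc (0, x0) (0, y))" for y
            using notPhi[OF o[of y]] oddPhi[OF x(2)] by (cases "y = x") auto
          then have "{y. y \<le> x \<and> fc (0, x0) (0, y)} = {}" by blast
          then have "k x = 0" unfolding k_def by (metis card.empty)
          moreover have "G (0, x - 1) (0, x) = 0" using notPhi[OF o[of "x - 1"]] oddPhi[OF x(2)] by (simp add: G_def)
          ultimately show ?thesis using c(1)[OF st] c0[of "(0, x - 1)"] True by simp
        next
          case nz: False
          obtain x1 where x1: "x1 \<le> x - 1" "odd (S (0, x1 - 1))" "\<And>y. x1 \<le> y \<Longrightarrow> y \<le> x - 1 \<Longrightarrow> even (S (0, y))"
            using prev_gap[OF nt ev nz] by blast
          have f: "fc (0, x1) (0, y)" if "x1 \<le> y" "y \<le> x - 1" for y by (rule run_fc) (use x1 that in auto)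
          have st1: "step n (0, x1 - 1) (0, x1)" using step_E[of 0 "x1 - 1"] by simp
          have I: "even (int (k (x1 - 1)) + c (0, x1 - 1))" using IH x1 by simp
          have cc: "c (0, x) = c (0, x1 - 1) + G (0, x1 - 1) (0, x1) + G (0, x - 1) (0, x)"
            using c(1)[OF st] c(1)[OF st1] c(2)[OF f[of "x - 1"]] x1(1) by simp
          have n1: "\<not> fc (0, x0) (0, x1 - 1)" "\<not> fc (0, x0) (0, x)" using oddPhi x1 x by auto
          have same: "fc (0, x0) (0, y) = fc (0, x0) (0, x1)" if "x1 \<le> y" "y \<le> x - 1" for y
            using fc_cong(2)[OF f[OF that]] by simp
          show ?thesis
          proof (cases "fc (0, x0) (0, x1)")
            case False
            have "y \<le> x \<and> fc (0, x0) (0, y) \<longleftrightarrow> y \<le> x1 - 1 \<and> fc (0, x0) (0, y)" for y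
              using same[of y] False n1(2) x1(1) by (cases "y = x"; cases "x1 \<le> y") auto
            then have "k x = k (x1 - 1)" unfolding k_def by simp
            moreover have "G (0, x1 - 1) (0, x1) = 0" "G (0, x - 1) (0, x) = 0"
              using False n1 same[of "x - 1"] x1(1) by (auto simp: G_def)
            ultimately show ?thesis using cc I by simp
          next
            case True
            have "y \<le> x \<and> fc (0, x0) (0, y) \<longleftrightarrow> y \<le> x1 - 1 \<and> fc (0, x0) (0, y) \<or> y \<in> {x1..<x}" for y
              using same[of y] True n1(2) x1(1) by (cases "y = x"; cases "x1 \<le> y") auto
            then have "{y. y \<le> x \<and> fc (0, x0) (0, y)} = {y. y \<le> x1 - 1 \<and> fc (0, x0) (0, y)} \<union> {x1..<x}" by blast
            moreover have "card ({y. y \<le> x1 - 1 \<and> fc (0, x0) (0, y)} \<union> {x1..<x}) = k (x1 - 1) + card {x1..<x}"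
              unfolding k_def by (rule card_Un_disjoint[OF fin]) auto
            ultimately have kk: "int (k x) = int (k (x1 - 1)) + (x - x1)" using x1(1) by (simp add: k_def)
            have dm: "d (0, x1) = m" "d (0, x - 1) = m"
              using valid_fc[OF d True] valid_fc[OF d f[of "x - 1"]] x1(1) by (auto simp: m_def)
            have p1: "even (S (0, x1))" using x1 by simp
            have a1: "\<bar>m - d (0, x1 - 1)\<bar> = 1" using valid_odd[OF d st1] p1 x1(2) dm by auto
            have a2: "\<bar>d (0, x) - m\<bar> = 1" using valid_odd[OF d st] ev x(2) dm by auto
            have "d (0, x1 - 1) = d (0, x) \<longleftrightarrow> even (x - x1)"
              using rr[unfolded runrule_def, rule_format, of x1 x] x1 x(2) dm x0(3) m_def by simp
            moreover have "G (0, x1 - 1) (0, x1) = (if d (0, x1 - 1) = m + 1 then - 1 else 0)"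
              using n1 True dm by (simp add: G_def)
            moreover have "G (0, x - 1) (0, x) = (if d (0, x) = m + 1 then 1 else 0)"
              using n1 same[of "x - 1"] True dm x1(1) by (simp add: G_def)
            moreover have "d (0, x1 - 1) = m + 1 \<or> d (0, x1 - 1) = m - 1" using a1 by linarith
            moreover have "d (0, x) = m + 1 \<or> d (0, x) = m - 1" using a2 by linarith
            ultimately show ?thesis using cc kk I by (elim disjE) auto
          qed
        qed
      qed
    qed
  qed
  have main: "even (int (k x) + c (0, x))" if "odd (S (0, x))" for x
  proof (cases "x < lo")
    case True then show ?thesis using lo[of x] that by simp
  next
    case False
    then have "x < lo + int (nat (x - lo + 1))" by simp
    then show ?thesis using main0[of "nat (x - lo + 1)"] that by blast
  qed
  obtain hi where hi: "\<And>p. fst p \<le> n \<Longrightarrow> hi \<le> snd p \<Longrightarrow> S p = 2 * int l" using S_right by blast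
  have l0: "S (0, lo - 1) = 0" using lo by simp
  have "l \<noteq> 0"
  proof
    assume "l = 0"
    then have "S (0, x0) = 0" using S_bounds[of "(0, x0)"] by simp
    then show False using x0(2) opnI[of "(0, x0)"] by simp
  qed
  define Y where "Y = {x \<in> {lo..max lo hi}. S (0, x) = 2 * int l}"
  have finY: "finite Y" by (rule finite_subset[of _ "{lo..max lo hi}"]) (auto simp: Y_def)
  have neY: "Y \<noteq> {}" using hi[of "(0, max lo hi)"] by (auto simp: Y_def)
  \<comment> \<open>The leftmost node of row 0 with \<open>S = 2 * int l\<close>. The node before it
    is odd since there are no ties, so the invariant applies there, with the whole face already
    counted.\<close>
  define e where "e = Min Y"
  have eY: "e \<in> Y" unfolding e_def by (rule Min_in[OF finY neY])
  have e1: "S (0, e - 1) \<noteq> 2 * int l"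
  proof
    assume *: "S (0, e - 1) = 2 * int l"
    have "lo \<le> e - 1" using * lo[of "e - 1"] \<open>l \<noteq> 0\<close> by force
    then have "e - 1 \<in> Y" using * eY by (auto simp: Y_def)
    then show False using Min_le[OF finY, of "e - 1"] unfolding e_def[symmetric] by simp
  qed
  have Se: "S (0, e) = 2 * int l" using eY by (simp add: Y_def)
  have ste: "step n (0, e - 1) (0, e)" using step_E[of 0 "e - 1"] by simp
  have odde: "odd (S (0, e - 1))"
  proof
    assume *: "even (S (0, e - 1))"
    then have "S (0, e - 1 + 1) = S (0, e - 1)" using step_even_bottom[OF nt, of "e - 1"] Se by simp
    then show False using e1 Se by simp
  qed
  have "{y. y \<le> e - 1 \<and> fc (0, x0) (0, y)} = {y. fc (0, x0) (0, y)}"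
  proof -
    have "y \<le> e - 1" if "fc (0, x0) (0, y)" for y
    proof (rule ccontr)
      assume "\<not> y \<le> e - 1"
      then have "S (0, y) = 2 * int l" using S_mono[of 0 e y] S_bounds(2)[of "(0, y)"] Se by simp
      then show False using notPhi[of "(0, y)"] opnI[of "(0, y)"] that by simp
    qed
    then show ?thesis by auto
  qed
  then have kc: "k (e - 1) = card {y. fc (0, x0) (0, y)}" by (simp add: k_def)
  have "c (0, e) = 0"
  proof -
    obtain z where z: "fc (0, e) (n, z)" using right_fc_top[of "(0, e)"] Se by auto
    have "G (n, y) (n, y + 1) = 0" for y using notPhi[OF opnI[of "(n, y)"]] notPhi[OF opnI[of "(n, y + 1)"]] by (simp add: G_def)
    then have "c (n, y + 1) = c (n, y)" for y using c(1)[OF step_E[of n y]] by simp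
    then have "c (n, z) = c (n, min z a)" using row_induct_const[where f = "\<lambda>z. c (n, z)", of "min z a" z] by simp
    then show ?thesis using c(2)[OF z] a[of "(n, min z a)"] by simp
  qed
  moreover have "G (0, e - 1) (0, e) = 0"
    using oddPhi[OF odde] notPhi[OF opnI[of "(0, e)"]] Se by (simp add: G_def)
  ultimately have "c (0, e - 1) = 0" using c(1)[OF ste] by simp
  then show ?thesis using main[OF odde] kc by simp
qed

definition conn :: "node set \<Rightarrow> node \<Rightarrow> node \<Rightarrow> bool" where
  "conn Z = (\<lambda>p q. p \<in> Z \<and> q \<in> Z \<and> (step n p q \<or> step n q p))\<^sup>*\<^sup>*"

text \<open>For families of paths this will be the interval between \<open>a i\<close> and
  \<open>b (i + 1)\<close>, be it an overlap or a hole. Since \<alpha> has position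
  \<open>a i + 1\<close> at height 0, a run of odd length belongs to an even overlap or
  hole.\<close>

definition run :: "nat \<Rightarrow> int set" where "run i = {y. S (0, y) = 2 * (int l - int i)}"

definition meets :: "node set \<Rightarrow> int \<Rightarrow> nat set" where
  "meets Z x = {i \<in> {1..<l}. odd (card (run i)) \<and> (\<exists>y\<in>run i. conn Z (0, x) (0, y))}"

definition at_boundary :: "node set \<Rightarrow> int \<Rightarrow> bool" where
  "at_boundary Z x \<longleftrightarrow> (\<exists>p. conn Z (0, x) p \<and> fst p \<le> n \<and> (fst p = n \<or> S p = 0 \<or> S p = 2 * int l))"

lemma fc_conn:
  assumes d: "valid d" and Z: "Z = {p. fst p \<le> n \<and> P (d p)}" and p: "p \<in> Z" and f: "fc p q"
  shows "conn Z p q"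
  using f unfolding fc_def conn_def
proof (induction rule: rtranclp_induct)
  case (step y z)
  have "fc p y" "fc p z" using step(1,2) unfolding fc_def by auto
  then have "d y = d p" "d z = d p" using valid_fc[OF d] by metis+
  moreover have "fst y \<le> n" "fst z \<le> n" "step n y z \<or> step n z y" using step(2) unfolding eadj_def step_def by auto
  ultimately have "y \<in> Z \<and> z \<in> Z \<and> (step n y z \<or> step n z y)" using p Z by auto
  then show ?case using step(3) by (metis (no_types, lifting) rtranclp.rtrancl_into_rtrancl)
qed simp

text \<open>A region may leave the face of \<open>x0\<close> high up and reach row 0 again
  elsewhere; the claim is that there it only finds nodes of that same face. The potential that jumps
  only between the face and nodes of height 1 is constant on the region, as \<open>Z\<close> avoids
  height 1, while on row 0 it singles out the face.\<close>

lemma region_separation: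
  assumes d: "valid d" and x0: "even (S (0, x0))"
    and gap: "\<And>x x'. \<bar>x - x'\<bar> = 1 \<Longrightarrow> fc (0, x0) (0, x) \<Longrightarrow> odd (S (0, x')) \<Longrightarrow> d (0, x') = 1"
    and Z: "\<And>p. p \<in> Z \<Longrightarrow> d p \<noteq> 1" and p: "conn Z (0, x0) p"
  shows "fst p = 0 \<Longrightarrow> even (S p) \<Longrightarrow> fc (0, x0) p"
    and "\<not> opn (0, x0) \<Longrightarrow> fst p \<le> n \<Longrightarrow> fst p \<noteq> n \<and> S p \<noteq> 0 \<and> S p \<noteq> 2 * int l"
proof -
  define G where "G p q = (if fc (0, x0) p \<and> d q = 1 \<or> fc (0, x0) q \<and> d p = 1 then d q - d p else 0)" for p q
  have "\<exists>c. (\<forall>p q. step n p q \<longrightarrow> c q - c p = G p q) \<and> (\<exists>m. \<forall>p. snd p \<le> m \<longrightarrow> c p = 0) \<and> (\<forall>p q. fc p q \<longrightarrow> c p = c q)"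
  proof (rule face_potential[of G])
    show "G q p = - G p q" for p q by (auto simp: G_def)
    show "G p q = G p' q" if "fc p p'" for p p' q
      unfolding G_def using fc_cong(2)[OF that] valid_fc[OF d that] by simp
  qed blast
  then obtain c a where c: "\<And>p q. step n p q \<Longrightarrow> c q - c p = G p q" "\<And>p q. fc p q \<Longrightarrow> c p = c q"
    and a: "\<And>p. snd p \<le> a \<Longrightarrow> c p = 0" by blast
  \<comment> \<open>On row 0 every jump at the border of the face leads to height 1, so there the
    potential is known explicitly up to the constant \<open>b\<close>.\<close>
  define h where "h x = (if fc (0, x0) (0, x) then d (0, x0) - 1 else 0)" for x
  have "odd (d (0, x0) - 1)" using valid_parity[OF d, of "(0, x0)"] x0 by simp
  then have h0: "d (0, x0) - 1 \<noteq> 0" by (metis even_zero)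
  have oddPhi: "\<not> fc (0, x0) p" if "odd (S p)" for p using fc_even[of "(0, x0)" p] that x0 by blast
  have Gh: "G (0, x) (0, x + 1) = h (x + 1) - h x" for x
  proof (cases "even (S (0, x)) = even (S (0, x + 1))")
    case True
    then have f: "fc (0, x) (0, x + 1)" by (rule bottom_fc)
    then show ?thesis using fc_cong(2)[OF f, of "(0, x0)"] valid_fc[OF d f] by (simp add: G_def h_def)
  next
    case False
    show ?thesis
    proof (cases "even (S (0, x))")
      case True
      then have o: "odd (S (0, x + 1))" using False by simp
      show ?thesis
      proof (cases "fc (0, x0) (0, x)")
        case f: True
        then have "d (0, x + 1) = 1" using gap[of x "x + 1"] o by simp
        then show ?thesis using f oddPhi[OF o] valid_fc[OF d f] by (simp add: G_def h_def)
      qed (use oddPhi[OF o] in \<open>simp add: G_def h_def\<close>)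
    next
      case o: False
      show ?thesis
      proof (cases "fc (0, x0) (0, x + 1)")
        case f: True
        then have "d (0, x) = 1" using gap[of "x + 1" x] o by simp
        then show ?thesis using f oddPhi[OF o] valid_fc[OF d f] by (simp add: G_def h_def)
      qed (use oddPhi[OF o] in \<open>simp add: G_def h_def\<close>)
    qed
  qed
  define b where "b = c (0, x0) - h x0"
  have ch: "c (0, x) = h x + b" for x
  proof -
    have eq: "c (0, z + 1) - h (z + 1) = c (0, z) - h z" for z using c(1)[OF step_E[of 0 z]] Gh[of z] by simp
    have "c (0, v) - h v = c (0, u) - h u" if "u \<le> v" for u v
      by (rule row_induct_const[where f = "\<lambda>z. c (0, z) - h z"]) (use eq that in auto)
    from this[of x x0] this[of x0 x] show ?thesis by (cases "x \<le> x0") (auto simp: b_def)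
  qed
  have "c p = c (0, x0)"
    using p unfolding conn_def
  proof (induction rule: rtranclp_induct)
    case (step y z)
    then have "d y \<noteq> 1" "d z \<noteq> 1" "step n y z \<or> step n z y" using Z by auto
    then have "c z = c y" using c(1)[of y z] c(1)[of z y] by (auto simp: G_def)
    then show ?case using step by simp
  qed simp
  then have cp: "c p = d (0, x0) - 1 + b" using ch[of x0] by (simp add: h_def)
  show "fc (0, x0) p" if "fst p = 0" "even (S p)"
  proof (rule ccontr)
    assume "\<not> fc (0, x0) p"
    then have "c p = b" using ch[of "snd p"] that by (cases p) (simp add: h_def)
    then show False using cp h0 by simp
  qed
  show "fst p \<noteq> n \<and> S p \<noteq> 0 \<and> S p \<noteq> 2 * int l" if cl: "\<not> opn (0, x0)" and pn: "fst p \<le> n"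
  proof -
    have notPhi: "\<not> fc (0, x0) p" if "opn p" for p using opn_fc[of "(0, x0)" p] that cl by blast
    obtain lo where lo: "\<And>x. x < lo \<Longrightarrow> S (0, x) = 0" using bottom_left by blast
    have "h (min a (lo - 1)) = 0"
      using notPhi[OF opnI[of "(0, min a (lo - 1))"]] lo[of "min a (lo - 1)"] by (simp add: h_def)
    then have b0: "b = 0" using ch[of "min a (lo - 1)"] a[of "(0, min a (lo - 1))"] by simp
    have ctop: "c (n, z) = 0" for z
    proof -
      have "G (n, y) (n, y + 1) = 0" for y using notPhi[OF opnI[of "(n, y)"]] notPhi[OF opnI[of "(n, y + 1)"]] by (simp add: G_def)
      then have "c (n, y + 1) = c (n, y)" for y using c(1)[OF step_E[of n y]] by simp
      then have "c (n, z) = c (n, min z a)" using row_induct_const[where f = "\<lambda>z. c (n, z)", of "min z a" z] by simp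
      then show ?thesis using a[of "(n, min z a)"] by simp
    qed
    have cp0: "c p \<noteq> 0" using cp b0 h0 by simp
    have "fst p \<noteq> n" using ctop[of "snd p"] cp0 by (cases p) auto
    moreover have "S p \<noteq> 0"
    proof
      assume "S p = 0"
      then have "fc (fst p, min (snd p) a) p" by (intro S0_fc[OF pn]) auto
      from c(2)[OF this] show False using a[of "(fst p, min (snd p) a)"] cp0 by simp
    qed
    moreover have "S p \<noteq> 2 * int l"
    proof
      assume "S p = 2 * int l"
      then obtain z where "fc p (n, z)" using right_fc_top[OF pn] by blast
      from c(2)[OF this] show False using ctop cp0 by simp
    qed
    ultimately show ?thesis by blast
  qed
qed

lemma run_same_face: "y \<in> run i \<Longrightarrow> y' \<in> run i \<Longrightarrow> fc (0, y) (0, y')"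
proof -
  have *: "fc (0, y) (0, y')" if y: "y \<in> run i" "y' \<in> run i" "y \<le> y'" for y y'
  proof (rule run_fc)
    fix z assume "y \<le> z" "z \<le> y'"
    then have "S (0, y) \<le> S (0, z)" "S (0, z) \<le> S (0, y')" by (auto intro: S_mono)
    then have "S (0, z) = 2 * (int l - int i)" using y by (simp add: run_def)
    then show "even (S (0, z))" by simp
  qed (rule y)
  assume "y \<in> run i" "y' \<in> run i"
  then show ?thesis using *[of y y'] fc_sym[OF *[of y' y]] by (cases "y \<le> y'") auto
qed

text \<open>On row 0 a closed even face is a disjoint union of full runs with
  \<open>1 \<le> i < l\<close>, so only runs of odd length matter for the parity.\<close>

lemma card_face:
  assumes x: "even (S (0, x))" "\<not> opn (0, x)"
  shows "even (card {y. fc (0, x) (0, y)}) \<longleftrightarrow>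
    even (card {i \<in> {1..<l}. odd (card (run i)) \<and> (\<exists>y\<in>run i. fc (0, x) (0, y))})"
proof -
  define I where "I = {i \<in> {1..<l}. \<exists>y\<in>run i. fc (0, x) (0, y)}"
  have finI: "finite I" by (simp add: I_def)
  have sub: "run i \<subseteq> {y. fc (0, x) (0, y)}" if "i \<in> I" for i
    using that run_same_face fc_trans unfolding I_def by blast
  have fin: "finite {y. fc (0, x) (0, y)}"
    by (rule finite_subset[OF _ finite_clE]) (use clE_fc x in \<open>auto simp: clE_def\<close>)
  have U: "{y. fc (0, x) (0, y)} = (\<Union>i\<in>I. run i)"
  proof
    show "(\<Union>i\<in>I. run i) \<subseteq> {y. fc (0, x) (0, y)}" using sub by blast
    show "{y. fc (0, x) (0, y)} \<subseteq> (\<Union>i\<in>I. run i)"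
    proof
      fix y assume "y \<in> {y. fc (0, x) (0, y)}"
      then have f: "fc (0, x) (0, y)" by simp
      have ev: "even (S (0, y))" using fc_even[OF f] x by simp
      have "\<not> opn (0, y)" using opn_fc[OF f] x by simp
      then have "S (0, y) \<noteq> 0" "S (0, y) \<noteq> 2 * int l" using opnI[of "(0, y)"] by auto
      then have b: "0 < S (0, y)" "S (0, y) < 2 * int l" using S_bounds[of "(0, y)"] by auto
      obtain k where k: "S (0, y) = 2 * k" using ev by (elim evenE)
      define i where "i = nat (int l - k)"
      have i: "i \<in> {1..<l}" "y \<in> run i" using k b by (auto simp: i_def run_def)
      then have "i \<in> I" using f unfolding I_def by blast
      then show "y \<in> (\<Union>i\<in>I. run i)" using i by blast
    qed
  qed
  have "card (\<Union>i\<in>I. run i) = (\<Sum>i\<in>I. card (run i))"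
    by (rule card_UN_disjoint[OF finI]) (use finite_subset[OF sub fin] in \<open>auto simp: run_def\<close>)
  then have "even (card {y. fc (0, x) (0, y)}) \<longleftrightarrow> even (\<Sum>i\<in>I. card (run i))" using U by simp
  also have "\<dots> \<longleftrightarrow> even (card {i \<in> I. odd (card (run i))})" by (rule even_sum_iff[OF finI])
  also have "{i \<in> I. odd (card (run i))} = {i \<in> {1..<l}. odd (card (run i)) \<and> (\<exists>y\<in>run i. fc (0, x) (0, y))}"
    by (auto simp: I_def)
  finally show ?thesis .
qed

lemma region_count:
  assumes d: "valid d" and x0: "even (S (0, x0))"
    and gap: "\<And>x x'. \<bar>x - x'\<bar> = 1 \<Longrightarrow> fc (0, x0) (0, x) \<Longrightarrow> odd (S (0, x')) \<Longrightarrow> d (0, x') = 1"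
    and Z: "Z = {p. fst p \<le> n \<and> P (d p)}" and P: "\<not> P 1" "P (d (0, x0))"
  shows "at_boundary Z x0 \<longleftrightarrow> opn (0, x0)"
    and "\<not> opn (0, x0) \<Longrightarrow> even (card (meets Z x0)) \<longleftrightarrow> even (card {y. fc (0, x0) (0, y)})"
proof -
  have Z1: "d p \<noteq> 1" if "p \<in> Z" for p using that Z P by auto
  have x0Z: "(0, x0) \<in> Z" using Z P by simp
  have sep1: "fc (0, x0) p" if "conn Z (0, x0) p" "fst p = 0" "even (S p)" for p
    by (rule region_separation(1)[OF d x0 _ _ that]) (erule (2) gap, erule Z1)
  have sep2: "fst p \<noteq> n \<and> S p \<noteq> 0 \<and> S p \<noteq> 2 * int l" if "conn Z (0, x0) p" "\<not> opn (0, x0)" "fst p \<le> n" for p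
    by (rule region_separation(2)[OF d x0 _ _ that]) (erule (2) gap, erule Z1)
  show "at_boundary Z x0 \<longleftrightarrow> opn (0, x0)"
  proof
    assume "at_boundary Z x0"
    then show "opn (0, x0)" unfolding at_boundary_def using sep2 by blast
  next
    assume "opn (0, x0)"
    then show "at_boundary Z x0" unfolding at_boundary_def opn_def using fc_conn[OF d Z x0Z] by blast
  qed
  show "even (card (meets Z x0)) \<longleftrightarrow> even (card {y. fc (0, x0) (0, y)})" if cl: "\<not> opn (0, x0)"
  proof -
    have "conn Z (0, x0) (0, y) \<longleftrightarrow> fc (0, x0) (0, y)" if "y \<in> run i" for y i
    proof
      assume "conn Z (0, x0) (0, y)"
      then show "fc (0, x0) (0, y)" using sep1 that by (simp add: run_def)
    qed (rule fc_conn[OF d Z x0Z])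
    then have "meets Z x0 = {i \<in> {1..<l}. odd (card (run i)) \<and> (\<exists>y\<in>run i. fc (0, x0) (0, y))}"
      unfolding meets_def by blast
    then show ?thesis using card_face[OF x0 cl] by simp
  qed
qed

text \<open>Odd nodes of row 0 have height 1, so an even face there belongs to a region of the first
  kind (height 2) or of the second (height 0). Regions of the first kind carry no boundary clause;
  an open even face has height 0 on row 0, so those regions come from closed faces all the
  same.\<close>

lemma regions2:
  assumes d: "d \<in> conf2 T" and T: "\<And>x. T x \<le> 1"
  shows "even_faces \<longleftrightarrow>
    (\<forall>x. 2 \<le> d (0, x) \<longrightarrow> even (card (meets {p. fst p \<le> n \<and> 2 \<le> d p} x))) \<and>
    (\<forall>x. d (0, x) \<le> 0 \<longrightarrow> \<not> at_boundary {p. fst p \<le> n \<and> d p \<le> 0} x \<longrightarrow>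
      even (card (meets {p. fst p \<le> n \<and> d p \<le> 0} x)))" (is "_ \<longleftrightarrow> ?I \<and> ?II")
proof -
  have v: "valid d" "\<And>x. d (n, x) = T x" "\<And>x. d (0, x) \<in> {0, 1, 2}" using d by (auto simp: conf2_def)
  have par: "even (d (0, x)) = even (S (0, x))" for x using valid_parity[OF v(1), of "(0, x)"] by simp
  have gap: "d (0, x) = 1" if "odd (S (0, x))" for x using par[of x] that v(3)[of x] by auto
  have ev: "even (S (0, x))" if "2 \<le> d (0, x) \<or> d (0, x) \<le> 0" for x using par[of x] that v(3)[of x] by auto
  have cl: "\<not> opn (0, x)" if "2 \<le> d (0, x)" for x
    using even_open_bottom_zero[OF v(1) _ v(3), of "(0, x)"] v(2) T ev[of x] that by auto
  have I: "even (card (meets {p. fst p \<le> n \<and> 2 \<le> d p} x)) \<longleftrightarrow> even (card {y. fc (0, x) (0, y)})" if "2 \<le> d (0, x)" for x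
    by (rule region_count(2)[OF v(1) ev gap refl]) (use that cl in auto)
  have II: "at_boundary {p. fst p \<le> n \<and> d p \<le> 0} x \<longleftrightarrow> opn (0, x)"
    "\<not> opn (0, x) \<Longrightarrow> even (card (meets {p. fst p \<le> n \<and> d p \<le> 0} x)) \<longleftrightarrow> even (card {y. fc (0, x) (0, y)})"
    if "d (0, x) \<le> 0" for x
    by (rule region_count[OF v(1) ev gap refl]; use that in auto)+
  show ?thesis
  proof
    assume e: "even_faces"
    show "?I \<and> ?II" using e I II ev cl unfolding even_faces_def by blast
  next
    assume r: "?I \<and> ?II"
    show "even_faces"
      unfolding even_faces_def
    proof (intro allI impI)
      fix x assume x: "even (S (0, x)) \<and> \<not> opn (0, x)"
      then have "d (0, x) = 0 \<or> d (0, x) = 2" using par[of x] v(3)[of x] by auto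
      then show "even (card {y. fc (0, x) (0, y)})" using r x I[of x] II[of x] by force
    qed
  qed
qed

text \<open>Next to a node of height 0 on row 0 an odd node has height 1 by nonnegativity, so faces
  of height 0 are handled by the regions. The closed even faces of other heights are even by
  \<open>face_even_nonzero\<close>.\<close>

lemma regionsP:
  assumes d: "d \<in> confP T" and nt: "no_even_tie"
  shows "even_faces \<longleftrightarrow>
    (\<forall>x. d (0, x) \<le> 0 \<longrightarrow> \<not> at_boundary {p. fst p \<le> n \<and> d p \<le> 0} x \<longrightarrow>
      even (card (meets {p. fst p \<le> n \<and> d p \<le> 0} x)))" (is "_ \<longleftrightarrow> ?II")
proof -
  have v: "valid d" "\<And>x. 0 \<le> d (0, x)" "runrule d" using d by (auto simp: confP_def)
  have par: "even (d (0, x)) = even (S (0, x))" for x using valid_parity[OF v(1), of "(0, x)"] by simp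
  have ev: "even (S (0, x))" if "d (0, x) \<le> 0" for x using par[of x] that v(2)[of x] by auto
  have gap: "d (0, y') = 1" if "d (0, x) \<le> 0" and y: "\<bar>y - y'\<bar> = 1" "fc (0, x) (0, y)" "odd (S (0, y'))" for x y y'
  proof -
    have dy: "d (0, y) = 0" using valid_fc[OF v(1) y(2)] that(1) v(2)[of x] by simp
    have "even (S (0, y))" using ev[of y] dy by simp
    moreover have "y' = y + 1 \<or> y = y' + 1" using y(1) by linarith
    ultimately have "\<bar>d (0, y') - d (0, y)\<bar> = 1"
    proof (elim disjE)
      assume e: "even (S (0, y))" "y' = y + 1"
      then show ?thesis using valid_odd[OF v(1) step_E[of 0 y]] y(3) by simp
    next
      assume e: "even (S (0, y))" "y = y' + 1"
      then show ?thesis using valid_odd[OF v(1) step_E[of 0 y']] y(3) by (simp add: abs_minus_commute)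
    qed
    then show ?thesis using dy v(2)[of y'] by linarith
  qed
  have II: "at_boundary {p. fst p \<le> n \<and> d p \<le> 0} x \<longleftrightarrow> opn (0, x)"
    "\<not> opn (0, x) \<Longrightarrow> even (card (meets {p. fst p \<le> n \<and> d p \<le> 0} x)) \<longleftrightarrow> even (card {y. fc (0, x) (0, y)})"
    if "d (0, x) \<le> 0" for x
    by (rule region_count[OF v(1) ev gap refl]; use that in auto)+
  show ?thesis
  proof
    assume e: "even_faces"
    show "?II" using e II ev unfolding even_faces_def by blast
  next
    assume r: "?II"
    show "even_faces"
      unfolding even_faces_def
    proof (intro allI impI)
      fix x assume x: "even (S (0, x)) \<and> \<not> opn (0, x)"
      show "even (card {y. fc (0, x) (0, y)})"
      proof (cases "d (0, x) = 0")
        case True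
        then show ?thesis using r x II[of x] by simp
      next
        case False
        then show ?thesis using face_even_nonzero[OF v(1,3) nt] x by blast
      qed
    qed
  qed
qed

end

section \<open>Paths\<close>

lemma vertex_0: "vertex q 0 = fst q"
  by (simp add: vertex_def)

lemma vertex_Suc: "k < length (snd q) \<Longrightarrow> vertex q (Suc k) = move (vertex q k) (snd q ! k)"
  by (simp add: vertex_def take_Suc_conv_app_nth)

lemma ht_move: "ht (move w s) = ht w + (if s = E_step then 0 else 1)"
  by (cases w; cases s) (auto simp: ht_def)

lemma fst_move: "fst (move w s) = fst w + (if s = NW_step then 0 else 1)"
  by (cases w; cases s) auto

lemma ht_vertex_Suc:
  "k < length (snd q) \<Longrightarrow> ht (vertex q (Suc k)) = ht (vertex q k) + (if snd q ! k = E_step then 0 else 1)"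
  by (simp add: vertex_Suc ht_move)

lemma fst_vertex_Suc:
  "k < length (snd q) \<Longrightarrow> fst (vertex q (Suc k)) = fst (vertex q k) + (if snd q ! k = NW_step then 0 else 1)"
  by (simp add: vertex_Suc fst_move)

lemma path_structure:
  assumes p: "is_path n q" and n: "0 < n"
  shows "length (snd q) = 2 * n + num_E q"
    and "\<And>k. k < n \<Longrightarrow> snd q ! k \<noteq> E_step"
    and "\<And>k. n \<le> k \<Longrightarrow> k < n + num_E q \<Longrightarrow> snd q ! k = E_step"
    and "\<And>k. n + num_E q \<le> k \<Longrightarrow> k < length (snd q) \<Longrightarrow> snd q ! k \<noteq> E_step"
    and "\<And>k. k \<le> n \<Longrightarrow> ht (vertex q k) = int k - int n"
    and "\<And>k. n \<le> k \<Longrightarrow> k \<le> n + num_E q \<Longrightarrow> ht (vertex q k) = 0"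
    and "\<And>k. n + num_E q \<le> k \<Longrightarrow> k \<le> length (snd q) \<Longrightarrow> ht (vertex q k) = int k - int n - int (num_E q)"
proof -
  let ?s = "snd q" and ?L = "length (snd q)"
  define h where "h k = ht (vertex q k)" for k
  have h0: "h 0 = - int n" and hL: "h ?L = int n"
    and E: "\<And>k. k < ?L \<Longrightarrow> ?s ! k = E_step \<Longrightarrow> h k = 0"
    using p by (auto simp: is_path_def h_def vertex_0 endpoint_def)
  have hS: "h (Suc k) = h k + (if ?s ! k = E_step then 0 else 1)" if "k < ?L" for k
    using ht_vertex_Suc[OF that] by (simp add: h_def)
  have low: "k \<le> n \<Longrightarrow> k \<le> ?L \<Longrightarrow> h k = int k - int n \<and> (\<forall>j<k. ?s ! j \<noteq> E_step)" for k
  proof (induction k)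
    case 0 then show ?case using h0 by simp
  next
    case (Suc k)
    then have IH: "h k = int k - int n" "\<forall>j<k. ?s ! j \<noteq> E_step" "k < ?L" by auto
    then have "?s ! k \<noteq> E_step" using E[of k] Suc.prems by auto
    then show ?case using IH hS[of k] by (auto simp: less_Suc_eq)
  qed
  have nL: "n \<le> ?L"
  proof (rule ccontr)
    assume "\<not> n \<le> ?L"
    then show False using low[of ?L] hL by simp
  qed
  \<comment> \<open>The index of the first step that leaves height 0; the alternative
    \<open>k = ?L\<close> only guarantees existence.\<close>
  define m where "m = (LEAST k. n \<le> k \<and> (k = ?L \<or> ?s ! k \<noteq> E_step))"
  have m: "n \<le> m \<and> (m = ?L \<or> ?s ! m \<noteq> E_step)"
    unfolding m_def by (rule LeastI_ex) (use nL in blast)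
  have mL: "m \<le> ?L" unfolding m_def by (rule Least_le) (use nL in simp)
  have mid: "?s ! k = E_step" if "n \<le> k" "k < m" for k
    using not_less_Least[of k "\<lambda>k. n \<le> k \<and> (k = ?L \<or> ?s ! k \<noteq> E_step)"] that unfolding m_def[symmetric] by blast
  have hm: "k \<le> m - n \<Longrightarrow> h (n + k) = 0" for k
  proof (induction k)
    case 0 then show ?case using low[of n] nL by simp
  next
    case (Suc k)
    then show ?case using hS[of "n + k"] mid[of "n + k"] mL by simp
  qed
  have hmm: "h k = 0" if "n \<le> k" "k \<le> m" for k using hm[of "k - n"] that by simp
  have "m \<noteq> ?L" using hmm[of m] hL m n by auto
  then have sm: "?s ! m \<noteq> E_step" "m < ?L" using m mL by auto
  have up: "k \<le> ?L - m \<Longrightarrow> h (m + k) = int k \<and> (\<forall>j<k. ?s ! (m + j) \<noteq> E_step)" for k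
  proof (induction k)
    case 0 then show ?case using hmm[of m] m by simp
  next
    case (Suc k)
    then have IH: "h (m + k) = int k" "\<forall>j<k. ?s ! (m + j) \<noteq> E_step" "m + k < ?L" by auto
    then have "?s ! (m + k) \<noteq> E_step" using E[of "m + k"] sm by (cases "k = 0") auto
    then show ?case using IH hS[of "m + k"] by (auto simp: less_Suc_eq)
  qed
  have Lm: "?L = m + n" using up[of "?L - m"] hL sm by simp
  have "{k. k < ?L \<and> ?s ! k = E_step} = {n..<m}"
  proof -
    have "k < ?L \<and> ?s ! k = E_step \<longleftrightarrow> n \<le> k \<and> k < m" for k
    proof (cases "k < n")
      case True then show ?thesis using low[of n] nL by auto
    next
      case False
      show ?thesis
      proof (cases "k < m")
        case True then show ?thesis using mid[of k] False mL by auto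
      next
        case F: False
        then show ?thesis using up[of "?L - m"] Lm by (auto dest!: spec[of _ "k - m"])
      qed
    qed
    then show ?thesis unfolding set_eq_iff mem_Collect_eq atLeastLessThan_iff by blast
  qed
  then have e: "num_E q = m - n" by (simp add: num_E_def)
  then have em: "n + num_E q = m" using m by simp
  show "?L = 2 * n + num_E q" using Lm em by simp
  show "?s ! k \<noteq> E_step" if "k < n" for k using low[of n] nL that by blast
  show "?s ! k = E_step" if "n \<le> k" "k < n + num_E q" for k using mid that em by simp
  show "?s ! k \<noteq> E_step" if "n + num_E q \<le> k" "k < ?L" for k
    using up[of "?L - m"] that em Lm by (auto dest!: spec[of _ "k - m"])
  show "ht (vertex q k) = int k - int n" if "k \<le> n" for k using low[of k] that nL by (simp add: h_def)
  show "ht (vertex q k) = 0" if "n \<le> k" "k \<le> n + num_E q" for k using hmm that em by (simp add: h_def)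
  show "ht (vertex q k) = int k - int n - int (num_E q)" if "n + num_E q \<le> k" "k \<le> ?L" for k
    using up[of "k - m"] that em Lm by (simp add: h_def)
qed

text \<open>Horizontal coordinates of the dual of the lower part and of the upper part at height \<open>r\<close>.\<close>

definition low :: "nat \<Rightarrow> path \<Rightarrow> nat \<Rightarrow> int" where
  "low n q r = fst (vertex q (n - r)) + int r - 1"

definition upp :: "nat \<Rightarrow> path \<Rightarrow> nat \<Rightarrow> int" where
  "upp n q r = fst (vertex q (n + num_E q + r))"

lemma snd_ht: "snd w = ht w - fst w" for w :: point
  by (simp add: ht_def)

context
  fixes n q assumes p: "is_path n q" and n: "0 < n"
begin

lemma vertex_low: "r \<le> n \<Longrightarrow> vertex q (n - r) = (low n q r - int r + 1, - low n q r - 1)"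
  using snd_ht[of "vertex q (n - r)"] path_structure(5)[OF p n, of "n - r"]
  by (intro prod_eqI) (simp_all add: low_def of_nat_diff)

lemma vertex_upp: "r \<le> n \<Longrightarrow> vertex q (n + num_E q + r) = (upp n q r, int r - upp n q r)"
  using snd_ht[of "vertex q (n + num_E q + r)"] path_structure(7)[OF p n, of "n + num_E q + r"]
    path_structure(1)[OF p n] by (intro prod_eqI) (simp_all add: upp_def)

lemma low_step: "r < n \<Longrightarrow> low n q (Suc r) = low n q r + (if snd q ! (n - Suc r) = NE_step then 0 else 1)"
proof -
  assume r: "r < n"
  have "Suc (n - Suc r) = n - r" using r by simp
  moreover have "n - Suc r < length (snd q)" using path_structure(1)[OF p n] r by simp
  moreover have "snd q ! (n - Suc r) \<noteq> E_step" using path_structure(2)[OF p n] r by simp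
  ultimately show ?thesis
    using fst_vertex_Suc[of "n - Suc r" q] by (cases "snd q ! (n - Suc r)") (auto simp: low_def)
qed

lemma upp_step: "r < n \<Longrightarrow> upp n q (Suc r) = upp n q r + (if snd q ! (n + num_E q + r) = NE_step then 1 else 0)"
proof -
  assume r: "r < n"
  have "n + num_E q + r < length (snd q)" using path_structure(1)[OF p n] r by simp
  moreover have "snd q ! (n + num_E q + r) \<noteq> E_step" using path_structure(1,4)[OF p n] r by simp
  ultimately show ?thesis
    using fst_vertex_Suc[of "n + num_E q + r" q] by (cases "snd q ! (n + num_E q + r)") (auto simp: upp_def)
qed

lemma vertex_mid: "j \<le> num_E q \<Longrightarrow> vertex q (n + j) = (low n q 0 + 1 + int j, - low n q 0 - 1 - int j)"
proof -
  have "j \<le> num_E q \<Longrightarrow> fst (vertex q (n + j)) = low n q 0 + 1 + int j"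
  proof (induction j)
    case 0 then show ?case by (simp add: low_def)
  next
    case (Suc j)
    then have "snd q ! (n + j) = E_step" "n + j < length (snd q)"
      using path_structure(1,3)[OF p n] by auto
    then show ?case using Suc fst_vertex_Suc[of "n + j" q] by simp
  qed
  moreover assume "j \<le> num_E q"
  ultimately show ?thesis
    using snd_ht[of "vertex q (n + j)"] path_structure(6)[OF p n, of "n + j"] by (intro prod_eqI) simp_all
qed

lemma num_E_upp: "int (num_E q) = upp n q 0 - low n q 0 - 1"
  using vertex_mid[of "num_E q"] by (simp add: upp_def)

lemma even_num_E: "even (num_E q)"
  using p by (simp add: is_path_def)

lemma path_start: "fst q = (low n q n - int n + 1, - low n q n - 1)"
  using vertex_low[of n] by (simp add: vertex_0)

lemma path_end: "endpoint q = (upp n q n, int n - upp n q n)"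
  using vertex_upp[of n] path_structure(1)[OF p n] by (simp add: endpoint_def mult_2 add.commute add.left_commute)

text \<open>In the coordinates \<open>low\<close> and \<open>upp\<close> a path has one point at
  each nonzero height, and at height 0 the points
  \<open>low n q 0 + 1, ..., upp n q 0\<close>.\<close>

lemma points_iff:
  "(x, y) \<in> points q \<longleftrightarrow> \<bar>x + y\<bar> \<le> int n \<and>
    (x + y < 0 \<longrightarrow> y = - low n q (nat (- (x + y))) - 1) \<and> (x + y > 0 \<longrightarrow> x = upp n q (nat (x + y))) \<and>
    (x + y = 0 \<longrightarrow> low n q 0 + 1 \<le> x \<and> x \<le> upp n q 0)"
    (is "_ \<longleftrightarrow> ?R")
proof
  assume "(x, y) \<in> points q"
  then obtain k where k: "k \<le> length (snd q)" "vertex q k = (x, y)" by (auto simp: points_def)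
  consider "k < n" | "n \<le> k" "k \<le> n + num_E q" | "n + num_E q < k" by linarith
  then show ?R
  proof cases
    case 1
    then have "vertex q k = (low n q (n - k) - int (n - k) + 1, - low n q (n - k) - 1)"
      using vertex_low[of "n - k"] by simp
    then have xy: "x = low n q (n - k) - int (n - k) + 1" "y = - low n q (n - k) - 1" using k by auto
    then have "x + y = - int (n - k)" by simp
    moreover have "nat (- (x + y)) = n - k" using xy by simp
    ultimately show ?thesis using xy 1 by simp
  next
    case 2
    then have "vertex q k = (low n q 0 + 1 + int (k - n), - low n q 0 - 1 - int (k - n))"
      using vertex_mid[of "k - n"] by simp
    then show ?thesis using k 2 num_E_upp by auto
  next
    case 3
    then have r: "k - (n + num_E q) \<le> n" using k path_structure(1)[OF p n] by simp
    then have "vertex q k = (upp n q (k - (n + num_E q)), int (k - (n + num_E q)) - upp n q (k - (n + num_E q)))"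
      using vertex_upp[OF r] 3 by simp
    then have xy: "x = upp n q (k - (n + num_E q))" "x + y = int (k - (n + num_E q))" using k by auto
    moreover have "nat (x + y) = k - (n + num_E q)" using xy(2) by linarith
    ultimately show ?thesis using 3 r by simp
  qed
next
  assume R: ?R
  have mem: "k \<le> length (snd q) \<Longrightarrow> vertex q k = (x, y) \<Longrightarrow> (x, y) \<in> points q" for k
    unfolding points_def by (metis atMost_iff image_eqI)
  note L = path_structure(1)[OF p n]
  consider "x + y < 0" | "x + y = 0" | "x + y > 0" by linarith
  then show "(x, y) \<in> points q"
  proof cases
    case 1
    define r where "r = nat (- (x + y))"
    have "r \<le> n" "y = - low n q r - 1" "int r = - (x + y)" using R 1 by (auto simp: r_def)
    then show ?thesis using mem[of "n - r"] vertex_low[of r] L by simp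
  next
    case 2
    define j where "j = nat (x - low n q 0 - 1)"
    have "j \<le> num_E q" "int j = x - low n q 0 - 1" using R 2 num_E_upp by (auto simp: j_def)
    then show ?thesis using mem[of "n + j"] vertex_mid[of j] L 2 by auto
  next
    case 3
    define r where "r = nat (x + y)"
    have "r \<le> n" "x = upp n q r" "int r = x + y" using R 3 by (auto simp: r_def)
    then show ?thesis using mem[of "n + num_E q + r"] vertex_upp[of r] L by simp
  qed
qed

lemma pos0_low: "pos0 q = real_of_int (low n q 0 + 1)"
proof -
  let ?a = "low n q 0 + 1" and ?b = "upp n q 0"
  have ab: "?a \<le> ?b" using num_E_upp by linarith
  have "{w \<in> points q. ht w = 0} = (\<lambda>x. (x, - x)) ` {?a..?b}"
  proof -
    have "w \<in> points q \<and> ht w = 0 \<longleftrightarrow> w \<in> (\<lambda>x. (x, - x)) ` {?a..?b}" for w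
    proof (cases w)
      case (Pair x y)
      then show ?thesis using points_iff[of x y] by (auto simp: ht_def image_iff)
    qed
    then show ?thesis by blast
  qed
  then have "hp ` {w \<in> points q. ht w = 0} = real_of_int ` {?a..?b}"
    by (simp add: image_image hp_def)
  moreover have "Min (real_of_int ` {?a..?b}) = real_of_int ?a"
    by (rule Min_eqI) (use ab in \<open>auto simp del: of_int_add\<close>)
  ultimately show ?thesis by (simp add: pos0_def)
qed

end

text \<open>The lower half is listed from height \<open>-n\<close> upwards, hence the argument
  \<open>n - k\<close>. Going away from height 0, the coordinate \<open>low\<close> stays along an
  NE-step and grows along an NW-step; for \<open>upp\<close> it is the other way round.\<close>

definition mkpath :: "nat \<Rightarrow> (nat \<Rightarrow> int) \<Rightarrow> (nat \<Rightarrow> int) \<Rightarrow> path" where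
  "mkpath n a b = ((a n - int n + 1, - a n - 1),
    map (\<lambda>k. if a (n - k) = a (n - Suc k) then NE_step else NW_step) [0..<n] @
    replicate (nat (b 0 - a 0 - 1)) E_step @ map (\<lambda>k. if b (Suc k) = b k then NW_step else NE_step) [0..<n])"

lemma path_eq_mkpath:
  assumes p: "is_path n q" and n: "0 < n"
  shows "q = mkpath n (low n q) (upp n q)"
proof (rule prod_eqI)
  show "fst q = fst (mkpath n (low n q) (upp n q))" using path_start[OF p n] by (simp add: mkpath_def)
  note s = path_structure[OF p n]
  have e: "nat (upp n q 0 - low n q 0 - 1) = num_E q" using num_E_upp[OF p n] by simp
  show "snd q = snd (mkpath n (low n q) (upp n q))"
  proof (rule nth_equalityI)
    show "length (snd q) = length (snd (mkpath n (low n q) (upp n q)))" using s(1) e by (simp add: mkpath_def)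
    fix k assume k: "k < length (snd q)"
    consider "k < n" | "n \<le> k" "k < n + num_E q" | "n + num_E q \<le> k" by linarith
    then show "snd q ! k = snd (mkpath n (low n q) (upp n q)) ! k"
    proof cases
      case 1
      then have "Suc (n - Suc k) = n - k" "n - Suc (n - Suc k) = k" by auto
      then show ?thesis using low_step[OF p n, of "n - Suc k"] 1 s(2)[OF 1]
        by (cases "snd q ! k") (auto simp: mkpath_def nth_append)
    next
      case 2
      then have "k - n < num_E q" by simp
      then show ?thesis using s(3)[OF 2] e 2 by (simp add: mkpath_def nth_append)
    next
      case 3
      then have "k - n - num_E q < n" "n + num_E q + (k - n - num_E q) = k" using k s(1) by auto
      then show ?thesis using upp_step[OF p n, of "k - n - num_E q"] 3 s(4)[OF 3 k] e
        by (cases "snd q ! k") (auto simp: mkpath_def nth_append)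
    qed
  qed
qed

lemma mkpath_path:
  assumes n: "0 < n" and a: "\<And>r. r < n \<Longrightarrow> a (Suc r) - a r \<in> {0, 1}" and b: "\<And>r. r < n \<Longrightarrow> b (Suc r) - b r \<in> {0, 1}"
    and ab: "a 0 + 1 \<le> b 0" "odd (b 0 - a 0)"
  shows "is_path n (mkpath n a b)" "\<And>r. r \<le> n \<Longrightarrow> low n (mkpath n a b) r = a r" "\<And>r. r \<le> n \<Longrightarrow> upp n (mkpath n a b) r = b r"
proof -
  let ?q = "mkpath n a b"
  define e where "e = nat (b 0 - a 0 - 1)"
  have e: "int e = b 0 - a 0 - 1" using ab by (simp add: e_def)
  have L: "length (snd ?q) = 2 * n + e" by (simp add: mkpath_def e_def)
  have s1: "snd ?q ! k = (if a (n - k) = a (n - Suc k) then NE_step else NW_step)" if "k < n" for k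
    using that by (simp add: mkpath_def nth_append)
  have s2: "snd ?q ! (n + k) = E_step" if "k < e" for k
    using that by (simp add: mkpath_def nth_append e_def)
  have s3: "snd ?q ! (n + e + k) = (if b (Suc k) = b k then NW_step else NE_step)" if "k < n" for k
    using that by (simp add: mkpath_def nth_append e_def)
  have v1: "k \<le> n \<Longrightarrow> vertex ?q k = (a (n - k) - int (n - k) + 1, - a (n - k) - 1)" for k
  proof (induction k)
    case 0 then show ?case by (simp add: vertex_0 mkpath_def)
  next
    case (Suc k)
    then have "Suc (n - Suc k) = n - k" by simp
    moreover have "vertex ?q (Suc k) = move (vertex ?q k) (snd ?q ! k)" using Suc L by (intro vertex_Suc) simp
    ultimately show ?case using Suc a[of "n - Suc k"] s1[of k] by auto
  qed
  have v2: "k \<le> e \<Longrightarrow> vertex ?q (n + k) = (a 0 + 1 + int k, - a 0 - 1 - int k)" for k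
  proof (induction k)
    case 0 then show ?case using v1[of n] by simp
  next
    case (Suc k)
    moreover have "vertex ?q (Suc (n + k)) = move (vertex ?q (n + k)) (snd ?q ! (n + k))"
      using Suc L by (intro vertex_Suc) simp
    ultimately show ?case using s2[of k] by auto
  qed
  have v3: "k \<le> n \<Longrightarrow> vertex ?q (n + e + k) = (b k, int k - b k)" for k
  proof (induction k)
    case 0 then show ?case using v2[of e] e by simp
  next
    case (Suc k)
    moreover have "vertex ?q (Suc (n + e + k)) = move (vertex ?q (n + e + k)) (snd ?q ! (n + e + k))"
      using Suc L by (intro vertex_Suc) simp
    ultimately show ?case using s3[of k] b[of k] by auto
  qed
  have s1E: "snd ?q ! k \<noteq> E_step" if "k < n" for k using s1[OF that] by simp
  have s3E: "snd ?q ! k \<noteq> E_step" if "n + e \<le> k" "k < 2 * n + e" for k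
    using s3[of "k - (n + e)"] that by (simp split: if_splits)
  have "{k. k < length (snd ?q) \<and> snd ?q ! k = E_step} = {n..<n + e}"
  proof -
    have "k < length (snd ?q) \<and> snd ?q ! k = E_step \<longleftrightarrow> n \<le> k \<and> k < n + e" for k
      using s1E[of k] s2[of "k - n"] s3E[of k] L by (cases "k < n"; cases "k < n + e") auto
    then show ?thesis unfolding set_eq_iff mem_Collect_eq atLeastLessThan_iff by blast
  qed
  then have nE: "num_E ?q = e" by (simp add: num_E_def)
  show "is_path n ?q"
    unfolding is_path_def
  proof (intro conjI allI impI)
    show "ht (fst ?q) = - int n" by (simp add: mkpath_def ht_def)
    show "ht (endpoint ?q) = int n" using v3[of n] L by (simp add: endpoint_def ht_def mult_2 add.commute add.left_commute)
    fix k assume k: "k < length (snd ?q)" "snd ?q ! k = E_step"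
    then have "n \<le> k" "k < n + e" using s1E[of k] s3E[of k] L by (cases "k < n", auto, cases "k < n + e", auto)
    then show "ht (vertex ?q k) = 0" using v2[of "k - n"] by (simp add: ht_def)
  next
    have "even (int e)" using e ab by simp
    then show "even (num_E ?q)" using nE by simp
  qed
  show "low n ?q r = a r" if "r \<le> n" for r using v1[of "n - r"] that by (simp add: low_def)
  show "upp n ?q r = b r" if "r \<le> n" for r using v3[OF that] nE by (simp add: upp_def)
qed

text \<open>Points of different heights are compared separately. The leftmost point at height 0 has
  position \<open>low n q 0 + 1\<close>, so the parity in the definition of a special intersection
  is that of the difference of the \<open>low\<close> coordinates.\<close>

lemma ordinarily_iff:
  assumes n: "0 < n" and q: "is_path n q" and q': "is_path n q'"
  shows "ordinarily_intersecting q q' \<longleftrightarrow> (\<exists>r\<in>{1..n}. low n q r = low n q' r) \<or> (\<exists>r\<in>{1..n}. upp n q r = upp n q' r) \<or>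
    (even (low n q 0 - low n q' 0) \<and> max (low n q 0) (low n q' 0) < min (upp n q 0) (upp n q' 0))"
    (is "_ \<longleftrightarrow> ?L \<or> ?U \<or> ?M")
proof -
  note pq = points_iff[OF q n] and pq' = points_iff[OF q' n]
  have L: "?L \<longleftrightarrow> (\<exists>w\<in>points q \<inter> points q'. ht w < 0)"
  proof
    assume ?L
    then obtain r where r: "r \<in> {1..n}" "low n q r = low n q' r" by blast
    then have "(low n q r - int r + 1, - low n q r - 1) \<in> points q \<inter> points q'"
      unfolding Int_iff pq pq' by auto
    then show "\<exists>w\<in>points q \<inter> points q'. ht w < 0" using r by (intro bexI) (auto simp: ht_def)
  next
    assume "\<exists>w\<in>points q \<inter> points q'. ht w < 0"
    then obtain x y where "(x, y) \<in> points q" "(x, y) \<in> points q'" "x + y < 0" by (auto simp: ht_def)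
    then have "nat (- (x + y)) \<in> {1..n}" "low n q (nat (- (x + y))) = low n q' (nat (- (x + y)))"
      unfolding pq pq' by auto
    then show ?L by blast
  qed
  have U: "?U \<longleftrightarrow> (\<exists>w\<in>points q \<inter> points q'. ht w > 0)"
  proof
    assume ?U
    then obtain r where r: "r \<in> {1..n}" "upp n q r = upp n q' r" by blast
    then have "(upp n q r, int r - upp n q r) \<in> points q \<inter> points q'"
      unfolding Int_iff pq pq' by auto
    then show "\<exists>w\<in>points q \<inter> points q'. ht w > 0" using r by (intro bexI) (auto simp: ht_def)
  next
    assume "\<exists>w\<in>points q \<inter> points q'. ht w > 0"
    then obtain x y where "(x, y) \<in> points q" "(x, y) \<in> points q'" "x + y > 0" by (auto simp: ht_def)
    then have "nat (x + y) \<in> {1..n}" "upp n q (nat (x + y)) = upp n q' (nat (x + y))"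
      unfolding pq pq' by auto
    then show ?U by blast
  qed
  have M: "max (low n q 0) (low n q' 0) < min (upp n q 0) (upp n q' 0) \<longleftrightarrow> (\<exists>w\<in>points q \<inter> points q'. ht w = 0)"
  proof
    assume *: "max (low n q 0) (low n q' 0) < min (upp n q 0) (upp n q' 0)"
    define x where "x = max (low n q 0) (low n q' 0) + 1"
    have "(x, - x) \<in> points q \<inter> points q'" unfolding Int_iff pq pq' using * by (auto simp: x_def)
    then show "\<exists>w\<in>points q \<inter> points q'. ht w = 0" by (intro bexI) (auto simp: ht_def)
  next
    assume "\<exists>w\<in>points q \<inter> points q'. ht w = 0"
    then obtain x y where "(x, y) \<in> points q" "(x, y) \<in> points q'" "x + y = 0" by (auto simp: ht_def)
    then show "max (low n q 0) (low n q' 0) < min (upp n q 0) (upp n q' 0)" unfolding pq pq' by auto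
  qed
  have odd: "(\<exists>k::int. odd k \<and> pos0 q - pos0 q' = of_int k) \<longleftrightarrow> odd (low n q 0 - low n q' 0)"
  proof -
    have "pos0 q - pos0 q' = of_int k \<longleftrightarrow> k = low n q 0 - low n q' 0" for k :: int
      unfolding pos0_low[OF q n] pos0_low[OF q' n] by linarith
    then show ?thesis by simp
  qed
  have tri: "(\<exists>w\<in>W. ht w < 0) \<or> (\<exists>w\<in>W. ht w > 0) \<or> (E \<and> (\<exists>w\<in>W. ht w = 0)) \<longleftrightarrow> W \<noteq> {} \<and> \<not> ((\<forall>w\<in>W. ht w = 0) \<and> \<not> E)"
    for W :: "point set" and E :: bool by (smt (verit) equals0I ex_in_conv)
  show ?thesis
    unfolding ordinarily_intersecting_def specially_intersecting_def intersecting_def odd L U M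
    using tri[of "points q \<inter> points q'" "even (low n q 0 - low n q' 0)"] by blast
qed

section \<open>Counting functions\<close>

definition fams :: "nat \<Rightarrow> nat \<Rightarrow> (nat \<Rightarrow> nat \<Rightarrow> int) \<Rightarrow> bool" where
  "fams n l A \<longleftrightarrow> (\<forall>i\<in>{1..l}. \<forall>r<n. A i (Suc r) - A i r \<in> {0, 1}) \<and>
    (\<forall>r\<le>n. \<forall>i j. 1 \<le> i \<longrightarrow> i < j \<longrightarrow> j \<le> l \<longrightarrow> A j r < A i r)"

definition cnt :: "nat \<Rightarrow> nat \<Rightarrow> (nat \<Rightarrow> nat \<Rightarrow> int) \<Rightarrow> node \<Rightarrow> int" where
  "cnt n l A p = (if fst p \<le> n then int (card {i \<in> {1..l}. A i (fst p) \<le> snd p}) else 0)"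

lemma fams_step: "fams n l A \<Longrightarrow> i \<in> {1..l} \<Longrightarrow> r < n \<Longrightarrow> A i (Suc r) = A i r \<or> A i (Suc r) = A i r + 1"
proof -
  assume "fams n l A" "i \<in> {1..l}" "r < n"
  then have "A i (Suc r) - A i r \<in> {0, 1}" unfolding fams_def by blast
  then show ?thesis by auto
qed

lemma fams_less: "fams n l A \<Longrightarrow> r \<le> n \<Longrightarrow> 1 \<le> i \<Longrightarrow> i < j \<Longrightarrow> j \<le> l \<Longrightarrow> A j r < A i r"
  unfolding fams_def by blast

lemma fams_inj: "fams n l A \<Longrightarrow> r \<le> n \<Longrightarrow> i \<in> {1..l} \<Longrightarrow> j \<in> {1..l} \<Longrightarrow> A i r = A j r \<Longrightarrow> i = j"
  using fams_less[of n l A r i j] fams_less[of n l A r j i] by (cases i j rule: linorder_cases) auto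

lemma cnt_bounds: "0 \<le> cnt n l A p" "cnt n l A p \<le> int l"
proof -
  have "card {i \<in> {1..l}. A i (fst p) \<le> snd p} \<le> card {1..l}" by (rule card_mono) auto
  then show "0 \<le> cnt n l A p" "cnt n l A p \<le> int l" by (auto simp: cnt_def)
qed

text \<open>Positions decrease with the index, so the counted indices form a final segment of
  \<open>1, ..., l\<close>. The count thus determines all positions.\<close>

lemma cnt_ge:
  assumes A: "fams n l A" and r: "r \<le> n" and i: "i \<in> {1..l}"
  shows "A i r \<le> x \<longleftrightarrow> int l + 1 - int i \<le> cnt n l A (r, x)"
proof
  assume *: "A i r \<le> x"
  have "{i..l} \<subseteq> {j \<in> {1..l}. A j r \<le> x}"
  proof
    fix j assume j: "j \<in> {i..l}"
    then have "A j r \<le> A i r" using fams_less[OF A r, of i j] i by (cases "i = j") auto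
    then show "j \<in> {j \<in> {1..l}. A j r \<le> x}" using * j i by auto
  qed
  then have "card {i..l} \<le> card {j \<in> {1..l}. A j r \<le> x}" by (intro card_mono) auto
  then show "int l + 1 - int i \<le> cnt n l A (r, x)" using r i by (simp add: cnt_def)
next
  assume *: "int l + 1 - int i \<le> cnt n l A (r, x)"
  show "A i r \<le> x"
  proof (rule ccontr)
    assume no: "\<not> A i r \<le> x"
    have "{j \<in> {1..l}. A j r \<le> x} \<subseteq> {Suc i..l}"
    proof
      fix j assume j: "j \<in> {j \<in> {1..l}. A j r \<le> x}"
      have "\<not> j \<le> i"
      proof
        assume "j \<le> i"
        then have "A i r \<le> A j r" using fams_less[OF A r, of j i] i j by (cases "i = j") auto
        then show False using j no by simp
      qed
      then show "j \<in> {Suc i..l}" using j by auto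
    qed
    then have "card {j \<in> {1..l}. A j r \<le> x} \<le> card {Suc i..l}" by (intro card_mono) auto
    then show False using * r i by (auto simp: cnt_def)
  qed
qed

lemma card_diff01:
  assumes "finite Y" "X \<subseteq> Y" "\<And>i j. i \<in> Y - X \<Longrightarrow> j \<in> Y - X \<Longrightarrow> i = j"
  shows "int (card Y) - int (card X) \<in> {0, 1}"
proof -
  have "finite (Y - X)" using assms by blast
  then have "card (Y - X) \<le> 1" using assms card_le_Suc0_iff_eq[of "Y - X"] by auto
  moreover have "card Y = card X + card (Y - X)"
    using assms card_mono[OF assms(1,2)] finite_subset[OF assms(2,1)] by (simp add: card_Diff_subset)
  ultimately show ?thesis by auto
qed

text \<open>The two sets of counted paths are nested, and any path counted only once sits at one
  particular node of one row. Members of a family are disjoint, so there is at most one such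
  path.\<close>

lemma cnt_step:
  assumes A: "fams n l A" and st: "step n p q"
  shows "cnt n l A q - cnt n l A p \<in> {0, 1}"
  using st
proof (cases rule: step_cases)
  case (E r x)
  have "int (card {i \<in> {1..l}. A i r \<le> x + 1}) - int (card {i \<in> {1..l}. A i r \<le> x}) \<in> {0, 1}"
  proof (rule card_diff01)
    fix i j assume "i \<in> {i \<in> {1..l}. A i r \<le> x + 1} - {i \<in> {1..l}. A i r \<le> x}"
      "j \<in> {i \<in> {1..l}. A i r \<le> x + 1} - {i \<in> {1..l}. A i r \<le> x}"
    then show "i = j" using fams_inj[OF A E(1), of i j] by auto
  qed auto
  then show ?thesis using E by (simp add: cnt_def)
next
  case (NE r x)
  have "int (card {i \<in> {1..l}. A i (Suc r) \<le> x + 1}) - int (card {i \<in> {1..l}. A i r \<le> x}) \<in> {0, 1}"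
  proof (rule card_diff01)
    show "{i \<in> {1..l}. A i r \<le> x} \<subseteq> {i \<in> {1..l}. A i (Suc r) \<le> x + 1}" using fams_step[OF A _ NE(1)] by force
    fix i j assume *: "i \<in> {i \<in> {1..l}. A i (Suc r) \<le> x + 1} - {i \<in> {1..l}. A i r \<le> x}"
      "j \<in> {i \<in> {1..l}. A i (Suc r) \<le> x + 1} - {i \<in> {1..l}. A i r \<le> x}"
    then have "A i r = x + 1" "A j r = x + 1"
      using fams_step[OF A _ NE(1), of i] fams_step[OF A _ NE(1), of j] by auto
    then show "i = j" using fams_inj[OF A, of r i j] NE * by auto
  qed auto
  then show ?thesis using NE by (simp add: cnt_def)
next
  case (SE r x)
  have "int (card {i \<in> {1..l}. A i r \<le> x}) - int (card {i \<in> {1..l}. A i (Suc r) \<le> x}) \<in> {0, 1}"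
  proof (rule card_diff01)
    show "{i \<in> {1..l}. A i (Suc r) \<le> x} \<subseteq> {i \<in> {1..l}. A i r \<le> x}" using fams_step[OF A _ SE(1)] by force
    fix i j assume *: "i \<in> {i \<in> {1..l}. A i r \<le> x} - {i \<in> {1..l}. A i (Suc r) \<le> x}"
      "j \<in> {i \<in> {1..l}. A i r \<le> x} - {i \<in> {1..l}. A i (Suc r) \<le> x}"
    then have "A i r = x" "A j r = x"
      using fams_step[OF A _ SE(1), of i] fams_step[OF A _ SE(1), of j] by auto
    then show "i = j" using fams_inj[OF A, of r i j] SE * by auto
  qed auto
  then show ?thesis using SE by (simp add: cnt_def)
qed

lemma fams_bounded:
  fixes A :: "nat \<Rightarrow> nat \<Rightarrow> int"
  obtains m M where "\<And>i r. i \<in> {1..l} \<Longrightarrow> r \<le> n \<Longrightarrow> m \<le> A i r \<and> A i r \<le> M"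
proof -
  define V where "V = insert 0 ((\<lambda>(i, r). A i r) ` ({1..l} \<times> {..n}))"
  have V: "finite V" by (simp add: V_def)
  have "A i r \<in> V" if "i \<in> {1..l}" "r \<le> n" for i r using that by (force simp: V_def)
  then show ?thesis using that[of "Min V" "Max V"] V by simp
qed

lemma cnt_left: "\<exists>m. \<forall>p. fst p \<le> n \<and> snd p < m \<longrightarrow> cnt n l A p = 0"
proof -
  obtain m M where m: "\<And>i r. i \<in> {1..l} \<Longrightarrow> r \<le> n \<Longrightarrow> m \<le> A i r \<and> A i r \<le> M" by (rule fams_bounded[of l n A]) blast
  have "cnt n l A p = 0" if "fst p \<le> n" "snd p < m" for p
  proof -
    have "{i \<in> {1..l}. A i (fst p) \<le> snd p} = {}" using m[of _ "fst p"] that by force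
    then show ?thesis unfolding cnt_def by (metis card.empty of_nat_0)
  qed
  then show ?thesis by blast
qed

lemma cnt_right: "\<exists>m. \<forall>p. fst p \<le> n \<and> m \<le> snd p \<longrightarrow> cnt n l A p = int l"
proof -
  obtain m M where m: "\<And>i r. i \<in> {1..l} \<Longrightarrow> r \<le> n \<Longrightarrow> m \<le> A i r \<and> A i r \<le> M" by (rule fams_bounded[of l n A]) blast
  have "cnt n l A p = int l" if "fst p \<le> n" "M \<le> snd p" for p
  proof -
    have "{i \<in> {1..l}. A i (fst p) \<le> snd p} = {1..l}" using m[of _ "fst p"] that by force
    then have "card {i \<in> {1..l}. A i (fst p) \<le> snd p} = l" by (metis card_atLeastAtMost diff_Suc_1)
    then show ?thesis using that by (simp add: cnt_def)
  qed
  then show ?thesis by blast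
qed

text \<open>The path \<open>A i\<close> passes, in each row, through the first column where the
  count reaches \<open>l + 1 - i\<close>. The window from \<open>m\<close> to \<open>max m M\<close>
  only makes \<open>Min\<close> meaningful.\<close>

lemma cnt_realize:
  fixes N :: "node \<Rightarrow> int"
  assumes st: "\<And>p q. step n p q \<Longrightarrow> N q - N p \<in> {0, 1}"
    and left: "\<exists>m. \<forall>p. fst p \<le> n \<and> snd p < m \<longrightarrow> N p = 0"
    and right: "\<exists>m. \<forall>p. fst p \<le> n \<and> m \<le> snd p \<longrightarrow> N p = int l"
    and out: "\<And>p. n < fst p \<Longrightarrow> N p = 0"
  obtains A where "fams n l A" "cnt n l A = N"
proof -
  obtain m where m: "\<And>p. fst p \<le> n \<Longrightarrow> snd p < m \<Longrightarrow> N p = 0" using left by blast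
  obtain M where M: "\<And>p. fst p \<le> n \<Longrightarrow> M \<le> snd p \<Longrightarrow> N p = int l" using right by blast
  have E: "N (r, x + 1) - N (r, x) \<in> {0, 1}" if "r \<le> n" for r x using st that by (simp add: step_def)
  have mono: "N (r, x) \<le> N (r, y)" if "r \<le> n" "x \<le> y" for r x y
    using that(2)
  proof (induction y rule: int_ge_induct)
    case (step y) then show ?case using E[OF that(1), of y] by auto
  qed simp
  define A where "A i r = Min {x \<in> {m..max m M}. int l + 1 - int i \<le> N (r, x)}" for i r
  have Aiff: "A i r \<le> x \<longleftrightarrow> int l + 1 - int i \<le> N (r, x)" if r: "r \<le> n" and i: "i \<in> {1..l}" for i r x
  proof -
    let ?X = "{x \<in> {m..max m M}. int l + 1 - int i \<le> N (r, x)}"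
    have fin: "finite ?X" by (rule finite_subset[of _ "{m..max m M}"]) auto
    have ne: "max m M \<in> ?X" using M[of "(r, max m M)"] r i by auto
    have "A i r \<in> ?X" unfolding A_def using fin ne by (intro Min_in) auto
    then have a: "int l + 1 - int i \<le> N (r, A i r)" "m \<le> A i r" by auto
    show ?thesis
    proof
      assume "A i r \<le> x" then show "int l + 1 - int i \<le> N (r, x)" using mono[OF r, of "A i r" x] a by simp
    next
      assume *: "int l + 1 - int i \<le> N (r, x)"
      have "m \<le> x" using m[of "(r, x)"] r i * by force
      show "A i r \<le> x"
      proof (cases "x \<le> max m M")
        case True
        then have "x \<in> ?X" using * \<open>m \<le> x\<close> by simp
        then show ?thesis unfolding A_def using fin by (intro Min_le) auto
      next
        case False
        have "A i r \<le> max m M" unfolding A_def using fin ne by (intro Min_le) auto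
        then show ?thesis using False by simp
      qed
    qed
  qed
  have Nb: "0 \<le> N (r, x) \<and> N (r, x) \<le> int l" if "r \<le> n" for r x
    using mono[OF that, of "min x (m - 1)" x] mono[OF that, of x "max x M"] m[of "(r, min x (m - 1))"] M[of "(r, max x M)"] that
    by simp
  have "fams n l A"
    unfolding fams_def
  proof (intro conjI ballI allI impI)
    fix i r assume i: "i \<in> {1..l}" and r: "r < n"
    have "N (r, x) - N (Suc r, x) \<in> {0, 1}" "N (Suc r, x + 1) - N (r, x) \<in> {0, 1}" for x
      using st r by (simp_all add: step_def)
    then have N: "N (Suc r, x) \<le> N (r, x)" "N (r, x) \<le> N (Suc r, x + 1)" for x
      by (auto dest: meta_spec[of _ x])
    have "A i r \<le> A i (Suc r)" using Aiff[of r i "A i (Suc r)"] Aiff[of "Suc r" i "A i (Suc r)"] N(1)[of "A i (Suc r)"] r i by simp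
    moreover have "A i (Suc r) \<le> A i r + 1"
      using Aiff[of "Suc r" i "A i r + 1"] Aiff[of r i "A i r"] N(2)[of "A i r"] r i by simp
    ultimately show "A i (Suc r) - A i r \<in> {0, 1}" by auto
  next
    fix r i j assume r: "r \<le> n" and ij: "1 \<le> i" "i < j" "j \<le> l"
    have "\<not> A i r \<le> A i r - 1" by simp
    then have "N (r, A i r - 1) < int l + 1 - int i" using Aiff[OF r, of i "A i r - 1"] ij by simp
    moreover have "int l + 1 - int i \<le> N (r, A i r)" using Aiff[OF r, of i "A i r"] ij by simp
    moreover have "N (r, A i r) - N (r, A i r - 1) \<in> {0, 1}" using E[OF r, of "A i r - 1"] by simp
    ultimately have "int l + 1 - int j \<le> N (r, A i r - 1)" using ij by auto
    then show "A j r < A i r" using Aiff[OF r, of j "A i r - 1"] ij by simp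
  qed
  moreover have "cnt n l A = N"
  proof
    fix p :: node
    obtain r x where p: "p = (r, x)" by (cases p)
    show "cnt n l A p = N p"
    proof (cases "r \<le> n")
      case True
      define k where "k = nat (N (r, x))"
      have k: "int k = N (r, x)" "k \<le> l" using Nb[OF True, of x] by (auto simp: k_def)
      have "{i \<in> {1..l}. A i r \<le> x} = {Suc l - k..l}"
        using Aiff[OF True] k by auto
      then show ?thesis using True k p by (simp add: cnt_def)
    qed (use out p in \<open>simp add: cnt_def\<close>)
  qed
  ultimately show ?thesis using that by blast
qed

section \<open>Sum and difference of two counting functions\<close>

definition dens :: "nat \<Rightarrow> nat \<Rightarrow> (nat \<Rightarrow> nat \<Rightarrow> int) \<Rightarrow> (nat \<Rightarrow> nat \<Rightarrow> int) \<Rightarrow> node \<Rightarrow> int" where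
  "dens n l A B p = cnt n l A p + cnt n l B p"

definition hgt :: "nat \<Rightarrow> nat \<Rightarrow> (nat \<Rightarrow> nat \<Rightarrow> int) \<Rightarrow> (nat \<Rightarrow> nat \<Rightarrow> int) \<Rightarrow> node \<Rightarrow> int" where
  "hgt n l A B p = cnt n l A p - cnt n l B p"

lemma strip_dens:
  assumes n: "0 < n" and A: "fams n l A" and B: "fams n l B"
  shows "strip n l (dens n l A B)"
proof
  fix p q assume st: "step n p q"
  show "dens n l A B q - dens n l A B p \<in> {0, 1, 2}"
    using cnt_step[OF A st] cnt_step[OF B st] by (auto simp: dens_def)
next
  obtain a b where "\<forall>p. fst p \<le> n \<and> snd p < a \<longrightarrow> cnt n l A p = 0" "\<forall>p. fst p \<le> n \<and> snd p < b \<longrightarrow> cnt n l B p = 0"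
    using cnt_left by metis
  then show "\<exists>m. \<forall>p. fst p \<le> n \<and> snd p < m \<longrightarrow> dens n l A B p = 0"
    by (intro exI[of _ "min a b"]) (simp add: dens_def)
  obtain a b where "\<forall>p. fst p \<le> n \<and> a \<le> snd p \<longrightarrow> cnt n l A p = int l" "\<forall>p. fst p \<le> n \<and> b \<le> snd p \<longrightarrow> cnt n l B p = int l"
    using cnt_right by metis
  then show "\<exists>m. \<forall>p. fst p \<le> n \<and> m \<le> snd p \<longrightarrow> dens n l A B p = 2 * int l"
    by (intro exI[of _ "max a b"]) (simp add: dens_def)
qed (rule n)

lemma valid_hgt:
  assumes n: "0 < n" and A: "fams n l A" and B: "fams n l B"
  shows "strip.valid n (dens n l A B) (hgt n l A B)"
proof -
  interpret strip n l "dens n l A B" by (rule strip_dens[OF assms])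
  show ?thesis
    unfolding valid_def
  proof (intro conjI allI impI)
    fix p q assume st: "step n p q"
    have "cnt n l A q = cnt n l A p \<or> cnt n l A q = cnt n l A p + 1" using cnt_step[OF A st] by auto
    moreover have "cnt n l B q = cnt n l B p \<or> cnt n l B q = cnt n l B p + 1" using cnt_step[OF B st] by auto
    ultimately show "if even (dens n l A B p) = even (dens n l A B q) then hgt n l A B q = hgt n l A B p
      else \<bar>hgt n l A B q - hgt n l A B p\<bar> = 1"
      by (elim disjE) (simp_all add: dens_def hgt_def)
  next
    obtain a b where "\<forall>p. fst p \<le> n \<and> snd p < a \<longrightarrow> cnt n l A p = 0" "\<forall>p. fst p \<le> n \<and> snd p < b \<longrightarrow> cnt n l B p = 0"
      using cnt_left by metis
    then show "\<exists>m. \<forall>p. fst p \<le> n \<and> snd p < m \<longrightarrow> hgt n l A B p = 0"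
      by (intro exI[of _ "min a b"]) (simp add: hgt_def)
    obtain a b where "\<forall>p. fst p \<le> n \<and> a \<le> snd p \<longrightarrow> cnt n l A p = int l" "\<forall>p. fst p \<le> n \<and> b \<le> snd p \<longrightarrow> cnt n l B p = int l"
      using cnt_right by metis
    then show "\<exists>m. \<forall>p. fst p \<le> n \<and> m \<le> snd p \<longrightarrow> hgt n l A B p = 0"
      by (intro exI[of _ "max a b"]) (simp add: hgt_def)
  qed (simp add: hgt_def cnt_def)
qed

text \<open>The candidates for the two counts are \<open>(S + d) div 2\<close> and
  \<open>(S - d) div 2\<close>. They are exact by \<open>valid_parity\<close>, and
  \<open>valid\<close> is what makes each grow by 0 or 1 along a step.\<close>

lemma conf_realize:
  assumes S: "strip n l S" and out: "\<And>p. n < fst p \<Longrightarrow> S p = 0" and d: "strip.valid n S d"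
  obtains A B where "fams n l A" "fams n l B" "dens n l A B = S" "hgt n l A B = d"
proof -
  interpret strip n l S by (rule S)
  have par: "even (S p + d p)" "even (S p - d p)" for p
  proof -
    have "even (d p) = even (S p)"
    proof (cases "fst p \<le> n")
      case False
      then have "d p = 0" using d unfolding valid_def by (meson linorder_not_le)
      then show ?thesis using out[of p] False by simp
    qed (rule valid_parity[OF d])
    then show "even (S p + d p)" "even (S p - d p)" by simp_all
  qed
  have real: "\<exists>A. fams n l A \<and> cnt n l A = (\<lambda>p. (S p + s * d p) div 2)" if s: "s = 1 \<or> s = - 1" for s :: int
  proof -
    have ev: "even (S p + s * d p)" for p using par[of p] s by auto
    have v0: "\<exists>m. \<forall>p. fst p \<le> n \<and> snd p < m \<longrightarrow> d p = 0" "\<exists>m. \<forall>p. fst p \<le> n \<and> m \<le> snd p \<longrightarrow> d p = 0"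
      using d unfolding valid_def by blast+
    show ?thesis
    proof (rule cnt_realize[of n "\<lambda>p. (S p + s * d p) div 2" l])
      fix p q assume st: "step n p q"
      have "S q - S p = 0 \<or> S q - S p = 1 \<or> S q - S p = 2" using S_step[OF st] by auto
      moreover have "d q = d p" if "even (S q - S p)" using valid_even[OF d st] that by simp
      moreover have "d q = d p + 1 \<or> d q = d p - 1" if "odd (S q - S p)"
        using valid_odd[OF d st] that by (auto simp: abs_if split: if_splits)
      ultimately have "S q + s * d q = S p + s * d p \<or> S q + s * d q = S p + s * d p + 2"
        using s by fastforce
      then show "(S q + s * d q) div 2 - (S p + s * d p) div 2 \<in> {0, 1}" by auto
    next
      obtain a b where "\<forall>p. fst p \<le> n \<and> snd p < a \<longrightarrow> S p = 0" "\<forall>p. fst p \<le> n \<and> snd p < b \<longrightarrow> d p = 0"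
        using S_left v0 by metis
      then show "\<exists>m. \<forall>p. fst p \<le> n \<and> snd p < m \<longrightarrow> (S p + s * d p) div 2 = 0"
        by (intro exI[of _ "min a b"]) simp
      obtain a b where "\<forall>p. fst p \<le> n \<and> a \<le> snd p \<longrightarrow> S p = 2 * int l" "\<forall>p. fst p \<le> n \<and> b \<le> snd p \<longrightarrow> d p = 0"
        using S_right v0 by metis
      then show "\<exists>m. \<forall>p. fst p \<le> n \<and> m \<le> snd p \<longrightarrow> (S p + s * d p) div 2 = int l"
        by (intro exI[of _ "max a b"]) simp
    next
      fix p :: node assume p: "n < fst p"
      then have "d p = 0" using d unfolding valid_def by blast
      then show "(S p + s * d p) div 2 = 0" using out[OF p] by simp
    qed blast
  qed
  obtain A where A: "fams n l A" "cnt n l A = (\<lambda>p. (S p + 1 * d p) div 2)" using real[of 1] by blast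
  obtain B where B: "fams n l B" "cnt n l B = (\<lambda>p. (S p + (- 1) * d p) div 2)" using real[of "- 1"] by blast
  have "dens n l A B p = S p" "hgt n l A B p = d p" for p
    using par[of p] unfolding dens_def hgt_def A(2) B(2) by (simp_all, presburger+)
  then show ?thesis using that A B by blast
qed

text \<open>Difference of the signed numbers of odd and of even intervals covering a point at height 0;
  it only depends on \<open>dens\<close>.\<close>

definition sg :: "int \<Rightarrow> int" where "sg x = (if even x then 1 else - 1)"

definition del :: "nat \<Rightarrow> (nat \<Rightarrow> nat \<Rightarrow> int) \<Rightarrow> (nat \<Rightarrow> nat \<Rightarrow> int) \<Rightarrow> int \<Rightarrow> int" where
  "del l A B x = (\<Sum>i | i \<in> {1..l} \<and> A i 0 \<le> x. sg (A i 0)) + (\<Sum>i | i \<in> {1..l} \<and> B i 0 \<le> x. sg (B i 0))"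

text \<open>Whatever arrives at \<open>x + 1\<close> contributes \<open>sg (x + 1)\<close>, no
  matter which family it comes from.\<close>

lemma del_rec: "del l A B (x + 1) - del l A B x = sg (x + 1) * (dens n l A B (0, x + 1) - dens n l A B (0, x))"
proof -
  have *: "(\<Sum>i | i \<in> {1..l} \<and> C i 0 \<le> x + 1. sg (C i 0)) - (\<Sum>i | i \<in> {1..l} \<and> C i 0 \<le> x. sg (C i 0)) =
    sg (x + 1) * (cnt n l C (0, x + 1) - cnt n l C (0, x))" for C
  proof -
    let ?X = "{i. i \<in> {1..l} \<and> C i 0 \<le> x}" and ?Y = "{i. i \<in> {1..l} \<and> C i 0 = x + 1}"
    have u: "{i. i \<in> {1..l} \<and> C i 0 \<le> x + 1} = ?X \<union> ?Y" "?X \<inter> ?Y = {}" by auto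
    have "(\<Sum>i\<in>?X \<union> ?Y. sg (C i 0)) = (\<Sum>i\<in>?X. sg (C i 0)) + (\<Sum>i\<in>?Y. sg (C i 0))"
      by (rule sum.union_disjoint) (use u in auto)
    moreover have "(\<Sum>i\<in>?Y. sg (C i 0)) = (\<Sum>i\<in>?Y. sg (x + 1))" by (rule sum.cong) auto
    moreover have "card (?X \<union> ?Y) = card ?X + card ?Y" by (rule card_Un_disjoint) (use u in auto)
    ultimately show ?thesis using u(1) by (simp add: cnt_def)
  qed
  show ?thesis unfolding del_def dens_def using *[of A] *[of B] by (simp add: algebra_simps)
qed

lemma del_left: "\<exists>m. \<forall>x<m. del l A B x = 0"
proof -
  obtain m M where m: "\<And>i r. i \<in> {1..l} \<Longrightarrow> r \<le> 0 \<Longrightarrow> m \<le> A i r \<and> A i r \<le> M" by (rule fams_bounded[of l 0 A]) blast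
  obtain m' M' where m': "\<And>i r. i \<in> {1..l} \<Longrightarrow> r \<le> 0 \<Longrightarrow> m' \<le> B i r \<and> B i r \<le> M'" by (rule fams_bounded[of l 0 B]) blast
  have "del l A B x = 0" if "x < min m m'" for x
  proof -
    have "{i. i \<in> {1..l} \<and> A i 0 \<le> x} = {}" "{i. i \<in> {1..l} \<and> B i 0 \<le> x} = {}"
      using m[of _ 0] m'[of _ 0] that by force+
    then show ?thesis unfolding del_def by (metis (no_types, lifting) sum.empty add_0)
  qed
  then show ?thesis by blast
qed

lemma del_unique:
  assumes "0 < n" "fams n l A" "fams n l B" and eq: "dens n l A B = dens n l A' B'"
  shows "del l A B = del l A' B'"
proof
  interpret strip n l "dens n l A B" by (rule strip_dens[OF assms(1-3)])
  fix x
  obtain m where m: "\<forall>x<m. del l A B x = 0" using del_left by blast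
  obtain m' where m': "\<forall>x<m'. del l A' B' x = 0" using del_left by blast
  show "del l A B x = del l A' B' x"
  proof (rule row_eqI[where m = "min m m'" and f = "del l A B" and g = "del l A' B'"])
    show "del l A B (x + 1) - del l A B x = del l A' B' (x + 1) - del l A' B' x" for x
      using del_rec[of l A B x n] del_rec[of l A' B' x n] eq by simp
  qed (use m m' in auto)
qed

lemma sg_cases: "sg x = 1 \<or> sg x = - 1" by (simp add: sg_def)

lemma sg_eq: "sg x = sg y \<longleftrightarrow> even (x - y)" by (auto simp: sg_def)

lemma sg_sq [simp]: "sg x * sg x = 1" "sg x * (sg x * y) = y" by (auto simp: sg_def)

lemma parity_step:
  fixes u v u' v' :: int
  assumes "u' = u \<or> u' = u + 1" "v' = v \<or> v' = v + 1" "even (u' + v') \<noteq> even (u + v)"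
  shows "u' + v' = u + v + 1"
  using assms by auto

lemma alt_sum: "p \<le> Suc q \<Longrightarrow> (\<Sum>i\<in>{p..q}. sg (int i)) = (if even (Suc q - p) then 0 else sg (int q))"
proof (induction q)
  case 0
  then show ?case by (cases p) (auto simp: le_Suc_eq)
next
  case (Suc q)
  show ?case
  proof (cases "p = Suc (Suc q)")
    case False
    then have "p \<le> Suc q" using Suc.prems by simp
    then have "{p..Suc q} = insert (Suc q) {p..q}" "Suc (Suc q) - p = Suc (Suc q - p)" by auto
    then show ?thesis using Suc.IH[OF \<open>p \<le> Suc q\<close>] by (auto simp: sg_def)
  qed simp
qed

section \<open>Intersections at height 0\<close>

locale two_fams =
  fixes n l :: nat and A B :: "nat \<Rightarrow> nat \<Rightarrow> int"
  assumes n0: "0 < n" and fA: "fams n l A" and fB: "fams n l B"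
begin

sublocale strip n l "dens n l A B" by (rule strip_dens[OF n0 fA fB])

abbreviation "a i \<equiv> A i 0"
abbreviation "b i \<equiv> B i 0"
abbreviation "NA x \<equiv> cnt n l A (0, x)"
abbreviation "NB x \<equiv> cnt n l B (0, x)"
abbreviation "D x \<equiv> hgt n l A B (0, x)"
abbreviation "Sb x \<equiv> dens n l A B (0, x)"
abbreviation "dl x \<equiv> del l A B x"

lemma valid: "valid (hgt n l A B)" by (rule valid_hgt[OF n0 fA fB])

lemma a_le: "i \<in> {1..l} \<Longrightarrow> a i \<le> x \<longleftrightarrow> int l + 1 - int i \<le> NA x"
  and b_le: "i \<in> {1..l} \<Longrightarrow> b i \<le> x \<longleftrightarrow> int l + 1 - int i \<le> NB x"
  using cnt_ge[OF fA] cnt_ge[OF fB] by simp_all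

lemma b_less: "i \<in> {1..l} \<Longrightarrow> x < b i \<longleftrightarrow> NB x \<le> int l - int i"
  using b_le[of i x] by auto

lemma a_decr: "i \<in> {1..l} \<Longrightarrow> j \<in> {1..l} \<Longrightarrow> a j < a i \<longleftrightarrow> i < j"
  and b_decr: "i \<in> {1..l} \<Longrightarrow> j \<in> {1..l} \<Longrightarrow> b j < b i \<longleftrightarrow> i < j"
  using fams_less[OF fA, of 0] fams_less[OF fB, of 0]
  by (metis atLeastAtMost_iff linorder_neqE_nat order_less_asym order_less_irrefl zero_le)+

lemma NA_step: "NA (x + 1) = NA x \<or> NA (x + 1) = NA x + 1" and NB_step: "NB (x + 1) = NB x \<or> NB (x + 1) = NB x + 1"
  using cnt_step[OF fA step_E[of 0 x]] cnt_step[OF fB step_E[of 0 x]] by auto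

lemma D_eq: "D x = NA x - NB x" and S_eq: "Sb x = NA x + NB x" by (simp_all add: hgt_def dens_def)

lemma dl_step: "dl (x + 1) = dl x + sg (x + 1) * (NA (x + 1) - NA x + (NB (x + 1) - NB x))"
  using del_rec[of l A B x n] by (simp add: dens_def algebra_simps)

lemma dl_S: "dl (x + 1) = dl x + sg (x + 1) * (Sb (x + 1) - Sb x)"
  using del_rec[of l A B x n] by simp

lemma bottom_induct:
  assumes "\<And>x. NA x = 0 \<Longrightarrow> NB x = 0 \<Longrightarrow> dl x = 0 \<Longrightarrow> P x" "\<And>x. P x \<Longrightarrow> P (x + 1)"
  shows "P x"
proof -
  obtain m where m: "\<forall>p. fst p \<le> n \<and> snd p < m \<longrightarrow> cnt n l A p = 0" using cnt_left by blast
  obtain m' where m': "\<forall>p. fst p \<le> n \<and> snd p < m' \<longrightarrow> cnt n l B p = 0" using cnt_left by blast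
  obtain m'' where m'': "\<forall>x<m''. dl x = 0" using del_left by blast
  define w where "w = min x (min m (min m' m'') - 1)"
  have "w \<le> x" by (simp add: w_def)
  then show ?thesis
  proof (induction x rule: int_ge_induct)
    case base
    show ?case by (rule assms(1)) (use m m' m'' in \<open>auto simp: w_def\<close>)
  qed (rule assms(2))
qed

lemma parity_dl: "even (dl x) = even (D x)"
proof (rule bottom_induct[of "\<lambda>x. even (dl x) = even (D x)"])
  show "even (dl (x + 1)) = even (D (x + 1))" if "even (dl x) = even (D x)" for x
    using that NA_step[of x] NB_step[of x] dl_step[of x] sg_cases[of "x + 1"] unfolding D_eq by auto
qed (simp add: D_eq)

lemma parity_DS: "even (Sb x) = even (D x)" unfolding D_eq S_eq by simp

lemma far_right: obtains M where "\<And>x. M \<le> x \<Longrightarrow> NA x = int l" "\<And>x. M \<le> x \<Longrightarrow> NB x = int l"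
proof -
  obtain m where m: "\<forall>p. fst p \<le> n \<and> m \<le> snd p \<longrightarrow> cnt n l A p = int l" using cnt_right by blast
  obtain m' where m': "\<forall>p. fst p \<le> n \<and> m' \<le> snd p \<longrightarrow> cnt n l B p = int l" using cnt_right by blast
  show ?thesis by (rule that[of "max m m'"]) (use m m' in auto)
qed

text \<open>At height 0 the path from \<alpha> number \<open>i\<close> fills the interval from
  \<open>a i + 1\<close> to \<open>b (\<sigma> i)\<close>. Intervals whose starts have equal parity
  must be disjoint; those of different parity may meet, which is the special intersection.\<close>

definition good2 :: "(nat \<Rightarrow> nat) \<Rightarrow> bool" where
  "good2 \<sigma> \<longleftrightarrow> \<sigma> permutes {1..l} \<and> (\<forall>i\<in>{1..l}. a i < b (\<sigma> i) \<and> odd (b (\<sigma> i) - a i)) \<and>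
    (\<forall>i\<in>{1..l}. \<forall>j\<in>{1..l}. i \<noteq> j \<longrightarrow> even (a i - a j) \<longrightarrow> \<not> max (a i) (a j) < min (b (\<sigma> i)) (b (\<sigma> j)))"

definition goodP :: bool where
  "goodP \<longleftrightarrow> (\<forall>i\<in>{1..l}. a i < b i \<and> odd (b i - a i)) \<and>
    (\<forall>i\<in>{1..<l}. even (a i - a (Suc i)) \<longrightarrow> b (Suc i) \<le> a i)"

text \<open>An interval of odd length starts at an even point exactly if it ends at an odd one. So
  \<open>kA P x - kB P x\<close> is the number of intervals of class \<open>P\<close> over
  \<open>x\<close>, without reference to a matching.\<close>

definition kA :: "bool \<Rightarrow> int \<Rightarrow> int" where "kA P x = int (card {i \<in> {1..l}. a i \<le> x \<and> even (a i) = P})"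
definition kB :: "bool \<Rightarrow> int \<Rightarrow> int" where "kB P x = int (card {i \<in> {1..l}. b i \<le> x \<and> odd (b i) = P})"

lemma D_class: "D x = (kA True x - kB True x) + (kA False x - kB False x)"
  and dl_class: "dl x = (kA True x - kB True x) - (kA False x - kB False x)"
proof -
  have c: "card {i \<in> {1..l}. C i 0 \<le> x} = card {i \<in> {1..l}. C i 0 \<le> x \<and> even (C i 0)} + card {i \<in> {1..l}. C i 0 \<le> x \<and> odd (C i 0)}"
    (is "card ?X = card ?Y + card ?Z") and
    s: "(\<Sum>i | i \<in> {1..l} \<and> C i 0 \<le> x. sg (C i 0)) = int (card {i \<in> {1..l}. C i 0 \<le> x \<and> even (C i 0)}) - int (card {i \<in> {1..l}. C i 0 \<le> x \<and> odd (C i 0)})"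
    for C :: "nat \<Rightarrow> nat \<Rightarrow> int"
  proof -
    have u: "?X = ?Y \<union> ?Z" "?Y \<inter> ?Z = {}" "finite ?Y" "finite ?Z" by auto
    show "card ?X = card ?Y + card ?Z" using card_Un_disjoint[OF u(3,4,2)] u(1) by simp
    have "(\<Sum>i\<in>?Y \<union> ?Z. sg (C i 0)) = (\<Sum>i\<in>?Y. sg (C i 0)) + (\<Sum>i\<in>?Z. sg (C i 0))"
      by (rule sum.union_disjoint[OF u(3,4,2)])
    moreover have "(\<Sum>i\<in>?Y. sg (C i 0)) = (\<Sum>i\<in>?Y. 1)" by (rule sum.cong) (auto simp: sg_def)
    moreover have "(\<Sum>i\<in>?Z. sg (C i 0)) = (\<Sum>i\<in>?Z. - 1)" by (rule sum.cong) (auto simp: sg_def)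
    ultimately show "(\<Sum>i | i \<in> {1..l} \<and> C i 0 \<le> x. sg (C i 0)) = int (card ?Y) - int (card ?Z)" using u(1) by simp
  qed
  show "D x = (kA True x - kB True x) + (kA False x - kB False x)"
    using c[of A] c[of B] by (simp add: D_eq cnt_def kA_def kB_def)
  show "dl x = (kA True x - kB True x) - (kA False x - kB False x)"
    unfolding del_def s by (simp add: kA_def kB_def)
qed

text \<open>\<open>D\<close> is the sum and \<open>dl\<close> the difference of the numbers of
  intervals of the two classes.\<close>

lemma class01_iff: "(D x \<in> {0, 1, 2} \<and> \<bar>dl x\<bar> \<le> 1) \<longleftrightarrow> (\<forall>P. kA P x - kB P x \<in> {0, 1})"
proof -
  have "(\<forall>P. kA P x - kB P x \<in> {0, 1}) \<longleftrightarrow> kA True x - kB True x \<in> {0, 1} \<and> kA False x - kB False x \<in> {0, 1}"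
    by (metis (full_types))
  moreover have "(u + v \<in> {0, 1, 2} \<and> \<bar>u - v\<bar> \<le> 1) \<longleftrightarrow> u \<in> {0, 1} \<and> v \<in> {0, 1}" for u v :: int
    by (smt (verit) insert_iff empty_iff)
  ultimately show ?thesis unfolding D_class dl_class by blast
qed

lemma good2_forward:
  assumes g: "good2 \<sigma>" shows "D x \<in> {0, 1, 2} \<and> \<bar>dl x\<bar> \<le> 1"
  unfolding class01_iff
proof
  fix P
  have \<sigma>: "\<sigma> permutes {1..l}" and ab: "\<And>i. i \<in> {1..l} \<Longrightarrow> a i < b (\<sigma> i) \<and> odd (b (\<sigma> i) - a i)"
    and dis: "\<And>i j. i \<in> {1..l} \<Longrightarrow> j \<in> {1..l} \<Longrightarrow> i \<noteq> j \<Longrightarrow> even (a i - a j) \<Longrightarrow> \<not> max (a i) (a j) < min (b (\<sigma> i)) (b (\<sigma> j))"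
    using g by (auto simp: good2_def)
  let ?X = "{i \<in> {1..l}. b (\<sigma> i) \<le> x \<and> even (a i) = P}" and ?Y = "{i \<in> {1..l}. a i \<le> x \<and> even (a i) = P}"
  have "int (card ?Y) - int (card ?X) \<in> {0, 1}"
  proof (rule card_diff01)
    show "?X \<subseteq> ?Y" using ab by force
    fix i j assume *: "i \<in> ?Y - ?X" "j \<in> ?Y - ?X"
    then have "max (a i) (a j) < min (b (\<sigma> i)) (b (\<sigma> j))" "even (a i - a j)" by auto
    then show "i = j" using dis[of i j] * by auto
  qed simp
  moreover have "\<sigma> ` ?X = {i \<in> {1..l}. b i \<le> x \<and> odd (b i) = P}"
  proof
    show "\<sigma> ` ?X \<subseteq> {i \<in> {1..l}. b i \<le> x \<and> odd (b i) = P}"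
      using ab permutes_in_image[OF \<sigma>] by force
    show "{i \<in> {1..l}. b i \<le> x \<and> odd (b i) = P} \<subseteq> \<sigma> ` ?X"
    proof
      fix j assume j: "j \<in> {i \<in> {1..l}. b i \<le> x \<and> odd (b i) = P}"
      then obtain i where i: "i \<in> {1..l}" "j = \<sigma> i" using permutes_image[OF \<sigma>] by blast
      then have "i \<in> ?X" using j ab[OF i(1)] by auto
      then show "j \<in> \<sigma> ` ?X" using i by blast
    qed
  qed
  moreover have "card (\<sigma> ` ?X) = card ?X" using permutes_inj[OF \<sigma>] by (intro card_image) (auto simp: inj_on_def)
  ultimately show "kA P x - kB P x \<in> {0, 1}" by (simp add: kA_def kB_def)
qed

text \<open>Match every start with the nearest end of opposite parity to its right. In each class at
  most one interval is open at any point, so an end must occur between two successive starts; hence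
  the greedy choice is injective and its intervals of one class are disjoint.\<close>

lemma good2_backward:
  assumes h: "\<And>x. D x \<in> {0, 1, 2} \<and> \<bar>dl x\<bar> \<le> 1" shows "\<exists>\<sigma>. good2 \<sigma>"
proof -
  have k: "kA P x - kB P x \<in> {0, 1}" for P x using h class01_iff by blast
  define T where "T i = {j \<in> {1..l}. a i < b j \<and> odd (b j - a i)}" for i
  have kA_mono: "kA P x \<le> kA P y" if "x \<le> y" for P x y
  proof -
    have "card {i \<in> {1..l}. a i \<le> x \<and> even (a i) = P} \<le> card {i \<in> {1..l}. a i \<le> y \<and> even (a i) = P}"
      by (rule card_mono) (use that in auto)
    then show ?thesis by (simp add: kA_def)
  qed
  have kA_new: "kA P x + 1 \<le> kA P y" if "i \<in> {1..l}" "x < a i" "a i \<le> y" "even (a i) = P" for P x y i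
  proof -
    have "i \<in> {j \<in> {1..l}. a j \<le> y \<and> even (a j) = P}" "i \<notin> {j \<in> {1..l}. a j \<le> x \<and> even (a j) = P}"
      using that by auto
    moreover have "{j \<in> {1..l}. a j \<le> x \<and> even (a j) = P} \<subseteq> {j \<in> {1..l}. a j \<le> y \<and> even (a j) = P}"
      using that(2,3) by auto
    ultimately have "{j \<in> {1..l}. a j \<le> x \<and> even (a j) = P} \<subset> {j \<in> {1..l}. a j \<le> y \<and> even (a j) = P}" by blast
    then have "card {j \<in> {1..l}. a j \<le> x \<and> even (a j) = P} < card {j \<in> {1..l}. a j \<le> y \<and> even (a j) = P}"
      by (intro psubset_card_mono) auto
    then show ?thesis by (simp add: kA_def)
  qed
  have ge1: "1 \<le> kA P (a i) - kB P (a i)" if i: "i \<in> {1..l}" and P: "P = even (a i)" for i P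
  proof -
    have "{j \<in> {1..l}. b j \<le> a i \<and> odd (b j) = P} = {j \<in> {1..l}. b j \<le> a i - 1 \<and> odd (b j) = P}"
    proof -
      have "b j \<le> a i \<and> odd (b j) = P \<longleftrightarrow> b j \<le> a i - 1 \<and> odd (b j) = P" for j
        using P by (cases "b j = a i") auto
      then show ?thesis by blast
    qed
    then have "kB P (a i) = kB P (a i - 1)" by (simp add: kB_def)
    moreover have "kA P (a i - 1) + 1 \<le> kA P (a i)" by (rule kA_new[OF i]) (use P in auto)
    ultimately show ?thesis using k[of P "a i - 1"] by auto
  qed
  have kB_const: "kB P y = kB P (a i)" if i: "i \<in> {1..l}" and P: "P = even (a i)" and y: "a i \<le> y" and no: "\<And>j. j \<in> T i \<Longrightarrow> y < b j" for i P y
  proof -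
    have "b j \<le> y \<and> odd (b j) = P \<longleftrightarrow> b j \<le> a i \<and> odd (b j) = P" if "j \<in> {1..l}" for j
    proof (cases "a i < b j \<and> odd (b j) = P")
      case True
      then have "j \<in> T i" using that P by (auto simp: T_def)
      then show ?thesis using no[of j] True by auto
    qed (use y in auto)
    then have "{j \<in> {1..l}. b j \<le> y \<and> odd (b j) = P} = {j \<in> {1..l}. b j \<le> a i \<and> odd (b j) = P}" by blast
    then show ?thesis by (simp add: kB_def)
  qed
  have neT: "T i \<noteq> {}" if i: "i \<in> {1..l}" for i
  proof
    assume e: "T i = {}"
    obtain M where M: "\<And>x. M \<le> x \<Longrightarrow> NA x = int l" "\<And>x. M \<le> x \<Longrightarrow> NB x = int l" using far_right by blast
    define y where "y = max M (a i)"
    have "D y = 0" using M[of y] by (simp add: D_eq y_def)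
    then have "kA (even (a i)) y - kB (even (a i)) y = 0"
      using k[of True y] k[of False y] D_class[of y] by (cases "even (a i)") auto
    moreover have "kB (even (a i)) y = kB (even (a i)) (a i)" by (rule kB_const[OF i]) (use e in \<open>auto simp: y_def\<close>)
    moreover have "kA (even (a i)) (a i) \<le> kA (even (a i)) y" by (rule kA_mono) (simp add: y_def)
    ultimately show False using ge1[OF i refl] by simp
  qed
  have between: "\<exists>j\<in>T i. b j < a m" if i: "i \<in> {1..l}" "m \<in> {1..l}" and lt: "a i < a m" and ev: "even (a i - a m)" for i m
  proof (rule ccontr)
    assume no: "\<not> ?thesis"
    let ?P = "even (a i)"
    have "a m < b j" if "j \<in> T i" for j
    proof -
      have "odd (b j - a i)" using that by (simp add: T_def)
      then have "b j \<noteq> a m" using ev by auto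
      moreover have "\<not> b j < a m" using no that by blast
      ultimately show ?thesis by linarith
    qed
    then have "kB ?P (a m) = kB ?P (a i)" by (intro kB_const[OF i(1)]) (use lt in auto)
    moreover have "kA ?P (a i) + 1 \<le> kA ?P (a m)" by (rule kA_new[OF i(2)]) (use lt ev in auto)
    ultimately show False using ge1[OF i(1) refl] k[of ?P "a m"] by auto
  qed
  \<comment> \<open>Ends decrease with the index, so the largest index is the nearest end.\<close>
  define s where "s i = Max (T i)" for i
  have finT: "finite (T i)" for i by (simp add: T_def)
  have sT: "s i \<in> T i" if "i \<in> {1..l}" for i unfolding s_def by (rule Max_in[OF finT neT[OF that]])
  have s_min: "b (s i) \<le> b j" if "i \<in> {1..l}" "j \<in> T i" for i j
  proof -
    have "j \<le> s i" unfolding s_def by (rule Max_ge[OF finT that(2)])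
    then show ?thesis using b_decr[of j "s i"] sT[OF that(1)] that(2) by (cases "j = s i") (auto simp: T_def)
  qed
  have lt: "b (s i) < a m" if "i \<in> {1..l}" "m \<in> {1..l}" "a i < a m" "even (a i - a m)" for i m
    using between[OF that] s_min[OF that(1)] by force
  have ab: "a i < b (s i)" "odd (b (s i) - a i)" "s i \<in> {1..l}" if "i \<in> {1..l}" for i
    using sT[OF that] by (auto simp: T_def)
  have neq: "a i < a m \<or> a m < a i" if "i \<in> {1..l}" "m \<in> {1..l}" "i \<noteq> m" for i m
    using a_decr[OF that(1,2)] a_decr[OF that(2,1)] that(3) by (simp add: neq_iff disj_commute)
  have dis: "\<not> max (a i) (a m) < min (b (s i)) (b (s m))" if "i \<in> {1..l}" "m \<in> {1..l}" "i \<noteq> m" "even (a i - a m)" for i m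
    using neq[OF that(1-3)]
  proof
    assume "a i < a m"
    from lt[OF that(1,2) this that(4)] show ?thesis by simp
  next
    assume *: "a m < a i"
    have "even (a m - a i)" using that(4) by simp
    from lt[OF that(2,1) * this] show ?thesis by simp
  qed
  have inj: "inj_on s {1..l}"
  proof (rule inj_onI, rule ccontr)
    fix i m assume im: "i \<in> {1..l}" "m \<in> {1..l}" "s i = s m" "i \<noteq> m"
    have "even (a i - a m)" using ab(2)[OF im(1)] ab(2)[OF im(2)] unfolding im(3) by simp
    from dis[OF im(1,2,4) this] show False using ab(1)[OF im(1)] ab(1)[OF im(2)] unfolding im(3) by simp
  qed
  define \<sigma> where "\<sigma> i = (if i \<in> {1..l} then s i else i)" for i
  have "s ` {1..l} = {1..l}" by (rule endo_inj_surj[OF _ _ inj]) (use ab(3) in auto)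
  then have "bij_betw s {1..l} {1..l}" using inj by (simp add: bij_betw_def)
  moreover have "bij_betw s {1..l} {1..l} = bij_betw \<sigma> {1..l} {1..l}" by (rule bij_betw_cong) (simp add: \<sigma>_def)
  ultimately have "bij_betw \<sigma> {1..l} {1..l}" by blast
  then have "\<sigma> permutes {1..l}" by (rule bij_imp_permutes) (auto simp: \<sigma>_def)
  then have "good2 \<sigma>" unfolding good2_def using ab dis by (simp add: \<sigma>_def)
  then show ?thesis by blast
qed

text \<open>If \<tau> used a nearer end than \<sigma> does, the interval that \<sigma> lets end
  there would be of the same class and overlap the one of \<open>i\<close>.\<close>

lemma good2_unique:
  assumes s: "good2 \<sigma>" and t: "good2 \<tau>" shows "\<sigma> = \<tau>"
proof -
  have le: "b (\<sigma> i) \<le> b (\<tau> i)" if s: "good2 \<sigma>" and t: "good2 \<tau>" and i: "i \<in> {1..l}" for \<sigma> \<tau> i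
  proof (rule ccontr)
    assume lt: "\<not> b (\<sigma> i) \<le> b (\<tau> i)"
    have S: "\<sigma> permutes {1..l}" "\<And>i. i \<in> {1..l} \<Longrightarrow> a i < b (\<sigma> i) \<and> odd (b (\<sigma> i) - a i)"
      "\<And>i j. i \<in> {1..l} \<Longrightarrow> j \<in> {1..l} \<Longrightarrow> i \<noteq> j \<Longrightarrow> even (a i - a j) \<Longrightarrow> \<not> max (a i) (a j) < min (b (\<sigma> i)) (b (\<sigma> j))"
      using s by (auto simp: good2_def)
    have T: "\<tau> permutes {1..l}" "a i < b (\<tau> i)" "odd (b (\<tau> i) - a i)" using t i by (auto simp: good2_def)
    have "\<tau> i \<in> {1..l}" using permutes_in_image[OF T(1)] i by blast
    then obtain k where k: "k \<in> {1..l}" "\<tau> i = \<sigma> k" using permutes_image[OF S(1)] by blast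
    have "k \<noteq> i" using lt k by auto
    moreover have "even (a i - a k)" using S(2)[OF k(1)] T(3) k(2) by auto
    moreover have "max (a i) (a k) < min (b (\<sigma> i)) (b (\<sigma> k))" using S(2)[OF k(1)] S(2)[OF i] T(2) lt k(2) by auto
    ultimately show False using S(3)[OF i k(1)] by auto
  qed
  have perm: "\<sigma> permutes {1..l}" "\<tau> permutes {1..l}" using s t by (auto simp: good2_def)
  show ?thesis
  proof
    fix i
    show "\<sigma> i = \<tau> i"
    proof (cases "i \<in> {1..l}")
      case True
      have m: "\<sigma> i \<in> {1..l}" "\<tau> i \<in> {1..l}"
        using permutes_in_image[OF perm(1), of i] permutes_in_image[OF perm(2), of i] True by blast+
      have "b (\<sigma> i) = b (\<tau> i)" using le[OF s t True] le[OF t s True] by simp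
      then show ?thesis using fams_inj[OF fB, of 0] m by simp
    next
      case False
      then show ?thesis using perm by (simp add: permutes_not_in)
    qed
  qed
qed

text \<open>The intervals over \<open>x\<close> have consecutive indices, and neighbours among them
  overlap, so their starts alternate in parity. One sign \<open>c\<close> thus describes all of
  them.\<close>

lemma active_sign:
  assumes g: goodP
  obtains c where "c = 1 \<or> c = - 1" "\<And>i. i \<in> {1..l} \<Longrightarrow> a i \<le> x \<Longrightarrow> x < b i \<Longrightarrow> sg (a i) = c * sg (int i)"
proof (cases "\<exists>i. i \<in> {1..l} \<and> a i \<le> x \<and> x < b i")
  case False
  then show ?thesis using that[of 1] by blast
next
  case True
  define i0 where "i0 = (LEAST i. i \<in> {1..l} \<and> a i \<le> x \<and> x < b i)"
  have i0: "i0 \<in> {1..l}" "a i0 \<le> x" "x < b i0" using LeastI_ex[OF True] unfolding i0_def by auto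
  have least: "i0 \<le> i" if "i \<in> {1..l}" "a i \<le> x" "x < b i" for i unfolding i0_def by (rule Least_le) (use that in simp)
  have *: "i \<in> {1..l} \<Longrightarrow> x < b i \<Longrightarrow> sg (a i) = sg (a i0) * sg (int i0) * sg (int i)" if "i0 \<le> i" for i
    using that
  proof (induction i rule: dec_induct)
    case base then show ?case by simp
  next
    case (step i)
    have i: "i \<in> {1..l}" "i \<in> {1..<l}" using step i0 by auto
    have xb: "x < b i" using b_decr[of i "Suc i"] step i by auto
    have "a i \<le> x" using a_decr[of i0 i] i0 i step by (cases "i = i0") auto
    then have "odd (a i - a (Suc i))" using g i(2) step.prems unfolding goodP_def by auto
    then have "sg (a (Suc i)) = - sg (a i)" by (auto simp: sg_def)
    moreover have "sg (int (Suc i)) = - sg (int i)" by (auto simp: sg_def)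
    ultimately show ?case using step.IH i xb by simp
  qed
  show ?thesis
  proof (rule that[of "sg (a i0) * sg (int i0)"])
    show "sg (a i0) * sg (int i0) = 1 \<or> sg (a i0) * sg (int i0) = - 1" using sg_cases[of "a i0"] sg_cases[of "int i0"] by auto
  qed (use * least in blast)
qed

lemma goodP_nonneg: "goodP \<Longrightarrow> 0 \<le> D x"
proof -
  assume g: goodP
  have "card {i \<in> {1..l}. b i \<le> x} \<le> card {i \<in> {1..l}. a i \<le> x}"
    by (rule card_mono) (use g in \<open>force simp: goodP_def\<close>)+
  then show ?thesis by (simp add: D_eq cnt_def)
qed

text \<open>The ended intervals cancel, as their two ends have opposite signs. Those over
  \<open>x\<close> have the indices from \<open>l + 1 - NA x\<close> to \<open>l - NB x\<close>, so
  an alternating sum remains.\<close>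

lemma goodP_dl:
  assumes g: goodP and c: "\<And>i. i \<in> {1..l} \<Longrightarrow> a i \<le> x \<Longrightarrow> x < b i \<Longrightarrow> sg (a i) = c * sg (int i)"
  shows "dl x = (if even (D x) then 0 else c * sg (int l - NB x))"
proof -
  let ?a = "nat (NA x)" and ?b = "nat (NB x)"
  have nn: "int ?a = NA x" "int ?b = NB x" "?a \<le> l" "?b \<le> ?a"
    using cnt_bounds[of n l A "(0, x)"] cnt_bounds[of n l B "(0, x)"] goodP_nonneg[OF g, of x] by (auto simp: D_eq)
  have act: "{i \<in> {1..l}. a i \<le> x \<and> x < b i} = {Suc l - ?a..l - ?b}"
  proof -
    have "i \<in> {1..l} \<and> a i \<le> x \<and> x < b i \<longleftrightarrow> i \<in> {Suc l - ?a..l - ?b}" for i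
    proof (cases "i \<in> {1..l}")
      case True
      then show ?thesis using a_le[OF True, of x] b_less[OF True, of x] nn by auto
    qed (use nn in auto)
    then show ?thesis by blast
  qed
  let ?X = "{i \<in> {1..l}. a i \<le> x}" and ?Y = "{i \<in> {1..l}. b i \<le> x}"
  have sub: "?Y \<subseteq> ?X" using g by (force simp: goodP_def)
  have "(\<Sum>i\<in>?Y. sg (b i)) = (\<Sum>i\<in>?Y. - sg (a i))"
  proof (rule sum.cong)
    fix i assume "i \<in> ?Y"
    then have "odd (b i - a i)" using g by (auto simp: goodP_def)
    then show "sg (b i) = - sg (a i)" by (auto simp: sg_def)
  qed simp
  moreover have "(\<Sum>i\<in>?X. sg (a i)) = (\<Sum>i\<in>?X - ?Y. sg (a i)) + (\<Sum>i\<in>?Y. sg (a i))"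
    by (rule sum.subset_diff[OF sub]) simp
  moreover have "?X - ?Y = {i \<in> {1..l}. a i \<le> x \<and> x < b i}" by auto
  then have "?X - ?Y = {Suc l - ?a..l - ?b}" using act by simp
  ultimately have "dl x = (\<Sum>i\<in>{Suc l - ?a..l - ?b}. sg (a i))" by (simp add: del_def sum_negf)
  also have "\<dots> = (\<Sum>i\<in>{Suc l - ?a..l - ?b}. c * sg (int i))"
    by (rule sum.cong) (use c act in blast)+
  also have "\<dots> = c * (\<Sum>i\<in>{Suc l - ?a..l - ?b}. sg (int i))" by (simp add: sum_distrib_left)
  also have "(\<Sum>i\<in>{Suc l - ?a..l - ?b}. sg (int i)) = (if even (Suc (l - ?b) - (Suc l - ?a)) then 0 else sg (int (l - ?b)))"
    by (rule alt_sum) (use nn in simp)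
  also have "Suc (l - ?b) - (Suc l - ?a) = ?a - ?b" using nn by simp
  also have "int (l - ?b) = int l - NB x" using nn by simp
  also have "even (?a - ?b) \<longleftrightarrow> even (D x)"
  proof -
    have "int (?a - ?b) = D x" using nn by (simp add: D_eq of_nat_diff)
    then show ?thesis by (metis even_of_nat)
  qed
  finally show ?thesis by simp
qed

lemma goodP_dl_even: "goodP \<Longrightarrow> even (D x) \<Longrightarrow> dl x = 0"
proof -
  assume g: goodP and e: "even (D x)"
  obtain c where "\<And>i. i \<in> {1..l} \<Longrightarrow> a i \<le> x \<Longrightarrow> x < b i \<Longrightarrow> sg (a i) = c * sg (int i)"
    using active_sign[OF g, of x] by blast
  from goodP_dl[OF g this] show ?thesis using e by simp
qed

text \<open>The sign \<open>c\<close> stays the same throughout a run of positive height, because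
  some interval covers the run together with the odd node on its left, and some interval covers it
  together with the one on its right. As \<open>dl\<close> vanishes on the run, its values on the
  two sides are \<open>- sg x1\<close> and \<open>sg x2\<close>; expressing them through
  \<open>c\<close> links the parity of the length to the two heights.\<close>

lemma goodP_forward:
  assumes g: goodP
  shows "\<bar>dl x\<bar> \<le> 1" "runrule (hgt n l A B)"
proof -
  obtain c where c: "c = 1 \<or> c = - 1" "\<And>i. i \<in> {1..l} \<Longrightarrow> a i \<le> x \<Longrightarrow> x < b i \<Longrightarrow> sg (a i) = c * sg (int i)"
    using active_sign[OF g, of x] by blast
  show "\<bar>dl x\<bar> \<le> 1" using goodP_dl[OF g c(2)] c(1) sg_cases[of "int l - NB x"] by auto
  show "runrule (hgt n l A B)"
    unfolding runrule_def
  proof (intro allI impI)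
    fix x1 x2 assume "x1 < x2 \<and> odd (Sb (x1 - 1)) \<and> (\<forall>y. x1 \<le> y \<and> y < x2 \<longrightarrow> even (Sb y)) \<and> odd (Sb x2) \<and> D x1 \<noteq> 0"
    then have r: "x1 < x2" "odd (Sb (x1 - 1))" "\<And>y. x1 \<le> y \<Longrightarrow> y \<le> x2 - 1 \<Longrightarrow> even (Sb y)" "odd (Sb x2)" "D x1 \<noteq> 0" by auto
    have nt: "no_even_tie"
      unfolding no_even_tie_def
    proof (intro allI impI, rule ccontr)
      fix y assume ev: "even (Sb y)" and "\<not> Sb (y + 1) - Sb y \<le> 1"
      then have N: "NA (y + 1) = NA y + 1" "NB (y + 1) = NB y + 1" using NA_step[of y] NB_step[of y] by (auto simp: S_eq)
      have "even (D y)" "even (D (y + 1))" using ev parity_DS[of y] N by (auto simp: D_eq)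
      then have "dl y = 0" "dl (y + 1) = 0" using goodP_dl_even[OF g] by blast+
      then show False using dl_step[of y] N sg_cases[of "y + 1"] by auto
    qed
    have D2: "2 \<le> D x1" using goodP_nonneg[OF g, of x1] r(5) parity_DS[of x1] r(3)[of x1] r(1) by presburger
    have Dg: "odd (D (x1 - 1))" "odd (D x2)" using r parity_DS by auto
    have cong: "NA (x2 - 1) = NA x1" "NB (x2 - 1) = NB x1"
    proof -
      have f: "fc (0, x1) (0, x2 - 1)" by (rule run_fc) (use r in auto)
      have "Sb (x2 - 1) = Sb x1"
        by (rule row_induct_const[where f = Sb]) (use r step_even_bottom[OF nt] in auto)
      then show "NA (x2 - 1) = NA x1" "NB (x2 - 1) = NB x1"
        using valid_fc[OF valid f] by (simp_all add: D_eq S_eq)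
    qed
    have st1: "NA x1 = NA (x1 - 1) \<or> NA x1 = NA (x1 - 1) + 1" "NB x1 = NB (x1 - 1) \<or> NB x1 = NB (x1 - 1) + 1"
      using NA_step[of "x1 - 1"] NB_step[of "x1 - 1"] by simp_all
    have st2: "NA x2 = NA x1 \<or> NA x2 = NA x1 + 1" "NB x2 = NB x1 \<or> NB x2 = NB x1 + 1"
      using NA_step[of "x2 - 1"] NB_step[of "x2 - 1"] cong by simp_all
    have p1: "Sb x1 = Sb (x1 - 1) + 1" "Sb x2 = Sb x1 + 1"
    proof -
      have "even (Sb x1)" using r(3)[of x1] r(1) by simp
      then show "Sb x1 = Sb (x1 - 1) + 1" "Sb x2 = Sb x1 + 1"
        using parity_step[OF st1] parity_step[OF st2] r(2,4) unfolding S_eq by simp_all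
    qed
    obtain cg where cg: "\<And>i. i \<in> {1..l} \<Longrightarrow> a i \<le> x1 - 1 \<Longrightarrow> x1 - 1 < b i \<Longrightarrow> sg (a i) = cg * sg (int i)"
      using active_sign[OF g, of "x1 - 1"] by blast
    obtain cm where cm: "\<And>i. i \<in> {1..l} \<Longrightarrow> a i \<le> x1 \<Longrightarrow> x1 < b i \<Longrightarrow> sg (a i) = cm * sg (int i)"
      using active_sign[OF g, of x1] by blast
    obtain c2 where c2: "\<And>i. i \<in> {1..l} \<Longrightarrow> a i \<le> x2 \<Longrightarrow> x2 < b i \<Longrightarrow> sg (a i) = c2 * sg (int i)"
      using active_sign[OF g, of x2] by blast
    have bnd: "0 \<le> NB x1" "NA x1 \<le> int l" "0 \<le> NB x2" "NA x2 \<le> int l" using cnt_bounds by auto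
    have Dx2: "1 \<le> D x2" using Dg(2) goodP_nonneg[OF g, of x2] by presburger
    \<comment> \<open>The largest index of an interval over \<open>x1\<close>; since the height
      there is at least 2, this interval also covers \<open>x1 - 1\<close>. Likewise the index
      \<open>j\<close> below gives an interval over both \<open>x1\<close> and
      \<open>x2\<close>.\<close>
    define i where "i = nat (int l - NB x1)"
    have i: "int i = int l - NB x1" "i \<in> {1..l}" using bnd D2 by (auto simp: i_def D_eq)
    have "cg = cm"
      using cg[OF i(2)] cm[OF i(2)] a_le[OF i(2), of x1] a_le[OF i(2), of "x1 - 1"] b_less[OF i(2), of x1] b_less[OF i(2), of "x1 - 1"]
        i(1) D2 st1 sg_cases[of "int i"] by (auto simp: D_eq)
    define j where "j = nat (int l - NB x2)"
    have j: "int j = int l - NB x2" "j \<in> {1..l}" using bnd Dx2 by (auto simp: j_def D_eq)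
    have "c2 = cm"
      using c2[OF j(2)] cm[OF j(2)] a_le[OF j(2), of x1] a_le[OF j(2), of x2] b_less[OF j(2), of x1] b_less[OF j(2), of x2]
        j(1) D2 Dx2 st2 sg_cases[of "int j"] by (auto simp: D_eq)
    have d1: "dl (x1 - 1) = cm * sg (int l - NB (x1 - 1))" using goodP_dl[OF g cg] Dg \<open>cg = cm\<close> by simp
    have d2: "dl x2 = cm * sg (int l - NB x2)" using goodP_dl[OF g c2] Dg \<open>c2 = cm\<close> by simp
    have "dl x1 = dl (x1 - 1) + sg x1" using dl_S[of "x1 - 1"] p1 by simp
    moreover have "dl x2 = dl (x2 - 1) + sg x2" using dl_S[of "x2 - 1"] p1 cong S_eq[of x1] S_eq[of "x2 - 1"] by simp
    moreover have "dl x1 = 0" "dl (x2 - 1) = 0"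
    proof -
      have "even (D x1)" "even (D (x2 - 1))" using r parity_DS by auto
      then show "dl x1 = 0" "dl (x2 - 1) = 0" using goodP_dl_even[OF g] by blast+
    qed
    ultimately have e: "sg x1 = - cm * sg (int l - NB (x1 - 1))" "sg x2 = cm * sg (int l - NB x2)" using d1 d2 by auto
    have "even (x2 - x1) \<longleftrightarrow> sg x2 = sg x1" using sg_eq[of x2 x1] by simp
    also have "\<dots> \<longleftrightarrow> sg (int l - NB x2) = - sg (int l - NB (x1 - 1))" 
      using e sg_cases[of x1] sg_cases[of x2] sg_cases[of "int l - NB x2"] sg_cases[of "int l - NB (x1 - 1)"]
      by (elim disjE) simp_all
    also have "\<dots> \<longleftrightarrow> odd (NB x2 - NB (x1 - 1))" by (auto simp: sg_def)
    also have "\<dots> \<longleftrightarrow> D (x1 - 1) = D x2" using st1 st2 p1 unfolding D_eq S_eq by auto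
    finally show "D (x1 - 1) = D x2 \<longleftrightarrow> even (x2 - x1)" by simp
  qed
qed

end

section \<open>Recovering disjointness from the heights by a sweep along row 0\<close>

context two_fams
begin

text \<open>The first two clauses say that everything settled up to \<open>x\<close> is as required.
  The third records the common sign of the intervals over \<open>x\<close>, read off at the last odd
  node \<open>x1 - 1\<close> not beyond \<open>x\<close>; at height 0 there is no such interval and
  nothing to record.\<close>

definition inv_at :: "int \<Rightarrow> bool" where
  "inv_at x \<longleftrightarrow> (\<forall>i\<in>{1..l}. b i \<le> x \<longrightarrow> odd (b i - a i)) \<and>
    (\<forall>i\<in>{1..<l}. a i \<le> x \<longrightarrow> even (a i - a (Suc i)) \<longrightarrow> b (Suc i) \<le> a i) \<and>
    (D x \<noteq> 0 \<longrightarrow> (\<exists>x1\<le>x + 1. odd (Sb (x1 - 1)) \<and> (\<forall>y. x1 \<le> y \<longrightarrow> y \<le> x \<longrightarrow> even (Sb y)) \<and>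
      (\<forall>i\<in>{1..l}. a i \<le> x \<longrightarrow> x < b i \<longrightarrow> sg (a i) = dl (x1 - 1) * sg (int l - NB (x1 - 1)) * sg (int i))))"

text \<open>An arrival at \<open>x + 1\<close> changes \<open>dl\<close> by
  \<open>sg (x + 1)\<close>, and the bound on \<open>dl\<close> leaves one possible parity, which
  the recorded sign translates into the required one. Across an even run of nonzero height it is the
  run rule that makes the sign read off before the run agree with the one read off after it.\<close>

lemma invI:
  assumes nn: "\<And>x. 0 \<le> D x" and dl1: "\<And>x. \<bar>dl x\<bar> \<le> 1" and rr: "runrule (hgt n l A B)"
    and I: "inv_at x"
  shows "inv_at (x + 1)"
proof -
  let ?X = "x + 1"
  have I1: "\<And>i. i \<in> {1..l} \<Longrightarrow> b i \<le> x \<Longrightarrow> odd (b i - a i)"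
    and I2: "\<And>i. i \<in> {1..<l} \<Longrightarrow> a i \<le> x \<Longrightarrow> even (a i - a (Suc i)) \<Longrightarrow> b (Suc i) \<le> a i"
    using I unfolding inv_at_def by blast+
  have dle: "dl y = 0" if "even (D y)" for y using parity_dl[of y] that dl1[of y] by auto
  have dlo: "dl y = 1 \<or> dl y = - 1" if "odd (D y)" for y using parity_dl[of y] that dl1[of y] by (auto simp: abs_le_iff) presburger
  have bnd: "0 \<le> NA y" "NA y \<le> int l" "0 \<le> NB y" "NB y \<le> int l" for y using cnt_bounds by auto
  \<comment> \<open>\<open>c\<close> is the common sign of \<open>sg (a i) * sg i\<close> over the intervals covering \<open>x\<close>; it also
    controls the marks at \<open>x + 1\<close>.\<close>
  have "\<exists>c. (\<forall>i\<in>{1..l}. a i \<le> x \<longrightarrow> x < b i \<longrightarrow> sg (a i) = c * sg (int i)) \<and>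
    (odd (D x) \<longrightarrow> c = dl x * sg (int l - NB x)) \<and>
    (even (D x) \<longrightarrow> odd (D ?X) \<longrightarrow> c = dl ?X * sg (int l - NB ?X)) \<and>
    (even (D x) \<longrightarrow> even (D ?X) \<longrightarrow> D x \<noteq> 0 \<longrightarrow> (\<exists>x1\<le>x. odd (Sb (x1 - 1)) \<and> (\<forall>y. x1 \<le> y \<longrightarrow> y \<le> x \<longrightarrow> even (Sb y)) \<and> c = dl (x1 - 1) * sg (int l - NB (x1 - 1))))"
  proof (cases "D x = 0")
    case True
    have "\<not> (a i \<le> x \<and> x < b i)" if "i \<in> {1..l}" for i
      using a_le[OF that, of x] b_less[OF that, of x] True by (auto simp: D_eq)
    then show ?thesis using True by (intro exI[of _ "dl ?X * sg (int l - NB ?X)"]) auto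
  next
    case nz: False
    then obtain x1 where x1: "x1 \<le> x + 1" "odd (Sb (x1 - 1))" "\<And>y. x1 \<le> y \<Longrightarrow> y \<le> x \<Longrightarrow> even (Sb y)"
      and act: "\<forall>i\<in>{1..l}. a i \<le> x \<longrightarrow> x < b i \<longrightarrow> sg (a i) = dl (x1 - 1) * sg (int l - NB (x1 - 1)) * sg (int i)"
      using I unfolding inv_at_def by blast
    show ?thesis
    proof (cases "odd (D x)")
      case True
      have "x1 = x + 1"
      proof (rule ccontr)
        assume "x1 \<noteq> x + 1"
        then have "even (Sb x)" using x1 by auto
        then show False using True parity_DS by blast
      qed
      then show ?thesis using act True by (intro exI[of _ "dl x * sg (int l - NB x)"]) auto
    next
      case ev: False
      then have xx: "x1 \<le> x" using x1 parity_DS[of x] by (cases "x1 = x + 1") auto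
      show ?thesis
      proof (cases "odd (D ?X)")
        case False
        then show ?thesis using act ev x1 xx
          by (intro exI[of _ "dl (x1 - 1) * sg (int l - NB (x1 - 1))"]) auto
      next
        case True
        have nt: "no_even_tie"
          unfolding no_even_tie_def
        proof (intro allI impI, rule ccontr)
          fix y assume e: "even (Sb y)" and "\<not> Sb (y + 1) - Sb y \<le> 1"
          then have N: "NA (y + 1) = NA y + 1" "NB (y + 1) = NB y + 1" using NA_step[of y] NB_step[of y] by (auto simp: S_eq)
          then have "dl (y + 1) = dl y + sg (y + 1) * 2" using dl_S[of y] by (simp add: S_eq)
          moreover have "even (D y)" "even (D (y + 1))" using e parity_DS[of y] N by (auto simp: D_eq)
          ultimately show False using dle[of y] dle[of "y + 1"] sg_cases[of "y + 1"] by auto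
        qed
        have f: "fc (0, x1) (0, x)" by (rule run_fc) (use x1 xx in auto)
        have "Sb x = Sb x1" by (rule row_induct_const[where f = Sb]) (use x1 xx step_even_bottom[OF nt] in auto)
        then have cong: "NA x = NA x1" "NB x = NB x1" using valid_fc[OF valid f] by (simp_all add: D_eq S_eq)
        have oX: "odd (Sb ?X)" using True parity_DS by blast
        have ex1: "even (Sb x1)" using x1(3)[of x1] xx by simp
        have st1: "NA x1 = NA (x1 - 1) \<or> NA x1 = NA (x1 - 1) + 1" "NB x1 = NB (x1 - 1) \<or> NB x1 = NB (x1 - 1) + 1"
          using NA_step[of "x1 - 1"] NB_step[of "x1 - 1"] by simp_all
        have st2: "NA ?X = NA x1 \<or> NA ?X = NA x1 + 1" "NB ?X = NB x1 \<or> NB ?X = NB x1 + 1"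
          using NA_step[of x] NB_step[of x] cong by simp_all
        have p1: "Sb x1 = Sb (x1 - 1) + 1" "Sb ?X = Sb x1 + 1"
          using parity_step[OF st1] parity_step[OF st2] x1(2) ex1 oX unfolding S_eq by simp_all
        have "D (x1 - 1) = D ?X \<longleftrightarrow> even (?X - x1)"
          using rr[unfolded runrule_def, rule_format, of x1 ?X] x1 xx oX nz cong by (simp add: D_eq)
        moreover have "D (x1 - 1) = D ?X \<longleftrightarrow> odd (NB ?X - NB (x1 - 1))" using st1 st2 p1 unfolding D_eq S_eq by auto
        ultimately have E: "odd (NB ?X - NB (x1 - 1)) \<longleftrightarrow> even (?X - x1)" by simp
        have "dl x1 = dl (x1 - 1) + sg x1" using dl_S[of "x1 - 1"] p1 by simp
        moreover have "dl x1 = 0" using dle[of x1] ex1 parity_DS by blast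
        moreover have "dl ?X = dl x + sg ?X" using dl_S[of x] p1 \<open>Sb x = Sb x1\<close> by simp
        moreover have "dl x = 0" using dle[of x] ev by blast
        ultimately have s: "dl (x1 - 1) = - sg x1" "dl ?X = sg ?X" by auto
        have "dl (x1 - 1) * sg (int l - NB (x1 - 1)) = dl ?X * sg (int l - NB ?X)"
          using s E by (auto simp: sg_def)
        then show ?thesis using act ev True by (intro exI[of _ "dl ?X * sg (int l - NB ?X)"]) auto
      qed
    qed
  qed
  then obtain c where c: "\<And>i. i \<in> {1..l} \<Longrightarrow> a i \<le> x \<Longrightarrow> x < b i \<Longrightarrow> sg (a i) = c * sg (int i)"
    and co: "odd (D x) \<Longrightarrow> c = dl x * sg (int l - NB x)"
    and ce: "even (D x) \<Longrightarrow> odd (D ?X) \<Longrightarrow> c = dl ?X * sg (int l - NB ?X)"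
    and cee: "even (D x) \<Longrightarrow> even (D ?X) \<Longrightarrow> D x \<noteq> 0 \<Longrightarrow> (\<exists>x1\<le>x. odd (Sb (x1 - 1)) \<and> (\<forall>y. x1 \<le> y \<longrightarrow> y \<le> x \<longrightarrow> even (Sb y)) \<and> c = dl (x1 - 1) * sg (int l - NB (x1 - 1)))"
    by blast
  have S2: "Sb ?X - Sb x = NA ?X - NA x + (NB ?X - NB x)" by (simp add: S_eq)
  have dX: "dl ?X = dl x + sg ?X * (NA ?X - NA x + (NB ?X - NB x))" using dl_S[of x] S2 by simp
  \<comment> \<open>a tie only occurs where \<open>D\<close> is odd\<close>
  have sgX_odd: "sg ?X = - dl x" if "odd (D x)" "NA ?X \<noteq> NA x \<or> NB ?X \<noteq> NB x"
    using dX dlo[OF that(1)] that(2) NA_step[of x] NB_step[of x] dl1[of ?X] sg_cases[of ?X] by auto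
  have even_step: "odd (D ?X) \<and> sg ?X = dl ?X" if "even (D x)" "NA ?X \<noteq> NA x \<or> NB ?X \<noteq> NB x"
    using dX dle[OF that(1)] that NA_step[of x] NB_step[of x] dl1[of ?X] sg_cases[of ?X] by (auto simp: D_eq)
  have newA: "int i = int l - NA x \<and> NA ?X = NA x + 1" if "i \<in> {1..l}" "a i = ?X" for i
    using a_le[OF that(1), of x] a_le[OF that(1), of ?X] that(2) NA_step[of x] by auto
  have newB: "int i = int l - NB x \<and> NB ?X = NB x + 1" if "i \<in> {1..l}" "b i = ?X" for i
    using b_le[OF that(1), of x] b_le[OF that(1), of ?X] that(2) NB_step[of x] by auto
  \<comment> \<open>If \<open>b i\<close> is exactly at \<open>x + 1\<close>, then \<open>i\<close>
    is the last index of an interval over \<open>x\<close>, so the recorded sign gives the parity of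
    \<open>a i\<close>.\<close>
  have "odd (b i - a i)" if i: "i \<in> {1..l}" "b i \<le> ?X" for i
  proof (cases "b i \<le> x")
    case True then show ?thesis using I1 i by blast
  next
    case False
    then have bX: "b i = ?X" using i by simp
    note nb = newB[OF i(1) bX]
    have pos: "1 \<le> D x"
    proof (rule ccontr)
      assume "\<not> 1 \<le> D x"
      then have D0: "D x = 0" using nn[of x] by simp
      then have "NA ?X = NA x + 1" using nn[of ?X] nb NA_step[of x] by (auto simp: D_eq)
      then show False using even_step D0 nb by (simp add: D_eq)
    qed
    then have act: "a i \<le> x" "x < b i" using a_le[OF i(1), of x] nb bX by (auto simp: D_eq)
    have "sg (a i) = - sg ?X"
    proof (cases "odd (D x)")
      case True
      then show ?thesis using c[OF i(1) act] co[OF True] sgX_odd[OF True] nb by simp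
    next
      case False
      then have e: "odd (D ?X)" "sg ?X = dl ?X" using even_step nb by auto
      have "sg (int l - NB ?X) = - sg (int i)" using nb by (simp add: sg_def)
      then show ?thesis using c[OF i(1) act] ce e False by simp
    qed
    then show ?thesis using bX sg_eq[of "a i" ?X] sg_cases[of ?X] by auto
  qed
  \<comment> \<open>If \<open>a i\<close> is exactly at \<open>x + 1\<close> and the interval of
    \<open>Suc i\<close> is still open, the recorded sign forces \<open>a (Suc i)\<close> to have
    the parity opposite to that of \<open>x + 1\<close>.\<close>
  moreover have "b (Suc i) \<le> a i" if i: "i \<in> {1..<l}" "a i \<le> ?X" "even (a i - a (Suc i))" for i
  proof (cases "a i \<le> x")
    case True then show ?thesis using I2 i by blast
  next
    case False
    then have aX: "a i = ?X" using i by simp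
    have i': "i \<in> {1..l}" "Suc i \<in> {1..l}" using i by auto
    note na = newA[OF i'(1) aX]
    show ?thesis
    proof (rule ccontr)
      assume "\<not> b (Suc i) \<le> a i"
      then have bS: "x < b (Suc i)" using aX by simp
      have aS: "a (Suc i) \<le> x" using a_decr[OF i'] aX by simp
      have eq: "sg (a (Suc i)) = sg ?X" using i(3) aX sg_eq[of "a (Suc i)" ?X] by auto
      have s: "sg (a (Suc i)) = c * sg (int (Suc i))" by (rule c[OF i'(2) aS bS])
      show False
      proof (cases "odd (D x)")
        case True
        have "sg (int l - NB x) = sg (int (Suc i))"
          unfolding sg_eq using na True by (auto simp: D_eq)
        then have "sg (a (Suc i)) = dl x" using s co[OF True] by simp
        then show False using eq sgX_odd[OF True] na dlo[OF True] by auto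
      next
        case False
        then have e: "odd (D ?X)" "sg ?X = dl ?X" using even_step na by auto
        have "NB ?X = NB x" using na e False NB_step[of x] by (auto simp: D_eq)
        then have "sg (int l - NB ?X) = - sg (int (Suc i))"
          using na False by (auto simp: sg_def D_eq)
        then have "sg (a (Suc i)) = - dl ?X" using s ce e False by simp
        then show False using eq e dlo[OF e(1)] by auto
      qed
    qed
  qed
  moreover have "\<exists>x1\<le>?X + 1. odd (Sb (x1 - 1)) \<and> (\<forall>y. x1 \<le> y \<longrightarrow> y \<le> ?X \<longrightarrow> even (Sb y)) \<and>
      (\<forall>i\<in>{1..l}. a i \<le> ?X \<longrightarrow> ?X < b i \<longrightarrow> sg (a i) = dl (x1 - 1) * sg (int l - NB (x1 - 1)) * sg (int i))" if "D ?X \<noteq> 0"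
  proof -
    have actX: "sg (a i) = c * sg (int i)" if i: "i \<in> {1..l}" "a i \<le> ?X" "?X < b i" for i
    proof (cases "a i \<le> x")
      case True then show ?thesis using c i by simp
    next
      case False
      then have aX: "a i = ?X" using i by simp
      note na = newA[OF i(1) aX]
      show ?thesis
      proof (cases "odd (D x)")
        case True
        have "sg (int l - NB x) = - sg (int i)" using na True by (auto simp: sg_def D_eq)
        then show ?thesis using aX co[OF True] sgX_odd[OF True] na by simp
      next
        case False
        then have e: "odd (D ?X)" "sg ?X = dl ?X" using even_step na by auto
        have "NB ?X = NB x" using na e False NB_step[of x] by (auto simp: D_eq)
        then have "sg (int l - NB ?X) = sg (int i)" unfolding sg_eq using na False by (auto simp: D_eq)
        then show ?thesis using aX ce e False by simp
      qed
    qed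
    show ?thesis
    proof (cases "odd (D ?X)")
      case oX: True
      have "c = dl ?X * sg (int l - NB ?X)"
      proof (cases "odd (D x)")
        case True
        have "NA ?X = NA x \<and> NB ?X = NB x \<or> NA ?X = NA x + 1 \<and> NB ?X = NB x + 1"
          using NA_step[of x] NB_step[of x] True oX by (auto simp: D_eq)
        then show ?thesis
        proof
          assume "NA ?X = NA x \<and> NB ?X = NB x"
          then show ?thesis using co[OF True] dX by simp
        next
          assume t: "NA ?X = NA x + 1 \<and> NB ?X = NB x + 1"
          then have "sg (int l - NB ?X) = - sg (int l - NB x)" "dl ?X = - dl x"
            using dX sgX_odd[OF True] by (auto simp: sg_def)
          then show ?thesis using co[OF True] by simp
        qed
      qed (use ce oX in blast)
      moreover have "?X + 1 - 1 = ?X" by simp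
      ultimately show ?thesis using actX oX parity_DS[of ?X]
        by (intro exI[of _ "?X + 1"]) (simp only: order_refl, auto)
    next
      case eX: False
      show ?thesis
      proof (cases "odd (D x)")
        case True
        then show ?thesis using actX co[OF True] eX parity_DS[of x] parity_DS[of ?X]
          by (intro exI[of _ "?X"]) auto
      next
        case False
        have "D x \<noteq> 0"
        proof
          assume "D x = 0"
          moreover have "NA ?X = NA x \<and> NB ?X = NB x" using even_step False eX by blast
          ultimately show False using that by (simp add: D_eq)
        qed
        then obtain x1 where "x1 \<le> x" "odd (Sb (x1 - 1))" "\<forall>y. x1 \<le> y \<longrightarrow> y \<le> x \<longrightarrow> even (Sb y)"
          "c = dl (x1 - 1) * sg (int l - NB (x1 - 1))" using cee False eX by blast
        moreover have "even (Sb ?X)" using eX parity_DS by blast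
        moreover have "y \<le> x \<or> y = ?X" if "y \<le> ?X" for y using that by linarith
        ultimately show ?thesis using actX by (intro exI[of _ x1]) (auto; metis)
      qed
    qed
  qed
  ultimately show ?thesis unfolding inv_at_def by blast
qed

lemma goodP_iff: "goodP \<longleftrightarrow> (\<forall>x. 0 \<le> D x) \<and> (\<forall>x. \<bar>dl x\<bar> \<le> 1) \<and> runrule (hgt n l A B)"
proof
  assume "goodP"
  then show "(\<forall>x. 0 \<le> D x) \<and> (\<forall>x. \<bar>dl x\<bar> \<le> 1) \<and> runrule (hgt n l A B)"
    using goodP_nonneg goodP_forward by blast
next
  assume h: "(\<forall>x. 0 \<le> D x) \<and> (\<forall>x. \<bar>dl x\<bar> \<le> 1) \<and> runrule (hgt n l A B)"
  have inv: "inv_at x" for x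
  proof (rule bottom_induct[of inv_at])
    fix x assume z: "NA x = 0" "NB x = 0"
    then have "\<not> a i \<le> x" "\<not> b i \<le> x" if "i \<in> {1..l}" for i using a_le[OF that, of x] b_le[OF that, of x] that by auto
    then show "inv_at x" unfolding inv_at_def using z by (auto simp: D_eq)
  qed (use h invI in blast)
  show "goodP"
    unfolding goodP_def
  proof (intro conjI ballI impI)
    fix i assume i: "i \<in> {1..l}"
    show o: "odd (b i - a i)" using inv[of "b i"] i unfolding inv_at_def by blast
    have "int l + 1 - int i \<le> NB (b i)" using b_le[OF i, of "b i"] by simp
    then have "int l + 1 - int i \<le> NA (b i)" using h[THEN conjunct1, rule_format, of "b i"] by (simp add: D_eq)
    then have "a i \<le> b i" using a_le[OF i] by simp
    then show "a i < b i" using o by (cases "a i = b i") auto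
  next
    fix i assume i: "i \<in> {1..<l}" "even (a i - a (Suc i))"
    then show "b (Suc i) \<le> a i" using inv[of "a i"] unfolding inv_at_def by blast
  qed
qed

lemma good2_iff: "(\<exists>\<sigma>. good2 \<sigma>) \<longleftrightarrow> (\<forall>x. D x \<in> {0, 1, 2} \<and> \<bar>dl x\<bar> \<le> 1)"
  using good2_forward good2_backward by blast

text \<open>At an even node \<open>dl\<close> is 0, and a tie would move it to 2 or -2.\<close>

lemma no_even_tieI: "(\<And>x. \<bar>dl x\<bar> \<le> 1) \<Longrightarrow> no_even_tie"
  unfolding no_even_tie_def
proof (intro allI impI, rule ccontr)
  fix y assume h: "\<And>x. \<bar>dl x\<bar> \<le> 1" and e: "even (Sb y)" and "\<not> Sb (y + 1) - Sb y \<le> 1"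
  then have N: "NA (y + 1) = NA y + 1" "NB (y + 1) = NB y + 1" using NA_step[of y] NB_step[of y] by (auto simp: S_eq)
  then have "dl (y + 1) = dl y + sg (y + 1) * 2" using dl_S[of y] by (simp add: S_eq)
  moreover have "even (dl y)" using e parity_DS[of y] parity_dl[of y] by blast
  moreover have "- 1 \<le> dl y" "dl y \<le> 1" "- 1 \<le> dl (y + 1)" "dl (y + 1) \<le> 1" using h[of y] h[of "y + 1"] by linarith+
  ultimately show False using sg_cases[of "y + 1"] by presburger
qed

end

section \<open>Tuples of paths\<close>

lemma conj_antimono:
  assumes "is_partition lam" "1 \<le> i" "i \<le> j"
  shows "conj_partition lam j \<le> conj_partition lam i"
  unfolding conj_partition_def
proof (rule card_mono)
  have "{k. 1 \<le> k \<and> i \<le> lam k} \<subseteq> {k. 1 \<le> k \<and> lam k \<noteq> 0}" using assms(2) by auto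
  then show "finite {k. 1 \<le> k \<and> i \<le> lam k}" using assms(1) unfolding is_partition_def by (meson finite_subset)
qed (use assms in auto)

text \<open>In each row step the difference changes by at most 1, so it cannot change sign without
  vanishing.\<close>

lemma order_keep:
  fixes f g :: "nat \<Rightarrow> int"
  assumes f: "\<And>r. r < n \<Longrightarrow> f (Suc r) = f r \<or> f (Suc r) = f r + 1"
    and g: "\<And>r. r < n \<Longrightarrow> g (Suc r) = g r \<or> g (Suc r) = g r + 1"
    and top: "g n < f n" and ne: "\<And>r. r \<le> n \<Longrightarrow> f r \<noteq> g r" and r: "r \<le> n"
  shows "g r < f r"
  using r
proof (induction r rule: inc_induct)
  case base show ?case by (rule top)
next
  case (step r)
  then show ?case using f[of r] g[of r] ne[of r] by auto
qed

lemma fams_adjI: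
  assumes st: "\<And>i r. i \<in> {1..l} \<Longrightarrow> r < n \<Longrightarrow> A i (Suc r) = A i r \<or> A i (Suc r) = A i r + 1"
    and adj: "\<And>i r. i \<in> {1..<l} \<Longrightarrow> r \<le> n \<Longrightarrow> A (Suc i) r < A i r"
  shows "fams n l A"
  unfolding fams_def
proof (intro conjI ballI allI impI)
  fix i r assume "i \<in> {1..l}" "r < n"
  then show "A i (Suc r) - A i r \<in> {0, 1}" using st[of i r] by auto
next
  fix r i j assume *: "r \<le> n" "1 \<le> i" "i < j" "j \<le> l"
  have "Suc i \<le> j" using * by simp
  then have "j \<le> l \<longrightarrow> A j r < A i r"
  proof (induction j rule: dec_induct)
    case base then show ?case using adj[of i r] * by auto
  next
    case (step k)
    then show ?case using adj[of k r] * by auto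
  qed
  then show "A j r < A i r" using * by blast
qed

definition src :: "nat \<Rightarrow> (nat \<Rightarrow> nat) \<Rightarrow> (nat \<Rightarrow> path) \<Rightarrow> nat \<Rightarrow> nat" where
  "src n lam p j = (THE i. i \<in> {1..lam 1} \<and> endpoint (p i) = v_pt n lam j)"

definition fa :: "nat \<Rightarrow> (nat \<Rightarrow> path) \<Rightarrow> nat \<Rightarrow> nat \<Rightarrow> int" where
  "fa n p i r = low n (p i) r"

definition fb :: "nat \<Rightarrow> (nat \<Rightarrow> nat) \<Rightarrow> (nat \<Rightarrow> path) \<Rightarrow> nat \<Rightarrow> nat \<Rightarrow> int" where
  "fb n lam p j r = upp n (p (src n lam p j)) r"

text \<open>The prescribed start points in the coordinate \<open>low\<close> at row
  \<open>n\<close>; \<open>topb\<close> does the same for the end points and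
  \<open>upp\<close>.\<close>

definition topa :: "nat \<Rightarrow> (nat \<Rightarrow> nat) \<Rightarrow> nat \<Rightarrow> int" where
  "topa n mu i = int (conj_partition mu i) - int i + int n"

definition topb :: "(nat \<Rightarrow> nat) \<Rightarrow> nat \<Rightarrow> int" where
  "topb lam i = int (conj_partition lam i) + 1 - int i"

lemma u_pt_iff: "is_path n q \<Longrightarrow> 0 < n \<Longrightarrow> fst q = u_pt n mu i \<longleftrightarrow> low n q n = topa n mu i"
  by (auto simp: path_start u_pt_def topa_def)

lemma v_pt_iff: "is_path n q \<Longrightarrow> 0 < n \<Longrightarrow> endpoint q = v_pt n lam i \<longleftrightarrow> upp n q n = topb lam i"
  by (auto simp: path_end v_pt_def topb_def)

locale diagram =
  fixes n :: nat and lam mu :: "nat \<Rightarrow> nat"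
  assumes n0: "0 < n" and skew: "skew_diagram lam mu" and pos: "positivity n lam mu"
begin

abbreviation "l \<equiv> lam 1"

lemma topa_less: "1 \<le> i \<Longrightarrow> i < j \<Longrightarrow> topa n mu j < topa n mu i"
  using conj_antimono[of mu i j] skew by (simp add: topa_def skew_diagram_def)

lemma topb_less: "1 \<le> i \<Longrightarrow> i < j \<Longrightarrow> topb lam j < topb lam i"
  using conj_antimono[of lam i j] skew by (simp add: topb_def skew_diagram_def)

text \<open>Here positivity enters: it will bound the heights on the top row by 1, as the folding
  argument requires.\<close>

lemma top_pos: "i \<in> {1..<l} \<Longrightarrow> topb lam (Suc i) \<le> topa n mu i"
proof -
  assume "i \<in> {1..<l}"
  then have "int (conj_partition lam (i + 1)) - int (conj_partition mu i) \<le> int n"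
    using pos unfolding positivity_def by blast
  then show ?thesis by (simp add: topa_def topb_def)
qed

context
  fixes \<sigma> p assumes perm: "\<sigma> permutes {1..l}" and p: "p \<in> tuples_perm \<sigma> n lam mu"
begin

lemma p_path: "i \<in> {1..l} \<Longrightarrow> is_path n (p i)"
  and p_start: "i \<in> {1..l} \<Longrightarrow> fst (p i) = u_pt n mu i"
  and p_end: "i \<in> {1..l} \<Longrightarrow> endpoint (p i) = v_pt n lam (\<sigma> i)"
  and p_ext: "i \<notin> {1..l} \<Longrightarrow> p i = undefined"
  using p by (auto simp: tuples_perm_def PiE_def Pi_def extensional_def)

lemma \<sigma>_in: "i \<in> {1..l} \<Longrightarrow> \<sigma> i \<in> {1..l}"
  using permutes_in_image[OF perm] by blast

lemma src_\<sigma>: "i \<in> {1..l} \<Longrightarrow> src n lam p (\<sigma> i) = i"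
  unfolding src_def
proof (rule the_equality)
  assume i: "i \<in> {1..l}"
  then show "i \<in> {1..l} \<and> endpoint (p i) = v_pt n lam (\<sigma> i)" using p_end by simp
  fix k assume k: "k \<in> {1..l} \<and> endpoint (p k) = v_pt n lam (\<sigma> i)"
  then have "v_pt n lam (\<sigma> k) = v_pt n lam (\<sigma> i)" using p_end[of k] by simp
  moreover have "inj_on (v_pt n lam) {1..l}" using v_pt_inj skew by (simp add: skew_diagram_def)
  ultimately have "\<sigma> k = \<sigma> i" using \<sigma>_in k i by (meson inj_onD)
  then show "k = i" using permutes_inj[OF perm] by (meson injD)
qed

lemma src_in: "j \<in> {1..l} \<Longrightarrow> src n lam p j \<in> {1..l} \<and> \<sigma> (src n lam p j) = j"
proof -
  assume "j \<in> {1..l}"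
  then obtain i where "i \<in> {1..l}" "j = \<sigma> i" using permutes_image[OF perm] by blast
  then show ?thesis using src_\<sigma> by simp
qed

lemma fb_\<sigma>: "i \<in> {1..l} \<Longrightarrow> fb n lam p (\<sigma> i) r = upp n (p i) r"
  by (simp add: fb_def src_\<sigma>)

lemma fa_top: "i \<in> {1..l} \<Longrightarrow> fa n p i n = topa n mu i"
  using u_pt_iff[OF p_path n0, of i mu i] p_start[of i] by (simp add: fa_def)

lemma fb_top: "j \<in> {1..l} \<Longrightarrow> fb n lam p j n = topb lam j"
  using v_pt_iff[OF p_path n0, of "src n lam p j" lam j] p_end[of "src n lam p j"] src_in[of j] by (simp add: fb_def)

lemma fa_step: "i \<in> {1..l} \<Longrightarrow> r < n \<Longrightarrow> fa n p i (Suc r) = fa n p i r \<or> fa n p i (Suc r) = fa n p i r + 1"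
  using low_step[OF p_path n0] by (simp add: fa_def)

lemma fb_step: "j \<in> {1..l} \<Longrightarrow> r < n \<Longrightarrow> fb n lam p j (Suc r) = fb n lam p j r \<or> fb n lam p j (Suc r) = fb n lam p j r + 1"
  using upp_step[OF p_path n0] src_in[of j] by (simp add: fb_def)

lemma fab: "i \<in> {1..l} \<Longrightarrow> fa n p i 0 < fb n lam p (\<sigma> i) 0"
  "i \<in> {1..l} \<Longrightarrow> odd (fb n lam p (\<sigma> i) 0 - fa n p i 0)"
proof -
  assume i: "i \<in> {1..l}"
  note e = num_E_upp[OF p_path[OF i] n0]
  then show "fa n p i 0 < fb n lam p (\<sigma> i) 0" using i by (simp add: fa_def fb_\<sigma>)
  have "even (int (num_E (p i)))" using even_num_E[OF p_path[OF i] n0] by simp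
  then show "odd (fb n lam p (\<sigma> i) 0 - fa n p i 0)" using e i by (simp add: fa_def fb_\<sigma>)
qed

lemma ord_iff:
  assumes "i \<in> {1..l}" "j \<in> {1..l}"
  shows "ordinarily_intersecting (p i) (p j) \<longleftrightarrow> (\<exists>r\<in>{1..n}. fa n p i r = fa n p j r) \<or>
    (\<exists>r\<in>{1..n}. fb n lam p (\<sigma> i) r = fb n lam p (\<sigma> j) r) \<or>
    (even (fa n p i 0 - fa n p j 0) \<and> max (fa n p i 0) (fa n p j 0) < min (fb n lam p (\<sigma> i) 0) (fb n lam p (\<sigma> j) 0))"
  using ordinarily_iff[OF n0 p_path[OF assms(1)] p_path[OF assms(2)]] assms by (simp add: fa_def fb_\<sigma>)

text \<open>Row 0 is not listed in \<open>ord_iff\<close>. Two paths that agree there in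
  \<open>low\<close> or in \<open>upp\<close> have starts of equal parity and overlapping intervals,
  so they intersect ordinarily.\<close>

lemma not_ordD:
  assumes ij: "i \<in> {1..l}" "j \<in> {1..l}" and no: "\<not> ordinarily_intersecting (p i) (p j)" and r: "r \<le> n"
  shows "fa n p i r \<noteq> fa n p j r" "fb n lam p (\<sigma> i) r \<noteq> fb n lam p (\<sigma> j) r"
proof -
  have M: "\<not> (even (fa n p i 0 - fa n p j 0) \<and> max (fa n p i 0) (fa n p j 0) < min (fb n lam p (\<sigma> i) 0) (fb n lam p (\<sigma> j) 0))"
    and L: "\<forall>r\<in>{1..n}. fa n p i r \<noteq> fa n p j r" and U: "\<forall>r\<in>{1..n}. fb n lam p (\<sigma> i) r \<noteq> fb n lam p (\<sigma> j) r"
    using no ord_iff[OF ij] by blast+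
  have "fa n p i 0 \<noteq> fa n p j 0" using M fab(1)[OF ij(1)] fab(1)[OF ij(2)] by auto
  then show "fa n p i r \<noteq> fa n p j r" using L r by (cases "r = 0") auto
  have "fb n lam p (\<sigma> i) 0 \<noteq> fb n lam p (\<sigma> j) 0"
  proof
    assume eq: "fb n lam p (\<sigma> i) 0 = fb n lam p (\<sigma> j) 0"
    then have "even (fa n p i 0 - fa n p j 0)" using fab(2)[OF ij(1)] fab(2)[OF ij(2)] by simp
    then show False using M eq fab(1)[OF ij(1)] fab(1)[OF ij(2)] by simp
  qed
  then show "fb n lam p (\<sigma> i) r \<noteq> fb n lam p (\<sigma> j) r" using U r by (cases "r = 0") auto
qed

text \<open>The order on row \<open>n\<close> is that of the prescribed points. Members that never
  meet keep it down to row 0, which turns disjointness of pairs into the ordered families of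
  \<open>fams\<close>.\<close>

lemma no_ord_iff2:
  "(\<forall>i\<in>{1..l}. \<forall>j\<in>{1..l}. i \<noteq> j \<longrightarrow> \<not> ordinarily_intersecting (p i) (p j)) \<longleftrightarrow>
    fams n l (fa n p) \<and> fams n l (fb n lam p) \<and> two_fams.good2 l (fa n p) (fb n lam p) \<sigma>"
proof
  assume no: "\<forall>i\<in>{1..l}. \<forall>j\<in>{1..l}. i \<noteq> j \<longrightarrow> \<not> ordinarily_intersecting (p i) (p j)"
  have A: "fams n l (fa n p)"
  proof (rule fams_adjI)
    fix i r assume i: "i \<in> {1..<l}" and r: "r \<le> n"
    then have i': "i \<in> {1..l}" "Suc i \<in> {1..l}" by auto
    have t: "fa n p (Suc i) n < fa n p i n" using fa_top[OF i'(1)] fa_top[OF i'(2)] topa_less[of i "Suc i"] i by simp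
    have no': "\<not> ordinarily_intersecting (p i) (p (Suc i))" using no i' by simp
    show "fa n p (Suc i) r < fa n p i r"
      by (rule order_keep[where f = "fa n p i"])
        (erule fa_step[OF i'(1)] | erule fa_step[OF i'(2)] | rule t | erule not_ordD(1)[OF i' no'] | rule r)+
  qed (rule fa_step)
  have B: "fams n l (fb n lam p)"
  proof (rule fams_adjI)
    fix i r assume i: "i \<in> {1..<l}" "r \<le> n"
    then have i': "i \<in> {1..l}" "Suc i \<in> {1..l}" by auto
    note s = src_in[OF i'(1)] src_in[OF i'(2)]
    have "src n lam p i \<noteq> src n lam p (Suc i)" using s by force
    then have ne: "fb n lam p i r \<noteq> fb n lam p (Suc i) r" if "r \<le> n" for r
      using no not_ordD(2)[of "src n lam p i" "src n lam p (Suc i)" r] s that by metis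
    have t: "fb n lam p (Suc i) n < fb n lam p i n" using fb_top[OF i'(1)] fb_top[OF i'(2)] topb_less[of i "Suc i"] i by simp
    show "fb n lam p (Suc i) r < fb n lam p i r"
      by (rule order_keep[where f = "fb n lam p i"])
        (erule fb_step[OF i'(1)] | erule fb_step[OF i'(2)] | rule t | erule ne | rule i(2))+
  qed (rule fb_step)
  interpret two_fams n l "fa n p" "fb n lam p" by (rule two_fams.intro[OF n0 A B])
  have "good2 \<sigma>" unfolding good2_def using perm fab no ord_iff by blast
  then show "fams n l (fa n p) \<and> fams n l (fb n lam p) \<and> good2 \<sigma>" using A B by blast
next
  assume h: "fams n l (fa n p) \<and> fams n l (fb n lam p) \<and> two_fams.good2 l (fa n p) (fb n lam p) \<sigma>"
  then interpret two_fams n l "fa n p" "fb n lam p" using two_fams.intro[OF n0] by blast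
  show "\<forall>i\<in>{1..l}. \<forall>j\<in>{1..l}. i \<noteq> j \<longrightarrow> \<not> ordinarily_intersecting (p i) (p j)"
  proof (intro ballI impI notI)
    fix i j assume ij: "i \<in> {1..l}" "j \<in> {1..l}" "i \<noteq> j" and o: "ordinarily_intersecting (p i) (p j)"
    have "\<sigma> i \<noteq> \<sigma> j" using permutes_inj[OF perm] ij(3) by (meson injD)
    then have "fb n lam p (\<sigma> i) r \<noteq> fb n lam p (\<sigma> j) r" if "r \<le> n" for r
      using fams_inj[OF fB that] \<sigma>_in ij by blast
    moreover have "fa n p i r \<noteq> fa n p j r" if "r \<le> n" for r
      using fams_inj[OF fA that] ij by blast
    ultimately show False using o h ij unfolding ord_iff[OF ij(1,2)] good2_def by auto
  qed
qed

end

text \<open>With \<sigma> the identity, neighbours in both families belong to neighbouring paths, so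
  the ban on adjacent ordinary intersections already orders the families; intervals at height 0
  remain controlled for neighbours only.\<close>

lemma no_ord_iffP:
  assumes p: "p \<in> tuples_perm id n lam mu"
  shows "(\<forall>i\<in>{1..<l}. \<not> ordinarily_intersecting (p i) (p (i + 1))) \<longleftrightarrow>
    fams n l (fa n p) \<and> fams n l (fb n lam p) \<and> two_fams.goodP l (fa n p) (fb n lam p)"
proof
  have perm: "id permutes {1..l}" by simp
  note ord = ord_iff[OF perm p, unfolded id_apply] and nD = not_ordD[OF perm p, unfolded id_apply]
    and ab = fab[OF perm p, unfolded id_apply]
  {
    assume no: "\<forall>i\<in>{1..<l}. \<not> ordinarily_intersecting (p i) (p (i + 1))"
    have A: "fams n l (fa n p)"
    proof (rule fams_adjI)
      fix i r assume i: "i \<in> {1..<l}" and r: "r \<le> n"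
      then have i': "i \<in> {1..l}" "Suc i \<in> {1..l}" by auto
      have t: "fa n p (Suc i) n < fa n p i n"
        using fa_top[OF perm p i'(1)] fa_top[OF perm p i'(2)] topa_less[of i "Suc i"] i by simp
      have no': "\<not> ordinarily_intersecting (p i) (p (Suc i))" using no i by simp
      show "fa n p (Suc i) r < fa n p i r"
        by (rule order_keep[where f = "fa n p i"])
          (erule fa_step[OF perm p i'(1)] | erule fa_step[OF perm p i'(2)] | rule t | erule nD(1)[OF i' no'] | rule r)+
    qed (rule fa_step[OF perm p])
    have B: "fams n l (fb n lam p)"
    proof (rule fams_adjI)
      fix i r assume i: "i \<in> {1..<l}" and r: "r \<le> n"
      then have i': "i \<in> {1..l}" "Suc i \<in> {1..l}" by auto
      have t: "fb n lam p (Suc i) n < fb n lam p i n"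
        using fb_top[OF perm p i'(1)] fb_top[OF perm p i'(2)] topb_less[of i "Suc i"] i by simp
      have no': "\<not> ordinarily_intersecting (p i) (p (Suc i))" using no i by simp
      show "fb n lam p (Suc i) r < fb n lam p i r"
        by (rule order_keep[where f = "fb n lam p i"])
          (erule fb_step[OF perm p i'(1)] | erule fb_step[OF perm p i'(2)] | rule t | erule nD(2)[OF i' no'] | rule r)+
    qed (rule fb_step[OF perm p])
    interpret two_fams n l "fa n p" "fb n lam p" by (rule two_fams.intro[OF n0 A B])
    have "goodP"
      unfolding goodP_def
    proof (intro conjI ballI impI)
      fix i assume i: "i \<in> {1..<l}" "even (fa n p i 0 - fa n p (Suc i) 0)"
      then have i': "i \<in> {1..l}" "Suc i \<in> {1..l}" by auto
      have "\<not> max (fa n p i 0) (fa n p (Suc i) 0) < min (fb n lam p i 0) (fb n lam p (Suc i) 0)"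
        using no i ord[OF i'] by auto
      then show "fb n lam p (Suc i) 0 \<le> fa n p i 0"
        using a_decr[OF i'] b_decr[OF i'] ab(1)[OF i'(1)] by auto
    qed (use ab in blast)+
    then show "fams n l (fa n p) \<and> fams n l (fb n lam p) \<and> goodP" using A B by blast
  }
  assume h: "fams n l (fa n p) \<and> fams n l (fb n lam p) \<and> two_fams.goodP l (fa n p) (fb n lam p)"
  then interpret two_fams n l "fa n p" "fb n lam p" using two_fams.intro[OF n0] by blast
  show "\<forall>i\<in>{1..<l}. \<not> ordinarily_intersecting (p i) (p (i + 1))"
  proof (intro ballI notI)
    fix i assume i: "i \<in> {1..<l}" and o: "ordinarily_intersecting (p i) (p (i + 1))"
    then have i': "i \<in> {1..l}" "Suc i \<in> {1..l}" by auto
    have "fa n p i r \<noteq> fa n p (Suc i) r" "fb n lam p i r \<noteq> fb n lam p (Suc i) r" if "r \<le> n" for r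
      using fams_inj[OF fA that i'] fams_inj[OF fB that i'] by auto
    then have "even (fa n p i 0 - fa n p (Suc i) 0)"
      "max (fa n p i 0) (fa n p (Suc i) 0) < min (fb n lam p i 0) (fb n lam p (Suc i) 0)"
      using o ord[OF i'] by auto
    moreover have "fb n lam p (Suc i) 0 \<le> fa n p i 0" using h i calculation(1) unfolding goodP_def by blast
    ultimately show False by simp
  qed
qed

lemma realize_tuple:
  assumes A: "\<And>i r. i \<in> {1..l} \<Longrightarrow> r < n \<Longrightarrow> A i (Suc r) - A i r \<in> {0, 1}"
    and B: "\<And>i r. i \<in> {1..l} \<Longrightarrow> r < n \<Longrightarrow> B i (Suc r) - B i r \<in> {0, 1}"
    and top: "\<And>i. i \<in> {1..l} \<Longrightarrow> A i n = topa n mu i" "\<And>i. i \<in> {1..l} \<Longrightarrow> B i n = topb lam i"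
    and perm: "\<sigma> permutes {1..l}"
    and ab: "\<And>i. i \<in> {1..l} \<Longrightarrow> A i 0 < B (\<sigma> i) 0 \<and> odd (B (\<sigma> i) 0 - A i 0)"
  obtains p where "p \<in> tuples_perm \<sigma> n lam mu" "\<And>i r. i \<in> {1..l} \<Longrightarrow> r \<le> n \<Longrightarrow> fa n p i r = A i r"
    "\<And>i r. i \<in> {1..l} \<Longrightarrow> r \<le> n \<Longrightarrow> fb n lam p i r = B i r"
proof -
  define p where "p = (\<lambda>i\<in>{1..l}. mkpath n (A i) (B (\<sigma> i)))"
  have \<sigma>: "\<sigma> i \<in> {1..l}" if "i \<in> {1..l}" for i using permutes_in_image[OF perm] that by blast
  have m: "is_path n (p i)" "\<And>r. r \<le> n \<Longrightarrow> low n (p i) r = A i r" "\<And>r. r \<le> n \<Longrightarrow> upp n (p i) r = B (\<sigma> i) r"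
    if i: "i \<in> {1..l}" for i
    using mkpath_path[OF n0, of "A i" "B (\<sigma> i)"] A[OF i] B[OF \<sigma>[OF i]] ab[OF i] i by (auto simp: p_def)
  have mem: "p \<in> tuples_perm \<sigma> n lam mu"
    unfolding tuples_perm_def
  proof (rule PiE_I)
    fix i assume i: "i \<in> {1..l}"
    show "p i \<in> {q. is_path n q \<and> fst q = u_pt n mu i \<and> endpoint q = v_pt n lam (\<sigma> i)}"
      using m[OF i] u_pt_iff[OF m(1)[OF i] n0] v_pt_iff[OF m(1)[OF i] n0] top(1)[OF i] top(2)[OF \<sigma>[OF i]] by simp
  qed (auto simp: p_def)
  show ?thesis
  proof (rule that[OF mem])
    show "fa n p i r = A i r" if "i \<in> {1..l}" "r \<le> n" for i r using m(2)[OF that] by (simp add: fa_def)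
    show "fb n lam p j r = B j r" if j: "j \<in> {1..l}" "r \<le> n" for j r
      using m(3)[of "src n lam p j" r] src_in[OF perm mem j(1)] j(2) by (simp add: fb_def)
  qed
qed

lemma tuple_unique:
  assumes perm: "\<sigma> permutes {1..l}" and p: "p \<in> tuples_perm \<sigma> n lam mu" and p': "p' \<in> tuples_perm \<sigma> n lam mu"
    and a: "\<And>i r. i \<in> {1..l} \<Longrightarrow> r \<le> n \<Longrightarrow> fa n p i r = fa n p' i r"
    and b: "\<And>i r. i \<in> {1..l} \<Longrightarrow> r \<le> n \<Longrightarrow> fb n lam p i r = fb n lam p' i r"
  shows "p = p'"
proof
  fix i
  show "p i = p' i"
  proof (cases "i \<in> {1..l}")
    case True
    have "low n (p i) r = low n (p' i) r" "upp n (p i) r = upp n (p' i) r" if "r \<le> n" for r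
      using a[OF True that] b[OF \<sigma>_in[OF perm p True] that] fb_\<sigma>[OF perm p True] fb_\<sigma>[OF perm p' True]
      by (simp_all add: fa_def)
    then have "mkpath n (low n (p i)) (upp n (p i)) = mkpath n (low n (p' i)) (upp n (p' i))"
      by (simp add: mkpath_def)
    then show ?thesis
      using path_eq_mkpath[OF p_path[OF perm p True] n0] path_eq_mkpath[OF p_path[OF perm p' True] n0] by simp
  next
    case False
    then show ?thesis using p_ext[OF perm p] p_ext[OF perm p'] by simp
  qed
qed

end

section \<open>Units\<close>

definition unit_plus :: "node \<Rightarrow> strip_unit" where
  "unit_plus v = (S_plus, (snd v, int (fst v) - snd v))"

text \<open>The dual of a unit in the upper strip, under which \<open>\<alpha>\<close> and \<open>\<beta>\<close> get interchanged with
  their duals.\<close>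

definition unit_minus :: "node \<Rightarrow> strip_unit" where
  "unit_minus v = (S_minus, (snd v - int (fst v) + 1, - snd v - 1))"

lemma square_subset:
  "square (x, y) \<subseteq> {w. u \<le> ht w \<and> ht w \<le> v} \<longleftrightarrow> u \<le> real_of_int (x + y) - 1 \<and> real_of_int (x + y) + 1 \<le> v"
proof
  assume h: "square (x, y) \<subseteq> {w. u \<le> ht w \<and> ht w \<le> v}"
  have "(real_of_int x, real_of_int y - 1) \<in> square (x, y)" "(real_of_int x + 1, real_of_int y) \<in> square (x, y)"
    by (auto simp: square_def)
  then have "u \<le> real_of_int x + (real_of_int y - 1)" "real_of_int x + 1 + real_of_int y \<le> v"
    using h by (auto simp: ht_def)
  then show "u \<le> real_of_int (x + y) - 1 \<and> real_of_int (x + y) + 1 \<le> v" by simp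
next
  assume "u \<le> real_of_int (x + y) - 1 \<and> real_of_int (x + y) + 1 \<le> v"
  then show "square (x, y) \<subseteq> {w. u \<le> ht w \<and> ht w \<le> v}" by (auto simp: square_def ht_def)
qed

text \<open>Full squares account for the heights strictly between 0 and \<open>n\<close>, half
  squares for 0 and \<open>n\<close> themselves. Each strip thus has one unit per node, and the
  lower one is a reflected copy of the upper one.\<close>

lemma is_unit_iff:
  assumes n: "0 < n"
  shows "is_unit n U \<longleftrightarrow> (\<exists>v. fst v \<le> n \<and> (U = unit_plus v \<or> U = unit_minus v))"
proof -
  obtain s x y where U: "U = (s, (x, y))" by (metis surj_pair)
  show ?thesis
  proof (cases s)
    case S_plus
    have "is_unit n U \<longleftrightarrow> (0 \<le> real_of_int (x + y) - 1 \<and> real_of_int (x + y) + 1 \<le> real n) \<or> x + y = 0 \<or> x + y = int n"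
      unfolding is_unit_def U S_plus fst_conv snd_conv strip_set.simps square_subset by (simp add: ht_def)
    then have "is_unit n U \<longleftrightarrow> 0 \<le> x + y \<and> x + y \<le> int n" using n by linarith
    moreover have "U = unit_plus v \<longleftrightarrow> snd v = x \<and> int (fst v) = x + y" for v
      unfolding U S_plus unit_plus_def by auto
    moreover have "U \<noteq> unit_minus v" for v unfolding U S_plus unit_minus_def by simp
    ultimately show ?thesis by (auto intro!: exI[of _ "nat (x + y)"])
  next
    case S_minus
    have "is_unit n U \<longleftrightarrow> (- real n \<le> real_of_int (x + y) - 1 \<and> real_of_int (x + y) + 1 \<le> 0) \<or> x + y = - int n \<or> x + y = 0"
      unfolding is_unit_def U S_minus fst_conv snd_conv strip_set.simps square_subset by (simp add: ht_def)
    then have "is_unit n U \<longleftrightarrow> - int n \<le> x + y \<and> x + y \<le> 0" using n by linarith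
    moreover have "U = unit_minus v \<longleftrightarrow> snd v = - y - 1 \<and> int (fst v) = - (x + y)" for v
      unfolding U S_minus unit_minus_def by auto
    moreover have "U \<noteq> unit_plus v" for v unfolding U S_minus unit_plus_def by simp
    ultimately show ?thesis by (auto intro!: exI[of _ "nat (- (x + y))"])
  qed
qed

lemma unit_ht_node: "unit_ht (unit_plus v) = int (fst v)" "unit_ht (unit_minus v) = - int (fst v)"
  by (simp_all add: unit_ht_def unit_plus_def unit_minus_def ht_def)

lemma unit_inj: "unit_plus v = unit_plus w \<longleftrightarrow> v = w" "unit_minus v = unit_minus w \<longleftrightarrow> v = w" "unit_plus v \<noteq> unit_minus w"
  by (auto simp: unit_plus_def unit_minus_def prod_eq_iff)

lemma unit_vertices_iff:
  "(s', w) \<in> unit_vertices n (s, (x, y)) \<longleftrightarrow> s' = s \<and> w \<in> {(x, y), (x + 1, y - 1), (x + 1, y), (x, y - 1)} \<and>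
    rpt w \<in> strip_set n s"
  unfolding unit_vertices_def unit_set_def square_def rpt_def by auto

text \<open>Squares sharing only the top vertex of one and the bottom vertex of the other are not
  adjacent. What remains besides equality are the six neighbours in the triangular lattice, so
  adjacency of units is given by the edges of \<open>step\<close>.\<close>

lemma adjacent_iff:
  assumes "rpt (x, y) \<in> strip_set n s" "rpt (x', y') \<in> strip_set n s"
  shows "adjacent n (s, (x, y)) (s, (x', y')) \<longleftrightarrow>
    x' = x \<and> y' = y \<or> x' = x + 1 \<and> y' = y - 1 \<or> x = x' + 1 \<and> y = y' - 1 \<or>
    x' = x + 1 \<and> y' = y \<or> x = x' + 1 \<and> y = y' \<or> x' = x \<and> y' = y + 1 \<or> x = x' \<and> y = y' + 1"
proof -
  have "rpt (x + 1, y - 1) \<in> strip_set n s" "rpt (x' + 1, y' - 1) \<in> strip_set n s"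
    using assms by (cases s; simp add: rpt_def ht_def)+
  then have "adjacent n (s, (x, y)) (s, (x', y')) \<longleftrightarrow>
    (x, y) \<in> {(x', y'), (x' + 1, y' - 1), (x' + 1, y'), (x', y' - 1)} \<or>
    (x + 1, y - 1) \<in> {(x', y'), (x' + 1, y' - 1), (x' + 1, y'), (x', y' - 1)} \<or>
    (x', y') \<in> {(x, y), (x + 1, y - 1), (x + 1, y), (x, y - 1)} \<or>
    (x' + 1, y' - 1) \<in> {(x, y), (x + 1, y - 1), (x + 1, y), (x, y - 1)}"
    using assms unfolding adjacent_def left_vertex_def right_vertex_def left_point_def right_point_def
      fst_conv snd_conv unit_vertices_iff by simp
  also have "\<dots> \<longleftrightarrow> x' = x \<and> y' = y \<or> x' = x + 1 \<and> y' = y - 1 \<or> x = x' + 1 \<and> y = y' - 1 \<or>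
    x' = x + 1 \<and> y' = y \<or> x = x' + 1 \<and> y = y' \<or> x' = x \<and> y' = y + 1 \<or> x = x' \<and> y = y' + 1"
    unfolding insert_iff empty_iff prod.inject by smt
  finally show ?thesis .
qed

lemma step_iff:
  "r \<le> n \<Longrightarrow> r' \<le> n \<Longrightarrow> (step n (r, x) (r', x') \<or> step n (r', x') (r, x)) \<longleftrightarrow>
    r' = r \<and> x' = x + 1 \<or> r' = r \<and> x = x' + 1 \<or> r' = Suc r \<and> x' = x \<or> r' = Suc r \<and> x' = x + 1 \<or>
    r = Suc r' \<and> x' = x \<or> r = Suc r' \<and> x = x' + 1"
  unfolding step_def by auto

lemma adjacent_plus:
  assumes "fst v \<le> n" "fst w \<le> n"
  shows "adjacent n (unit_plus v) (unit_plus w) \<longleftrightarrow> v = w \<or> step n v w \<or> step n w v"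
proof -
  obtain r x r' x' where vw: "v = (r, x)" "w = (r', x')" by (metis surj_pair)
  have "rpt (x, int r - x) \<in> strip_set n S_plus" "rpt (x', int r' - x') \<in> strip_set n S_plus"
    using assms unfolding vw by (simp_all add: rpt_def ht_def)
  note adj = adjacent_iff[OF this]
  have "adjacent n (unit_plus v) (unit_plus w) \<longleftrightarrow> x' = x \<and> r' = r \<or> x' = x + 1 \<and> r' = r \<or> x = x' + 1 \<and> r = r' \<or>
    x' = x + 1 \<and> r' = Suc r \<or> x = x' + 1 \<and> r = Suc r' \<or> x' = x \<and> r' = Suc r \<or> x = x' \<and> r = Suc r'"
    unfolding vw unit_plus_def fst_conv snd_conv adj by (intro arg_cong2[where f = "(\<or>)"]) linarith+
  then show ?thesis using assms unfolding vw fst_conv by (simp only: step_iff prod.inject) blast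
qed

lemma adjacent_minus:
  assumes "fst v \<le> n" "fst w \<le> n"
  shows "adjacent n (unit_minus v) (unit_minus w) \<longleftrightarrow> v = w \<or> step n v w \<or> step n w v"
proof -
  obtain r x r' x' where vw: "v = (r, x)" "w = (r', x')" by (metis surj_pair)
  have "rpt (x - int r + 1, - x - 1) \<in> strip_set n S_minus" "rpt (x' - int r' + 1, - x' - 1) \<in> strip_set n S_minus"
    using assms unfolding vw by (simp_all add: rpt_def ht_def)
  note adj = adjacent_iff[OF this]
  have "adjacent n (unit_minus v) (unit_minus w) \<longleftrightarrow> x' = x \<and> r' = r \<or> x' = x + 1 \<and> r' = r \<or> x = x' + 1 \<and> r = r' \<or>
    x' = x \<and> r = Suc r' \<or> x = x' \<and> r' = Suc r \<or> x = x' + 1 \<and> r = Suc r' \<or> x' = x + 1 \<and> r' = Suc r"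
    unfolding vw unit_minus_def fst_conv snd_conv adj by (intro arg_cong2[where f = "(\<or>)"]) linarith+
  then show ?thesis using assms unfolding vw fst_conv by (simp only: step_iff prod.inject) blast
qed

lemma adjacent_mixed: "\<not> adjacent n (unit_plus v) (unit_minus w)" "\<not> adjacent n (unit_minus w) (unit_plus v)"
  by (auto simp: adjacent_def left_vertex_def right_vertex_def unit_plus_def unit_minus_def left_point_def right_point_def unit_vertices_iff)

lemma equivclp_image:
  fixes r :: "'a \<Rightarrow> 'a \<Rightarrow> bool" and R :: "'b \<Rightarrow> 'b \<Rightarrow> bool"
  assumes R: "\<And>v w. v \<in> Z \<Longrightarrow> R (h v) w \<longleftrightarrow> (\<exists>u\<in>Z. w = h u \<and> (v = u \<or> r v u))"
    and Rsym: "\<And>x y. R x y \<Longrightarrow> R y x" and inj: "\<And>v w. h v = h w \<Longrightarrow> v = w" and v: "v \<in> Z"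
  shows "equivclp R (h v) w \<longleftrightarrow> (\<exists>u. w = h u \<and> (\<lambda>v w. v \<in> Z \<and> w \<in> Z \<and> r v w)\<^sup>*\<^sup>* v u)"
proof -
  let ?r = "\<lambda>v w. v \<in> Z \<and> w \<in> Z \<and> r v w"
  have sym: "symclp R = R" by (intro ext) (auto simp: symclp_def dest: Rsym)
  show ?thesis
    unfolding equivclp_def sym
  proof
    assume "R\<^sup>*\<^sup>* (h v) w"
    then have "\<exists>u\<in>Z. w = h u \<and> ?r\<^sup>*\<^sup>* v u"
    proof (induction rule: rtranclp_induct)
      case base then show ?case using v by blast
    next
      case (step y z)
      then obtain u where u: "u \<in> Z" "y = h u" "?r\<^sup>*\<^sup>* v u" by blast
      then obtain t where t: "t \<in> Z" "z = h t" "u = t \<or> r u t" using step(2) R[OF u(1)] by blast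
      then show ?case using u by (metis (no_types, lifting) rtranclp.rtrancl_into_rtrancl)
    qed
    then show "\<exists>u. w = h u \<and> ?r\<^sup>*\<^sup>* v u" by blast
  next
    assume "\<exists>u. w = h u \<and> ?r\<^sup>*\<^sup>* v u"
    then obtain u where w: "w = h u" and u: "?r\<^sup>*\<^sup>* v u" by blast
    have "R\<^sup>*\<^sup>* (h v) (h u)"
      using u
    proof (induction rule: rtranclp_induct)
      case (step y z)
      then have "R (h y) (h z)" using R[of y "h z"] by blast
      then show ?case using step(3) by simp
    qed simp
    then show "R\<^sup>*\<^sup>* (h v) w" using w by simp
  qed
qed

lemma vertex_lower: "k \<le> n \<Longrightarrow> vertex (lower_part n q) k = vertex q k"
  by (simp add: vertex_def lower_part_def min_def)

lemma vertex_upper: "vertex (upper_part n q) k = vertex q (n + num_E q + k)"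
  by (simp add: vertex_def upper_part_def take_add)

text \<open>The point is the right vertex, the left vertex and, in the upper strip, the bottom
  vertex (in the lower strip the top vertex) of the three units, in this order. The three nodes are
  pairwise adjacent.\<close>

lemma point_in_unit:
  "rpt (b, - b) \<in> unit_set n (unit_plus v) \<longleftrightarrow> v \<in> {(0, b - 1), (0, b), (1, b)}"
  "rpt (a + 1, - a - 1) \<in> unit_set n (unit_minus v) \<longleftrightarrow> v \<in> {(0, a - 1), (0, a), (1, a)}"
proof -
  obtain r x where v: "v = (r, x)" by (cases v)
  have "rpt (b, - b) \<in> unit_set n (unit_plus v) \<longleftrightarrow> x \<le> b \<and> b \<le> x + 1 \<and> int r - x - 1 \<le> - b \<and> - b \<le> int r - x"
    unfolding v unit_set_def unit_plus_def square_def rpt_def ht_def by (auto simp: ht_def)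
  then show "rpt (b, - b) \<in> unit_set n (unit_plus v) \<longleftrightarrow> v \<in> {(0, b - 1), (0, b), (1, b)}" unfolding v by auto
  have "rpt (a + 1, - a - 1) \<in> unit_set n (unit_minus v) \<longleftrightarrow> x - int r + 1 \<le> a + 1 \<and> a + 1 \<le> x - int r + 2 \<and>
    - x - 2 \<le> - a - 1 \<and> - a - 1 \<le> - x - 1"
    unfolding v unit_set_def unit_minus_def square_def rpt_def ht_def by (auto simp: ht_def)
  then show "rpt (a + 1, - a - 1) \<in> unit_set n (unit_minus v) \<longleftrightarrow> v \<in> {(0, a - 1), (0, a), (1, a)}" unfolding v by auto
qed

locale dtuple = diagram +
  fixes p :: "nat \<Rightarrow> path"
  assumes fA': "fams n (lam 1) (fa n p)" and fB': "fams n (lam 1) (fb n lam p)"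
    and paths: "\<And>i. i \<in> {1..lam 1} \<Longrightarrow> is_path n (p i)"
    and src: "\<And>j. j \<in> {1..lam 1} \<Longrightarrow> src n lam p j \<in> {1..lam 1}"
begin

sublocale two_fams n l "fa n p" "fb n lam p"
  by (rule two_fams.intro[OF n0 fA' fB'])

lemma hp_alpha:
  assumes i: "i \<in> {1..l}" and r: "r \<le> n"
  shows "pos_at (alpha_path n p i) (- int r) = real_of_int (fa n p i r) - real r / 2 + 1"
proof -
  have "ht (fst (alpha_path n p i)) = - int n"
    using paths[OF i] by (simp add: alpha_path_def lower_part_def is_path_def)
  then have "nat (- int r - ht (fst (alpha_path n p i))) = n - r" using r by simp
  then have "pos_at (alpha_path n p i) (- int r) = hp (vertex (p i) (n - r))"
    unfolding pos_at_def by (simp add: alpha_path_def vertex_lower)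
  then show ?thesis using vertex_low[OF paths[OF i] n0 r] by (simp add: hp_def fa_def field_simps)
qed

lemma hp_beta:
  assumes j: "j \<in> {1..l}" and r: "r \<le> n"
  shows "pos_at (beta_path n lam p j) (int r) = real_of_int (fb n lam p j r) - real r / 2"
proof -
  let ?q = "p (src n lam p j)"
  have b: "beta_path n lam p j = upper_part n ?q" by (simp add: beta_path_def src_def)
  have q: "is_path n ?q" using paths src[OF j] by blast
  have "ht (fst (upper_part n ?q)) = 0" using path_structure(6)[OF q n0, of "n + num_E ?q"] by (simp add: upper_part_def)
  then have "pos_at (beta_path n lam p j) (int r) = hp (vertex ?q (n + num_E ?q + r))"
    unfolding pos_at_def b by (simp add: vertex_upper)
  then show ?thesis using vertex_upp[OF q n0 r] by (simp add: hp_def fb_def field_simps)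
qed

lemma gap_eq: "i \<in> {1..<l} \<Longrightarrow> gap n lam p i = real_of_int (fa n p i 0 + 1 - fb n lam p (Suc i) 0)"
  using hp_alpha[of i 0] hp_beta[of "Suc i" 0] by (simp add: gap_def)

lemma even_overlap_iff: "i \<in> {1..<l} \<Longrightarrow> even_overlap n lam p i \<longleftrightarrow> fa n p i 0 < fb n lam p (Suc i) 0 \<and> odd (fb n lam p (Suc i) 0 - fa n p i 0)"
proof -
  assume i: "i \<in> {1..<l}"
  have "(\<exists>k::int. even k \<and> gap n lam p i = of_int k) \<longleftrightarrow> even (fa n p i 0 + 1 - fb n lam p (Suc i) 0)"
    unfolding gap_eq[OF i] by (metis of_int_eq_iff)
  moreover have "gap n lam p i \<le> 0 \<longleftrightarrow> fa n p i 0 < fb n lam p (Suc i) 0" unfolding gap_eq[OF i] by linarith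
  ultimately show ?thesis by (auto simp: even_overlap_def)
qed

lemma even_hole_iff: "i \<in> {1..<l} \<Longrightarrow> even_hole n lam p i \<longleftrightarrow> fb n lam p (Suc i) 0 \<le> fa n p i 0 \<and> odd (fa n p i 0 - fb n lam p (Suc i) 0)"
proof -
  assume i: "i \<in> {1..<l}"
  have "(\<exists>k::int. even k \<and> gap n lam p i = of_int k) \<longleftrightarrow> even (fa n p i 0 + 1 - fb n lam p (Suc i) 0)"
    unfolding gap_eq[OF i] by (metis of_int_eq_iff)
  moreover have "gap n lam p i > 0 \<longleftrightarrow> fb n lam p (Suc i) 0 \<le> fa n p i 0" unfolding gap_eq[OF i] by linarith
  ultimately show ?thesis by (auto simp: even_hole_def)
qed

lemma hp_unit: "hp (left_point (unit_plus (r, x))) = real_of_int x - real r / 2"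
  "hp (right_point (unit_plus (r, x))) = real_of_int x + 1 - real r / 2"
  "hp (left_point (unit_minus (r, x))) = real_of_int x - real r / 2 + 1"
  "hp (right_point (unit_minus (r, x))) = real_of_int x - real r / 2 + 2"
  by (simp_all add: hp_def left_point_def right_point_def unit_plus_def unit_minus_def field_simps)

lemma alpha_cmp:
  assumes "i \<le> l" "r \<le> n"
  shows "alpha_dual n p i (int r) \<le> ereal (real_of_int x - real r / 2) \<longleftrightarrow> i \<noteq> 0 \<and> fa n p i r \<le> x"
    and "alpha n p i (- int r) \<le> ereal (real_of_int x - real r / 2 + 1) \<longleftrightarrow> i \<noteq> 0 \<and> fa n p i r \<le> x"
    and "ereal (real_of_int x + 1 - real r / 2) \<le> alpha_dual n p i (int r) \<longleftrightarrow> i = 0 \<or> x < fa n p i r"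
    and "ereal (real_of_int x - real r / 2 + 2) \<le> alpha n p i (- int r) \<longleftrightarrow> i = 0 \<or> x < fa n p i r"
  using hp_alpha[of i r] assms by (auto simp: alpha_dual_def alpha_def one_ereal_def)

lemma beta_cmp:
  assumes "i \<le> l" "r \<le> n"
  shows "ereal (real_of_int x + 1 - real r / 2) \<le> beta n lam p (i + 1) (int r) \<longleftrightarrow> i \<noteq> l \<and> x < fb n lam p (Suc i) r"
    and "ereal (real_of_int x - real r / 2 + 2) \<le> beta_dual n lam p (i + 1) (- int r) \<longleftrightarrow> i \<noteq> l \<and> x < fb n lam p (Suc i) r"
    and "beta n lam p (i + 1) (int r) \<le> ereal (real_of_int x - real r / 2) \<longleftrightarrow> i = l \<or> fb n lam p (Suc i) r \<le> x"
    and "beta_dual n lam p (i + 1) (- int r) \<le> ereal (real_of_int x - real r / 2 + 1) \<longleftrightarrow> i = l \<or> fb n lam p (Suc i) r \<le> x"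
  using hp_beta[of "Suc i" r] assms by (auto simp: beta_dual_def beta_def one_ereal_def)

text \<open>Having \<alpha> number \<open>i\<close> weakly left and \<beta> number
  \<open>i + 1\<close> strictly right of the node means that the two counts are at least
  \<open>l + 1 - i\<close> and at most \<open>l - i - 1\<close>.\<close>

lemma I_unit_node:
  assumes r: "r \<le> n"
  shows "I_unit n lam p (unit_plus (r, x)) \<longleftrightarrow> 2 \<le> hgt n l (fa n p) (fb n lam p) (r, x)"
    and "I_unit n lam p (unit_minus (r, x)) \<longleftrightarrow> 2 \<le> hgt n l (fa n p) (fb n lam p) (r, x)"
proof -
  let ?R = "\<exists>i\<le>l. (i \<noteq> 0 \<and> fa n p i r \<le> x) \<and> (i \<noteq> l \<and> x < fb n lam p (Suc i) r)"
  have u: "is_unit n (unit_plus (r, x))" "is_unit n (unit_minus (r, x))"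
    unfolding is_unit_iff[OF n0] using r by force+
  have R: "?R \<longleftrightarrow> 2 \<le> hgt n l (fa n p) (fb n lam p) (r, x)"
  proof
    assume ?R
    then obtain i where i': "i \<le> l" "i \<noteq> 0" "i \<noteq> l" "fa n p i r \<le> x" "\<not> fb n lam p (Suc i) r \<le> x" by (meson not_le)
    then have i: "i \<in> {1..l}" "Suc i \<in> {1..l}" "fa n p i r \<le> x" "\<not> fb n lam p (Suc i) r \<le> x" by simp_all
    then show "2 \<le> hgt n l (fa n p) (fb n lam p) (r, x)"
      using cnt_ge[OF fA r i(1), of x] cnt_ge[OF fB r i(2), of x] by (simp add: hgt_def)
  next
    assume h: "2 \<le> hgt n l (fa n p) (fb n lam p) (r, x)"
    \<comment> \<open>The smallest index of an \<alpha> weakly left of the node, hence the one with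
      the rightmost \<alpha>.\<close>
    define i where "i = nat (int l + 1 - cnt n l (fa n p) (r, x))"
    have b: "0 \<le> cnt n l (fb n lam p) (r, x)" "cnt n l (fa n p) (r, x) \<le> int l" using cnt_bounds by auto
    have i: "i \<in> {1..l}" "Suc i \<in> {1..l}" "int i = int l + 1 - cnt n l (fa n p) (r, x)" using h b by (auto simp: i_def hgt_def)
    have "fa n p i r \<le> x" "\<not> fb n lam p (Suc i) r \<le> x"
      using cnt_ge[OF fA r i(1), of x] cnt_ge[OF fB r i(2), of x] i(3) h by (auto simp: hgt_def)
    then show ?R using i by (intro exI[of _ i]) auto
  qed
  show "I_unit n lam p (unit_plus (r, x)) \<longleftrightarrow> 2 \<le> hgt n l (fa n p) (fb n lam p) (r, x)"
    unfolding R[symmetric] I_unit_def hp_unit unit_ht_node Let_def using u(1) r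
    by (simp add: unit_plus_def alpha_cmp beta_cmp cong: conj_cong del: One_nat_def)
  show "I_unit n lam p (unit_minus (r, x)) \<longleftrightarrow> 2 \<le> hgt n l (fa n p) (fb n lam p) (r, x)"
    unfolding R[symmetric] I_unit_def hp_unit unit_ht_node Let_def using u(2) r
    by (simp add: unit_minus_def alpha_cmp beta_cmp cong: conj_cong del: One_nat_def)
qed

lemma II_unit_at_node:
  assumes r: "r \<le> n" and i: "i \<le> l"
  shows "II_unit_at n lam p i (unit_plus (r, x)) \<longleftrightarrow> (i = l \<or> fb n lam p (Suc i) r \<le> x) \<and> (i = 0 \<or> x < fa n p i r)"
    and "II_unit_at n lam p i (unit_minus (r, x)) \<longleftrightarrow> (i = l \<or> fb n lam p (Suc i) r \<le> x) \<and> (i = 0 \<or> x < fa n p i r)"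
proof -
  have u: "is_unit n (unit_plus (r, x))" "is_unit n (unit_minus (r, x))"
    unfolding is_unit_iff[OF n0] using r by force+
  show "II_unit_at n lam p i (unit_plus (r, x)) \<longleftrightarrow> (i = l \<or> fb n lam p (Suc i) r \<le> x) \<and> (i = 0 \<or> x < fa n p i r)"
    unfolding II_unit_at_def hp_unit unit_ht_node Let_def using u(1) r i
    by (simp add: unit_plus_def alpha_cmp beta_cmp cong: conj_cong del: One_nat_def)
  show "II_unit_at n lam p i (unit_minus (r, x)) \<longleftrightarrow> (i = l \<or> fb n lam p (Suc i) r \<le> x) \<and> (i = 0 \<or> x < fa n p i r)"
    unfolding II_unit_at_def hp_unit unit_ht_node Let_def using u(2) r i
    by (simp add: unit_minus_def alpha_cmp beta_cmp cong: conj_cong del: One_nat_def)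
qed

text \<open>The conventions for the missing members of index 0 and \<open>l + 1\<close> turn into
  the trivial bounds 0 and \<open>l\<close> of the counts, so all indices can be treated
  alike.\<close>

lemma II_at_iff:
  assumes r: "r \<le> n" and i: "i \<le> l"
  shows "(i = l \<or> fb n lam p (Suc i) r \<le> x) \<and> (i = 0 \<or> x < fa n p i r) \<longleftrightarrow>
    int l - int i \<le> cnt n l (fb n lam p) (r, x) \<and> cnt n l (fa n p) (r, x) \<le> int l - int i"
proof -
  have b: "0 \<le> cnt n l (fb n lam p) (r, x)" "cnt n l (fa n p) (r, x) \<le> int l" using cnt_bounds by auto
  have "(i = l \<or> fb n lam p (Suc i) r \<le> x) \<longleftrightarrow> int l - int i \<le> cnt n l (fb n lam p) (r, x)"
    using b(1) i cnt_ge[OF fB r, of "Suc i" x] by (cases "i = l") auto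
  moreover have "(i = 0 \<or> x < fa n p i r) \<longleftrightarrow> cnt n l (fa n p) (r, x) \<le> int l - int i"
    using b(2) i cnt_ge[OF fA r, of i x] by (cases "i = 0") auto
  ultimately show ?thesis by (simp only:)
qed

lemma II_unit_node:
  assumes r: "r \<le> n"
  shows "II_unit n lam p (unit_plus (r, x)) \<longleftrightarrow> hgt n l (fa n p) (fb n lam p) (r, x) \<le> 0"
    and "II_unit n lam p (unit_minus (r, x)) \<longleftrightarrow> hgt n l (fa n p) (fb n lam p) (r, x) \<le> 0"
proof -
  have "(\<exists>i\<le>l. int l - int i \<le> cnt n l (fb n lam p) (r, x) \<and> cnt n l (fa n p) (r, x) \<le> int l - int i) \<longleftrightarrow>
    hgt n l (fa n p) (fb n lam p) (r, x) \<le> 0" (is "?L = ?R")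
  proof
    assume h: ?R
    have "0 \<le> cnt n l (fa n p) (r, x)" "cnt n l (fa n p) (r, x) \<le> int l" using cnt_bounds by auto
    then show ?L using h by (intro exI[of _ "nat (int l - cnt n l (fa n p) (r, x))"]) (auto simp: hgt_def)
  qed (auto simp: hgt_def)
  then show "II_unit n lam p (unit_plus (r, x)) \<longleftrightarrow> hgt n l (fa n p) (fb n lam p) (r, x) \<le> 0"
    and "II_unit n lam p (unit_minus (r, x)) \<longleftrightarrow> hgt n l (fa n p) (fb n lam p) (r, x) \<le> 0"
    unfolding II_unit_def using II_unit_at_node[OF r] II_at_iff[OF r] by (metis (no_types, lifting))+
qed

lemma boundary_node:
  assumes r: "r \<le> n"
  shows "boundary_II_unit n lam p (unit_plus (r, x)) \<longleftrightarrow> hgt n l (fa n p) (fb n lam p) (r, x) \<le> 0 \<and>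
      (r = n \<or> cnt n l (fb n lam p) (r, x) = int l \<or> cnt n l (fa n p) (r, x) = 0)"
    and "boundary_II_unit n lam p (unit_minus (r, x)) \<longleftrightarrow> hgt n l (fa n p) (fb n lam p) (r, x) \<le> 0 \<and>
      (r = n \<or> cnt n l (fb n lam p) (r, x) = int l \<or> cnt n l (fa n p) (r, x) = 0)"
proof -
  have b: "0 \<le> cnt n l (fa n p) (r, x)" "cnt n l (fa n p) (r, x) \<le> int l"
    "0 \<le> cnt n l (fb n lam p) (r, x)" "cnt n l (fb n lam p) (r, x) \<le> int l" using cnt_bounds by auto
  have *: "(\<exists>i\<le>l. (int l - int i \<le> cnt n l (fb n lam p) (r, x) \<and> cnt n l (fa n p) (r, x) \<le> int l - int i) \<and> (i = 0 \<or> i = l \<or> r = n)) \<longleftrightarrow>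
    hgt n l (fa n p) (fb n lam p) (r, x) \<le> 0 \<and> (r = n \<or> cnt n l (fb n lam p) (r, x) = int l \<or> cnt n l (fa n p) (r, x) = 0)" (is "?L = ?R")
  proof
    assume ?L then show ?R using b by (auto simp: hgt_def)
  next
    assume h: ?R
    then consider "r = n" | "cnt n l (fb n lam p) (r, x) = int l" | "cnt n l (fa n p) (r, x) = 0" by blast
    then show ?L
    proof cases
      case 1
      then show ?thesis using h b by (intro exI[of _ "nat (int l - cnt n l (fa n p) (r, x))"]) (auto simp: hgt_def)
    next
      case 2 then show ?thesis using b by (intro exI[of _ 0]) auto
    next
      case 3 then show ?thesis using b by (intro exI[of _ l]) auto
    qed
  qed
  have ab: "\<bar>int r\<bar> = int n \<longleftrightarrow> r = n" "\<bar>- int r\<bar> = int n \<longleftrightarrow> r = n" by auto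
  show "boundary_II_unit n lam p (unit_plus (r, x)) \<longleftrightarrow> hgt n l (fa n p) (fb n lam p) (r, x) \<le> 0 \<and>
      (r = n \<or> cnt n l (fb n lam p) (r, x) = int l \<or> cnt n l (fa n p) (r, x) = 0)"
    and "boundary_II_unit n lam p (unit_minus (r, x)) \<longleftrightarrow> hgt n l (fa n p) (fb n lam p) (r, x) \<le> 0 \<and>
      (r = n \<or> cnt n l (fb n lam p) (r, x) = int l \<or> cnt n l (fa n p) (r, x) = 0)"
    unfolding *[symmetric] boundary_II_unit_def unit_ht_node fst_conv ab
    using II_unit_at_node[OF r] II_at_iff[OF r] by (metis (no_types, lifting))+
qed

end

section \<open>Regions as components of nodes\<close>

context strip
begin

lemma conn_in: "conn Z v w \<Longrightarrow> v \<in> Z \<Longrightarrow> w \<in> Z"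
  unfolding conn_def by (induction rule: rtranclp_induct) auto

lemma conn_sym: "conn Z v w \<Longrightarrow> conn Z w v"
  unfolding conn_def
proof (induction rule: rtranclp_induct)
  case (step y z)
  then have "(\<lambda>p q. p \<in> Z \<and> q \<in> Z \<and> (step n p q \<or> step n q p))\<^sup>*\<^sup>* z y" by blast
  then show ?case using step(3) by (rule rtranclp_trans)
qed simp

lemma conn_trans: "conn Z v w \<Longrightarrow> conn Z w u \<Longrightarrow> conn Z v u"
  unfolding conn_def by (rule rtranclp_trans)

lemma conn_step: "conn Z v u \<Longrightarrow> u \<in> Z \<Longrightarrow> w \<in> Z \<Longrightarrow> step n u w \<or> step n w u \<Longrightarrow> conn Z v w"
  unfolding conn_def by (rule rtranclp.rtrancl_into_rtrancl) auto

lemma conn_triangle: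
  assumes "0 < n" "u \<in> {(0, y - 1), (0, y), (1, y)}" "w \<in> {(0, y - 1), (0, y), (1, y)}"
    and "v \<in> Z" "w \<in> Z" "conn Z v u"
  shows "conn Z v w"
proof (cases "u = w")
  case False
  then have "step n u w \<or> step n w u"
    using assms(1-3) unfolding insert_iff empty_iff by (elim disjE) (simp_all add: step_def)
  then show ?thesis using conn_step[OF assms(6)] conn_in[OF assms(6,4)] assms(5) by blast
qed (use assms in simp)

lemma component_classes:
  assumes Z: "Z \<subseteq> {v. fst v \<le> n}" and A: "A = unit_plus ` Z \<union> unit_minus ` Z" and v: "v \<in> Z"
  shows "{W. equivclp (\<lambda>W W'. W \<in> A \<and> W' \<in> A \<and> adjacent n W W') (unit_plus v) W} = unit_plus ` {u. conn Z v u}"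
    and "{W. equivclp (\<lambda>W W'. W \<in> A \<and> W' \<in> A \<and> adjacent n W W') (unit_minus v) W} = unit_minus ` {u. conn Z v u}"
proof -
  let ?R = "\<lambda>W W'. W \<in> A \<and> W' \<in> A \<and> adjacent n W W'"
  have sym: "?R W W' \<Longrightarrow> ?R W' W" for W W' unfolding adjacent_def by blast
  have le: "v \<in> Z \<Longrightarrow> fst v \<le> n" for v using Z by blast
  have p: "?R (unit_plus v) W \<longleftrightarrow> (\<exists>u\<in>Z. W = unit_plus u \<and> (v = u \<or> step n v u \<or> step n u v))" if v: "v \<in> Z" for v W
  proof
    assume h: "?R (unit_plus v) W"
    then obtain u where u: "u \<in> Z" "W = unit_plus u" unfolding A using adjacent_mixed by (metis Un_iff imageE)
    then show "\<exists>u\<in>Z. W = unit_plus u \<and> (v = u \<or> step n v u \<or> step n u v)"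
      using h adjacent_plus[OF le[OF v] le[OF u(1)]] by blast
  next
    assume "\<exists>u\<in>Z. W = unit_plus u \<and> (v = u \<or> step n v u \<or> step n u v)"
    then obtain u where u: "u \<in> Z" "W = unit_plus u" "v = u \<or> step n v u \<or> step n u v" by blast
    then show "?R (unit_plus v) W" using adjacent_plus[OF le[OF v] le[OF u(1)]] v unfolding A by blast
  qed
  have m: "?R (unit_minus v) W \<longleftrightarrow> (\<exists>u\<in>Z. W = unit_minus u \<and> (v = u \<or> step n v u \<or> step n u v))" if v: "v \<in> Z" for v W
  proof
    assume h: "?R (unit_minus v) W"
    then obtain u where u: "u \<in> Z" "W = unit_minus u" unfolding A using adjacent_mixed by (metis Un_iff imageE)
    then show "\<exists>u\<in>Z. W = unit_minus u \<and> (v = u \<or> step n v u \<or> step n u v)"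
      using h adjacent_minus[OF le[OF v] le[OF u(1)]] by blast
  next
    assume "\<exists>u\<in>Z. W = unit_minus u \<and> (v = u \<or> step n v u \<or> step n u v)"
    then obtain u where u: "u \<in> Z" "W = unit_minus u" "v = u \<or> step n v u \<or> step n u v" by blast
    then show "?R (unit_minus v) W" using adjacent_minus[OF le[OF v] le[OF u(1)]] v unfolding A by blast
  qed
  have "equivclp ?R (unit_plus v) W \<longleftrightarrow> (\<exists>u. W = unit_plus u \<and> conn Z v u)" for W
    unfolding conn_def
    by (rule equivclp_image[where r = "\<lambda>v u. step n v u \<or> step n u v" and Z = Z and h = unit_plus and R = ?R])
      (use p sym v unit_inj in blast)+
  then show "{W. equivclp ?R (unit_plus v) W} = unit_plus ` {u. conn Z v u}" by blast
  have "equivclp ?R (unit_minus v) W \<longleftrightarrow> (\<exists>u. W = unit_minus u \<and> conn Z v u)" for W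
    unfolding conn_def
    by (rule equivclp_image[where r = "\<lambda>v u. step n v u \<or> step n u v" and Z = Z and h = unit_minus and R = ?R])
      (use m sym v unit_inj in blast)+
  then show "{W. equivclp ?R (unit_minus v) W} = unit_minus ` {u. conn Z v u}" by blast
qed

text \<open>Units of different strips are never adjacent. Each component of nodes that meets row 0
  therefore yields two regions, one in each strip, dual to each other.\<close>

lemma bottom_component_iff:
  assumes Z: "Z \<subseteq> {v. fst v \<le> n}" and A: "A = unit_plus ` Z \<union> unit_minus ` Z"
  shows "V \<in> components n A \<and> (\<exists>U\<in>V. unit_ht U = 0) \<longleftrightarrow>
    (\<exists>x. (0, x) \<in> Z \<and> (V = unit_plus ` {u. conn Z (0, x) u} \<or> V = unit_minus ` {u. conn Z (0, x) u}))"
proof -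
  note cl = component_classes[OF Z A]
  have comp: "V \<in> components n A \<longleftrightarrow> (\<exists>v\<in>Z. V = unit_plus ` {u. conn Z v u} \<or> V = unit_minus ` {u. conn Z v u})"
  proof -
    have "V \<in> components n A \<longleftrightarrow> (\<exists>U\<in>A. V = {W. equivclp (\<lambda>W W'. W \<in> A \<and> W' \<in> A \<and> adjacent n W W') U W})"
      unfolding components_def quotient_def by (simp add: Image_def)
    also have "\<dots> \<longleftrightarrow> (\<exists>v\<in>Z. V = {W. equivclp (\<lambda>W W'. W \<in> A \<and> W' \<in> A \<and> adjacent n W W') (unit_plus v) W} \<or>
        V = {W. equivclp (\<lambda>W W'. W \<in> A \<and> W' \<in> A \<and> adjacent n W W') (unit_minus v) W})"
      by (subst A) blast
    finally show ?thesis using cl by simp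
  qed
  have eq: "{u. conn Z v u} = {u. conn Z w u}" if "conn Z v w" for v w
    using conn_trans conn_sym that by blast
  show ?thesis
  proof
    assume "V \<in> components n A \<and> (\<exists>U\<in>V. unit_ht U = 0)"
    then obtain v U where v: "v \<in> Z" "V = unit_plus ` {u. conn Z v u} \<or> V = unit_minus ` {u. conn Z v u}"
      and U: "U \<in> V" "unit_ht U = 0" unfolding comp by blast
    then obtain w where w: "conn Z v w" "U = unit_plus w \<or> U = unit_minus w" by blast
    then have "fst w = 0" using U(2) unit_ht_node[of w] by auto
    then obtain x where x: "w = (0, x)" by (cases w) auto
    show "\<exists>x. (0, x) \<in> Z \<and> (V = unit_plus ` {u. conn Z (0, x) u} \<or> V = unit_minus ` {u. conn Z (0, x) u})"
      using v(2) conn_in[OF w(1) v(1)] unfolding eq[OF w(1)] x by blast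
  next
    assume "\<exists>x. (0, x) \<in> Z \<and> (V = unit_plus ` {u. conn Z (0, x) u} \<or> V = unit_minus ` {u. conn Z (0, x) u})"
    then obtain x where x: "(0, x) \<in> Z" "V = unit_plus ` {u. conn Z (0, x) u} \<or> V = unit_minus ` {u. conn Z (0, x) u}" by blast
    have "conn Z (0, x) (0, x)" by (simp add: conn_def)
    then have "unit_plus (0, x) \<in> V \<or> unit_minus (0, x) \<in> V" using x(2) by blast
    then have "\<exists>U\<in>V. unit_ht U = 0" using unit_ht_node[of "(0, x)"] by auto
    then show "V \<in> components n A \<and> (\<exists>U\<in>V. unit_ht U = 0)" using x comp by blast
  qed
qed

end

section \<open>Overlaps, holes and boundary units in terms of the counts\<close>

context two_fams
begin

lemma half_sum:
  fixes k X Y :: int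
  assumes "X + Y = 2 * k"
  shows "\<not> (X < k + 1 \<and> k - 1 < Y) \<Longrightarrow> k + 1 \<le> X \<and> Y \<le> k - 1" "\<not> (k + 1 \<le> X \<and> Y \<le> k - 1) \<Longrightarrow> X < k + 1 \<and> k - 1 < Y"
  using assms by linarith+

text \<open>On the overlap the count of the \<open>A\<close> is at least \<open>l - i + 1\<close>
  and that of the \<open>B\<close> at most \<open>l - i - 1\<close>. As the height does not exceed
  2, both are equalities and the sum is fixed.\<close>

lemma run_overlap:
  assumes D: "\<And>x. D x \<in> {0, 1, 2}" and i: "i \<in> {1..<l}" and ab: "a i < b (Suc i)"
  shows "run i = {a i..b (Suc i) - 1}"
proof -
  have i': "i \<in> {1..l}" "Suc i \<in> {1..l}" using i by auto
  have "y \<in> run i \<longleftrightarrow> y \<in> {a i..b (Suc i) - 1}" for y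
  proof -
    have c: "a i \<le> y \<longleftrightarrow> int l - int i + 1 \<le> NA y" "y < b (Suc i) \<longleftrightarrow> NB y \<le> int l - int i - 1"
      using a_le[OF i'(1), of y] b_less[OF i'(2), of y] by auto
    have d: "0 \<le> NA y - NB y" "NA y - NB y \<le> 2" using D[of y] unfolding D_eq by auto
    have "NA y + NB y = 2 * (int l - int i) \<longleftrightarrow> a i \<le> y \<and> y < b (Suc i)"
    proof
      assume "a i \<le> y \<and> y < b (Suc i)"
      then have "int l - int i + 1 \<le> NA y" "NB y \<le> int l - int i - 1" using c by blast+
      then show "NA y + NB y = 2 * (int l - int i)" using d by presburger
    next
      assume S: "NA y + NB y = 2 * (int l - int i)"
      have "\<not> (NA y < int l - int i + 1 \<and> int l - int i - 1 < NB y)" using c ab by linarith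
      then have "int l - int i + 1 \<le> NA y \<and> NB y \<le> int l - int i - 1" using half_sum(1)[OF S] by blast
      then show "a i \<le> y \<and> y < b (Suc i)" using c by blast
    qed
    then show ?thesis by (auto simp: run_def S_eq)
  qed
  then show ?thesis by blast
qed

text \<open>On the hole the inequalities are reversed, and nonnegativity of the height leaves
  \<open>l - i\<close> for both counts.\<close>

lemma run_hole:
  assumes D: "\<And>x. 0 \<le> D x" and i: "i \<in> {1..<l}" and ab: "b (Suc i) \<le> a i"
  shows "run i = {b (Suc i)..a i - 1}"
proof -
  have i': "i \<in> {1..l}" "Suc i \<in> {1..l}" using i by auto
  have "y \<in> run i \<longleftrightarrow> y \<in> {b (Suc i)..a i - 1}" for y
  proof -
    have c: "a i \<le> y \<longleftrightarrow> int l - int i + 1 \<le> NA y" "y < b (Suc i) \<longleftrightarrow> NB y \<le> int l - int i - 1"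
      using a_le[OF i'(1), of y] b_less[OF i'(2), of y] by auto
    have d: "0 \<le> NA y - NB y" using D[of y] unfolding D_eq .
    have "NA y + NB y = 2 * (int l - int i) \<longleftrightarrow> b (Suc i) \<le> y \<and> y < a i"
    proof
      assume "b (Suc i) \<le> y \<and> y < a i"
      then have "NA y < int l - int i + 1" "int l - int i - 1 < NB y" using c by linarith+
      then show "NA y + NB y = 2 * (int l - int i)" using d by presburger
    next
      assume S: "NA y + NB y = 2 * (int l - int i)"
      have "\<not> (int l - int i + 1 \<le> NA y \<and> NB y \<le> int l - int i - 1)" using c ab by linarith
      then have "NA y < int l - int i + 1 \<and> int l - int i - 1 < NB y" using half_sum(2)[OF S] by blast
      then show "b (Suc i) \<le> y \<and> y < a i" using c by linarith
    qed
    then show ?thesis by (auto simp: run_def S_eq)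
  qed
  then show ?thesis by blast
qed

lemma run_cmp:
  assumes i: "i \<in> {1..<l}" and y: "y \<in> run i"
  shows "2 \<le> D y \<Longrightarrow> a i < b (Suc i)" "D y \<le> 0 \<Longrightarrow> b (Suc i) \<le> a i"
proof -
  have i': "i \<in> {1..l}" "Suc i \<in> {1..l}" using i by auto
  have S: "NA y + NB y = 2 * (int l - int i)" using y by (simp add: run_def S_eq)
  have c: "a i \<le> y \<longleftrightarrow> int l - int i + 1 \<le> NA y" "y < b (Suc i) \<longleftrightarrow> NB y \<le> int l - int i - 1"
    using a_le[OF i'(1), of y] b_less[OF i'(2), of y] by auto
  show "a i < b (Suc i)" if "2 \<le> D y"
  proof -
    have "int l - int i + 1 \<le> NA y" "NB y \<le> int l - int i - 1" using S that unfolding D_eq by presburger+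
    then have "a i \<le> y" "y < b (Suc i)" using c by blast+
    then show ?thesis by linarith
  qed
  show "b (Suc i) \<le> a i" if "D y \<le> 0"
  proof -
    have "\<not> int l - int i + 1 \<le> NA y" "\<not> NB y \<le> int l - int i - 1" using S that unfolding D_eq by presburger+
    then have "\<not> a i \<le> y" "\<not> y < b (Suc i)" using c by blast+
    then show ?thesis by linarith
  qed
qed

text \<open>The outermost indices only say that one of the counts is 0 or \<open>l\<close>. Then a
  walk along the row, to the left or to the right respectively, stays in \<open>Z\<close> until the
  other count has reached the same value, that is, until \<open>dens\<close> is 0 or
  \<open>2 * l\<close>.\<close>

lemma at_boundary_iff:
  assumes Z: "Z = {q. fst q \<le> n \<and> hgt n l A B q \<le> 0}" and z: "(0, x) \<in> Z"
  shows "(\<exists>v. conn Z (0, x) v \<and> (fst v = n \<or> cnt n l B v = int l \<or> cnt n l A v = 0)) \<longleftrightarrow> at_boundary Z x"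
proof
  assume "at_boundary Z x"
  then obtain v where v: "conn Z (0, x) v" "fst v = n \<or> dens n l A B v = 0 \<or> dens n l A B v = 2 * int l"
    unfolding at_boundary_def by blast
  have "0 \<le> cnt n l A v" "cnt n l A v \<le> int l" "0 \<le> cnt n l B v" "cnt n l B v \<le> int l" using cnt_bounds by auto
  then have "fst v = n \<or> cnt n l B v = int l \<or> cnt n l A v = 0" using v(2) unfolding dens_def by linarith
  then show "\<exists>v. conn Z (0, x) v \<and> (fst v = n \<or> cnt n l B v = int l \<or> cnt n l A v = 0)" using v(1) by blast
next
  assume "\<exists>v. conn Z (0, x) v \<and> (fst v = n \<or> cnt n l B v = int l \<or> cnt n l A v = 0)"
  then obtain r y where v: "conn Z (0, x) (r, y)" "r = n \<or> cnt n l B (r, y) = int l \<or> cnt n l A (r, y) = 0" by auto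
  have r: "r \<le> n" using conn_in[OF v(1) z] Z by simp
  have mono: "cnt n l A (r, x) \<le> cnt n l A (r, x + 1)" "cnt n l B (r, x) \<le> cnt n l B (r, x + 1)" for x
    using cnt_step[OF fA step_E[OF r, of x]] cnt_step[OF fB step_E[OF r, of x]] by auto
  consider "r = n" | "cnt n l B (r, y) = int l" | "cnt n l A (r, y) = 0" using v(2) by blast
  then show "at_boundary Z x"
  proof cases
    case 1
    then show ?thesis unfolding at_boundary_def using v(1) by (intro exI[of _ "(r, y)"]) simp
  next
    case 2
    have *: "conn Z (0, x) (r, y') \<and> cnt n l B (r, y') = int l" if "y \<le> y'" for y'
      using that
    proof (induction y' rule: int_ge_induct)
      case base then show ?case using v(1) 2 by simp
    next
      case (step y')
      have B: "cnt n l B (r, y' + 1) = int l" using step(2) mono(2)[of y'] cnt_bounds(2)[of n l B "(r, y' + 1)"] by linarith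
      have "(r, y' + 1) \<in> Z" using B r cnt_bounds(2)[of n l A "(r, y' + 1)"] by (simp add: Z hgt_def)
      then have "conn Z (0, x) (r, y' + 1)"
        using conn_step[of Z "(0, x)" "(r, y')" "(r, y' + 1)"] conn_in[OF _ z] step(2) step_E[OF r] by blast
      then show ?case using B by blast
    qed
    obtain m where m: "\<forall>p. fst p \<le> n \<and> m \<le> snd p \<longrightarrow> cnt n l A p = int l" using cnt_right by blast
    have "cnt n l A (r, max y m) = int l" using m r by simp
    then have "dens n l A B (r, max y m) = 2 * int l" using *[of "max y m"] by (simp add: dens_def)
    then show ?thesis unfolding at_boundary_def using *[of "max y m"] r by (intro exI[of _ "(r, max y m)"]) simp
  next
    case 3
    have *: "conn Z (0, x) (r, y') \<and> cnt n l A (r, y') = 0" if "y' \<le> y" for y'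
      using that
    proof (induction y' rule: int_le_induct)
      case base then show ?case using v(1) 3 by simp
    next
      case (step y')
      have B: "cnt n l A (r, y' - 1) = 0" using step(2) mono(1)[of "y' - 1"] cnt_bounds(1)[of n l A "(r, y' - 1)"] by simp
      have "(r, y' - 1) \<in> Z" using B r cnt_bounds(1)[of n l B "(r, y' - 1)"] by (simp add: Z hgt_def)
      moreover have "step n (r, y' - 1) (r, y')" using step_E[OF r, of "y' - 1"] by simp
      ultimately have "conn Z (0, x) (r, y' - 1)"
        using conn_step[of Z "(0, x)" "(r, y')" "(r, y' - 1)"] conn_in[OF _ z] step(2) by blast
      then show ?case using B by blast
    qed
    obtain m where m: "\<forall>p. fst p \<le> n \<and> snd p < m \<longrightarrow> cnt n l B p = 0" using cnt_left by blast
    have "cnt n l B (r, min y (m - 1)) = 0" using m r by simp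
    then have "dens n l A B (r, min y (m - 1)) = 0" using *[of "min y (m - 1)"] by (simp add: dens_def)
    then show ?thesis unfolding at_boundary_def using *[of "min y (m - 1)"] r by (intro exI[of _ "(r, min y (m - 1))"]) simp
  qed
qed

end

section \<open>Odd regions of a tuple and the evenness of faces\<close>

context dtuple
begin

abbreviation "height \<equiv> hgt n l (fa n p) (fb n lam p)"

lemma intersects_iff:
  assumes i: "i \<in> {1..<l}"
  shows "intersects_at_0 n lam p i (unit_plus ` X) \<longleftrightarrow> (\<exists>u\<in>{(0, b (Suc i) - 1), (0, b (Suc i)), (1, b (Suc i))}. u \<in> X)"
    and "intersects_at_0 n lam p i (unit_minus ` X) \<longleftrightarrow> (\<exists>u\<in>{(0, a i - 1), (0, a i), (1, a i)}. u \<in> X)"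
proof -
  have i': "i \<in> {1..l}" "Suc i \<in> {1..l}" using i by auto
  have q: "is_path n (p (src n lam p (Suc i)))" using paths src[OF i'(2)] by blast
  have b: "fst (beta_path n lam p (i + 1)) = (b (Suc i), - b (Suc i))"
    using vertex_upp[OF q n0, of 0] unfolding beta_path_def src_def[symmetric] upper_part_def fb_def by simp
  have a: "endpoint (alpha_path n p i) = (a i + 1, - a i - 1)"
    using vertex_low[OF paths[OF i'(1)] n0, of 0] path_structure(1)[OF paths[OF i'(1)] n0]
    by (simp add: alpha_path_def endpoint_def vertex_lower fa_def) (simp add: lower_part_def vertex_lower[unfolded lower_part_def])
  have F: "fst (unit_plus u) = S_plus" "fst (unit_minus u) = S_minus" for u by (simp_all add: unit_plus_def unit_minus_def)
  show "intersects_at_0 n lam p i (unit_plus ` X) \<longleftrightarrow> (\<exists>u\<in>{(0, b (Suc i) - 1), (0, b (Suc i)), (1, b (Suc i))}. u \<in> X)"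
    unfolding intersects_at_0_def b bex_simps F point_in_unit by blast
  show "intersects_at_0 n lam p i (unit_minus ` X) \<longleftrightarrow> (\<exists>u\<in>{(0, a i - 1), (0, a i), (1, a i)}. u \<in> X)"
    unfolding intersects_at_0_def a bex_simps F point_in_unit by blast
qed

lemma units_I: "{U. I_unit n lam p U} = unit_plus ` {v. fst v \<le> n \<and> 2 \<le> height v} \<union> unit_minus ` {v. fst v \<le> n \<and> 2 \<le> height v}"
proof -
  have "I_unit n lam p U \<longleftrightarrow> (\<exists>v. fst v \<le> n \<and> 2 \<le> height v \<and> (U = unit_plus v \<or> U = unit_minus v))" for U
  proof
    assume "I_unit n lam p U"
    moreover from this obtain r x where "r \<le> n" "U = unit_plus (r, x) \<or> U = unit_minus (r, x)"
      using is_unit_iff[OF n0, of U] unfolding I_unit_def by auto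
    ultimately show "\<exists>v. fst v \<le> n \<and> 2 \<le> height v \<and> (U = unit_plus v \<or> U = unit_minus v)"
      using I_unit_node by (intro exI[of _ "(r, x)"]) auto
  next
    assume "\<exists>v. fst v \<le> n \<and> 2 \<le> height v \<and> (U = unit_plus v \<or> U = unit_minus v)"
    then show "I_unit n lam p U" using I_unit_node by auto
  qed
  then show ?thesis by blast
qed

lemma units_II: "{U. II_unit n lam p U} = unit_plus ` {v. fst v \<le> n \<and> height v \<le> 0} \<union> unit_minus ` {v. fst v \<le> n \<and> height v \<le> 0}"
proof -
  have "II_unit n lam p U \<longleftrightarrow> (\<exists>v. fst v \<le> n \<and> height v \<le> 0 \<and> (U = unit_plus v \<or> U = unit_minus v))" for U
  proof
    assume "II_unit n lam p U"
    moreover from this obtain r x where "r \<le> n" "U = unit_plus (r, x) \<or> U = unit_minus (r, x)"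
      using is_unit_iff[OF n0, of U] unfolding II_unit_def II_unit_at_def by auto
    ultimately show "\<exists>v. fst v \<le> n \<and> height v \<le> 0 \<and> (U = unit_plus v \<or> U = unit_minus v)"
      using II_unit_node by (intro exI[of _ "(r, x)"]) auto
  next
    assume "\<exists>v. fst v \<le> n \<and> height v \<le> 0 \<and> (U = unit_plus v \<or> U = unit_minus v)"
    then show "II_unit n lam p U" using II_unit_node by auto
  qed
  then show ?thesis by blast
qed

text \<open>The three units around the endpoint are pairwise adjacent, and one of them is an end of
  the run, which lies in \<open>Z\<close>. So a region touches the endpoint exactly if it contains
  the run. The upper strip tests the end at \<open>b (Suc i)\<close> and the lower one the end at
  \<open>a i\<close>; a run lies in one face, so dual regions count the same indices.\<close>

lemma meets_overlap:
  assumes D: "\<And>x. D x \<in> {0, 1, 2}" and Z: "Z = {v. fst v \<le> n \<and> 2 \<le> height v}" and z: "(0, x) \<in> Z"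
    and V: "V = unit_plus ` {u. conn Z (0, x) u} \<or> V = unit_minus ` {u. conn Z (0, x) u}"
  shows "{i \<in> {1..<l}. even_overlap n lam p i \<and> intersects_at_0 n lam p i V} = meets Z x"
proof -
  have "even_overlap n lam p i \<and> intersects_at_0 n lam p i V \<longleftrightarrow>
    odd (card (run i)) \<and> (\<exists>y\<in>run i. conn Z (0, x) (0, y))" if i: "i \<in> {1..<l}" for i
  proof (cases "a i < b (Suc i)")
    case True
    note R = run_overlap[OF D i True]
    have c: "odd (card (run i)) \<longleftrightarrow> odd (b (Suc i) - a i)" unfolding R using True by (auto simp: even_nat_iff)
    have rZ: "(0, y) \<in> Z" if "y \<in> run i" for y
    proof -
      have "int l + 1 - int i \<le> NA y" "NB y \<le> int l - int (Suc i)"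
        using that a_le[of i y] b_less[of "Suc i" y] i unfolding R by auto
      then show ?thesis unfolding Z mem_Collect_eq fst_conv D_eq by linarith
    qed
    have ends: "b (Suc i) - 1 \<in> run i" "a i \<in> run i" unfolding R using True by auto
    have eq: "conn Z (0, x) (0, y) \<longleftrightarrow> conn Z (0, x) (0, y')" if "y \<in> run i" "y' \<in> run i" for y y'
      using fc_conn[OF valid Z rZ run_same_face] that conn_trans by blast
    have "(\<exists>u\<in>{(0, b (Suc i) - 1), (0, b (Suc i)), (1, b (Suc i))}. conn Z (0, x) u) \<longleftrightarrow> conn Z (0, x) (0, b (Suc i) - 1)"
      using conn_triangle[OF n0 _ _ z rZ[OF ends(1)]] by blast
    moreover have "(\<exists>u\<in>{(0, a i - 1), (0, a i), (1, a i)}. conn Z (0, x) u) \<longleftrightarrow> conn Z (0, x) (0, a i)"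
      using conn_triangle[OF n0 _ _ z rZ[OF ends(2)]] by blast
    ultimately have "intersects_at_0 n lam p i V \<longleftrightarrow> (\<exists>y\<in>run i. conn Z (0, x) (0, y))"
      using V eq ends intersects_iff[OF i] by (metis mem_Collect_eq)
    then show ?thesis using c even_overlap_iff[OF i] True by simp
  next
    case False
    have "\<not> conn Z (0, x) (0, y)" if "y \<in> run i" for y
      using run_cmp(1)[OF i that] False conn_in[OF _ z, of "(0, y)"] unfolding Z by auto
    then show ?thesis using even_overlap_iff[OF i] False by blast
  qed
  then show ?thesis unfolding meets_def by blast
qed

text \<open>As for overlaps, with the ends \<open>b (Suc i)\<close> and \<open>a i - 1\<close> of
  the run. An even hole is never an empty run, since its run has odd length.\<close>

lemma meets_hole:
  assumes D: "\<And>x. 0 \<le> D x" and Z: "Z = {v. fst v \<le> n \<and> height v \<le> 0}" and z: "(0, x) \<in> Z"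
    and V: "V = unit_plus ` {u. conn Z (0, x) u} \<or> V = unit_minus ` {u. conn Z (0, x) u}"
  shows "{i \<in> {1..<l}. even_hole n lam p i \<and> intersects_at_0 n lam p i V} = meets Z x"
proof -
  have "even_hole n lam p i \<and> intersects_at_0 n lam p i V \<longleftrightarrow>
    odd (card (run i)) \<and> (\<exists>y\<in>run i. conn Z (0, x) (0, y))" if i: "i \<in> {1..<l}" for i
  proof (cases "b (Suc i) \<le> a i \<and> odd (a i - b (Suc i))")
    case True
    then have le: "b (Suc i) \<le> a i" and lt: "b (Suc i) < a i" by (auto simp: order_less_le)
    note R = run_hole[OF D i le]
    have c: "odd (card (run i)) \<longleftrightarrow> odd (a i - b (Suc i))" unfolding R using lt by (auto simp: even_nat_iff)
    have rZ: "(0, y) \<in> Z" if "y \<in> run i" for y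
    proof -
      have "\<not> int l + 1 - int i \<le> NA y" "\<not> NB y \<le> int l - int (Suc i)"
        using that a_le[of i y] b_less[of "Suc i" y] i unfolding R by auto
      then show ?thesis unfolding Z mem_Collect_eq fst_conv D_eq by linarith
    qed
    have ends: "b (Suc i) \<in> run i" "a i - 1 \<in> run i" unfolding R using lt by auto
    have eq: "conn Z (0, x) (0, y) \<longleftrightarrow> conn Z (0, x) (0, y')" if "y \<in> run i" "y' \<in> run i" for y y'
      using fc_conn[OF valid Z rZ run_same_face] that conn_trans by blast
    have "(\<exists>u\<in>{(0, b (Suc i) - 1), (0, b (Suc i)), (1, b (Suc i))}. conn Z (0, x) u) \<longleftrightarrow> conn Z (0, x) (0, b (Suc i))"
      using conn_triangle[OF n0 _ _ z rZ[OF ends(1)]] by blast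
    moreover have "(\<exists>u\<in>{(0, a i - 1), (0, a i), (1, a i)}. conn Z (0, x) u) \<longleftrightarrow> conn Z (0, x) (0, a i - 1)"
      using conn_triangle[OF n0 _ _ z rZ[OF ends(2)]] by blast
    ultimately have "intersects_at_0 n lam p i V \<longleftrightarrow> (\<exists>y\<in>run i. conn Z (0, x) (0, y))"
      using V eq ends intersects_iff[OF i] by (metis mem_Collect_eq)
    then show ?thesis using c even_hole_iff[OF i] True by simp
  next
    case False
    have "\<not> (odd (card (run i)) \<and> (\<exists>y\<in>run i. conn Z (0, x) (0, y)))"
    proof
      assume h: "odd (card (run i)) \<and> (\<exists>y\<in>run i. conn Z (0, x) (0, y))"
      then obtain y where "y \<in> run i" "conn Z (0, x) (0, y)" by blast
      then have le: "b (Suc i) \<le> a i" using run_cmp(2)[OF i, of y] conn_in[OF _ z, of "(0, y)"] unfolding Z by auto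
      have "odd (a i - b (Suc i))" using h unfolding run_hole[OF D i le] using le by (auto simp: even_nat_iff)
      then show False using le False by blast
    qed
    then show ?thesis using even_hole_iff[OF i] False by blast
  qed
  then show ?thesis unfolding meets_def by blast
qed

lemma odd_I_iff:
  assumes D: "\<And>x. D x \<in> {0, 1, 2}"
  shows "(\<exists>V. odd_I_region n lam p V) \<longleftrightarrow> (\<exists>x. 2 \<le> D x \<and> odd (card (meets {v. fst v \<le> n \<and> 2 \<le> height v} x)))"
proof -
  define Z where "Z = {v. fst v \<le> n \<and> 2 \<le> height v}"
  have z: "(0, x) \<in> Z \<longleftrightarrow> 2 \<le> D x" for x by (simp add: Z_def)
  define cls where "cls x V \<longleftrightarrow> V = unit_plus ` {u. conn Z (0, x) u} \<or> V = unit_minus ` {u. conn Z (0, x) u}" for x V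
  have ex: "\<exists>V. cls x V" for x unfolding cls_def by blast
  have R: "I_region n lam p V \<longleftrightarrow> (\<exists>x. (0, x) \<in> Z \<and> cls x V)" for V
    unfolding I_region_def cls_def by (rule bottom_component_iff) (auto simp: Z_def units_I)
  define c where "c V = card {i \<in> {1..<l}. even_overlap n lam p i \<and> intersects_at_0 n lam p i V}" for V
  have c: "c V = card (meets Z x)" if "(0, x) \<in> Z" "cls x V" for x V
    unfolding c_def using meets_overlap[OF D Z_def that(1)] that(2) unfolding cls_def by simp
  have "(\<exists>V. (\<exists>x. (0, x) \<in> Z \<and> cls x V) \<and> odd (c V)) \<longleftrightarrow> (\<exists>x. (0, x) \<in> Z \<and> odd (card (meets Z x)))"
    using ex c by metis
  then show ?thesis unfolding odd_I_region_def R Z_def[symmetric] z c_def .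
qed

lemma odd_II_iff:
  assumes D: "\<And>x. 0 \<le> D x"
  shows "(\<exists>V. odd_II_region n lam p V) \<longleftrightarrow>
    (\<exists>x. D x \<le> 0 \<and> \<not> at_boundary {v. fst v \<le> n \<and> height v \<le> 0} x \<and> odd (card (meets {v. fst v \<le> n \<and> height v \<le> 0} x)))"
proof -
  define Z where "Z = {v. fst v \<le> n \<and> height v \<le> 0}"
  have z: "(0, x) \<in> Z \<longleftrightarrow> D x \<le> 0" for x by (simp add: Z_def)
  define cls where "cls x V \<longleftrightarrow> V = unit_plus ` {u. conn Z (0, x) u} \<or> V = unit_minus ` {u. conn Z (0, x) u}" for x V
  have ex: "\<exists>V. cls x V" for x unfolding cls_def by blast
  have bd: "(\<exists>U\<in>V. boundary_II_unit n lam p U) \<longleftrightarrow> at_boundary Z x"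
    if V: "cls x V" and x: "(0, x) \<in> Z" for V x
  proof -
    have "boundary_II_unit n lam p (unit_plus v) \<longleftrightarrow> fst v = n \<or> cnt n l (fb n lam p) v = int l \<or> cnt n l (fa n p) v = 0"
      "boundary_II_unit n lam p (unit_minus v) \<longleftrightarrow> fst v = n \<or> cnt n l (fb n lam p) v = int l \<or> cnt n l (fa n p) v = 0"
      if "conn Z (0, x) v" for v
      using conn_in[OF that x] boundary_node[of "fst v" "snd v"] by (simp_all add: Z_def)
    then have "(\<exists>U\<in>V. boundary_II_unit n lam p U) \<longleftrightarrow>
      (\<exists>v. conn Z (0, x) v \<and> (fst v = n \<or> cnt n l (fb n lam p) v = int l \<or> cnt n l (fa n p) v = 0))"
      using V unfolding cls_def by (elim disjE) (simp_all only: bex_simps mem_Collect_eq cong: conj_cong)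
    then show ?thesis using at_boundary_iff[OF Z_def x] by simp
  qed
  have "V \<in> components n {U. II_unit n lam p U} \<and> (\<exists>U\<in>V. unit_ht U = 0) \<longleftrightarrow> (\<exists>x. (0, x) \<in> Z \<and> cls x V)" for V
    unfolding cls_def by (rule bottom_component_iff) (auto simp: Z_def units_II)
  then have R: "II_region n lam p V \<longleftrightarrow> (\<exists>x. (0, x) \<in> Z \<and> \<not> at_boundary Z x \<and> cls x V)" for V
    unfolding II_region_def conj_assoc[symmetric] using bd[of _ V] by (smt (verit))
  define c where "c V = card {i \<in> {1..<l}. even_hole n lam p i \<and> intersects_at_0 n lam p i V}" for V
  have c: "c V = card (meets Z x)" if "(0, x) \<in> Z" "cls x V" for x V
    unfolding c_def using meets_hole[OF D Z_def that(1)] that(2) unfolding cls_def by simp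
  have "(\<exists>V. (\<exists>x. (0, x) \<in> Z \<and> \<not> at_boundary Z x \<and> cls x V) \<and> odd (c V)) \<longleftrightarrow>
    (\<exists>x. (0, x) \<in> Z \<and> \<not> at_boundary Z x \<and> odd (card (meets Z x)))"
  proof
    assume "\<exists>V. (\<exists>x. (0, x) \<in> Z \<and> \<not> at_boundary Z x \<and> cls x V) \<and> odd (c V)"
    then obtain V x where "(0, x) \<in> Z" "\<not> at_boundary Z x" "cls x V" "odd (c V)" by blast
    then show "\<exists>x. (0, x) \<in> Z \<and> \<not> at_boundary Z x \<and> odd (card (meets Z x))" using c[of x V] by (intro exI[of _ x]) simp
  next
    assume "\<exists>x. (0, x) \<in> Z \<and> \<not> at_boundary Z x \<and> odd (card (meets Z x))"
    then obtain x where x: "(0, x) \<in> Z" "\<not> at_boundary Z x" "odd (card (meets Z x))" by blast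
    obtain V where V: "cls x V" using ex by blast
    have "odd (c V)" using c[OF x(1) V] x(3) by simp
    then show "\<exists>V. (\<exists>x. (0, x) \<in> Z \<and> \<not> at_boundary Z x \<and> cls x V) \<and> odd (c V)" using x V by blast
  qed
  then show ?thesis unfolding odd_II_region_def R Z_def[symmetric] z c_def .
qed

lemma odd_regions_iff2:
  assumes g: "\<exists>\<sigma>. good2 \<sigma>" and T: "\<And>x. height (n, x) \<le> 1"
  shows "\<not> (\<exists>V. odd_I_region n lam p V) \<and> \<not> (\<exists>V. odd_II_region n lam p V) \<longleftrightarrow> even_faces"
proof -
  have D: "D x \<in> {0, 1, 2}" for x using g good2_iff by blast
  have D0: "0 \<le> D x" for x using D[of x] by auto
  have c: "height \<in> conf2 (\<lambda>x. height (n, x))" unfolding conf2_def using valid D by blast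
  show ?thesis unfolding regions2[OF c T] odd_I_iff[OF D] odd_II_iff[OF D0] by blast
qed

lemma odd_regions_iffP:
  assumes g: "goodP"
  shows "\<not> (\<exists>V. odd_II_region n lam p V) \<longleftrightarrow> even_faces"
proof -
  have h: "\<And>x. 0 \<le> D x" "\<And>x. \<bar>dl x\<bar> \<le> 1" "runrule height" using g goodP_iff by blast+
  have c: "height \<in> confP (\<lambda>x. height (n, x))" unfolding confP_def using valid h by blast
  show ?thesis unfolding regionsP[OF c no_even_tieI[OF h(2)]] odd_II_iff[OF h(1)] by blast
qed

end

section \<open>The bijection\<close>

lemma fams_cong:
  assumes "\<And>i r. i \<in> {1..l} \<Longrightarrow> r \<le> n \<Longrightarrow> A i r = A' i r" "fams n l A"
  shows "fams n l A'"
  using assms unfolding fams_def by simp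

lemma cnt_cong:
  assumes "\<And>i r. i \<in> {1..l} \<Longrightarrow> r \<le> n \<Longrightarrow> A i r = A' i r"
  shows "cnt n l A = cnt n l A'"
proof
  fix v
  have "{i \<in> {1..l}. A i (fst v) \<le> snd v} = {i \<in> {1..l}. A' i (fst v) \<le> snd v}" if "fst v \<le> n"
    using assms that by auto
  then show "cnt n l A v = cnt n l A' v" by (simp add: cnt_def)
qed

lemma cnt_dens_hgt:
  assumes "dens n l A B v = dens n l A' B' v" "hgt n l A B v = hgt n l A' B' v"
  shows "cnt n l A v = cnt n l A' v \<and> cnt n l B v = cnt n l B' v"
  using assms by (simp add: dens_def hgt_def)

lemma row_inj:
  assumes "fams n l A" "fams n l A'" "r \<le> n" "i \<in> {1..l}" "\<And>x. cnt n l A (r, x) = cnt n l A' (r, x)"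
  shows "A i r = A' i r"
proof -
  have "A i r \<le> x \<longleftrightarrow> A' i r \<le> x" for x using cnt_ge[OF assms(1,3,4)] cnt_ge[OF assms(2,3,4)] assms(5) by simp
  from this[of "A i r"] this[of "A' i r"] show ?thesis by simp
qed

lemma good2_cong:
  assumes T: "two_fams n l A B" "two_fams n l A' B'" and eq: "\<And>i. i \<in> {1..l} \<Longrightarrow> A i 0 = A' i 0 \<and> B i 0 = B' i 0"
    and g: "two_fams.good2 l A B \<sigma>"
  shows "two_fams.good2 l A' B' \<sigma>"
proof -
  have perm: "\<sigma> permutes {1..l}" using g two_fams.good2_def[OF T(1)] by blast
  have \<sigma>: "\<sigma> i \<in> {1..l}" if "i \<in> {1..l}" for i using permutes_in_image[OF perm] that by blast
  have e: "A' i 0 = A i 0" "B' (\<sigma> i) 0 = B (\<sigma> i) 0" if "i \<in> {1..l}" for i using eq[OF that] eq[OF \<sigma>[OF that]] by simp_all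
  show ?thesis
    unfolding two_fams.good2_def[OF T(2)]
    using g[unfolded two_fams.good2_def[OF T(1)]] by (simp only: e cong: ball_cong) blast
qed

lemma goodP_cong:
  assumes T: "two_fams n l A B" "two_fams n l A' B'" and eq: "\<And>i. i \<in> {1..l} \<Longrightarrow> A i 0 = A' i 0 \<and> B i 0 = B' i 0"
    and g: "two_fams.goodP l A B"
  shows "two_fams.goodP l A' B'"
  unfolding two_fams.goodP_def[OF T(2)]
proof (intro conjI ballI impI)
  have G: "\<forall>i\<in>{1..l}. A i 0 < B i 0 \<and> odd (B i 0 - A i 0)" "\<forall>i\<in>{1..<l}. even (A i 0 - A (Suc i) 0) \<longrightarrow> B (Suc i) 0 \<le> A i 0"
    using g unfolding two_fams.goodP_def[OF T(1)] by auto
  fix i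
  show "A' i 0 < B' i 0" "odd (B' i 0 - A' i 0)" if "i \<in> {1..l}" using bspec[OF G(1) that] eq[OF that] by simp_all
  show "B' (Suc i) 0 \<le> A' i 0" if "i \<in> {1..<l}" "even (A' i 0 - A' (Suc i) 0)"
  proof -
    have "i \<in> {1..l}" "Suc i \<in> {1..l}" using that by auto
    then show ?thesis using eq[of i] eq[of "Suc i"] bspec[OF G(2) that(1)] that(2) by simp
  qed
qed

lemma bij_betw_fibres:
  assumes "\<And>s. s \<in> g ` X \<union> h ` Y \<Longrightarrow> \<exists>f. bij_betw f {x \<in> X. g x = s} {y \<in> Y. h y = s}"
  shows "\<exists>f. bij_betw f X Y \<and> (\<forall>x\<in>X. h (f x) = g x)"
proof -
  define F where "F s = (SOME f. bij_betw f {x \<in> X. g x = s} {y \<in> Y. h y = s})" for s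
  have F: "bij_betw (F s) {x \<in> X. g x = s} {y \<in> Y. h y = s}" if "s \<in> g ` X \<union> h ` Y" for s
    unfolding F_def using assms[OF that] by (rule someI_ex)
  have X: "F (g x) x \<in> Y \<and> h (F (g x) x) = g x" if "x \<in> X" for x
    using bij_betwE[OF F[of "g x"]] that by blast
  have "bij_betw (\<lambda>x. F (g x) x) X Y"
  proof (rule bij_betwI')
    fix x y assume xy: "x \<in> X" "y \<in> X"
    show "F (g x) x = F (g y) y \<longleftrightarrow> x = y"
    proof
      assume e: "F (g x) x = F (g y) y"
      then have "g x = g y" using X xy by metis
      then show "x = y" using e bij_betw_imp_inj_on[OF F[of "g y"]] xy by (auto dest: inj_onD)
    qed simp
  next
    fix x assume "x \<in> X" then show "F (g x) x \<in> Y" using X by blast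
  next
    fix y assume y: "y \<in> Y"
    then have "y \<in> F (h y) ` {x \<in> X. g x = h y}" using bij_betw_imp_surj_on[OF F[of "h y"]] by blast
    then show "\<exists>x\<in>X. y = F (g x) x" by force
  qed
  then show ?thesis using X by blast
qed

context diagram
begin

definition dn :: "(nat \<Rightarrow> path) \<Rightarrow> node \<Rightarrow> int" where "dn p = dens n l (fa n p) (fb n lam p)"
definition hg :: "(nat \<Rightarrow> path) \<Rightarrow> node \<Rightarrow> int" where "hg p = hgt n l (fa n p) (fb n lam p)"

definition topT :: "int \<Rightarrow> int" where
  "topT x = int (card {i \<in> {1..l}. topa n mu i \<le> x}) - int (card {i \<in> {1..l}. topb lam i \<le> x})"

lemma topT_eq:
  assumes "\<And>i. i \<in> {1..l} \<Longrightarrow> A i n = topa n mu i" "\<And>i. i \<in> {1..l} \<Longrightarrow> B i n = topb lam i"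
  shows "hgt n l A B (n, x) = topT x"
proof -
  have "{i \<in> {1..l}. A i n \<le> x} = {i \<in> {1..l}. topa n mu i \<le> x}" "{i \<in> {1..l}. B i n \<le> x} = {i \<in> {1..l}. topb lam i \<le> x}"
    using assms by auto
  then show ?thesis by (simp add: hgt_def cnt_def topT_def)
qed

text \<open>Height 2 at a top node would place some \<open>topa n mu i\<close> strictly left of
  \<open>topb lam (Suc i)\<close>, against positivity. The start and end points are viewed as
  families with the single row 0.\<close>

lemma topT_le: "topT x \<le> 1"
proof (rule ccontr)
  assume "\<not> topT x \<le> 1"
  have A: "fams 0 l (\<lambda>i r. topa n mu i)" "fams 0 l (\<lambda>i r. topb lam i)"
    using topa_less topb_less by (auto simp: fams_def)
  define ca where "ca = cnt 0 l (\<lambda>i r. topa n mu i) (0, x)"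
  define cb where "cb = cnt 0 l (\<lambda>i r. topb lam i) (0, x)"
  have h: "2 \<le> ca - cb" using \<open>\<not> topT x \<le> 1\<close> by (simp add: ca_def cb_def cnt_def topT_def)
  have b: "0 \<le> cb" "ca \<le> int l" unfolding ca_def cb_def using cnt_bounds by auto
  define i where "i = nat (int l + 1 - ca)"
  have i: "i \<in> {1..<l}" "int i = int l + 1 - ca" using h b by (auto simp: i_def)
  have "topa n mu i \<le> x" using cnt_ge[OF A(1), of 0 i x] i unfolding ca_def by auto
  moreover have "\<not> topb lam (Suc i) \<le> x" using cnt_ge[OF A(2), of 0 "Suc i" x] i h unfolding cb_def[symmetric] by auto
  ultimately show False using top_pos[OF i(1)] by simp
qed

text \<open>What membership in the two sets has in common; they differ by \<open>good2\<close> and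
  \<open>goodP\<close>, and by \<sigma> being the identity for \<open>P\<close>.\<close>

definition sound :: "(nat \<Rightarrow> nat) \<Rightarrow> (nat \<Rightarrow> path) \<Rightarrow> bool" where
  "sound \<sigma> p \<longleftrightarrow> \<sigma> permutes {1..l} \<and> p \<in> tuples_perm \<sigma> n lam mu \<and> fams n l (fa n p) \<and> fams n l (fb n lam p) \<and>
    strip.even_faces n l (dn p)"

lemma tuple_dtuple:
  assumes "\<sigma> permutes {1..l}" "p \<in> tuples_perm \<sigma> n lam mu" "fams n l (fa n p)" "fams n l (fb n lam p)"
  shows "dtuple n lam mu p" "hg p (n, x) = topT x"
  subgoal using assms p_path[OF assms(1,2)] src_in[OF assms(1,2)] by unfold_locales blast+
  subgoal unfolding hg_def by (rule topT_eq) (use fa_top[OF assms(1,2)] fb_top[OF assms(1,2)] in auto)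
  done

lemma P2_iff: "p \<in> P2_set n lam mu \<longleftrightarrow> (\<exists>\<sigma>. sound \<sigma> p \<and> two_fams.good2 l (fa n p) (fb n lam p) \<sigma>)"
proof -
  have "(\<forall>i\<in>{1..l}. \<forall>j\<in>{1..l}. i \<noteq> j \<longrightarrow> \<not> ordinarily_intersecting (p i) (p j)) \<and>
    \<not> (\<exists>V. odd_I_region n lam p V) \<and> \<not> (\<exists>V. odd_II_region n lam p V) \<longleftrightarrow>
    fams n l (fa n p) \<and> fams n l (fb n lam p) \<and> strip.even_faces n l (dn p) \<and> two_fams.good2 l (fa n p) (fb n lam p) \<sigma>"
    if s: "\<sigma> permutes {1..l}" "p \<in> tuples_perm \<sigma> n lam mu" for \<sigma>
  proof -
    have "\<not> (\<exists>V. odd_I_region n lam p V) \<and> \<not> (\<exists>V. odd_II_region n lam p V) \<longleftrightarrow> strip.even_faces n l (dn p)"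
      if f: "fams n l (fa n p)" "fams n l (fb n lam p)" "two_fams.good2 l (fa n p) (fb n lam p) \<sigma>"
      unfolding dn_def
      by (rule dtuple.odd_regions_iff2[OF tuple_dtuple(1)[OF s f(1,2)]])
        (use f(3) tuple_dtuple(2)[OF s f(1,2)] topT_le in \<open>auto simp: hg_def\<close>)
    then show ?thesis unfolding no_ord_iff2[OF s] by blast
  qed
  then show ?thesis unfolding P2_set_def tuples_def sound_def by blast
qed

lemma P_iff: "p \<in> P_set n lam mu \<longleftrightarrow> sound id p \<and> two_fams.goodP l (fa n p) (fb n lam p)"
proof -
  have "(\<forall>i\<in>{1..<l}. \<not> ordinarily_intersecting (p i) (p (i + 1))) \<and> \<not> (\<exists>V. odd_II_region n lam p V) \<longleftrightarrow>
    fams n l (fa n p) \<and> fams n l (fb n lam p) \<and> strip.even_faces n l (dn p) \<and> two_fams.goodP l (fa n p) (fb n lam p)"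
    if s: "p \<in> tuples_perm id n lam mu"
  proof -
    have "\<not> (\<exists>V. odd_II_region n lam p V) \<longleftrightarrow> strip.even_faces n l (dn p)"
      if f: "fams n l (fa n p)" "fams n l (fb n lam p)" "two_fams.goodP l (fa n p) (fb n lam p)"
      unfolding dn_def by (rule dtuple.odd_regions_iffP[OF tuple_dtuple(1)[OF permutes_id s f(1,2)] f(3)])
    then show ?thesis unfolding no_ord_iffP[OF s] by blast
  qed
  then show ?thesis unfolding P_set_def sound_def using permutes_id[of "{1..l}"] by blast
qed

text \<open>The sums that can occur in either set, described without reference to which one. The
  bound on \<open>del\<close> belongs here because it depends on the sum only.\<close>

definition realizable :: "(node \<Rightarrow> int) \<Rightarrow> bool" where
  "realizable S \<longleftrightarrow> (\<exists>A B. two_fams n l A B \<and> dens n l A B = S \<and> (\<forall>i\<in>{1..l}. A i n = topa n mu i \<and> B i n = topb lam i) \<and>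
    (\<forall>x. \<bar>del l A B x\<bar> \<le> 1) \<and> strip.even_faces n l S)"

lemma sound_realizable:
  assumes "sound \<sigma> p" and "\<And>x. \<bar>del l (fa n p) (fb n lam p) x\<bar> \<le> 1"
  shows "realizable (dn p)"
proof -
  have s: "\<sigma> permutes {1..l}" "p \<in> tuples_perm \<sigma> n lam mu" "fams n l (fa n p)" "fams n l (fb n lam p)" "strip.even_faces n l (dn p)"
    using assms(1) by (auto simp: sound_def)
  have "two_fams n l (fa n p) (fb n lam p)" using two_fams.intro[OF n0 s(3,4)] .
  then show ?thesis unfolding realizable_def
    using fa_top[OF s(1,2)] fb_top[OF s(1,2)] s(5) assms(2) dn_def[of p]
    by (intro exI[of _ "fa n p"] exI[of _ "fb n lam p"]) simp
qed

lemma two_famsI: "sound \<sigma> p \<Longrightarrow> two_fams n l (fa n p) (fb n lam p)"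
  unfolding sound_def using two_fams.intro[OF n0] by blast

lemma P2_realizable: "p \<in> P2_set n lam mu \<Longrightarrow> realizable (dn p)"
proof -
  assume "p \<in> P2_set n lam mu"
  then obtain \<sigma> where "sound \<sigma> p" "two_fams.good2 l (fa n p) (fb n lam p) \<sigma>" unfolding P2_iff by blast
  then show ?thesis using two_fams.good2_iff[OF two_famsI] sound_realizable by blast
qed

lemma P_realizable: "p \<in> P_set n lam mu \<Longrightarrow> realizable (dn p)"
  unfolding P_iff using two_fams.goodP_iff[OF two_famsI] sound_realizable by blast

text \<open>Sum and difference on row \<open>n\<close> determine both counts there, so the new
  families have the prescribed endpoints.\<close>

lemma realize_conf:
  assumes S: "realizable S" and d: "strip.valid n S d" "\<And>x. d (n, x) = topT x"
  obtains A B where "two_fams n l A B" "dens n l A B = S" "hgt n l A B = d" "\<And>x. \<bar>del l A B x\<bar> \<le> 1"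
    "\<And>i. i \<in> {1..l} \<Longrightarrow> A i n = topa n mu i" "\<And>i. i \<in> {1..l} \<Longrightarrow> B i n = topb lam i"
proof -
  obtain A0 B0 where AB: "two_fams n l A0 B0" "dens n l A0 B0 = S"
    "\<And>i. i \<in> {1..l} \<Longrightarrow> A0 i n = topa n mu i" "\<And>i. i \<in> {1..l} \<Longrightarrow> B0 i n = topb lam i" "\<And>x. \<bar>del l A0 B0 x\<bar> \<le> 1"
    using S unfolding realizable_def by blast
  have f: "fams n l A0" "fams n l B0" using AB(1) by (simp_all add: two_fams_def)
  have st: "strip n l S" using strip_dens[OF n0 f] AB(2) by simp
  have out: "S v = 0" if "n < fst v" for v using that unfolding AB(2)[symmetric] by (simp add: dens_def cnt_def)
  obtain A B where A: "fams n l A" "fams n l B" "dens n l A B = S" "hgt n l A B = d"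
    using conf_realize[OF st out d(1)] by blast
  have c: "cnt n l A (n, x) = cnt n l A0 (n, x) \<and> cnt n l B (n, x) = cnt n l B0 (n, x)" for x
    by (rule cnt_dens_hgt) (use A AB d(2) topT_eq[of A0 B0, OF AB(3,4)] in auto)
  show ?thesis
  proof
    show "two_fams n l A B" using A n0 by (simp add: two_fams_def)
    show "\<bar>del l A B x\<bar> \<le> 1" for x using del_unique[OF n0 f, of A B] A(3) AB(2,5) by simp
    show "A i n = topa n mu i" "B i n = topb lam i" if "i \<in> {1..l}" for i
      using row_inj[OF A(1) f(1) _ that, of n] row_inj[OF A(2) f(2) _ that, of n] c AB(3,4) that by simp_all
  qed (use A in auto)
qed

lemma realize_sound:
  assumes A: "two_fams n l A B" "\<And>i. i \<in> {1..l} \<Longrightarrow> A i n = topa n mu i" "\<And>i. i \<in> {1..l} \<Longrightarrow> B i n = topb lam i"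
    and perm: "\<sigma> permutes {1..l}" and ab: "\<And>i. i \<in> {1..l} \<Longrightarrow> A i 0 < B (\<sigma> i) 0 \<and> odd (B (\<sigma> i) 0 - A i 0)"
    and ev: "strip.even_faces n l (dens n l A B)"
  obtains p where "sound \<sigma> p" "dn p = dens n l A B" "hg p = hgt n l A B"
    "\<And>i r. i \<in> {1..l} \<Longrightarrow> r \<le> n \<Longrightarrow> A i r = fa n p i r \<and> B i r = fb n lam p i r"
proof -
  have f: "fams n l A" "fams n l B" using A(1) by (simp_all add: two_fams_def)
  have st: "A i (Suc r) - A i r \<in> {0, 1}" "B i (Suc r) - B i r \<in> {0, 1}" if "i \<in> {1..l}" "r < n" for i r
    using f that unfolding fams_def by blast+
  obtain p where p: "p \<in> tuples_perm \<sigma> n lam mu" "\<And>i r. i \<in> {1..l} \<Longrightarrow> r \<le> n \<Longrightarrow> fa n p i r = A i r"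
    "\<And>i r. i \<in> {1..l} \<Longrightarrow> r \<le> n \<Longrightarrow> fb n lam p i r = B i r"
    using realize_tuple[OF st A(2,3) perm ab] by blast
  have c: "cnt n l (fa n p) = cnt n l A" "cnt n l (fb n lam p) = cnt n l B" using p(2,3) by (auto intro!: cnt_cong)
  have d: "dn p = dens n l A B" "hg p = hgt n l A B" unfolding dn_def hg_def dens_def hgt_def fun_eq_iff c by auto
  have "fams n l (fa n p)" by (rule fams_cong[OF _ f(1)]) (simp add: p)
  moreover have "fams n l (fb n lam p)" by (rule fams_cong[OF _ f(2)]) (simp add: p)
  ultimately have "sound \<sigma> p" unfolding sound_def d using perm p(1) ev by blast
  then show ?thesis using that[of p] d p(2,3) by simp
qed

lemma hg_inj:
  assumes s: "sound \<sigma> p" "sound \<tau> q" and e: "dn p = dn q" "hg p = hg q" and i: "i \<in> {1..l}" and r: "r \<le> n"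
  shows "fa n p i r = fa n q i r \<and> fb n lam p i r = fb n lam q i r"
proof -
  have c: "cnt n l (fa n p) v = cnt n l (fa n q) v \<and> cnt n l (fb n lam p) v = cnt n l (fb n lam q) v" for v
    by (rule cnt_dens_hgt) (use e in \<open>simp_all add: dn_def hg_def\<close>)
  have f: "fams n l (fa n p)" "fams n l (fa n q)" "fams n l (fb n lam p)" "fams n l (fb n lam q)"
    using s by (auto simp: sound_def)
  show ?thesis using row_inj[OF f(1,2) r i] row_inj[OF f(3,4) r i] c by blast
qed

lemma sound_eq:
  assumes s: "sound \<sigma> p" "sound \<sigma> q" and e: "dn p = dn q" "hg p = hg q"
  shows "p = q"
  by (rule tuple_unique[of \<sigma>]) (use s hg_inj[OF s e] in \<open>simp_all add: sound_def\<close>)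

lemma sound_conf:
  assumes s: "sound \<sigma> p" and S: "dn p = S"
  shows "strip.valid n S (hg p)" "hg p (n, x) = topT x"
proof -
  have p: "\<sigma> permutes {1..l}" "p \<in> tuples_perm \<sigma> n lam mu" "fams n l (fa n p)" "fams n l (fb n lam p)"
    using s by (auto simp: sound_def)
  show "strip.valid n S (hg p)" using two_fams.valid[OF two_famsI[OF s]] S by (simp add: dn_def hg_def)
  show "hg p (n, x) = topT x" by (rule tuple_dtuple(2)[OF p])
qed

text \<open>The permutation is not part of the data: it is recovered from the positions at height 0
  by \<open>good2_unique\<close>, which gives injectivity, and supplied by \<open>good2_iff\<close>
  for surjectivity.\<close>

lemma bij_conf2:
  assumes S: "realizable S"
  shows "bij_betw hg {p \<in> P2_set n lam mu. dn p = S} (strip.conf2 n S topT)"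
proof -
  obtain A0 B0 where AB: "two_fams n l A0 B0" "dens n l A0 B0 = S" and ev: "strip.even_faces n l S"
    using S unfolding realizable_def by blast
  interpret S: strip n l S using strip_dens[OF n0, of l A0 B0] AB by (simp add: two_fams_def)
  show ?thesis
  proof (rule bij_betwI')
    fix p q assume "p \<in> {p \<in> P2_set n lam mu. dn p = S}" "q \<in> {p \<in> P2_set n lam mu. dn p = S}"
    then obtain \<sigma> \<tau> where s: "sound \<sigma> p" "two_fams.good2 l (fa n p) (fb n lam p) \<sigma>" "dn p = S"
      and t: "sound \<tau> q" "two_fams.good2 l (fa n q) (fb n lam q) \<tau>" "dn q = S" unfolding P2_iff by blast
    show "hg p = hg q \<longleftrightarrow> p = q"
    proof
      assume e: "hg p = hg q"
      have d: "dn p = dn q" using s t by simp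
      have "two_fams.good2 l (fa n q) (fb n lam q) \<sigma>"
        using good2_cong[OF two_famsI[OF s(1)] two_famsI[OF t(1)] _ s(2)] hg_inj[OF s(1) t(1) d e] by blast
      then have "\<sigma> = \<tau>" using two_fams.good2_unique[OF two_famsI[OF t(1)]] t(2) by blast
      then show "p = q" using sound_eq[of \<sigma>] s(1) t(1) d e by blast
    qed simp
  next
    fix p assume "p \<in> {p \<in> P2_set n lam mu. dn p = S}"
    then obtain \<sigma> where s: "sound \<sigma> p" "two_fams.good2 l (fa n p) (fb n lam p) \<sigma>" "dn p = S" unfolding P2_iff by blast
    have "\<forall>x. hg p (0, x) \<in> {0, 1, 2}" using two_fams.good2_iff[OF two_famsI[OF s(1)]] s(2) unfolding hg_def by blast
    then show "hg p \<in> S.conf2 topT" unfolding S.conf2_def using sound_conf[OF s(1,3)] by blast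
  next
    fix d assume d: "d \<in> S.conf2 topT"
    then have v: "S.valid d" "\<And>x. d (n, x) = topT x" "\<And>x. d (0, x) \<in> {0, 1, 2}" unfolding S.conf2_def by blast+
    obtain A B where A: "two_fams n l A B" "dens n l A B = S" "hgt n l A B = d" "\<And>x. \<bar>del l A B x\<bar> \<le> 1"
      "\<And>i. i \<in> {1..l} \<Longrightarrow> A i n = topa n mu i" "\<And>i. i \<in> {1..l} \<Longrightarrow> B i n = topb lam i"
      using realize_conf[OF S v(1,2)] by blast
    obtain \<sigma> where g: "two_fams.good2 l A B \<sigma>" using two_fams.good2_iff[OF A(1)] v(3) A(3,4) by blast
    have perm: "\<sigma> permutes {1..l}" and ab: "\<And>i. i \<in> {1..l} \<Longrightarrow> A i 0 < B (\<sigma> i) 0 \<and> odd (B (\<sigma> i) 0 - A i 0)"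
      using g two_fams.good2_def[OF A(1)] by blast+
    have ev': "strip.even_faces n l (dens n l A B)" using ev A(2) by simp
    obtain p where p: "sound \<sigma> p" "dn p = dens n l A B" "hg p = hgt n l A B"
      "\<And>i r. i \<in> {1..l} \<Longrightarrow> r \<le> n \<Longrightarrow> A i r = fa n p i r \<and> B i r = fb n lam p i r"
      using realize_sound[OF A(1,5,6) perm ab ev'] by blast
    have "two_fams.good2 l (fa n p) (fb n lam p) \<sigma>"
      using good2_cong[OF A(1) two_famsI[OF p(1)] _ g] p(4) by blast
    then have "p \<in> {p \<in> P2_set n lam mu. dn p = S}" unfolding P2_iff using p A(2) by blast
    moreover have "d = hg p" using p(3) A(3) by simp
    ultimately show "\<exists>p\<in>{p \<in> P2_set n lam mu. dn p = S}. d = hg p" by blast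
  qed
qed

lemma bij_confP:
  assumes S: "realizable S"
  shows "bij_betw hg {p \<in> P_set n lam mu. dn p = S} (strip.confP n S topT)"
proof -
  obtain A0 B0 where AB: "two_fams n l A0 B0" "dens n l A0 B0 = S" and ev: "strip.even_faces n l S"
    using S unfolding realizable_def by blast
  interpret S: strip n l S using strip_dens[OF n0, of l A0 B0] AB by (simp add: two_fams_def)
  show ?thesis
  proof (rule bij_betwI')
    fix p q assume "p \<in> {p \<in> P_set n lam mu. dn p = S}" "q \<in> {p \<in> P_set n lam mu. dn p = S}"
    then have "sound id p" "sound id q" "dn p = dn q" unfolding P_iff by auto
    then show "hg p = hg q \<longleftrightarrow> p = q" using sound_eq by blast
  next
    fix p assume "p \<in> {p \<in> P_set n lam mu. dn p = S}"
    then have s: "sound id p" "two_fams.goodP l (fa n p) (fb n lam p)" "dn p = S" unfolding P_iff by blast+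
    have "(\<forall>x. 0 \<le> hg p (0, x)) \<and> S.runrule (hg p)"
      using two_fams.goodP_iff[OF two_famsI[OF s(1)]] s(2) unfolding hg_def s(3)[symmetric] dn_def by blast
    then show "hg p \<in> S.confP topT" unfolding S.confP_def using sound_conf[OF s(1,3)] by blast
  next
    fix d assume d: "d \<in> S.confP topT"
    then have v: "S.valid d" "\<And>x. d (n, x) = topT x" "\<And>x. 0 \<le> d (0, x)" "S.runrule d" unfolding S.confP_def by blast+
    obtain A B where A: "two_fams n l A B" "dens n l A B = S" "hgt n l A B = d" "\<And>x. \<bar>del l A B x\<bar> \<le> 1"
      "\<And>i. i \<in> {1..l} \<Longrightarrow> A i n = topa n mu i" "\<And>i. i \<in> {1..l} \<Longrightarrow> B i n = topb lam i"
      using realize_conf[OF S v(1,2)] by blast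
    have g: "two_fams.goodP l A B" using two_fams.goodP_iff[OF A(1)] v(3,4) unfolding A(2,3) using A(4) by blast
    have ab: "\<And>i. i \<in> {1..l} \<Longrightarrow> A i 0 < B (id i) 0 \<and> odd (B (id i) 0 - A i 0)"
      using g two_fams.goodP_def[OF A(1)] by simp
    have ev': "strip.even_faces n l (dens n l A B)" using ev A(2) by simp
    obtain p where p: "sound id p" "dn p = dens n l A B" "hg p = hgt n l A B"
      "\<And>i r. i \<in> {1..l} \<Longrightarrow> r \<le> n \<Longrightarrow> A i r = fa n p i r \<and> B i r = fb n lam p i r"
      using realize_sound[OF A(1,5,6) permutes_id ab ev'] by blast
    have "two_fams.goodP l (fa n p) (fb n lam p)"
      using goodP_cong[OF A(1) two_famsI[OF p(1)] _ g] p(4) by blast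
    then have "p \<in> {p \<in> P_set n lam mu. dn p = S}" unfolding P_iff using p A(2) by blast
    moreover have "d = hg p" using p(3) A(3) by simp
    ultimately show "\<exists>p\<in>{p \<in> P_set n lam mu. dn p = S}. d = hg p" by blast
  qed
qed

theorem dens_bij: "\<exists>\<phi>. bij_betw \<phi> (P2_set n lam mu) (P_set n lam mu) \<and> (\<forall>p\<in>P2_set n lam mu. dn (\<phi> p) = dn p)"
proof (rule bij_betw_fibres)
  fix S assume "S \<in> dn ` P2_set n lam mu \<union> dn ` P_set n lam mu"
  then have S: "realizable S" using P2_realizable P_realizable by blast
  obtain A B where AB: "two_fams n l A B" "dens n l A B = S" "\<And>x. \<bar>del l A B x\<bar> \<le> 1" and ev: "strip.even_faces n l S"
    using S unfolding realizable_def by blast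
  have st: "strip n l S" using strip_dens[OF n0, of l A B] AB(1,2) by (simp add: two_fams_def)
  have nt: "strip.no_even_tie S" using two_fams.no_even_tieI[OF AB(1) AB(3)] AB(2) by simp
  obtain f where f: "bij_betw f (strip.conf2 n S topT) (strip.confP n S topT)"
    using strip.conf_bij[OF st, of topT, OF topT_le nt ev] by blast
  have "bij_betw (inv_into {p \<in> P_set n lam mu. dn p = S} hg \<circ> (f \<circ> hg)) {p \<in> P2_set n lam mu. dn p = S} {p \<in> P_set n lam mu. dn p = S}"
    using bij_betw_trans[OF bij_betw_trans[OF bij_conf2[OF S] f] bij_betw_inv_into[OF bij_confP[OF S]]] .
  then show "\<exists>f. bij_betw f {p \<in> P2_set n lam mu. dn p = S} {p \<in> P_set n lam mu. dn p = S}" by blast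
qed

end

section \<open>Weights\<close>

abbreviation zcarrier :: "nat \<Rightarrow> zpoly set" where "zcarrier n \<equiv> carrier (zpoly_ring n)"

definition zcls :: "nat \<Rightarrow> zpoly \<Rightarrow> zpoly set" where
  "zcls n f = zideal n +>\<^bsub>zpoly_ring n\<^esub> f"

lemma zcarrier_one: "1 \<in> zcarrier n" by (simp add: zpoly_ring_def)

lemma zcarrier_mult: "f \<in> zcarrier n \<Longrightarrow> g \<in> zcarrier n \<Longrightarrow> f * g \<in> zcarrier n"
proof -
  interpret cring "zpoly_ring n" by (rule zpoly_ring_cring)
  show "f \<in> zcarrier n \<Longrightarrow> g \<in> zcarrier n \<Longrightarrow> f * g \<in> zcarrier n"
    using m_closed[of f g] by (simp add: zpoly_ring_def)
qed

lemma zcarrier_prod: "(\<And>k. k \<in> K \<Longrightarrow> f k \<in> zcarrier n) \<Longrightarrow> prod f K \<in> zcarrier n"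
  by (induction K rule: infinite_finite_induct) (auto intro: zcarrier_one zcarrier_mult)

lemma zcarrier_power: "f \<in> zcarrier n \<Longrightarrow> f ^ k \<in> zcarrier n"
  by (induction k) (auto intro: zcarrier_one zcarrier_mult)

lemma zideal_ideal: "ideal (zideal n) (zpoly_ring n)"
proof -
  interpret cring "zpoly_ring n" by (rule zpoly_ring_cring)
  show ?thesis unfolding zideal_def by (rule genideal_ideal[OF zrelators_closed])
qed

lemma zcls_hom: "zcls n \<in> ring_hom (zpoly_ring n) (Zring n)"
  using ideal.rcos_ring_hom[OF zideal_ideal] unfolding Zring_def zcls_def by (simp add: eta_contract_eq)

lemma zcls_mult: "f \<in> zcarrier n \<Longrightarrow> g \<in> zcarrier n \<Longrightarrow> zcls n (f * g) = zcls n f \<otimes>\<^bsub>Zring n\<^esub> zcls n g"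
  using ring_hom_mult[OF zcls_hom, of f n g] by (simp add: zpoly_ring_def)

lemma zcls_one: "zcls n 1 = \<one>\<^bsub>Zring n\<^esub>"
  using ring_hom_one[OF zcls_hom, of n] by (simp add: zpoly_ring_def)

lemma zcls_closed: "f \<in> zcarrier n \<Longrightarrow> zcls n f \<in> carrier (Zring n)"
  by (rule ring_hom_closed[OF zcls_hom])

lemma finprod_zcls:
  assumes "finite K" "\<And>k. k \<in> K \<Longrightarrow> f k \<in> zcarrier n"
  shows "(\<Otimes>\<^bsub>Zring n\<^esub>k\<in>K. zcls n (f k)) = zcls n (prod f K)"
proof -
  interpret cring "Zring n" by (rule Zring_cring)
  show ?thesis
    using assms
  proof (induction K rule: finite_induct)
    case (insert k K)
    have "(\<Otimes>\<^bsub>Zring n\<^esub>j\<in>insert k K. zcls n (f j)) = zcls n (f k) \<otimes>\<^bsub>Zring n\<^esub> (\<Otimes>\<^bsub>Zring n\<^esub>j\<in>K. zcls n (f j))"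
      using insert by (intro finprod_insert) (auto intro: zcls_closed)
    then show ?case using insert zcls_mult[of "f k" n "prod f K"] zcarrier_prod[of K f n] by simp
  qed (simp add: zcls_one)
qed

text \<open>Membership in the carrier is included so that products and chains of equalities need no
  side conditions.\<close>

definition zeq :: "nat \<Rightarrow> zpoly \<Rightarrow> zpoly \<Rightarrow> bool" where
  "zeq n f g \<longleftrightarrow> f \<in> zcarrier n \<and> g \<in> zcarrier n \<and> zcls n f = zcls n g"

lemma zeq_refl: "f \<in> zcarrier n \<Longrightarrow> zeq n f f" by (simp add: zeq_def)

lemma zeq_trans [trans]: "zeq n f g \<Longrightarrow> zeq n g h \<Longrightarrow> zeq n f h" by (simp add: zeq_def)

lemma zeq_mult: "zeq n f g \<Longrightarrow> zeq n f' g' \<Longrightarrow> zeq n (f * f') (g * g')"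
  by (simp add: zeq_def zcarrier_mult zcls_mult)

lemma zeq_power: "zeq n f g \<Longrightarrow> zeq n (f ^ k) (g ^ k)"
  by (induction k) (auto intro: zeq_mult zeq_refl zcarrier_one)

lemma zeq_prod: "(\<And>k. k \<in> K \<Longrightarrow> zeq n (f k) (g k)) \<Longrightarrow> zeq n (prod f K) (prod g K)"
  by (induction K rule: infinite_finite_induct) (auto intro: zeq_mult zeq_refl zcarrier_one)

lemma zeq_relator:
  assumes "i \<in> {1..n}"
  shows "zeq n (zvar (Unbarred i) b * zvar (Barred i) (b - 2 * of_nat n + 2 * of_nat i))
    (zvar (Unbarred (i - 1)) b * zvar (Barred (i - 1)) (b - 2 * of_nat n + 2 * of_nat i))" (is "zeq n ?f ?g")
proof -
  interpret ideal "zideal n" "zpoly_ring n" by (rule zideal_ideal)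
  have v: "zvar (Unbarred j) c \<in> zcarrier n" "zvar (Barred j) c \<in> zcarrier n" if "j \<le> n" for j c
    using that by (cases "j = 0"; auto intro!: zvar_closed simp: letters_def)+
  have C: "?f \<in> zcarrier n" "?g \<in> zcarrier n" using assms by (auto intro!: zcarrier_mult v)
  have "?f - ?g \<in> zrelators n" unfolding zrelators_def using assms by blast
  then have "?f - ?g \<in> zideal n" unfolding zideal_def using genideal_self[OF zrelators_closed] by blast
  then have "(?f - ?g) \<oplus>\<^bsub>zpoly_ring n\<^esub> ?g \<in> zideal n +>\<^bsub>zpoly_ring n\<^esub> ?g"
    unfolding a_r_coset_def' by blast
  then have "?f \<in> zideal n +>\<^bsub>zpoly_ring n\<^esub> ?g" by (simp add: zpoly_ring_def)
  then have "zcls n ?g = zcls n ?f" unfolding zcls_def using a_repr_independence'[OF _ C(2)] by blast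
  then show ?thesis using C by (simp add: zeq_def)
qed

section \<open>Normal form of a weight\<close>

definition zlow :: "nat \<Rightarrow> complex \<Rightarrow> nat \<Rightarrow> int \<Rightarrow> zpoly" where
  "zlow n c r x = zvar (Unbarred (n - r)) (c - 2 * of_int x + 2 * of_nat r)"

definition zupp :: "nat \<Rightarrow> complex \<Rightarrow> nat \<Rightarrow> int \<Rightarrow> zpoly" where
  "zupp n c r x = zvar (Barred (n - r)) (c - 2 * of_int x)"

text \<open>In row 0 this is the weight of two consecutive E-steps, the first starting at
  \<open>x\<close>: odd-numbered E-steps carry the barred letter and even-numbered ones the unbarred
  letter.\<close>

definition zpair :: "nat \<Rightarrow> complex \<Rightarrow> nat \<Rightarrow> int \<Rightarrow> zpoly" where
  "zpair n c r x = zupp n c r x * zlow n c r (x + 1)"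

lemma zlow_closed: "zlow n c r x \<in> zcarrier n" and zupp_closed: "zupp n c r x \<in> zcarrier n"
  unfolding zlow_def zupp_def by (cases "n - r = 0"; auto intro!: zvar_closed simp: letters_def)+

lemma zpair_closed: "zpair n c r x \<in> zcarrier n"
  unfolding zpair_def by (intro zcarrier_mult zlow_closed zupp_closed)

lemma zpair_top: "zpair n c n x = 1"
  by (simp add: zpair_def zlow_def zupp_def zvar_def)

text \<open>The defining relation of the ring in node coordinates: a match of \<open>zlow\<close>
  and \<open>zupp\<close> at one node is traded for a pair one row higher. On the top row pairs
  equal 1 and disappear.\<close>

lemma zeq_Suc:
  assumes r: "r < n"
  shows "zeq n (zlow n c r x * zupp n c r x) (zpair n c (Suc r) x)"
proof -
  have i: "n - r \<in> {1..n}" "n - r - 1 = n - Suc r" "(of_nat (n - r) :: complex) = of_nat n - of_nat r"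
    using r by (auto simp: of_nat_diff)
  show ?thesis
    using zeq_relator[OF i(1), of "c - 2 * of_int x + 2 * of_nat r"]
    unfolding zpair_def zlow_def zupp_def i(2,3) by (simp add: algebra_simps)
qed

text \<open>The multiplicity with which \<open>zpair\<close> can be carried over to row \<open>r\<close>, when row \<open>s\<close> contributes
  the powers \<open>e s\<close> and \<open>f s\<close> of \<open>zlow\<close> and \<open>zupp\<close>.\<close>

fun carried :: "(nat \<Rightarrow> int \<Rightarrow> nat) \<Rightarrow> (nat \<Rightarrow> int \<Rightarrow> nat) \<Rightarrow> (int \<Rightarrow> nat) \<Rightarrow> nat \<Rightarrow> int \<Rightarrow> nat" where
  "carried e f m 0 x = m x"
| "carried e f m (Suc r) x = min (carried e f m r (x - 1) + e r x) (carried e f m r x + f r x)"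

lemma prod_shift:
  fixes g :: "int \<Rightarrow> 'a::comm_monoid_mult"
  assumes "L \<le> H" "h (L - 1) = 0" "h H = 0"
  shows "(\<Prod>x\<in>{L..H}. g (x + 1) ^ h x) = (\<Prod>x\<in>{L..H}. g x ^ h (x - 1))"
proof -
  have "(\<Prod>x\<in>{L..H}. g (x + 1) ^ h x) = (\<Prod>x\<in>{L..H - 1}. g (x + 1) ^ h x)"
    by (rule prod.mono_neutral_right) (use assms in auto)
  also have "\<dots> = (\<Prod>x\<in>{L + 1..H}. g x ^ h (x - 1))"
    by (rule prod.reindex_bij_witness[of _ "\<lambda>x. x - 1" "\<lambda>x. x + 1"]) auto
  also have "\<dots> = (\<Prod>x\<in>{L..H}. g x ^ h (x - 1))"
  proof (rule prod.mono_neutral_left)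
    have "i = L" if "i \<in> {L..H} - {L + 1..H}" for i using that by auto
    then show "\<forall>i\<in>{L..H} - {L + 1..H}. g i ^ h (i - 1) = 1" using assms(2) by (metis power_0)
  qed auto
  finally show ?thesis .
qed

text \<open>In each row all available matches are carried upwards and only the unmatched factors
  stay, so after \<open>n\<close> rows a normal form remains. A pair uses columns \<open>x\<close>
  and \<open>x + 1\<close>, so exponents must vanish at the two ends of the window.\<close>

lemma zeq_carry:
  assumes "L \<le> H" "k \<le> n"
    and m: "m (L - 1) = 0" "m H = 0" and f: "\<And>r. r < n \<Longrightarrow> f r (L - 1) = 0" "\<And>r. r < n \<Longrightarrow> f r H = 0"
  shows "zeq n ((\<Prod>x\<in>{L..H}. zpair n c 0 x ^ m x) * (\<Prod>r<k. \<Prod>x\<in>{L..H}. zlow n c r x ^ e r x * zupp n c r x ^ f r x))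
    ((\<Prod>r<k. \<Prod>x\<in>{L..H}. zlow n c r x ^ (carried e f m r (x - 1) + e r x - carried e f m (Suc r) x) *
        zupp n c r x ^ (carried e f m r x + f r x - carried e f m (Suc r) x)) *
      (\<Prod>x\<in>{L..H}. zpair n c k x ^ carried e f m k x))"
  using assms(2)
proof (induction k)
  case 0
  then show ?case by (auto intro!: zeq_refl zcarrier_prod zcarrier_power zpair_closed)
next
  case (Suc k)
  define K where "K = carried e f m"
  define P where "P = (\<Prod>r<k. \<Prod>x\<in>{L..H}. zlow n c r x ^ (K r (x - 1) + e r x - K (Suc r) x) *
        zupp n c r x ^ (K r x + f r x - K (Suc r) x))"
  define Q where "Q = (\<Prod>x\<in>{L..H}. zlow n c k x ^ e k x * zupp n c k x ^ f k x)"
  define R where "R = (\<Prod>x\<in>{L..H}. zlow n c k x ^ (K k (x - 1) + e k x - K (Suc k) x) *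
        zupp n c k x ^ (K k x + f k x - K (Suc k) x))"
  have k: "k < n" using Suc.prems by simp
  have z: "K r (L - 1) = 0 \<and> K r H = 0" if "r \<le> n" for r
    using that
  proof (induction r)
    case 0 then show ?case using m by (simp add: K_def)
  next
    case (Suc r) then show ?case using f[of r] by (simp add: K_def)
  qed
  have "(\<Prod>x\<in>{L..H}. zpair n c k x ^ K k x) * Q = (\<Prod>x\<in>{L..H}. zlow n c k x ^ (K k (x - 1) + e k x) * zupp n c k x ^ (K k x + f k x))"
    unfolding Q_def zpair_def power_mult_distrib prod.distrib power_add
      prod_shift[OF assms(1), of "K k" "zlow n c k", OF conjunct1[OF z] conjunct2[OF z], OF less_imp_le[OF k] less_imp_le[OF k]]
    by (simp add: mult_ac)
  also have "\<dots> = R * (\<Prod>x\<in>{L..H}. (zlow n c k x * zupp n c k x) ^ K (Suc k) x)"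
    unfolding R_def prod.distrib[symmetric]
  proof (rule prod.cong)
    fix x
    have le: "K (Suc k) x \<le> K k (x - 1) + e k x" "K (Suc k) x \<le> K k x + f k x" by (simp_all add: K_def)
    show "zlow n c k x ^ (K k (x - 1) + e k x) * zupp n c k x ^ (K k x + f k x) =
      zlow n c k x ^ (K k (x - 1) + e k x - K (Suc k) x) * zupp n c k x ^ (K k x + f k x - K (Suc k) x) *
      (zlow n c k x * zupp n c k x) ^ K (Suc k) x"
      using power_add[of "zlow n c k x" "K k (x - 1) + e k x - K (Suc k) x" "K (Suc k) x"]
        power_add[of "zupp n c k x" "K k x + f k x - K (Suc k) x" "K (Suc k) x"] le
      by (simp add: power_mult_distrib mult_ac)
  qed simp
  finally have 1: "(\<Prod>x\<in>{L..H}. zpair n c k x ^ K k x) * Q = R * (\<Prod>x\<in>{L..H}. (zlow n c k x * zupp n c k x) ^ K (Suc k) x)" .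
  have C: "P \<in> zcarrier n" "Q \<in> zcarrier n" "R \<in> zcarrier n" unfolding P_def Q_def R_def
    by (auto intro!: zcarrier_prod zcarrier_mult zcarrier_power zlow_closed zupp_closed)
  have IH: "zeq n ((\<Prod>x\<in>{L..H}. zpair n c 0 x ^ m x) * (\<Prod>r<k. \<Prod>x\<in>{L..H}. zlow n c r x ^ e r x * zupp n c r x ^ f r x))
    (P * (\<Prod>x\<in>{L..H}. zpair n c k x ^ K k x))"
    using Suc.IH Suc.prems unfolding K_def P_def by simp
  have "zeq n ((\<Prod>x\<in>{L..H}. zpair n c 0 x ^ m x) * (\<Prod>r<Suc k. \<Prod>x\<in>{L..H}. zlow n c r x ^ e r x * zupp n c r x ^ f r x))
    (P * (R * (\<Prod>x\<in>{L..H}. (zlow n c k x * zupp n c k x) ^ K (Suc k) x)))"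
    using zeq_mult[OF IH zeq_refl[OF C(2)]] unfolding 1[symmetric] by (simp add: Q_def mult_ac)
  also have "zeq n \<dots> (P * (R * (\<Prod>x\<in>{L..H}. zpair n c (Suc k) x ^ K (Suc k) x)))"
    by (intro zeq_mult zeq_refl C zeq_prod zeq_power zeq_Suc[OF k])
  finally show ?case unfolding K_def[symmetric] by (simp add: P_def R_def mult_ac)
qed

lemma prod_if_card:
  fixes g :: "'b \<Rightarrow> 'c::comm_monoid_mult"
  assumes "finite K"
  shows "(\<Prod>i\<in>K. \<Prod>x\<in>I. if P i x then g x else 1) = (\<Prod>x\<in>I. g x ^ card {i \<in> K. P i x})"
proof -
  have "(\<Prod>i\<in>K. if P i x then g x else 1) = g x ^ card {i \<in> K. P i x}" for x
  proof -
    have "(\<Prod>i\<in>K. if P i x then g x else 1) = (\<Prod>i\<in>{i \<in> K. P i x}. g x)"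
      by (rule prod.inter_filter[OF assms, symmetric])
    then show ?thesis by simp
  qed
  then show ?thesis by (subst prod.swap) simp
qed

lemma prod_lessThan_add: "(\<Prod>k<a + (b::nat). g k) = (\<Prod>k<a. g k) * (\<Prod>k<b. g (a + k) :: 'a::comm_monoid_mult)"
  by (induction b) (simp_all add: mult_ac)

text \<open>An even number of E-steps, grouped in consecutive pairs; the pair is recorded at the
  column where it begins.\<close>

lemma prod_pairs:
  fixes g h :: "int \<Rightarrow> 'a::comm_monoid_mult"
  shows "(\<Prod>j<2 * t. if even j then g (y + int j) else h (y + int j)) = (\<Prod>x\<in>{y..<y + 2 * int t}. if even (x - y) then g x * h (x + 1) else 1)"
proof (induction t)
  case (Suc t)
  have "{y..<y + 2 * int (Suc t)} = insert (y + 2 * int t + 1) (insert (y + 2 * int t) {y..<y + 2 * int t})" by auto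
  then have "(\<Prod>x\<in>{y..<y + 2 * int (Suc t)}. if even (x - y) then g x * h (x + 1) else 1) =
    (g (y + 2 * int t) * h (y + 2 * int t + 1)) * (\<Prod>x\<in>{y..<y + 2 * int t}. if even (x - y) then g x * h (x + 1) else 1)"
    by simp
  moreover have "2 * Suc t = Suc (Suc (2 * t))" by simp
  ultimately show ?case using Suc by (simp add: mult_ac add_ac)
qed simp

text \<open>The weight is spread over all nodes of a window, with trivial factors, so that the
  product over a tuple can be sorted by nodes. Only NE-steps count: \<open>low\<close> stays and
  \<open>upp\<close> grows along them.\<close>

lemma path_weight_eq:
  fixes c :: complex
  assumes q: "is_path n q" and n: "0 < n" and I: "\<And>r. r \<le> n \<Longrightarrow> L \<le> low n q r \<and> low n q r \<le> H"
    "\<And>r. r \<le> n \<Longrightarrow> L \<le> upp n q r \<and> upp n q r \<le> H"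
  defines "W \<equiv> (\<Prod>x\<in>{L..H}. if low n q 0 < x \<and> x < upp n q 0 \<and> odd (x - low n q 0) then zpair n c 0 x else 1) *
    (\<Prod>r<n. \<Prod>x\<in>{L..H}. if low n q r = x \<and> low n q (Suc r) = x then zlow n c r x else 1) *
    (\<Prod>r<n. \<Prod>x\<in>{L..H}. if upp n q r = x \<and> upp n q (Suc r) = x + 1 then zupp n c r x else 1)"
  shows "path_weight n c q = zcls n W" "W \<in> zcarrier n"
proof -
  show C: "W \<in> zcarrier n" unfolding W_def
    by (intro zcarrier_mult zcarrier_prod) (auto intro: zcarrier_one zlow_closed zupp_closed zpair_closed)
  define E where "E = num_E q"
  define z where "z k = zvar (L1 n q k) (c - 2 * of_int (fst (vertex q k)))" for k
  define w where "w k = (if snd q ! k \<noteq> NW_step then z k else 1)" for k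
  note st = path_structure[OF q n, folded E_def]
  have wl: "w (n - Suc r) = (\<Prod>x\<in>{L..H}. if low n q r = x \<and> low n q (Suc r) = x then zlow n c r x else 1)" if r: "r < n" for r
  proof -
    have v: "vertex q (n - Suc r) = (low n q (Suc r) - int (Suc r) + 1, - low n q (Suc r) - 1)"
      using vertex_low[OF q n, of "Suc r"] r by simp
    have "snd q ! (n - Suc r) \<noteq> E_step" using st(2) r by simp
    then have NE: "snd q ! (n - Suc r) \<noteq> NW_step \<longleftrightarrow> low n q (Suc r) = low n q r"
      using low_step[OF q n r] by (cases "snd q ! (n - Suc r)") auto
    have "nat (int n + 1 + (- int (Suc r))) = n - r" using r by auto
    then have "z (n - Suc r) = zlow n c r (low n q (Suc r))"
      by (simp add: z_def L1_def v ht_def zlow_def algebra_simps)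
    moreover have "(\<Prod>x\<in>{L..H}. if low n q r = x \<and> low n q (Suc r) = x then zlow n c r x else 1) =
      (\<Prod>x\<in>{L..H}. if x = low n q r then (if low n q (Suc r) = low n q r then zlow n c r x else 1) else 1)"
      by (rule prod.cong) auto
    ultimately show ?thesis unfolding w_def NE using I(1)[of r] r by (simp add: prod.delta)
  qed
  have wu: "w (n + E + r) = (\<Prod>x\<in>{L..H}. if upp n q r = x \<and> upp n q (Suc r) = x + 1 then zupp n c r x else 1)" if r: "r < n" for r
  proof -
    have v: "vertex q (n + E + r) = (upp n q r, int r - upp n q r)"
      using vertex_upp[OF q n, of r] r by (simp add: E_def)
    have ne: "snd q ! (n + E + r) \<noteq> E_step" using st(1,4) r by simp
    then have NE: "snd q ! (n + E + r) \<noteq> NW_step \<longleftrightarrow> upp n q (Suc r) = upp n q r + 1"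
      using upp_step[OF q n r] by (cases "snd q ! (n + E + r)") (auto simp: E_def)
    have "nat (int n - int r) = n - r" using r by auto
    then have "z (n + E + r) = zupp n c r (upp n q r)"
      using ne by (simp add: z_def L1_def v ht_def zupp_def)
    moreover have "(\<Prod>x\<in>{L..H}. if upp n q r = x \<and> upp n q (Suc r) = x + 1 then zupp n c r x else 1) =
      (\<Prod>x\<in>{L..H}. if x = upp n q r then (if upp n q (Suc r) = upp n q r + 1 then zupp n c r x else 1) else 1)"
      by (rule prod.cong) auto
    ultimately show ?thesis unfolding w_def NE using I(2)[of r] r by (simp add: prod.delta)
  qed
  have wm: "w (n + j) = (if even j then zupp n c 0 (low n q 0 + 1 + int j) else zlow n c 0 (low n q 0 + 1 + int j))" if j: "j < E" for j
  proof -
    have v: "vertex q (n + j) = (low n q 0 + 1 + int j, - low n q 0 - 1 - int j)"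
      using vertex_mid[OF q n, of j] j by (simp add: E_def)
    have Es: "snd q ! (n + j) = E_step" using st(3) j by simp
    have "{i. i \<le> n + j \<and> snd q ! i = E_step} = {n..n + j}"
      using st(2) st(3) j by (auto simp: not_less) (meson not_less)
    then have "card {i. i \<le> n + j \<and> snd q ! i = E_step} = Suc j" by simp
    then show ?thesis using Es by (simp add: w_def z_def L1_def v ht_def zlow_def zupp_def)
  qed
  obtain t where t: "E = 2 * t" using even_num_E[OF q n] by (auto simp: E_def)
  have up: "upp n q 0 = low n q 0 + 1 + 2 * int t" using num_E_upp[OF q n] t by (simp add: E_def)
  have "(\<Prod>j<E. w (n + j)) = (\<Prod>j<2 * t. if even j then zupp n c 0 (low n q 0 + 1 + int j) else zlow n c 0 (low n q 0 + 1 + int j))"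
    unfolding t[symmetric] by (rule prod.cong) (simp_all add: wm)
  also have "\<dots> = (\<Prod>x\<in>{low n q 0 + 1..<upp n q 0}. if even (x - (low n q 0 + 1)) then zpair n c 0 x else 1)"
    unfolding prod_pairs up zpair_def ..
  also have "\<dots> = (\<Prod>x\<in>{L..H}. if low n q 0 < x \<and> x < upp n q 0 \<and> odd (x - low n q 0) then zpair n c 0 x else 1)"
    by (rule prod.mono_neutral_cong_left) (use I(1)[of 0] I(2)[of 0] in auto)
  finally have m: "(\<Prod>j<E. w (n + j)) = (\<Prod>x\<in>{L..H}. if low n q 0 < x \<and> x < upp n q 0 \<and> odd (x - low n q 0) then zpair n c 0 x else 1)" .
  let ?K = "{k. k < length (snd q) \<and> snd q ! k \<noteq> NW_step}"
  have "prod z ?K = (\<Prod>k<length (snd q). w k)"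
    unfolding w_def by (subst prod.inter_filter[symmetric]) (auto simp: lessThan_def)
  also have "\<dots> = (\<Prod>k<n + E + n. w k)" by (rule arg_cong[where f = "\<lambda>m. prod w {..<m}"]) (use st(1) in simp)
  also have "\<dots> = (\<Prod>k<n. w k) * (\<Prod>j<E. w (n + j)) * (\<Prod>r<n. w (n + E + r))"
    by (simp add: prod_lessThan_add)
  also have "(\<Prod>k<n. w k) = (\<Prod>r<n. w (n - Suc r))" by (rule prod.nat_diff_reindex[symmetric])
  also have "(\<Prod>r<n. w (n - Suc r)) = (\<Prod>r<n. \<Prod>x\<in>{L..H}. if low n q r = x \<and> low n q (Suc r) = x then zlow n c r x else 1)"
    by (rule prod.cong) (simp_all only: wl lessThan_iff)
  also have "(\<Prod>r<n. w (n + E + r)) = (\<Prod>r<n. \<Prod>x\<in>{L..H}. if upp n q r = x \<and> upp n q (Suc r) = x + 1 then zupp n c r x else 1)"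
    by (rule prod.cong) (simp_all only: wu lessThan_iff)
  finally have zW: "prod z ?K = W" unfolding W_def m by (simp only: mult_ac)
  have zC: "z k \<in> zcarrier n" if "k \<in> ?K" for k
  proof -
    have "k < length (snd q)" using that by simp
    consider "ht (vertex q k) < 0" "- int n \<le> ht (vertex q k)" | "0 \<le> ht (vertex q k)" "ht (vertex q k) \<le> int n"
    proof -
      consider "k < n" | "n \<le> k" "k \<le> n + E" | "n + E \<le> k" by linarith
      then show ?thesis
      proof cases
        case 1 then show ?thesis using st(5)[of k] that(1) by simp
      next
        case 2 then show ?thesis using st(6)[of k] that(2) by simp
      next
        case 3 then show ?thesis using st(1) st(7)[of k] that(2) \<open>k < length (snd q)\<close> by simp
      qed
    qed
    then have "L1 n q k \<in> letters n \<union> {Unbarred 0, Barred 0}"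
    proof cases
      case 1
      then have "nat (int n + 1 + ht (vertex q k)) \<in> {1..n}" by auto
      then show ?thesis using 1 by (simp add: L1_def letters_def)
    next
      case 2
      have "nat (int n - ht (vertex q k)) \<in> {1..n} \<or> nat (int n - ht (vertex q k)) = 0" using 2 by auto
      moreover have "n \<in> {1..n}" using n by simp
      ultimately show ?thesis using 2 by (auto simp: L1_def letters_def Let_def)
    qed
    then show ?thesis unfolding z_def by (rule zvar_closed)
  qed
  have "path_weight n c q = (\<Otimes>\<^bsub>Zring n\<^esub>k\<in>?K. zcls n (z k))"
    unfolding path_weight_def zgen_def zcls_def z_def ..
  also have "\<dots> = zcls n (prod z ?K)" by (rule finprod_zcls) (use zC in auto)
  finally show "path_weight n c q = zcls n W" unfolding zW .
qed

lemma card_diff_int: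
  assumes "finite X" "Y \<subseteq> X" "Z = X - Y"
  shows "int (card Z) = int (card X) - int (card Y)"
  using assms card_mono[of X Y] by (simp add: card_Diff_subset finite_subset of_nat_diff)

lemma double_diff:
  fixes s s' :: int
  assumes "s = y - z" "s' = y' - z'" "2 * (y - y') = u" "2 * (z - z') = v"
  shows "2 * (s - s') = u - v"
  unfolding assms(1,2) assms(3,4)[symmetric] by simp

lemma remainder_eq:
  fixes j k e j' k' e' :: nat and u v :: int
  assumes "2 * (int k - int k') = u" "2 * (int j - int j') = v" "2 * (int e - int e') = v - u" "j \<le> k + e" "j' \<le> k' + e'"
  shows "k + e - j = k' + e' - j'"
proof -
  have "2 * (int e - int e') = 2 * (int j - int j') - 2 * (int k - int k')" using assms(1-3) by simp
  then have "int (k + e) - int j = int (k' + e') - int j'" by simp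
  then show ?thesis using assms(4,5) by linarith
qed

context diagram
begin

definition stay :: "(nat \<Rightarrow> path) \<Rightarrow> nat \<Rightarrow> int \<Rightarrow> nat" where
  "stay p r x = card {i \<in> {1..l}. fa n p i r = x \<and> fa n p i (Suc r) = x}"

definition shift :: "(nat \<Rightarrow> path) \<Rightarrow> nat \<Rightarrow> int \<Rightarrow> nat" where
  "shift p r x = card {i \<in> {1..l}. fb n lam p i r = x \<and> fb n lam p i (Suc r) = x + 1}"

definition level :: "(nat \<Rightarrow> nat) \<Rightarrow> (nat \<Rightarrow> path) \<Rightarrow> int \<Rightarrow> nat" where
  "level \<sigma> p x = card {i \<in> {1..l}. fa n p i 0 < x \<and> x < fb n lam p (\<sigma> i) 0 \<and> odd (x - fa n p i 0)}"

lemma weight_eq: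
  assumes perm: "\<sigma> permutes {1..l}" and p: "p \<in> tuples_perm \<sigma> n lam mu"
    and I: "\<And>i r. i \<in> {1..l} \<Longrightarrow> r \<le> n \<Longrightarrow> L \<le> fa n p i r \<and> fa n p i r \<le> H"
      "\<And>i r. i \<in> {1..l} \<Longrightarrow> r \<le> n \<Longrightarrow> L \<le> fb n lam p i r \<and> fb n lam p i r \<le> H"
  shows "weight n c l p = zcls n ((\<Prod>x\<in>{L..H}. zpair n c 0 x ^ level \<sigma> p x) *
    (\<Prod>r<n. \<Prod>x\<in>{L..H}. zlow n c r x ^ stay p r x * zupp n c r x ^ shift p r x))"
proof -
  interpret Z: cring "Zring n" by (rule Zring_cring)
  define U where "U i = (\<Prod>x\<in>{L..H}. if fa n p i 0 < x \<and> x < fb n lam p (\<sigma> i) 0 \<and> odd (x - fa n p i 0) then zpair n c 0 x else 1)" for i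
  define V where "V i = (\<Prod>r<n. \<Prod>x\<in>{L..H}. if fa n p i r = x \<and> fa n p i (Suc r) = x then zlow n c r x else 1)" for i
  define W where "W i = (\<Prod>r<n. \<Prod>x\<in>{L..H}. if fb n lam p i r = x \<and> fb n lam p i (Suc r) = x + 1 then zupp n c r x else 1)" for i
  have w: "path_weight n c (p i) = zcls n (U i * V i * W (\<sigma> i)) \<and> U i * V i * W (\<sigma> i) \<in> zcarrier n" if i: "i \<in> {1..l}" for i
  proof -
    have lo: "low n (p i) = fa n p i" and up: "upp n (p i) = fb n lam p (\<sigma> i)"
      using fb_\<sigma>[OF perm p i] by (auto simp: fa_def)
    show ?thesis
      unfolding U_def V_def W_def
      using path_weight_eq[OF p_path[OF perm p i] n0, of L H c, unfolded lo up] I[OF i] I(2)[OF \<sigma>_in[OF perm p i]] by blast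
  qed
  have "weight n c l p = (\<Otimes>\<^bsub>Zring n\<^esub>i\<in>{1..l}. zcls n (U i * V i * W (\<sigma> i)))"
    unfolding weight_def by (rule Z.finprod_cong') (use w zcls_closed in auto)
  also have "\<dots> = zcls n (\<Prod>i\<in>{1..l}. U i * V i * W (\<sigma> i))" by (rule finprod_zcls) (use w in auto)
  also have "(\<Prod>i\<in>{1..l}. U i * V i * W (\<sigma> i)) = prod U {1..l} * prod V {1..l} * prod W {1..l}"
    unfolding prod.distrib using prod.permute[OF perm, of W] by (simp add: comp_def)
  also have "prod U {1..l} = (\<Prod>x\<in>{L..H}. zpair n c 0 x ^ level \<sigma> p x)"
    unfolding U_def level_def by (rule prod_if_card) simp
  also have "prod V {1..l} = (\<Prod>r<n. \<Prod>x\<in>{L..H}. zlow n c r x ^ stay p r x)"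
    unfolding V_def stay_def by (subst prod.swap) (simp only: prod_if_card finite_atLeastAtMost)
  also have "prod W {1..l} = (\<Prod>r<n. \<Prod>x\<in>{L..H}. zupp n c r x ^ shift p r x)"
    unfolding W_def shift_def by (subst prod.swap) (simp only: prod_if_card finite_atLeastAtMost)
  finally show ?thesis by (simp only: prod.distrib mult.assoc)
qed

text \<open>\<open>level\<close> counts the intervals over \<open>x\<close> whose start has parity
  opposite to \<open>x\<close>, one of the two classes. Half the sum or difference of
  \<open>D\<close> and \<open>dl\<close> isolates it, without any trace of \<sigma>.\<close>

lemma level_eq:
  assumes s: "sound \<sigma> p"
  shows "2 * int (level \<sigma> p x) = hg p (0, x) - sg x * del l (fa n p) (fb n lam p) x"
proof -
  interpret two_fams n l "fa n p" "fb n lam p" by (rule two_famsI[OF s])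
  have perm: "\<sigma> permutes {1..l}" and p: "p \<in> tuples_perm \<sigma> n lam mu" using s by (auto simp: sound_def)
  note ab = fab[OF perm p]
  let ?X = "{i \<in> {1..l}. a i \<le> x \<and> even (a i) = odd x}" and ?Y = "{i \<in> {1..l}. b (\<sigma> i) \<le> x \<and> odd (b (\<sigma> i)) = odd x}"
  have Y: "?Y \<subseteq> ?X" and M: "{i \<in> {1..l}. a i < x \<and> x < b (\<sigma> i) \<and> odd (x - a i)} = ?X - ?Y"
  proof -
    have "i \<in> ?X" if "i \<in> ?Y" for i
    proof -
      have i: "i \<in> {1..l}" using that by blast
      show ?thesis using ab[OF i] that by auto
    qed
    then show "?Y \<subseteq> ?X" by blast
    have "a i < x \<and> x < b (\<sigma> i) \<and> odd (x - a i) \<longleftrightarrow> i \<in> ?X \<and> i \<notin> ?Y" if i: "i \<in> {1..l}" for i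
    proof -
      have "odd (x - a i) \<Longrightarrow> a i \<noteq> x" by auto
      then show ?thesis using ab[OF i] i by (auto simp: order_less_le)
    qed
    then show "{i \<in> {1..l}. a i < x \<and> x < b (\<sigma> i) \<and> odd (x - a i)} = ?X - ?Y" by blast
  qed
  have "\<sigma> ` ?Y = {i \<in> {1..l}. b i \<le> x \<and> odd (b i) = odd x}"
  proof
    show "\<sigma> ` ?Y \<subseteq> {i \<in> {1..l}. b i \<le> x \<and> odd (b i) = odd x}" using \<sigma>_in[OF perm p] by auto
    show "{i \<in> {1..l}. b i \<le> x \<and> odd (b i) = odd x} \<subseteq> \<sigma> ` ?Y"
    proof
      fix j assume j: "j \<in> {i \<in> {1..l}. b i \<le> x \<and> odd (b i) = odd x}"
      then have "j \<in> \<sigma> ` {1..l}" using permutes_image[OF perm] by simp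
      then obtain i where i: "i \<in> {1..l}" "j = \<sigma> i" by blast
      then have "i \<in> ?Y" using j by simp
      then show "j \<in> \<sigma> ` ?Y" using i(2) by blast
    qed
  qed
  then have "card ?Y = card {i \<in> {1..l}. b i \<le> x \<and> odd (b i) = odd x}"
    using card_image[of \<sigma> ?Y] permutes_inj_on[OF perm] by metis
  then have "int (level \<sigma> p x) = kA (odd x) x - kB (odd x) x"
    unfolding level_def kA_def kB_def using card_diff_int[OF _ Y M] by simp
  then show ?thesis unfolding hg_def D_class[of x] dl_class[of x] sg_def by (cases "even x") simp_all
qed

lemma stay_eq:
  assumes "fams n l (fa n p)" "r < n"
  shows "int (stay p r x) = cnt n l (fa n p) (Suc r, x) - cnt n l (fa n p) (r, x - 1)"
proof -
  have *: "fa n p i (Suc r) = fa n p i r \<or> fa n p i (Suc r) = fa n p i r + 1" if "i \<in> {1..l}" for i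
    using fams_step[OF assms(1) that assms(2)] .
  have "int (stay p r x) = int (card {i \<in> {1..l}. fa n p i (Suc r) \<le> x}) - int (card {i \<in> {1..l}. fa n p i r \<le> x - 1})"
    unfolding stay_def by (rule card_diff_int) (use * in force)+
  then show ?thesis using assms(2) by (simp add: cnt_def)
qed

lemma shift_eq:
  assumes "fams n l (fb n lam p)" "r < n"
  shows "int (shift p r x) = cnt n l (fb n lam p) (r, x) - cnt n l (fb n lam p) (Suc r, x)"
proof -
  have *: "fb n lam p i (Suc r) = fb n lam p i r \<or> fb n lam p i (Suc r) = fb n lam p i r + 1" if "i \<in> {1..l}" for i
    using fams_step[OF assms(1) that assms(2)] .
  have "int (shift p r x) = int (card {i \<in> {1..l}. fb n lam p i r \<le> x}) - int (card {i \<in> {1..l}. fb n lam p i (Suc r) \<le> x})"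
    unfolding shift_def by (rule card_diff_int) (use * in force)+
  then show ?thesis using assms(2) by (simp add: cnt_def)
qed

abbreviation "carry \<sigma> p \<equiv> carried (stay p) (shift p) (level \<sigma> p)"

text \<open>For tuples with the same sum, the count of the lower parts and minus the count of the
  upper parts both change by half the change of the height. By induction on the rows the two terms
  of the minimum in \<open>carried\<close> change by the same amount, hence so does the
  minimum.\<close>

lemma carry_diff:
  assumes s: "sound \<sigma> p" and t: "sound \<tau> q" and e: "dn p = dn q" and r: "r \<le> n"
  shows "2 * (int (carry \<sigma> p r x) - int (carry \<tau> q r x)) = hg p (r, x) - hg q (r, x)"
    and "r < n \<Longrightarrow> 2 * (int (stay p r x) - int (stay q r x)) = (hg p (Suc r, x) - hg q (Suc r, x)) - (hg p (r, x - 1) - hg q (r, x - 1))"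
    and "r < n \<Longrightarrow> 2 * (int (shift p r x) - int (shift q r x)) = (hg p (Suc r, x) - hg q (Suc r, x)) - (hg p (r, x) - hg q (r, x))"
proof -
  have f: "fams n l (fa n p)" "fams n l (fb n lam p)" "fams n l (fa n q)" "fams n l (fb n lam q)"
    using s t by (auto simp: sound_def)
  have c: "2 * (cnt n l (fa n p) v - cnt n l (fa n q) v) = hg p v - hg q v"
    "2 * (cnt n l (fb n lam p) v - cnt n l (fb n lam q) v) = - (hg p v - hg q v)" for v
    using fun_cong[OF e, of v] by (simp_all add: dn_def hg_def dens_def hgt_def)
  have st: "2 * (int (stay p r x) - int (stay q r x)) = (hg p (Suc r, x) - hg q (Suc r, x)) - (hg p (r, x - 1) - hg q (r, x - 1))"
    if "r < n" for r x
    by (rule double_diff[OF stay_eq[OF f(1) that] stay_eq[OF f(3) that] c(1) c(1)])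
  have sh: "2 * (int (shift p r x) - int (shift q r x)) = (hg p (Suc r, x) - hg q (Suc r, x)) - (hg p (r, x) - hg q (r, x))"
    if "r < n" for r x
    using double_diff[OF shift_eq[OF f(2) that] shift_eq[OF f(4) that] c(2) c(2), of x] by simp
  show "r < n \<Longrightarrow> 2 * (int (stay p r x) - int (stay q r x)) = (hg p (Suc r, x) - hg q (Suc r, x)) - (hg p (r, x - 1) - hg q (r, x - 1))"
    and "r < n \<Longrightarrow> 2 * (int (shift p r x) - int (shift q r x)) = (hg p (Suc r, x) - hg q (Suc r, x)) - (hg p (r, x) - hg q (r, x))"
    using st sh by blast+
  have "del l (fa n p) (fb n lam p) = del l (fa n q) (fb n lam q)"
    by (rule del_unique[OF n0 f(1,2)]) (use e in \<open>simp add: dn_def\<close>)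
  then have 0: "2 * (int (level \<sigma> p x) - int (level \<tau> q x)) = hg p (0, x) - hg q (0, x)" for x
    using level_eq[OF s, of x] level_eq[OF t, of x] by simp
  show "2 * (int (carry \<sigma> p r x) - int (carry \<tau> q r x)) = hg p (r, x) - hg q (r, x)"
    using r
  proof (induction r arbitrary: x)
    case 0 then show ?case using \<open>\<And>x. 2 * (int (level \<sigma> p x) - int (level \<tau> q x)) = hg p (0, x) - hg q (0, x)\<close> by simp
  next
    case (Suc r)
    then have r: "r < n" by simp
    show ?case
      using Suc.IH[of x] Suc.IH[of "x - 1"] r st[OF r, of x] sh[OF r, of x] by (simp add: min_def)
  qed
qed

text \<open>The exponents of the normal form are what remains after the carried matches are taken
  away; by \<open>carry_diff\<close> the changes cancel, so the exponents depend on the sum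
  only.\<close>

lemma weight_dn:
  assumes s: "sound \<sigma> p" and t: "sound \<tau> q" and e: "dn p = dn q"
  shows "weight n c l p = weight n c l q"
proof -
  have S: "\<sigma> permutes {1..l}" "p \<in> tuples_perm \<sigma> n lam mu" "\<tau> permutes {1..l}" "q \<in> tuples_perm \<tau> n lam mu"
    using s t by (auto simp: sound_def)
  obtain m1 M1 where 1: "\<And>i r. i \<in> {1..l} \<Longrightarrow> r \<le> n \<Longrightarrow> m1 \<le> fa n p i r \<and> fa n p i r \<le> M1" by (rule fams_bounded[of l n "fa n p"]) blast
  obtain m2 M2 where 2: "\<And>i r. i \<in> {1..l} \<Longrightarrow> r \<le> n \<Longrightarrow> m2 \<le> fb n lam p i r \<and> fb n lam p i r \<le> M2" by (rule fams_bounded[of l n "fb n lam p"]) blast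
  obtain m3 M3 where 3: "\<And>i r. i \<in> {1..l} \<Longrightarrow> r \<le> n \<Longrightarrow> m3 \<le> fa n q i r \<and> fa n q i r \<le> M3" by (rule fams_bounded[of l n "fa n q"]) blast
  obtain m4 M4 where 4: "\<And>i r. i \<in> {1..l} \<Longrightarrow> r \<le> n \<Longrightarrow> m4 \<le> fb n lam q i r \<and> fb n lam q i r \<le> M4" by (rule fams_bounded[of l n "fb n lam q"]) blast
  define L where "L = min (min m1 m2) (min m3 m4)"
  \<comment> \<open>The margin 1 puts all positions of both tuples strictly below \<open>H\<close>,
    so the exponents required to vanish at \<open>L - 1\<close> and at \<open>H\<close> do.\<close>
  define H where "H = max (max M1 M2) (max M3 (max M4 L)) + 1"
  have LH: "L \<le> H" by (simp add: H_def)
  have LM: "L \<le> m1" "L \<le> m2" "L \<le> m3" "L \<le> m4" "M1 < H" "M2 < H" "M3 < H" "M4 < H" by (simp_all add: L_def H_def le_max_iff_disj)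
  have w: "weight n c l p = zcls n (\<Prod>r<n. \<Prod>x\<in>{L..H}. zlow n c r x ^ (carry \<sigma> p r (x - 1) + stay p r x - carry \<sigma> p (Suc r) x) *
        zupp n c r x ^ (carry \<sigma> p r x + shift p r x - carry \<sigma> p (Suc r) x))"
    if S: "\<sigma> permutes {1..l}" "p \<in> tuples_perm \<sigma> n lam mu"
      and I: "\<And>i r. i \<in> {1..l} \<Longrightarrow> r \<le> n \<Longrightarrow> L \<le> fa n p i r \<and> fa n p i r < H"
        "\<And>i r. i \<in> {1..l} \<Longrightarrow> r \<le> n \<Longrightarrow> L \<le> fb n lam p i r \<and> fb n lam p i r < H" for \<sigma> p
  proof -
    have lev: "level \<sigma> p (L - 1) = 0" "level \<sigma> p H = 0"
    proof -
      have "{i \<in> {1..l}. fa n p i 0 < L - 1 \<and> L - 1 < fb n lam p (\<sigma> i) 0 \<and> odd (L - 1 - fa n p i 0)} = {}"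
        using I(1)[of _ 0] by force
      then show "level \<sigma> p (L - 1) = 0" unfolding level_def by (metis card.empty)
      have "{i \<in> {1..l}. fa n p i 0 < H \<and> H < fb n lam p (\<sigma> i) 0 \<and> odd (H - fa n p i 0)} = {}"
        using I(2)[OF \<sigma>_in[OF S], of _ 0] by force
      then show "level \<sigma> p H = 0" unfolding level_def by (metis card.empty)
    qed
    have sh: "shift p r (L - 1) = 0" "shift p r H = 0" if "r < n" for r
    proof -
      have "{i \<in> {1..l}. fb n lam p i r = L - 1 \<and> fb n lam p i (Suc r) = L - 1 + 1} = {}"
        "{i \<in> {1..l}. fb n lam p i r = H \<and> fb n lam p i (Suc r) = H + 1} = {}"
        using I(2)[of _ r] that by force+
      then show "shift p r (L - 1) = 0" "shift p r H = 0" unfolding shift_def by (metis card.empty)+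
    qed
    have "weight n c l p = zcls n ((\<Prod>x\<in>{L..H}. zpair n c 0 x ^ level \<sigma> p x) *
      (\<Prod>r<n. \<Prod>x\<in>{L..H}. zlow n c r x ^ stay p r x * zupp n c r x ^ shift p r x))"
      by (rule weight_eq[OF S]) (use I in \<open>auto intro: less_imp_le\<close>)
    moreover have "zeq n ((\<Prod>x\<in>{L..H}. zpair n c 0 x ^ level \<sigma> p x) *
      (\<Prod>r<n. \<Prod>x\<in>{L..H}. zlow n c r x ^ stay p r x * zupp n c r x ^ shift p r x))
      ((\<Prod>r<n. \<Prod>x\<in>{L..H}. zlow n c r x ^ (carry \<sigma> p r (x - 1) + stay p r x - carry \<sigma> p (Suc r) x) *
        zupp n c r x ^ (carry \<sigma> p r x + shift p r x - carry \<sigma> p (Suc r) x)) *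
       (\<Prod>x\<in>{L..H}. zpair n c n x ^ carry \<sigma> p n x))"
      by (rule zeq_carry[OF LH order_refl lev sh])
    ultimately show ?thesis unfolding zeq_def by (simp only: zpair_top power_one prod.neutral_const mult_1_right)
  qed
  have b: "L \<le> fa n p i r \<and> fa n p i r < H" "L \<le> fb n lam p i r \<and> fb n lam p i r < H"
    "L \<le> fa n q i r \<and> fa n q i r < H" "L \<le> fb n lam q i r \<and> fb n lam q i r < H" if "i \<in> {1..l}" "r \<le> n" for i r
    using 1[OF that] 2[OF that] 3[OF that] 4[OF that] LM by linarith+
  have eq: "carry \<sigma> p r (x - 1) + stay p r x - carry \<sigma> p (Suc r) x = carry \<tau> q r (x - 1) + stay q r x - carry \<tau> q (Suc r) x"
    "carry \<sigma> p r x + shift p r x - carry \<sigma> p (Suc r) x = carry \<tau> q r x + shift q r x - carry \<tau> q (Suc r) x" if "r < n" for r x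
  proof -
    note d = carry_diff[OF s t e]
    have le: "carry \<sigma> p (Suc r) x \<le> carry \<sigma> p r (x - 1) + stay p r x" "carry \<tau> q (Suc r) x \<le> carry \<tau> q r (x - 1) + stay q r x"
      "carry \<sigma> p (Suc r) x \<le> carry \<sigma> p r x + shift p r x" "carry \<tau> q (Suc r) x \<le> carry \<tau> q r x + shift q r x" by simp_all
    have D: "2 * (int (carry \<sigma> p r (x - 1)) - int (carry \<tau> q r (x - 1))) = hg p (r, x - 1) - hg q (r, x - 1)"
      "2 * (int (carry \<sigma> p r x) - int (carry \<tau> q r x)) = hg p (r, x) - hg q (r, x)"
      "2 * (int (carry \<sigma> p (Suc r) x) - int (carry \<tau> q (Suc r) x)) = hg p (Suc r, x) - hg q (Suc r, x)"
      "2 * (int (stay p r x) - int (stay q r x)) = (hg p (Suc r, x) - hg q (Suc r, x)) - (hg p (r, x - 1) - hg q (r, x - 1))"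
      "2 * (int (shift p r x) - int (shift q r x)) = (hg p (Suc r, x) - hg q (Suc r, x)) - (hg p (r, x) - hg q (r, x))"
      using d(1)[of r "x - 1"] d(1)[of r x] d(1)[of "Suc r" x] d(2)[of r x] d(3)[of r x] that by auto
    show "carry \<sigma> p r (x - 1) + stay p r x - carry \<sigma> p (Suc r) x = carry \<tau> q r (x - 1) + stay q r x - carry \<tau> q (Suc r) x"
      by (rule remainder_eq[OF D(1,3,4) le(1,2)])
    show "carry \<sigma> p r x + shift p r x - carry \<sigma> p (Suc r) x = carry \<tau> q r x + shift q r x - carry \<tau> q (Suc r) x"
      by (rule remainder_eq[OF D(2,3,5) le(3,4)])
  qed
  have "weight n c l p = zcls n (\<Prod>r<n. \<Prod>x\<in>{L..H}. zlow n c r x ^ (carry \<sigma> p r (x - 1) + stay p r x - carry \<sigma> p (Suc r) x) *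
        zupp n c r x ^ (carry \<sigma> p r x + shift p r x - carry \<sigma> p (Suc r) x))"
    by (rule w[OF S(1,2)]) (use b in auto)
  also have "\<dots> = zcls n (\<Prod>r<n. \<Prod>x\<in>{L..H}. zlow n c r x ^ (carry \<tau> q r (x - 1) + stay q r x - carry \<tau> q (Suc r) x) *
        zupp n c r x ^ (carry \<tau> q r x + shift q r x - carry \<tau> q (Suc r) x))"
    by (intro arg_cong[of _ _ "zcls n"] prod.cong refl arg_cong2[of _ _ _ _ "(*)"] arg_cong2[of _ _ _ _ "(^)"] eq) simp_all
  also have "\<dots> = weight n c l q" by (rule w[OF S(3,4), symmetric]) (use b in auto)
  finally show ?thesis .
qed

end

theorem proposition5p1:
  fixes n :: nat and a :: complex and lam mu :: "nat \<Rightarrow> nat"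
  assumes "n > 0"
    and "skew_diagram lam mu"
    and "positivity n lam mu"
  shows "\<exists>\<phi>. bij_betw \<phi> (P2_set n lam mu) (P_set n lam mu) \<and>
    (\<forall>p \<in> P2_set n lam mu. weight n a (lam 1) (\<phi> p) = weight n a (lam 1) p)"
proof -
  interpret diagram n lam mu by (rule diagram.intro[OF assms])
  obtain \<phi> where \<phi>: "bij_betw \<phi> (P2_set n lam mu) (P_set n lam mu)" "\<And>p. p \<in> P2_set n lam mu \<Longrightarrow> dn (\<phi> p) = dn p"
    using dens_bij by blast
  have "weight n a (lam 1) (\<phi> p) = weight n a (lam 1) p" if p: "p \<in> P2_set n lam mu" for p
  proof -
    obtain \<sigma> where s: "sound \<sigma> p" using p unfolding P2_iff by blast
    have "sound id (\<phi> p)" using bij_betwE[OF \<phi>(1)] p unfolding P_iff by blast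
    then show ?thesis using weight_dn[OF _ s \<phi>(2)[OF p]] by blast
  qed
  then show ?thesis using \<phi>(1) by blast
qed

end
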